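(* Let $(\gamma,\delta=\nu(\gamma-1),\alpha,\beta,\daleth)$ satisfy $$\gamma>1,\quad 0<\delta<1,\quad \gamma+\delta\le 2,\quad \alpha>0,\quad 2\alpha+3\beta\ge 0,\quad \daleth>0,$$ and assume that the initial data $(\rho_0,u_0,S_0)$ satisfy, for some $q\in(3,\infty)$, $$\rho_0>0,\quad \rho_0^{\gamma-1}\in D^1_*\cap D^3,\quad \nabla\rho_0^{\delta-1}\in L^q\cap D^{1,3},\quad \rho_0^{\frac{\delta-1}{4}}\nabla^3\rho_0^{\delta-1}\in L^2,$$ $$\nabla\rho_0^{\frac{3(\delta-1)}{4}}\in D^1_*,\quad \nabla\rho_0^{\frac{3(\delta-1)}{8}}\in L^4,\quad u_0\in H^3,\quad S_0-\bar S\in D^1_*\cap D^3,$$ and, for some $(g_1,\dots,g_6)\in L^2$, $$\nabla u_0=\rho_0^{\frac{1-\delta}{2}}g_1,\quad Lu_0=\rho_0^{1-\delta}g_2,\quad \nabla(\rho_0^{\delta-1}Lu_0)=\rho_0^{\frac{1-\delta}{2}}g_3,$$ $$\nabla e^{\frac{S_0}{c_v}}=\rho_0^{\frac{1-\delta}{4}}g_4,\quad \triangle e^{\frac{S_0}{c_v}}=\rho_0^{\frac{3(1-\delta)}{4}}g_5,\quad \nabla\big(\rho_0^{\frac{\delta-1}{2}}\triangle e^{\frac{S_0}{c_v}}\big)=\rho_0^{\frac{3(1-\delta)}{4}}g_6 .$$ If in addition $0<m(0)<\infty$ and $|\mathbb P(0)|>0$, then for the Cauchy problem (E) (see context) there is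 no global regular solution $(\rho,u,S)$ with the regularities (Reg) (see context) satisfying $$\limsup_{t\to\infty}|u(t,\cdot)|_{L^\infty(\mathbb R^3)}=0 .$$
   Context: All functions are on $\mathbb R^3$; $L^p,H^s$ mean $L^p(\mathbb R^3),H^s(\mathbb R^3)$. $D^{k,r}=\{f\in L^1_{loc}(\mathbb R^3):|\nabla^kf|_{L^r}<\infty\}$, $D^k=D^{k,2}$, $D^1_*=\{f\in L^6(\mathbb R^3):|\nabla f|_{L^2}<\infty\}$. Constants: $A,R>0$; $c_v=R/(\gamma-1)$; $\nu>0$, $\delta=(\gamma-1)\nu$; $\bar S\in\mathbb R$; $\digamma=R\daleth(AR^{-1})^{\nu+1}$. $Lu=-\alpha\triangle u-(\alpha+\beta)\nabla\mathrm{div}\,u$. $m(t)=\int_{\mathbb R^3}\rho\,dx$, $\mathbb P(t)=\int_{\mathbb R^3}\rho u\,dx$. Cauchy problem (E). Unknowns: density $\rho\ge0$, velocity $u$ ($\mathbb R^3$-valued), entropy $S$, with $P=Ae^{S/c_v}\rho^\gamma$: $$\rho_t+\mathrm{div}(\rho u)=0,$$ $$\rho(u_t+u\cdot\nabla u)+\nabla P=A^\nu R^{-\nu}\mathrm{div}\big(\rho^\delta e^{\frac{S}{c_v}\nu}Q(u)\big),$$ $$P(S_t+u\cdot\nabla S)-\digamma\rho^{\delta+\gamma-1}e^{\frac{S}{c_v}\nu}\triangle e^{\frac{S}{c_v}}=A^\nu R^{1-\nu}\rho^\delta e^{\frac{S}{c_v}\nu}H(u)+\digamma\rho^\delta e^{\frac{S}{c_v}(\nu+1)}\triangle\rho^{\gamma-1}+\Lambda(\rho,S),$$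 where $Q(u)=\alpha(\nabla u+(\nabla u)^\top)+\beta\,\mathrm{div}u\,\mathbb I_3$, $H(u)=\mathrm{div}(uQ(u))-u\cdot\mathrm{div}Q(u)$, and $$\Lambda(\rho,S)=2\digamma\rho^\delta e^{\frac{S}{c_v}\nu}\nabla\rho^{\gamma-1}\cdot\nabla e^{\frac{S}{c_v}}+\digamma\nabla(\rho^\delta e^{\frac{S}{c_v}\nu})\cdot\nabla(e^{\frac{S}{c_v}}\rho^{\gamma-1}),$$ with $(\rho,u,S)|_{t=0}=(\rho_0,u_0,S_0)$ and $(\rho,u,S)(t,x)\to(0,0,\bar S)$ as $|x|\to\infty$ for $t\ge0$. Regular solution. For finite $T>0$, $(\rho,u,S)$ is a regular solution to (E) in $[0,T]\times\mathbb R^3$ if it solves (E) in the sense of distributions and: (1) $\rho>0$, $\rho^{\gamma-1}\in C([0,T];D^1_*\cap D^3)$, $\nabla\rho^{\delta-1}\in C([0,T];L^\infty\cap D^{1,3}\cap D^2)$, $\nabla\rho^{\frac{3(\delta-1)}{4}}\in C([0,T];D^1_* )$, $\nabla\rho^{\frac{3(\delta-1)}{8}}\in C([0,T];L^4)$; (2) $u\in C([0,T];H^3)\cap L^2([0,T];D^4)$, $\rho^{\frac{\delta-1}{2}}\nabla u\in C([0,T];L^2)$, $\rho^{\delta-1}\nabla^2u\in L^\infty([0,T];H^1)\cap L^2([0,T];D^2)$; (3) $S-\bar S\in C([0,T];D^1_*\cap D^3)$, $e^{\frac{S}{c_v}}-e^{\frac{\bar S}{c_v}}\in C([0,T];D^1_*\cap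 D^3)$, $\rho^{\frac{\delta-1}{4}}\nabla e^{\frac{S}{c_v}}\in L^\infty([0,T];L^2)$, $\rho^{\frac{\delta-1}{2}}\nabla^2e^{\frac{S}{c_v}}\in L^\infty([0,T];H^1)$, $\rho^{\delta+\gamma-1}e^{\frac{S}{c_v}(\nu+1)}\in L^2([0,T];D^1\cap D^4)$. Regularities (Reg) on $[0,T]$: $\nabla\rho^{\delta-1}\in C([0,T];L^q)$; $(\rho^{\gamma-1})_t\in C([0,T];H^2)$; $(\rho^{\gamma-1})_{tt}\in C([0,T];L^2)$; $(\nabla(\rho^{\delta-1})_t,u_t)\in C([0,T];H^1)$; $t^{\frac12}u_t\in L^\infty([0,T];D^2)\cap L^2([0,T];D^3)$; $(\nabla(\rho^{\delta-1})_{tt},\nabla(\rho^{\gamma-1})_{tt},\rho^{\delta-1}\nabla^2u_t,t^{\frac12}\rho^{\delta-1}\nabla^3u_t,u_{tt},t^{\frac12}\rho^{\frac{\delta-1}{2}}\nabla u_{tt})\in L^2([0,T];L^2)$; $t^{\frac12}u_{tt}\in L^\infty([0,T];L^2)\cap L^2([0,T];D^1_* )$; $(t^{\frac12}\rho^{\delta-1}\nabla^4u,\rho^{\frac{\delta-1}{2}}\nabla u_t,t^{\frac12}\rho^{\delta-1}\nabla^2u_t,\rho^{\frac{\delta-1}{4}}\nabla S)\in L^\infty([0,T];L^2)$; $(\rho^{\frac{\delta-1}{2}}\nabla^2S,\rho^{\frac{\delta-1}{2}}\nabla^3S,\rho^{\frac{1-\delta}{4}}S_t,t^{\frac12}\rho^{\frac{\delta-1}{2}}\nabla^2S_t,t^{\frac12}\rho^{\frac{1-\delta}{4}}S_{tt})\in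 L^\infty([0,T];L^2)$; $S_t\in C([0,T];D^1_* )\cap L^2([0,T];D^2)$; $\rho^{\frac{\delta-1}{4}}S_t\in L^\infty([0,T];D^1_* )$; $\rho^{\frac{\delta-1}{2}}S_t\in L^2([0,T];D^2)$; $(\rho^{\frac{1-\delta}{4}}S_{tt},t^{\frac12}\rho^{\frac{\delta-1}{4}}\nabla S_{tt})\in L^2([0,T];L^2)$. A global regular solution with the regularities (Reg) is a triple defined for all $t\ge0$ that, for every $T>0$, is a regular solution in $[0,T]\times\mathbb R^3$ satisfying (Reg) on $[0,T]$. *)

theory Defs
  imports "HOL-Analysis.Analysis" "HOL-Probability.Essential_Supremum"
begin

section \<open>Test functions, distributions, weak derivatives\<close>

text \<open>All functions are representatives of classes modulo Lebesgue-null sets; every notion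
  below is invariant under changes on null sets.\<close>

primrec iter_deriv :: "'a list \<Rightarrow> ('a::euclidean_space \<Rightarrow> real) \<Rightarrow> 'a \<Rightarrow> real" where
  "iter_deriv [] \<phi> = \<phi>"
| "iter_deriv (v # vs) \<phi> = (\<lambda>x. frechet_derivative (iter_deriv vs \<phi>) (at x) v)"

text \<open>The space $C_c^\infty(\Omega)$.\<close>
definition test_fun :: "'a::euclidean_space set \<Rightarrow> ('a \<Rightarrow> real) set" where
  "test_fun \<Omega> = {\<phi>. (\<forall>vs. set vs \<subseteq> Basis \<longrightarrow> (\<forall>x. iter_deriv vs \<phi> differentiable (at x))) \<and>
                    (\<exists>K. compact K \<and> K \<subseteq> \<Omega> \<and> (\<forall>x. x \<notin> K \<longrightarrow> \<phi> x = 0))}"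

definition loc_int :: "'a::euclidean_space set \<Rightarrow> ('a \<Rightarrow> 'b::euclidean_space) \<Rightarrow> bool" where
  "loc_int \<Omega> f \<longleftrightarrow> (\<forall>K. compact K \<and> K \<subseteq> \<Omega> \<longrightarrow> f absolutely_integrable_on K)"

text \<open>\<open>has_weak_deriv \<Omega> [v\<^sub>1, \<dots>, v\<^sub>k] f g\<close>: the distributional derivative of \<open>f\<close> in the directions
  \<open>v\<^sub>1, \<dots>, v\<^sub>k\<close> is the locally integrable function \<open>g\<close>.  The list plays the role of a multi-index.\<close>
definition has_weak_deriv ::
    "'a::euclidean_space set \<Rightarrow> 'a list \<Rightarrow> ('a \<Rightarrow> 'b::euclidean_space) \<Rightarrow> ('a \<Rightarrow> 'b) \<Rightarrow> bool" where
  "has_weak_deriv \<Omega> vs f g \<longleftrightarrow> loc_int \<Omega> f \<and> loc_int \<Omega> g \<and>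
     (\<forall>\<phi>\<in>test_fun \<Omega>. (\<integral>x. iter_deriv vs \<phi> x *\<^sub>R f x \<partial>lebesgue)
                     = (-1) ^ length vs *\<^sub>R (\<integral>x. \<phi> x *\<^sub>R g x \<partial>lebesgue))"

definition weakly_diff :: "'a::euclidean_space set \<Rightarrow> 'a list \<Rightarrow> ('a \<Rightarrow> 'b::euclidean_space) \<Rightarrow> bool" where
  "weakly_diff \<Omega> vs f \<longleftrightarrow> (\<exists>g. has_weak_deriv \<Omega> vs f g)"

text \<open>Only meaningful (and then unique a.e. on \<open>\<Omega>\<close>) if \<open>weakly_diff \<Omega> vs f\<close>.\<close>
definition wderiv :: "'a::euclidean_space set \<Rightarrow> 'a list \<Rightarrow> ('a \<Rightarrow> 'b::euclidean_space) \<Rightarrow> 'a \<Rightarrow> 'b" where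
  "wderiv \<Omega> vs f = (SOME g. has_weak_deriv \<Omega> vs f g)"

definition dist_of :: "('a::euclidean_space \<Rightarrow> real) \<Rightarrow> ('a \<Rightarrow> real) \<Rightarrow> real" where
  "dist_of f \<phi> = (\<integral>x. f x * \<phi> x \<partial>lebesgue)"

definition dist_deriv :: "'a \<Rightarrow> (('a::euclidean_space \<Rightarrow> real) \<Rightarrow> real) \<Rightarrow> ('a \<Rightarrow> real) \<Rightarrow> real" where
  "dist_deriv v D \<phi> = - D (iter_deriv [v] \<phi>)"


section \<open>Function spaces on \<open>\<real>\<^sup>3\<close>\<close>

text \<open>A space is represented by its extended (semi)norm, which is \<open>\<infinity>\<close> exactly off the space.
  An intersection of spaces is the sum of the seminorms.\<close>

type_synonym 'b snorm = "(real^3 \<Rightarrow> 'b) \<Rightarrow> ennreal"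

definition Lp :: "real \<Rightarrow> 'b::euclidean_space snorm" where
  "Lp r f = (if f \<in> borel_measurable lebesgue \<and> integrable lebesgue (\<lambda>x. norm (f x) powr r)
             then ennreal ((\<integral>x. norm (f x) powr r \<partial>lebesgue) powr (1 / r)) else \<infinity>)"

definition Linf :: "'b::euclidean_space snorm" where
  "Linf f = (if f \<in> borel_measurable lebesgue
             then esssup lebesgue (\<lambda>x. ennreal (norm (f x))) else \<infinity>)"

text \<open>\<open>Dkr k r f\<close> is $|\nabla^k f|_{L^r}$; membership of \<open>f\<close> in $L^1_{loc}$ is part of \<open>weakly_diff\<close>.\<close>
definition Dkr :: "nat \<Rightarrow> real \<Rightarrow> 'b::euclidean_space snorm" where
  "Dkr k r f =
     (if \<forall>vs. set vs \<subseteq> Basis \<and> length vs = k \<longrightarrow> weakly_diff UNIV vs f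
      then Lp r (\<lambda>x. L2_set (\<lambda>vs. norm (wderiv UNIV vs f x)) {vs. set vs \<subseteq> Basis \<and> length vs = k})
      else \<infinity>)"

abbreviation Dk :: "nat \<Rightarrow> 'b::euclidean_space snorm" where
  "Dk k \<equiv> Dkr k 2"

definition Hs :: "nat \<Rightarrow> 'b::euclidean_space snorm" where
  "Hs s f = (\<Sum>k\<le>s. Dk k f)"

text \<open>$D^1_*$\<close>
definition D1s :: "'b::euclidean_space snorm" where
  "D1s f = Lp 6 f + Dk 1 f"

definition D1s_D3 :: "'b::euclidean_space snorm" where
  "D1s_D3 f = D1s f + Dk 3 f"

definition tends_at_infinity :: "(real^3 \<Rightarrow> 'b::euclidean_space) \<Rightarrow> 'b \<Rightarrow> bool" where
  "tends_at_infinity f l \<longleftrightarrow> (\<forall>e>0. \<exists>r. AE x in lebesgue. r < norm x \<longrightarrow> norm (f x - l) < e)"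


section \<open>Spaces of time-dependent functions\<close>

text \<open>\<open>C_in T N f\<close>: $f \in C([0,T];X)$, where \<open>N\<close> is the (semi)norm of $X$.\<close>
definition C_in :: "real \<Rightarrow> 'b::euclidean_space snorm \<Rightarrow> (real \<Rightarrow> real^3 \<Rightarrow> 'b) \<Rightarrow> bool" where
  "C_in T N f \<longleftrightarrow> (\<forall>t\<in>{0..T}. N (f t) < \<infinity>) \<and>
     (\<forall>s\<in>{0..T}. ((\<lambda>t. N (\<lambda>x. f t x - f s x)) \<longlongrightarrow> 0) (at s within {0..T}))"

text \<open>Bochner measurability: a.e. limit, in the (semi)norm \<open>N\<close>, of $X$-valued simple functions.\<close>
definition strongly_measurable ::
    "real \<Rightarrow> 'b::euclidean_space snorm \<Rightarrow> (real \<Rightarrow> real^3 \<Rightarrow> 'b) \<Rightarrow> bool" where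
  "strongly_measurable T N f \<longleftrightarrow> (\<exists>\<sigma> :: nat \<Rightarrow> real \<Rightarrow> real^3 \<Rightarrow> 'b.
     (\<forall>n. simple_function (lebesgue_on {0..T}) (\<sigma> n) \<and> (\<forall>t\<in>{0..T}. N (\<sigma> n t) < \<infinity>)) \<and>
     (AE t in lebesgue_on {0..T}. (\<lambda>n. N (\<lambda>x. f t x - \<sigma> n t x)) \<longlonglongrightarrow> 0))"

definition L2_in :: "real \<Rightarrow> 'b::euclidean_space snorm \<Rightarrow> (real \<Rightarrow> real^3 \<Rightarrow> 'b) \<Rightarrow> bool" where
  "L2_in T N f \<longleftrightarrow> strongly_measurable T N f \<and>
     (\<integral>\<^sup>+t. (N (f t))\<^sup>2 \<partial>lebesgue_on {0..T}) < \<infinity>"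

definition Linf_in :: "real \<Rightarrow> 'b::euclidean_space snorm \<Rightarrow> (real \<Rightarrow> real^3 \<Rightarrow> 'b) \<Rightarrow> bool" where
  "Linf_in T N f \<longleftrightarrow> strongly_measurable T N f \<and>
     (\<exists>M<\<infinity>. AE t in lebesgue_on {0..T}. N (f t) \<le> M)"

definition slab :: "real \<Rightarrow> (real \<times> (real^3)) set" where
  "slab T = {0<..<T} \<times> UNIV"

abbreviation et :: "real \<times> (real^3)" where
  "et \<equiv> (1, 0)"

abbreviation ex :: "3 \<Rightarrow> real \<times> (real^3)" where
  "ex j \<equiv> (0, axis j 1)"

text \<open>\<open>dtx_in T j k f Z\<close>: the distribution $\partial_t^j \nabla^k f$ on $(0,T)\times\mathbb R^3$ is
  (componentwise) a locally integrable function with a representative having property \<open>Z\<close>.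
  No assumption is made on derivatives of lower order.\<close>
definition dtx_in :: "real \<Rightarrow> nat \<Rightarrow> nat \<Rightarrow> (real \<Rightarrow> real^3 \<Rightarrow> 'b::euclidean_space) \<Rightarrow>
    ((real \<Rightarrow> real^3 \<Rightarrow> 'b) \<Rightarrow> bool) \<Rightarrow> bool" where
  "dtx_in T j k f Z \<longleftrightarrow> (\<forall>vs. set vs \<subseteq> Basis \<and> length vs = k \<longrightarrow>
     (\<exists>g. has_weak_deriv (slab T) (replicate j et @ map (Pair 0) vs) (case_prod f) (case_prod g) \<and> Z g))"

text \<open>The variant of \<open>dtx_in T 0 1\<close> for properties \<open>Z\<close> that refer to every single time, such as
  continuity in time: the representative is moreover the weak gradient of \<open>f t\<close> for every \<open>t\<close>.\<close>
definition grad_in :: "real \<Rightarrow> (real \<Rightarrow> real^3 \<Rightarrow> 'b::euclidean_space) \<Rightarrow>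
    ((real \<Rightarrow> real^3 \<Rightarrow> 'b) \<Rightarrow> bool) \<Rightarrow> bool" where
  "grad_in T f Z \<longleftrightarrow> (\<forall>b\<in>Basis. \<exists>g.
     has_weak_deriv (slab T) [(0, b)] (case_prod f) (case_prod g) \<and>
     (\<forall>t\<in>{0..T}. has_weak_deriv UNIV [b] (f t) (g t)) \<and> Z g)"

text \<open>Multiplication by $\rho^a$ and by $t^{1/2}$.\<close>
definition wt :: "(real \<Rightarrow> real^3 \<Rightarrow> real) \<Rightarrow> real \<Rightarrow> (real \<Rightarrow> real^3 \<Rightarrow> 'b::euclidean_space) \<Rightarrow>
    real \<Rightarrow> real^3 \<Rightarrow> 'b" where
  "wt \<rho> a g = (\<lambda>t x. \<rho> t x powr a *\<^sub>R g t x)"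

definition sqt :: "(real \<Rightarrow> real^3 \<Rightarrow> 'b::euclidean_space) \<Rightarrow> real \<Rightarrow> real^3 \<Rightarrow> 'b" where
  "sqt g = (\<lambda>t x. sqrt t *\<^sub>R g t x)"


section \<open>The Cauchy problem\<close>

definition mass :: "(real^3 \<Rightarrow> real) \<Rightarrow> ennreal" where
  "mass \<rho> = (\<integral>\<^sup>+x. ennreal (\<rho> x) \<partial>lebesgue)"

definition momentum :: "(real^3 \<Rightarrow> real) \<Rightarrow> (real^3 \<Rightarrow> real^3) \<Rightarrow> real^3" where
  "momentum \<rho> u = (\<integral>x. \<rho> x *\<^sub>R u x \<partial>lebesgue)"

text \<open>\<open>dal\<close> is the constant written $\daleth$; \<open>Sb\<close> is $\bar S$.\<close>
locale cns =
  fixes A R \<gamma> \<nu> \<alpha> \<beta> dal Sb :: real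
begin

definition cv :: real where "cv = R / (\<gamma> - 1)"

definition \<delta> :: real where "\<delta> = (\<gamma> - 1) * \<nu>"

definition digamma_c :: real where "digamma_c = R * dal * (A / R) powr (\<nu> + 1)"

text \<open>$\Omega$ is the domain of the functions and \<open>e j\<close> the \<open>j\<close>-th spatial direction in it.\<close>

definition Q :: "'a::euclidean_space set \<Rightarrow> (3 \<Rightarrow> 'a) \<Rightarrow> ('a \<Rightarrow> real^3) \<Rightarrow> 3 \<Rightarrow> 3 \<Rightarrow> 'a \<Rightarrow> real" where
  "Q \<Omega> e u i j = (\<lambda>z.
     \<alpha> * (wderiv \<Omega> [e j] u z $ i + wderiv \<Omega> [e i] u z $ j)
     + (if i = j then \<beta> * (\<Sum>k\<in>UNIV. wderiv \<Omega> [e k] u z $ k) else 0))"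

definition lap :: "'a::euclidean_space set \<Rightarrow> (3 \<Rightarrow> 'a) \<Rightarrow> ('a \<Rightarrow> real) \<Rightarrow> 'a \<Rightarrow> real" where
  "lap \<Omega> e f = (\<lambda>z. \<Sum>k\<in>UNIV. wderiv \<Omega> [e k, e k] f z)"

definition Lame :: "(real^3 \<Rightarrow> real^3) \<Rightarrow> real^3 \<Rightarrow> real^3" where
  "Lame u = (\<lambda>x. \<chi> i. - \<alpha> * (\<Sum>k\<in>UNIV. wderiv UNIV [axis k 1, axis k 1] u x $ i)
                    - (\<alpha> + \<beta>) * (\<Sum>k\<in>UNIV. wderiv UNIV [axis i 1, axis k 1] u x $ k))"

definition H :: "'a::euclidean_space set \<Rightarrow> (3 \<Rightarrow> 'a) \<Rightarrow> ('a \<Rightarrow> real^3) \<Rightarrow> 'a \<Rightarrow> real" where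
  "H \<Omega> e u = (\<lambda>z.
     (\<Sum>j\<in>UNIV. wderiv \<Omega> [e j] (\<lambda>y. \<Sum>i\<in>UNIV. u y $ i * Q \<Omega> e u i j y) z)
     - (\<Sum>i\<in>UNIV. u z $ i * (\<Sum>j\<in>UNIV. wderiv \<Omega> [e j] (Q \<Omega> e u i j) z)))"

definition pressure :: "('a \<Rightarrow> real) \<Rightarrow> ('a \<Rightarrow> real) \<Rightarrow> 'a \<Rightarrow> real" where
  "pressure \<rho> S = (\<lambda>z. A * exp (S z / cv) * \<rho> z powr \<gamma>)"

definition \<Lambda> :: "'a::euclidean_space set \<Rightarrow> (3 \<Rightarrow> 'a) \<Rightarrow> ('a \<Rightarrow> real) \<Rightarrow> ('a \<Rightarrow> real) \<Rightarrow> 'a \<Rightarrow> real" where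
  "\<Lambda> \<Omega> e \<rho> S = (\<lambda>z.
     2 * digamma_c * \<rho> z powr \<delta> * exp (S z / cv * \<nu>) *
       (\<Sum>k\<in>UNIV. wderiv \<Omega> [e k] (\<lambda>y. \<rho> y powr (\<gamma> - 1)) z
                 * wderiv \<Omega> [e k] (\<lambda>y. exp (S y / cv)) z)
     + digamma_c *
       (\<Sum>k\<in>UNIV. wderiv \<Omega> [e k] (\<lambda>y. \<rho> y powr \<delta> * exp (S y / cv * \<nu>)) z
                 * wderiv \<Omega> [e k] (\<lambda>y. exp (S y / cv) * \<rho> y powr (\<gamma> - 1)) z))"

text \<open>The three equations in $\mathcal D'((0,T)\times\mathbb R^3)$, for functions of \<open>z = (t, x)\<close>.
  The derivatives that occur inside products are required to be locally integrable functions, so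
  that the products make sense; outer derivatives are taken in the sense of distributions.\<close>

definition mass_eq :: "real \<Rightarrow> (real \<times> (real^3) \<Rightarrow> real) \<Rightarrow> (real \<times> (real^3) \<Rightarrow> real^3) \<Rightarrow> bool" where
  "mass_eq T \<rho> u \<longleftrightarrow>
     loc_int (slab T) \<rho> \<and> loc_int (slab T) (\<lambda>z. \<rho> z *\<^sub>R u z) \<and>
     (\<forall>\<phi>\<in>test_fun (slab T).
        dist_deriv et (dist_of \<rho>) \<phi>
        + (\<Sum>j\<in>UNIV. dist_deriv (ex j) (dist_of (\<lambda>z. \<rho> z * u z $ j)) \<phi>) = 0)"

definition momentum_eq :: "real \<Rightarrow> (real \<times> (real^3) \<Rightarrow> real) \<Rightarrow> (real \<times> (real^3) \<Rightarrow> real^3) \<Rightarrow>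
    (real \<times> (real^3) \<Rightarrow> real) \<Rightarrow> bool" where
  "momentum_eq T \<rho> u S \<longleftrightarrow>
     (let D = (\<lambda>v. wderiv (slab T) [v] u);
          acc = (\<lambda>i z. \<rho> z * (D et z $ i + (\<Sum>j\<in>UNIV. u z $ j * D (ex j) z $ i)));
          K = (\<lambda>i j z. \<rho> z powr \<delta> * exp (S z / cv * \<nu>) * Q (slab T) ex u i j z)
      in weakly_diff (slab T) [et] u \<and> (\<forall>j. weakly_diff (slab T) [ex j] u) \<and>
         loc_int (slab T) (pressure \<rho> S) \<and>
         (\<forall>i. loc_int (slab T) (acc i) \<and> (\<forall>j. loc_int (slab T) (K i j))) \<and>
         (\<forall>i. \<forall>\<phi>\<in>test_fun (slab T).
            dist_of (acc i) \<phi> + dist_deriv (ex i) (dist_of (pressure \<rho> S)) \<phi>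
            = A powr \<nu> * R powr (- \<nu>) * (\<Sum>j\<in>UNIV. dist_deriv (ex j) (dist_of (K i j)) \<phi>)))"

definition entropy_eq :: "real \<Rightarrow> (real \<times> (real^3) \<Rightarrow> real) \<Rightarrow> (real \<times> (real^3) \<Rightarrow> real^3) \<Rightarrow>
    (real \<times> (real^3) \<Rightarrow> real) \<Rightarrow> bool" where
  "entropy_eq T \<rho> u S \<longleftrightarrow>
     (let \<Omega> = slab T;
          E = (\<lambda>z. exp (S z / cv));
          r = (\<lambda>z. \<rho> z powr (\<gamma> - 1));
          w = (\<lambda>z. \<rho> z powr \<delta> * exp (S z / cv * \<nu>));
          lhs = (\<lambda>z. pressure \<rho> S z *
                   (wderiv \<Omega> [et] S z + (\<Sum>j\<in>UNIV. u z $ j * wderiv \<Omega> [ex j] S z))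
                 - digamma_c * \<rho> z powr (\<delta> + \<gamma> - 1) * exp (S z / cv * \<nu>) * lap \<Omega> ex E z);
          rhs = (\<lambda>z. A powr \<nu> * R powr (1 - \<nu>) * \<rho> z powr \<delta> * exp (S z / cv * \<nu>) * H \<Omega> ex u z
                 + digamma_c * \<rho> z powr \<delta> * exp (S z / cv * (\<nu> + 1)) * lap \<Omega> ex r z
                 + \<Lambda> \<Omega> ex \<rho> S z)
      in weakly_diff \<Omega> [et] S \<and>
         (\<forall>j. weakly_diff \<Omega> [ex j] S \<and> weakly_diff \<Omega> [ex j] u \<and>
              weakly_diff \<Omega> [ex j] E \<and> weakly_diff \<Omega> [ex j, ex j] E \<and>
              weakly_diff \<Omega> [ex j] r \<and> weakly_diff \<Omega> [ex j, ex j] r \<and>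
              weakly_diff \<Omega> [ex j] w \<and> weakly_diff \<Omega> [ex j] (\<lambda>z. E z * r z) \<and>
              weakly_diff \<Omega> [ex j] (\<lambda>z. \<Sum>i\<in>UNIV. u z $ i * Q \<Omega> ex u i j z) \<and>
              (\<forall>i. weakly_diff \<Omega> [ex j] (Q \<Omega> ex u i j))) \<and>
         loc_int \<Omega> lhs \<and> loc_int \<Omega> rhs \<and>
         (\<forall>\<phi>\<in>test_fun \<Omega>. dist_of lhs \<phi> = dist_of rhs \<phi>))"

text \<open>Since \<open>\<rho>\<close>, \<open>u\<close>, \<open>S\<close> are continuous in time in the spaces required below, the initial
  condition is imposed on the values at time 0.\<close>
definition solves_E :: "real \<Rightarrow> (real^3 \<Rightarrow> real) \<Rightarrow> (real^3 \<Rightarrow> real^3) \<Rightarrow> (real^3 \<Rightarrow> real) \<Rightarrow>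
    (real \<Rightarrow> real^3 \<Rightarrow> real) \<Rightarrow> (real \<Rightarrow> real^3 \<Rightarrow> real^3) \<Rightarrow> (real \<Rightarrow> real^3 \<Rightarrow> real) \<Rightarrow> bool" where
  "solves_E T \<rho>\<^sub>0 u\<^sub>0 S\<^sub>0 \<rho> u S \<longleftrightarrow>
     mass_eq T (case_prod \<rho>) (case_prod u) \<and>
     momentum_eq T (case_prod \<rho>) (case_prod u) (case_prod S) \<and>
     entropy_eq T (case_prod \<rho>) (case_prod u) (case_prod S) \<and>
     (AE x in lebesgue. \<rho> 0 x = \<rho>\<^sub>0 x \<and> u 0 x = u\<^sub>0 x \<and> S 0 x = S\<^sub>0 x) \<and>
     (\<forall>t\<in>{0..T}. tends_at_infinity (\<rho> t) 0 \<and> tends_at_infinity (u t) 0 \<and>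
                 tends_at_infinity (S t) Sb)"

definition regular_solution :: "real \<Rightarrow> (real^3 \<Rightarrow> real) \<Rightarrow> (real^3 \<Rightarrow> real^3) \<Rightarrow> (real^3 \<Rightarrow> real) \<Rightarrow>
    (real \<Rightarrow> real^3 \<Rightarrow> real) \<Rightarrow> (real \<Rightarrow> real^3 \<Rightarrow> real^3) \<Rightarrow> (real \<Rightarrow> real^3 \<Rightarrow> real) \<Rightarrow> bool" where
  "regular_solution T \<rho>\<^sub>0 u\<^sub>0 S\<^sub>0 \<rho> u S \<longleftrightarrow>
     (let E = (\<lambda>t x. exp (S t x / cv)); rp = (\<lambda>a t x. \<rho> t x powr a) in
     solves_E T \<rho>\<^sub>0 u\<^sub>0 S\<^sub>0 \<rho> u S \<and>
     (\<forall>t\<in>{0..T}. AE x in lebesgue. 0 < \<rho> t x) \<and>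
     C_in T D1s_D3 (rp (\<gamma> - 1)) \<and>
     grad_in T (rp (\<delta> - 1)) (C_in T (\<lambda>f. Linf f + Dkr 1 3 f + Dk 2 f)) \<and>
     grad_in T (rp (3 * (\<delta> - 1) / 4)) (C_in T D1s) \<and>
     grad_in T (rp (3 * (\<delta> - 1) / 8)) (C_in T (Lp 4)) \<and>
     C_in T (Hs 3) u \<and> L2_in T (Dk 4) u \<and>
     grad_in T u (\<lambda>g. C_in T (Lp 2) (wt \<rho> ((\<delta> - 1) / 2) g)) \<and>
     dtx_in T 0 2 u (\<lambda>g. Linf_in T (Hs 1) (wt \<rho> (\<delta> - 1) g) \<and> L2_in T (Dk 2) (wt \<rho> (\<delta> - 1) g)) \<and>
     C_in T D1s_D3 (\<lambda>t x. S t x - Sb) \<and>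
     C_in T D1s_D3 (\<lambda>t x. E t x - exp (Sb / cv)) \<and>
     dtx_in T 0 1 E (\<lambda>g. Linf_in T (Lp 2) (wt \<rho> ((\<delta> - 1) / 4) g)) \<and>
     dtx_in T 0 2 E (\<lambda>g. Linf_in T (Hs 1) (wt \<rho> ((\<delta> - 1) / 2) g)) \<and>
     L2_in T (\<lambda>f. Dk 1 f + Dk 4 f)
       (\<lambda>t x. \<rho> t x powr (\<delta> + \<gamma> - 1) * exp (S t x / cv * (\<nu> + 1))))"

text \<open>\<open>q\<close> is the exponent from the assumptions on the initial data.\<close>
definition Reg :: "real \<Rightarrow> real \<Rightarrow> (real \<Rightarrow> real^3 \<Rightarrow> real) \<Rightarrow> (real \<Rightarrow> real^3 \<Rightarrow> real^3) \<Rightarrow>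
    (real \<Rightarrow> real^3 \<Rightarrow> real) \<Rightarrow> bool" where
  "Reg q T \<rho> u S \<longleftrightarrow>
     (let rg = (\<lambda>t x. \<rho> t x powr (\<gamma> - 1)); rd = (\<lambda>t x. \<rho> t x powr (\<delta> - 1)) in
     grad_in T rd (C_in T (Lp q)) \<and>
     dtx_in T 1 0 rg (C_in T (Hs 2)) \<and>
     dtx_in T 2 0 rg (C_in T (Lp 2)) \<and>
     dtx_in T 1 1 rd (C_in T (Hs 1)) \<and>
     dtx_in T 1 0 u (C_in T (Hs 1)) \<and>
     dtx_in T 1 0 u (\<lambda>g. Linf_in T (Dk 2) (sqt g) \<and> L2_in T (Dk 3) (sqt g)) \<and>
     dtx_in T 2 1 rd (L2_in T (Lp 2)) \<and>
     dtx_in T 2 1 rg (L2_in T (Lp 2)) \<and>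
     dtx_in T 1 2 u (\<lambda>g. L2_in T (Lp 2) (wt \<rho> (\<delta> - 1) g)) \<and>
     dtx_in T 1 3 u (\<lambda>g. L2_in T (Lp 2) (sqt (wt \<rho> (\<delta> - 1) g))) \<and>
     dtx_in T 2 0 u (L2_in T (Lp 2)) \<and>
     dtx_in T 2 1 u (\<lambda>g. L2_in T (Lp 2) (sqt (wt \<rho> ((\<delta> - 1) / 2) g))) \<and>
     dtx_in T 2 0 u (\<lambda>g. Linf_in T (Lp 2) (sqt g) \<and> L2_in T D1s (sqt g)) \<and>
     dtx_in T 0 4 u (\<lambda>g. Linf_in T (Lp 2) (sqt (wt \<rho> (\<delta> - 1) g))) \<and>
     dtx_in T 1 1 u (\<lambda>g. Linf_in T (Lp 2) (wt \<rho> ((\<delta> - 1) / 2) g)) \<and>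
     dtx_in T 1 2 u (\<lambda>g. Linf_in T (Lp 2) (sqt (wt \<rho> (\<delta> - 1) g))) \<and>
     dtx_in T 0 1 S (\<lambda>g. Linf_in T (Lp 2) (wt \<rho> ((\<delta> - 1) / 4) g)) \<and>
     dtx_in T 0 2 S (\<lambda>g. Linf_in T (Lp 2) (wt \<rho> ((\<delta> - 1) / 2) g)) \<and>
     dtx_in T 0 3 S (\<lambda>g. Linf_in T (Lp 2) (wt \<rho> ((\<delta> - 1) / 2) g)) \<and>
     dtx_in T 1 0 S (\<lambda>g. Linf_in T (Lp 2) (wt \<rho> ((1 - \<delta>) / 4) g)) \<and>
     dtx_in T 1 2 S (\<lambda>g. Linf_in T (Lp 2) (sqt (wt \<rho> ((\<delta> - 1) / 2) g))) \<and>
     dtx_in T 2 0 S (\<lambda>g. Linf_in T (Lp 2) (sqt (wt \<rho> ((1 - \<delta>) / 4) g))) \<and>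
     dtx_in T 1 0 S (\<lambda>g. C_in T D1s g \<and> L2_in T (Dk 2) g) \<and>
     dtx_in T 1 0 S (\<lambda>g. Linf_in T D1s (wt \<rho> ((\<delta> - 1) / 4) g)) \<and>
     dtx_in T 1 0 S (\<lambda>g. L2_in T (Dk 2) (wt \<rho> ((\<delta> - 1) / 2) g)) \<and>
     dtx_in T 2 0 S (\<lambda>g. L2_in T (Lp 2) (wt \<rho> ((1 - \<delta>) / 4) g)) \<and>
     dtx_in T 2 1 S (\<lambda>g. L2_in T (Lp 2) (sqt (wt \<rho> ((\<delta> - 1) / 4) g))))"

definition global_regular_solution :: "real \<Rightarrow> (real^3 \<Rightarrow> real) \<Rightarrow> (real^3 \<Rightarrow> real^3) \<Rightarrow>
    (real^3 \<Rightarrow> real) \<Rightarrow> (real \<Rightarrow> real^3 \<Rightarrow> real) \<Rightarrow> (real \<Rightarrow> real^3 \<Rightarrow> real^3) \<Rightarrow>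
    (real \<Rightarrow> real^3 \<Rightarrow> real) \<Rightarrow> bool" where
  "global_regular_solution q \<rho>\<^sub>0 u\<^sub>0 S\<^sub>0 \<rho> u S \<longleftrightarrow>
     (\<forall>T>0. regular_solution T \<rho>\<^sub>0 u\<^sub>0 S\<^sub>0 \<rho> u S \<and> Reg q T \<rho> u S)"

definition initial_regularity :: "real \<Rightarrow> (real^3 \<Rightarrow> real) \<Rightarrow> (real^3 \<Rightarrow> real^3) \<Rightarrow> (real^3 \<Rightarrow> real) \<Rightarrow> bool"
  where
  "initial_regularity q \<rho>\<^sub>0 u\<^sub>0 S\<^sub>0 \<longleftrightarrow>
     (let rp = (\<lambda>a x. \<rho>\<^sub>0 x powr a) in
     (AE x in lebesgue. 0 < \<rho>\<^sub>0 x) \<and>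
     D1s_D3 (rp (\<gamma> - 1)) < \<infinity> \<and>
     (\<forall>b\<in>Basis. \<exists>g. has_weak_deriv UNIV [b] (rp (\<delta> - 1)) g \<and> Lp q g < \<infinity> \<and> Dkr 1 3 g < \<infinity>) \<and>
     (\<forall>vs. set vs \<subseteq> Basis \<and> length vs = 3 \<longrightarrow>
        (\<exists>g. has_weak_deriv UNIV vs (rp (\<delta> - 1)) g \<and> Lp 2 (\<lambda>x. rp ((\<delta> - 1) / 4) x * g x) < \<infinity>)) \<and>
     (\<forall>b\<in>Basis. \<exists>g. has_weak_deriv UNIV [b] (rp (3 * (\<delta> - 1) / 4)) g \<and> D1s g < \<infinity>) \<and>
     (\<forall>b\<in>Basis. \<exists>g. has_weak_deriv UNIV [b] (rp (3 * (\<delta> - 1) / 8)) g \<and> Lp 4 g < \<infinity>) \<and>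
     Hs 3 u\<^sub>0 < \<infinity> \<and>
     D1s_D3 (\<lambda>x. S\<^sub>0 x - Sb) < \<infinity>)"

text \<open>\<open>g\<^sub>1\<close>, \<open>g\<^sub>3\<close>, \<open>g\<^sub>4\<close>, \<open>g\<^sub>6\<close> are gradient-valued; their first argument is the direction of
  differentiation.\<close>
definition initial_compatibility :: "(real^3 \<Rightarrow> real) \<Rightarrow> (real^3 \<Rightarrow> real^3) \<Rightarrow> (real^3 \<Rightarrow> real) \<Rightarrow>
    (3 \<Rightarrow> real^3 \<Rightarrow> real^3) \<Rightarrow> (real^3 \<Rightarrow> real^3) \<Rightarrow> (3 \<Rightarrow> real^3 \<Rightarrow> real^3) \<Rightarrow>
    (3 \<Rightarrow> real^3 \<Rightarrow> real) \<Rightarrow> (real^3 \<Rightarrow> real) \<Rightarrow> (3 \<Rightarrow> real^3 \<Rightarrow> real) \<Rightarrow> bool" where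
  "initial_compatibility \<rho>\<^sub>0 u\<^sub>0 S\<^sub>0 g\<^sub>1 g\<^sub>2 g\<^sub>3 g\<^sub>4 g\<^sub>5 g\<^sub>6 \<longleftrightarrow>
     (let rp = (\<lambda>a x. \<rho>\<^sub>0 x powr a); E = (\<lambda>x. exp (S\<^sub>0 x / cv)); e = (\<lambda>j. axis j 1) in
     (\<forall>j. Lp 2 (g\<^sub>1 j) < \<infinity> \<and> Lp 2 (g\<^sub>3 j) < \<infinity> \<and> Lp 2 (g\<^sub>4 j) < \<infinity> \<and> Lp 2 (g\<^sub>6 j) < \<infinity>) \<and>
     Lp 2 g\<^sub>2 < \<infinity> \<and> Lp 2 g\<^sub>5 < \<infinity> \<and>
     (\<forall>j. has_weak_deriv UNIV [e j] u\<^sub>0 (\<lambda>x. rp ((1 - \<delta>) / 2) x *\<^sub>R g\<^sub>1 j x)) \<and>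
     (\<forall>i j. weakly_diff UNIV [e i, e j] u\<^sub>0) \<and>
     (AE x in lebesgue. Lame u\<^sub>0 x = rp (1 - \<delta>) x *\<^sub>R g\<^sub>2 x) \<and>
     (\<forall>j. has_weak_deriv UNIV [e j] (\<lambda>x. rp (\<delta> - 1) x *\<^sub>R Lame u\<^sub>0 x)
                                  (\<lambda>x. rp ((1 - \<delta>) / 2) x *\<^sub>R g\<^sub>3 j x)) \<and>
     (\<forall>j. has_weak_deriv UNIV [e j] E (\<lambda>x. rp ((1 - \<delta>) / 4) x * g\<^sub>4 j x)) \<and>
     (\<forall>j. weakly_diff UNIV [e j, e j] E) \<and>
     (AE x in lebesgue. lap UNIV e E x = rp (3 * (1 - \<delta>) / 4) x * g\<^sub>5 x) \<and>
     (\<forall>j. has_weak_deriv UNIV [e j] (\<lambda>x. rp ((\<delta> - 1) / 2) x * lap UNIV e E x)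
                                  (\<lambda>x. rp (3 * (1 - \<delta>) / 4) x * g\<^sub>6 j x)))"

end

end

theory Submission
  imports Defs
begin

text \<open>The momentum of a solution is conserved, its mass does not grow, and the size of the momentum is at most the
  supremum of \<open>\<bar>u\<bar>\<close> times the mass.  A velocity that tends to zero uniformly would therefore force the
  initial momentum to vanish.  What has to be proved is that mass and momentum, which are integrals over the
  whole space, really obey these laws, although the equations hold only in the sense of distributions, and the
  momentum equation in the form \<open>\<rho> (u\<^sub>t + u \<cdot> \<nabla>u)\<close>, which is not a divergence.

  \<^emph>\<open>Bounds.\<close>  The norms of \<open>D\<^sup>1\<^sub>* \<inter> D\<^sup>3\<close> and \<open>H\<^sup>3\<close> control the essential supremum (\<open>sobolev_sup\<close>): the
  mollifications of a function at dyadic scales differ by pairings of its pure third derivatives with bounded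
  kernels on cubes of volume \<open>8 ^ - n\<close>, so that they form a geometrically convergent series.  Hence density,
  velocity and entropy are bounded and continuous in time with values in the essentially bounded functions
  (\<open>C_in_imp_sup_continuous\<close>).  Integrals against a fixed spatial cut-off are then continuous functions of
  time, and a weak balance law turns into a Lipschitz estimate for them (\<open>balance_lipschitz\<close>).

  \<^emph>\<open>Mass\<close> (\<open>mass_le\<close>).  Nothing is known about the integrability of the density at positive times.  With a
  cut-off at distance \<open>r\<close> the flux is at most \<open>1 / r\<close> times the mass in a cube of size \<open>2 * r\<close>, up to a
  constant.  As the density is bounded, that mass is of order \<open>r ^ 3\<close>; inserting the estimate into itself
  lowers the exponent by one each time, until the mass is bounded and the flux is of order \<open>1 / r\<close>.

  \<^emph>\<open>Momentum\<close> (\<open>momentum_conserved\<close>).  By the mass equation the field \<open>(\<rho>, \<rho> u)\<close> is divergence-free in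
  space-time, and a divergence-free field may be multiplied by a weakly differentiable function
  (\<open>divergence_free_product\<close>); this brings the acceleration into divergence form
  (\<open>acceleration_divergence_form\<close>).  The three fluxes are integrable in space, uniformly in time: the convective
  one is bounded by a multiple of \<open>\<rho>\<close>, so is the pressure because \<open>\<gamma> > 1\<close>, and the viscous one is bounded by
  a combination of \<open>\<rho>\<close> and \<open>\<rho> powr (\<delta> - 1) * \<bar>\<nabla>u\<bar>\<^sup>2\<close> (\<open>viscous_weight_bound\<close>), whose integral is bounded for
  a regular solution.  The error of a cut-off at distance \<open>r\<close> is thus of order \<open>1 / r\<close>, and the momentum is
  conserved.\<close>

section \<open>Smooth functions of one variable\<close>

primrec n_times_diff :: "nat \<Rightarrow> (real \<Rightarrow> real) \<Rightarrow> bool" where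
  "n_times_diff 0 f = True"
| "n_times_diff (Suc n) f = ((\<forall>x. f differentiable at x) \<and> n_times_diff n (deriv f))"

definition smooth :: "(real \<Rightarrow> real) \<Rightarrow> bool" where
  "smooth f \<longleftrightarrow> (\<forall>n. n_times_diff n f)"

lemma n_times_diff_mono: "n_times_diff (Suc n) f \<Longrightarrow> n_times_diff n f"
  by (induction n arbitrary: f) auto

lemma n_times_diff_SucI:
  assumes "\<And>x. (f has_real_derivative f' x) (at x)" "n_times_diff n f'"
  shows "n_times_diff (Suc n) f"
proof -
  have "deriv f = f'" using assms(1) by (intro ext DERIV_imp_deriv)
  moreover have "f differentiable at x" for x
    using assms(1)[of x] by (auto simp: real_differentiable_def)
  ultimately show ?thesis using assms(2) by auto
qed

lemma n_times_diff_deriv: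
  assumes "n_times_diff (Suc n) f"
  shows "(f has_real_derivative deriv f x) (at x)" "n_times_diff n (deriv f)"
  using assms by (auto simp: DERIV_deriv_iff_real_differentiable)

lemma smooth_deriv: "smooth f \<Longrightarrow> smooth (deriv f)"
  by (auto simp: smooth_def dest: spec[of _ "Suc _"])

lemma smooth_has_deriv: "smooth f \<Longrightarrow> (f has_real_derivative deriv f x) (at x)"
  unfolding smooth_def using n_times_diff_deriv(1) by blast

lemma smooth_DERIV_chain:
  "smooth f \<Longrightarrow> (g has_real_derivative g') (at x) \<Longrightarrow>
   ((\<lambda>x. f (g x)) has_real_derivative deriv f (g x) * g') (at x)"
  using DERIV_chain2[OF smooth_has_deriv] by blast

lemma smooth_continuous: "smooth f \<Longrightarrow> continuous_on A f"
  by (meson DERIV_isCont continuous_at_imp_continuous_on smooth_has_deriv)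

lemma smooth_measurable [measurable_dest]: "smooth f \<Longrightarrow> f \<in> borel_measurable borel"
  by (intro borel_measurable_continuous_onI smooth_continuous)

lemma n_times_diff_const: "n_times_diff n (\<lambda>x. c)"
proof (induction n arbitrary: c)
  case (Suc n)
  show ?case by (rule n_times_diff_SucI[OF DERIV_const Suc])
qed simp

lemma n_times_diff_id: "n_times_diff n (\<lambda>x. x)"
  by (cases n) (auto intro!: n_times_diff_SucI[OF DERIV_ident n_times_diff_const] simp del: n_times_diff.simps(2))

lemma n_times_diff_add: "n_times_diff n f \<Longrightarrow> n_times_diff n g \<Longrightarrow> n_times_diff n (\<lambda>x. f x + g x)"
proof (induction n arbitrary: f g)
  case (Suc n)
  show ?case
    by (rule n_times_diff_SucI[OF DERIV_add[OF n_times_diff_deriv(1) n_times_diff_deriv(1)]])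
       (use Suc in auto)
qed simp

lemma n_times_diff_mult: "n_times_diff n f \<Longrightarrow> n_times_diff n g \<Longrightarrow> n_times_diff n (\<lambda>x. f x * g x)"
proof (induction n arbitrary: f g)
  case (Suc n)
  have "n_times_diff n f" "n_times_diff n g" using Suc.prems n_times_diff_mono by blast+
  then show ?case
    using Suc by (intro n_times_diff_SucI[OF DERIV_mult[OF n_times_diff_deriv(1) n_times_diff_deriv(1)]]
        n_times_diff_add Suc.IH) auto
qed simp

lemma n_times_diff_compose: "n_times_diff n f \<Longrightarrow> n_times_diff n g \<Longrightarrow> n_times_diff n (\<lambda>x. f (g x))"
proof (induction n arbitrary: f g)
  case (Suc n)
  have "n_times_diff n g" using Suc.prems n_times_diff_mono by blast
  then have "n_times_diff n (\<lambda>x. deriv f (g x) * deriv g x)"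
    using Suc by (intro n_times_diff_mult Suc.IH[of "deriv f" g]) auto
  moreover have "((\<lambda>x. f (g x)) has_real_derivative deriv f (g x) * deriv g x) (at x)" for x
    by (rule DERIV_chain2[of f]) (rule n_times_diff_deriv(1)[OF Suc.prems(1)] n_times_diff_deriv(1)[OF Suc.prems(2)])+
  ultimately show ?case by (rule n_times_diff_SucI[rotated])
qed simp

lemma n_times_diff_inverse:
  "n_times_diff n f \<Longrightarrow> (\<And>x. f x \<noteq> 0) \<Longrightarrow> n_times_diff n (\<lambda>x. inverse (f x))"
proof (induction n arbitrary: f)
  case (Suc n)
  have f: "n_times_diff n f" using Suc.prems n_times_diff_mono by blast
  have "n_times_diff n (\<lambda>x. - 1 * (inverse (f x) * deriv f x * inverse (f x)))"
    using Suc f by (intro n_times_diff_mult n_times_diff_const Suc.IH) auto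
  moreover have "((\<lambda>x. inverse (f x)) has_real_derivative
      - 1 * (inverse (f x) * deriv f x * inverse (f x))) (at x)" for x
    using DERIV_inverse'[OF n_times_diff_deriv(1)[OF Suc.prems(1), of x] Suc.prems(2)[of x]] by simp
  ultimately show ?case by (rule n_times_diff_SucI[rotated])
qed simp

lemma smooth_const: "smooth (\<lambda>x. c)"
  and smooth_id: "smooth (\<lambda>x. x)"
  and smooth_add: "smooth f \<Longrightarrow> smooth g \<Longrightarrow> smooth (\<lambda>x. f x + g x)"
  and smooth_mult: "smooth f \<Longrightarrow> smooth g \<Longrightarrow> smooth (\<lambda>x. f x * g x)"
  and smooth_compose: "smooth f \<Longrightarrow> smooth g \<Longrightarrow> smooth (\<lambda>x. f (g x))"
  and smooth_inverse: "smooth f \<Longrightarrow> (\<And>x. f x \<noteq> 0) \<Longrightarrow> smooth (\<lambda>x. inverse (f x))"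
  by (simp_all add: smooth_def n_times_diff_const n_times_diff_id n_times_diff_add n_times_diff_mult
      n_times_diff_compose n_times_diff_inverse)

lemma smooth_minus: "smooth f \<Longrightarrow> smooth (\<lambda>x. - f x)"
  using smooth_mult[OF smooth_const[of "-1"], of f] by simp

lemma smooth_diff: "smooth f \<Longrightarrow> smooth g \<Longrightarrow> smooth (\<lambda>x. f x - g x)"
  using smooth_add[OF _ smooth_minus, of f g] by simp

lemma smooth_power: "smooth f \<Longrightarrow> smooth (\<lambda>x. f x ^ n)"
  by (induction n) (auto intro: smooth_const smooth_mult)

lemmas smooth_intros = smooth_const smooth_id smooth_add smooth_mult smooth_minus smooth_diff smooth_power

lemma smooth_affine: "smooth f \<Longrightarrow> smooth (\<lambda>x. f (a * x + b))"
  by (rule smooth_compose[of f "\<lambda>x. a * x + b"]) (intro smooth_intros | assumption)+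

text \<open>The powers in the denominator make the family closed under differentiation, up to linear combinations; this
  is what proves all of its members smooth across the origin.\<close>
definition flat :: "nat \<Rightarrow> real \<Rightarrow> real" where
  "flat k x = (if x > 0 then exp (- (1 / x)) / x ^ k else 0)"

lemma flat_has_deriv:
  "(flat k has_real_derivative flat (k + 2) x - real k * flat (k + 1) x) (at x)"
proof -
  consider "x > 0" | "x = 0" | "x < 0" by linarith
  then show ?thesis
  proof cases
    case 1
    have "((\<lambda>x. exp (- (1 / x)) * (1 / x) ^ k) has_real_derivative
        exp (- (1 / x)) * (1 / x) ^ 2 * (1 / x) ^ k
        - real k * (exp (- (1 / x)) * ((1 / x) ^ (k - 1) * (1 / x) ^ 2))) (at x)"
      using 1 by (auto intro!: derivative_eq_intros simp: power2_eq_square)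
    also have "exp (- (1 / x)) * (1 / x) ^ 2 * (1 / x) ^ k
        - real k * (exp (- (1 / x)) * ((1 / x) ^ (k - 1) * (1 / x) ^ 2))
        = flat (k + 2) x - real k * flat (k + 1) x"
      using 1 by (cases k) (simp_all add: flat_def power_divide power2_eq_square mult_ac)
    finally show ?thesis
      by (rule has_field_derivative_transform_within_open[of _ _ _ "{0<..}"])
         (use 1 in \<open>auto simp: flat_def power_divide\<close>)
  next
    case 2
    have "((\<lambda>y. (flat k y - flat k 0) / (y - 0)) \<longlongrightarrow> 0) (at_right 0)"
    proof -
      have "((\<lambda>y. y ^ (Suc k) / exp y) \<longlongrightarrow> (0::real)) at_top"
        by (rule tendsto_power_div_exp_0)
      then have "((\<lambda>y. inverse y ^ (Suc k) / exp (inverse y)) \<longlongrightarrow> (0::real)) (at_right 0)"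
        by (rule filterlim_compose) (rule filterlim_inverse_at_top_right)
      moreover have "eventually (\<lambda>y. inverse y ^ (Suc k) / exp (inverse y)
           = (flat k y - flat k 0) / (y - 0)) (at_right (0::real))"
        using eventually_at_right_less[of "0::real"]
        by eventually_elim (auto simp: flat_def field_simps exp_minus)
      ultimately show ?thesis by (rule Lim_transform_eventually)
    qed
    moreover have "((\<lambda>y. (flat k y - flat k 0) / (y - 0)) \<longlongrightarrow> 0) (at_left 0)"
    proof (rule Lim_transform_eventually[OF tendsto_const])
      show "eventually (\<lambda>y. 0 = (flat k y - flat k 0) / (y - 0)) (at_left (0::real))"
        by (rule eventually_mono[OF eventually_at_left_real[of "-1" 0]]) (auto simp: flat_def)
    qed
    ultimately have "((\<lambda>y. (flat k y - flat k 0) / (y - 0)) \<longlongrightarrow> 0) (at 0)"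
      by (simp add: filterlim_split_at)
    then show ?thesis using 2 by (simp add: has_field_derivative_iff flat_def)
  next
    case 3
    have "((\<lambda>x. 0) has_real_derivative 0) (at x)" by simp
    then have "(flat k has_real_derivative 0) (at x)"
      by (rule has_field_derivative_transform_within_open[of _ _ _ "{..<0}"])
         (use 3 in \<open>auto simp: flat_def\<close>)
    with 3 show ?thesis by (simp add: flat_def)
  qed
qed

lemma smooth_flat: "smooth (flat k)"
proof -
  have "n_times_diff n (flat k)" for n
  proof (induction n arbitrary: k)
    case (Suc n)
    have "n_times_diff n (\<lambda>x. flat (k + 2) x + - real k * flat (k + 1) x)"
      by (intro n_times_diff_add n_times_diff_mult n_times_diff_const Suc)
    then show ?case using flat_has_deriv[of k] by (intro n_times_diff_SucI) auto
  qed simp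
  then show ?thesis by (simp add: smooth_def)
qed

text \<open>A smooth transition from 0 to 1 over the unit interval.\<close>
definition step :: "real \<Rightarrow> real" where
  "step x = flat 0 x * inverse (flat 0 x + flat 0 (1 - x))"

lemma step_denominator_pos: "0 < flat 0 x + flat 0 (1 - x)"
  by (auto simp: flat_def add_pos_pos)

lemma smooth_step: "smooth step"
proof -
  have "smooth (\<lambda>x. flat 0 (-1 * x + 1))" by (rule smooth_affine[OF smooth_flat])
  then have 1: "smooth (\<lambda>x. flat 0 (1 - x))" by simp
  have "smooth (\<lambda>x. flat 0 x * inverse (flat 0 x + flat 0 (1 - x)))"
    using step_denominator_pos
    by (intro smooth_mult smooth_inverse smooth_add smooth_flat 1) (simp add: less_imp_neq[symmetric])
  then show ?thesis by (simp add: step_def[abs_def])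
qed

lemma step_eq_0: "x \<le> 0 \<Longrightarrow> step x = 0"
  by (simp add: step_def flat_def)

lemma step_eq_1: "1 \<le> x \<Longrightarrow> step x = 1"
  by (simp add: step_def flat_def)

lemma step_ge_0: "0 \<le> step x" and step_le_1: "step x \<le> 1"
  using step_denominator_pos[of x]
  by (auto simp: step_def flat_def field_simps)

lemma deriv_eq_0_open:
  fixes f :: "real \<Rightarrow> real"
  assumes "open U" "x \<in> U" "\<And>y. y \<in> U \<Longrightarrow> f y = c"
  shows "deriv f x = 0"
proof -
  have "deriv f x = deriv (\<lambda>_. c) x"
    by (rule deriv_cong_ev) (use assms eventually_nhds_in_open[OF assms(1,2)] in \<open>auto elim: eventually_mono\<close>)
  then show ?thesis by simp
qed

lemma deriv_zero_outside:
  fixes f :: "real \<Rightarrow> real"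
  assumes "\<And>x. x \<notin> {a..b} \<Longrightarrow> f x = 0" "x \<notin> {a..b}"
  shows "deriv f x = 0"
  by (rule deriv_eq_0_open[of "- {a..b}"]) (use assms in auto)

lemma bounded_of_support:
  assumes "smooth f" "\<And>x. x \<notin> {a..b} \<Longrightarrow> f x = 0"
  obtains B where "B \<ge> 0" "\<And>x. \<bar>f x\<bar> \<le> B"
proof -
  have "compact (f ` {a..b})" by (rule compact_continuous_image[OF smooth_continuous[OF assms(1)]]) auto
  then have "bounded (f ` {a..b})" by (rule compact_imp_bounded)
  then obtain B where B: "\<And>x. x \<in> {a..b} \<Longrightarrow> \<bar>f x\<bar> \<le> B"
    unfolding bounded_iff real_norm_def by blast
  show thesis
  proof (rule that[of "\<bar>B\<bar>"])
    fix x show "\<bar>f x\<bar> \<le> \<bar>B\<bar>" using B[of x] assms(2)[of x] by (cases "x \<in> {a..b}") auto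
  qed simp
qed

section \<open>Tensor products as test functions\<close>

text \<open>Products of functions of one coordinate each.  The test functions constructed below are of this kind: their partial
  derivatives are again such products, and the quantification over all multi-indices in \<open>test_fun\<close> reduces to
  smoothness of the factors.\<close>
definition tens :: "('a::euclidean_space \<Rightarrow> real \<Rightarrow> real) \<Rightarrow> 'a \<Rightarrow> real" where
  "tens g x = (\<Prod>b\<in>Basis. g b (x \<bullet> b))"

lemma tens_split: "v \<in> Basis \<Longrightarrow> tens g x = g v (x \<bullet> v) * (\<Prod>b\<in>Basis - {v}. g b (x \<bullet> b))"
  unfolding tens_def by (simp add: prod.remove)

lemma tens_cong: "(\<And>b. b \<in> Basis \<Longrightarrow> g b = h b) \<Longrightarrow> tens g = tens h"
  unfolding tens_def by (auto intro!: ext prod.cong)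

lemma tens_upd: "v \<in> Basis \<Longrightarrow> tens (g(v := h)) x = h (x \<bullet> v) * (\<Prod>b\<in>Basis - {v}. g b (x \<bullet> b))"
  by (simp add: tens_split)

lemma tens_has_derivative:
  assumes "\<And>b. b \<in> Basis \<Longrightarrow> smooth (g b)"
  shows "(tens g has_derivative (\<lambda>v. \<Sum>b\<in>Basis. (v \<bullet> b) * tens (g(b := deriv (g b))) x)) (at x)"
proof -
  have D: "((\<lambda>x. g b (x \<bullet> b)) has_derivative (\<lambda>v. (v \<bullet> b) * deriv (g b) (x \<bullet> b))) (at x)"
    if "b \<in> Basis" for b
  proof -
    have "(g b has_derivative (\<lambda>h. h * deriv (g b) (x \<bullet> b))) (at (x \<bullet> b))"
      using smooth_has_deriv[OF assms[OF that], of "x \<bullet> b"]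
      by (simp add: has_field_derivative_def mult.commute[of _ "deriv _ _"])
    moreover have "((\<lambda>x. x \<bullet> b) has_derivative (\<lambda>v. v \<bullet> b)) (at x)"
      by (auto intro!: derivative_eq_intros)
    ultimately show ?thesis
      using has_derivative_compose[of "\<lambda>x. x \<bullet> b" "\<lambda>v. v \<bullet> b" x UNIV "g b"] by blast
  qed
  have T: "tens g = (\<lambda>x. \<Prod>b\<in>Basis. g b (x \<bullet> b))"
    by (rule ext) (rule tens_def)
  have "(tens g has_derivative
     (\<lambda>v. \<Sum>b\<in>Basis. ((v \<bullet> b) * deriv (g b) (x \<bullet> b)) * (\<Prod>j\<in>Basis - {b}. g j (x \<bullet> j)))) (at x)"
    unfolding T by (rule has_derivative_prod) (use D in auto)
  moreover have "(\<lambda>v. \<Sum>b\<in>Basis. ((v \<bullet> b) * deriv (g b) (x \<bullet> b)) * (\<Prod>j\<in>Basis - {b}. g j (x \<bullet> j)))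
      = (\<lambda>v. \<Sum>b\<in>Basis. (v \<bullet> b) * tens (g(b := deriv (g b))) x)"
    by (rule ext, rule sum.cong[OF refl]) (simp only: tens_upd mult.assoc)
  ultimately show ?thesis by metis
qed

lemma frechet_derivative_tens:
  assumes "\<And>b. b \<in> Basis \<Longrightarrow> smooth (g b)" "v \<in> Basis"
  shows "frechet_derivative (tens g) (at x) v = tens (g(v := deriv (g v))) x"
proof -
  have "frechet_derivative (tens g) (at x) = (\<lambda>v. \<Sum>b\<in>Basis. (v \<bullet> b) * tens (g(b := deriv (g b))) x)"
    by (rule frechet_derivative_at[symmetric]) (rule tens_has_derivative[of g x], rule assms(1))
  then show ?thesis using assms(2)
    by (simp add: inner_Basis if_distrib[of "\<lambda>c. c * _"] cong: if_cong)
qed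

lemma iter_deriv_tens_Cons:
  assumes "\<And>b. b \<in> Basis \<Longrightarrow> smooth (g b)" "v \<in> Basis" "iter_deriv vs f = tens g"
  shows "iter_deriv (v # vs) f = tens (g(v := deriv (g v)))"
  using assms(3) frechet_derivative_tens[of g v] assms(1,2) by auto

lemma iter_deriv_tens:
  assumes "\<And>b. b \<in> Basis \<Longrightarrow> smooth (g b)" "v \<in> Basis"
  shows "iter_deriv [v] (tens g) = tens (g(v := deriv (g v)))"
  by (rule iter_deriv_tens_Cons) (use assms in auto)

lemma iter_deriv_tens_smooth:
  assumes "\<And>b. b \<in> Basis \<Longrightarrow> smooth (g b)" "set vs \<subseteq> Basis"
  shows "\<exists>g'. iter_deriv vs (tens g) = tens g' \<and> (\<forall>b\<in>Basis. smooth (g' b))"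
  using assms(2)
proof (induction vs)
  case Nil
  then show ?case using assms(1) by auto
next
  case (Cons v vs)
  then obtain g' where g': "iter_deriv vs (tens g) = tens g'" "\<forall>b\<in>Basis. smooth (g' b)" by auto
  then have "iter_deriv (v # vs) (tens g) = tens (g'(v := deriv (g' v)))"
    using Cons.prems by (intro iter_deriv_tens_Cons) auto
  moreover have "\<forall>b\<in>Basis. smooth ((g'(v := deriv (g' v))) b)"
    using g' smooth_deriv Cons.prems by auto
  ultimately show ?case by blast
qed

lemma tens_zero_outside:
  assumes "\<And>b s. b \<in> Basis \<Longrightarrow> s \<notin> {a \<bullet> b..c \<bullet> b} \<Longrightarrow> g b s = 0" "x \<notin> cbox a c"
  shows "tens g x = 0"
proof -
  obtain b where "b \<in> Basis" "x \<bullet> b \<notin> {a \<bullet> b..c \<bullet> b}" using assms(2) by (auto simp: mem_box)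
  then show ?thesis using assms(1) unfolding tens_def by (intro prod_zero) auto
qed

lemma tens_test_fun:
  assumes "\<And>b. b \<in> Basis \<Longrightarrow> smooth (g b)"
    and "\<And>b s. b \<in> Basis \<Longrightarrow> s \<notin> {a \<bullet> b..c \<bullet> b} \<Longrightarrow> g b s = 0" "cbox a c \<subseteq> \<Omega>"
  shows "tens g \<in> test_fun \<Omega>"
  unfolding test_fun_def
proof (intro CollectI conjI allI impI exI[of _ "cbox a c"])
  fix vs :: "'a list" and x assume "set vs \<subseteq> Basis"
  then obtain g' where "iter_deriv vs (tens g) = tens g'" "\<forall>b\<in>Basis. smooth (g' b)"
    using iter_deriv_tens_smooth[of g vs] assms(1) by blast
  then show "iter_deriv vs (tens g) differentiable at x"
    using tens_has_derivative[of g' x] by (auto simp: differentiable_def)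
qed (use assms tens_zero_outside[of a c g] in auto)

lemma tens_measurable [measurable (raw)]:
  assumes "\<And>b. b \<in> Basis \<Longrightarrow> smooth (g b)"
  shows "tens g \<in> borel_measurable borel"
  unfolding tens_def[abs_def]
proof (rule borel_measurable_prod)
  fix b :: 'a assume "b \<in> Basis"
  note [measurable] = smooth_measurable[OF assms[OF this]]
  show "(\<lambda>x. g b (x \<bullet> b)) \<in> borel_measurable borel" by measurable
qed

lemma abs_tens_le:
  assumes "\<And>b s. b \<in> Basis \<Longrightarrow> \<bar>g b s\<bar> \<le> B b"
  shows "\<bar>tens g x\<bar> \<le> (\<Prod>b\<in>Basis. B b)"
  unfolding tens_def abs_prod by (intro prod_mono) (use assms in auto)

section \<open>Borel representatives of Lebesgue measurable functions\<close>

lemma lebesgue_borel_rep: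
  fixes f :: "'a::euclidean_space \<Rightarrow> 'b::euclidean_space"
  assumes "f \<in> borel_measurable lebesgue"
  obtains g where "g \<in> borel_measurable borel" "AE x in lborel. f x = g x"
proof -
  have "\<exists>g\<in>borel_measurable lborel. AE x in lborel. f x \<bullet> b = g x" for b
    by (intro completion_ex_borel_measurable_real measurable_compose[OF assms]) simp
  then obtain g where g: "\<And>b. g b \<in> borel_measurable lborel" "\<And>b. AE x in lborel. f x \<bullet> b = g b x"
    by metis
  show thesis
  proof
    show "(\<lambda>x. \<Sum>b\<in>Basis. g b x *\<^sub>R b) \<in> borel_measurable borel" using g(1) by simp
    have "AE x in lborel. \<forall>b\<in>Basis. f x \<bullet> b = g b x"
      using g(2) by (intro AE_finite_allI) auto
    then show "AE x in lborel. f x = (\<Sum>b\<in>Basis. g b x *\<^sub>R b)"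
    proof eventually_elim
      case (elim x)
      then have "(\<Sum>b\<in>Basis. g b x *\<^sub>R b) = (\<Sum>b\<in>Basis. (f x \<bullet> b) *\<^sub>R b)" by simp
      then show ?case by (simp add: euclidean_representation)
    qed
  qed
qed

lemma lebesgue_borel_rep_integrable:
  fixes f :: "'a::euclidean_space \<Rightarrow> 'b::euclidean_space"
  assumes "integrable lebesgue f"
  obtains g where "g \<in> borel_measurable borel" "integrable lborel g" "AE x in lborel. f x = g x"
    "AE x in lebesgue. f x = g x"
proof -
  obtain g where g: "g \<in> borel_measurable borel" "AE x in lborel. f x = g x"
    by (rule lebesgue_borel_rep[OF borel_measurable_integrable[OF assms]])
  have "AE x in lebesgue. f x = g x" using g(2) by (rule AE_completion)
  moreover have "integrable lebesgue g"
    by (rule integrable_cong_AE_imp[OF assms]) (use g \<open>AE x in lebesgue. f x = g x\<close> in \<open>auto intro: measurable_completion\<close>)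
  then have "integrable lborel g" using g integrable_completion[of g lborel] by simp
  ultimately show thesis using that g by blast
qed

lemma lebesgue_integral_cong_AE_borel:
  fixes f g :: "'a::euclidean_space \<Rightarrow> 'b::euclidean_space"
  assumes "f \<in> borel_measurable lebesgue" "g \<in> borel_measurable borel" "AE x in lborel. f x = g x"
  shows "(\<integral>x. f x \<partial>lebesgue) = (\<integral>x. g x \<partial>lborel)"
proof -
  have "(\<integral>x. f x \<partial>lebesgue) = (\<integral>x. g x \<partial>lebesgue)"
    by (rule integral_cong_AE) (use assms AE_completion in \<open>auto intro: measurable_completion\<close>)
  then show ?thesis using assms by (simp add: integral_completion)
qed

lemma integral_reflect_lborel:
  fixes f :: "'a::euclidean_space \<Rightarrow> 'b::{banach, second_countable_topology}"
  assumes [measurable]: "f \<in> borel_measurable borel"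
  shows "(\<integral>y. f (x - y) \<partial>lborel) = (\<integral>y. f y \<partial>lborel)"
    and "(\<integral>\<^sup>+y. norm (f (x - y)) \<partial>lborel) = (\<integral>\<^sup>+y. norm (f y) \<partial>lborel)"
proof -
  have eq: "lborel = distr lborel borel (\<lambda>y::'a. x - y)"
    using lborel_affine[of "-1" x] by (simp add: density_1)
  show "(\<integral>y. f (x - y) \<partial>lborel) = (\<integral>y. f y \<partial>lborel)"
    by (subst (2) eq) (simp add: integral_distr)
  show "(\<integral>\<^sup>+y. norm (f (x - y)) \<partial>lborel) = (\<integral>\<^sup>+y. norm (f y) \<partial>lborel)"
    by (subst (2) eq) (simp add: nn_integral_distr)
qed

lemma nn_integral_translate_lborel:
  fixes f :: "'a::euclidean_space \<Rightarrow> ennreal"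
  assumes [measurable]: "f \<in> borel_measurable borel"
  shows "(\<integral>\<^sup>+x. f (x + h) \<partial>lborel) = (\<integral>\<^sup>+x. f x \<partial>lborel)"
  by (subst (2) lborel_distr_plus[of h, symmetric]) (simp add: nn_integral_distr add.commute)

section \<open>Slices of functions on a product\<close>

lemma AE_slices:
  fixes P :: "'a::euclidean_space \<times> 'b::euclidean_space \<Rightarrow> bool"
  assumes "AE z in lebesgue. P z"
  shows "AE t in lebesgue. AE x in lebesgue. P (t, x)"
proof -
  have "AE z in lborel \<Otimes>\<^sub>M lborel. P z" using assms unfolding lborel_prod AE_completion_iff .
  then have "AE t in lborel. AE x in lborel. P (t, x)" by (rule lborel_pair.AE_pair)
  then show ?thesis by (simp add: AE_completion_iff)
qed

lemma AE_of_slices: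
  fixes N :: "('a::euclidean_space \<times> 'b::euclidean_space) set"
  assumes N: "N \<in> sets lebesgue" and "\<And>t. AE x in lebesgue. (t, x) \<notin> N"
  shows "AE z in lebesgue. z \<notin> N"
proof -
  have "indicat_real N \<in> borel_measurable lebesgue" using N by simp
  then obtain g where g [measurable]: "g \<in> borel_measurable borel"
    and eq: "AE z in lborel. indicat_real N z = g z"
    by (rule lebesgue_borel_rep)
  have "AE t in lborel. AE x in lborel. indicat_real N (t, x) = g (t, x)"
    by (rule lborel_pair.AE_pair) (use eq in \<open>unfold lborel_prod\<close>)
  then have "AE t in lborel. AE x in lborel. g (t, x) = 0"
  proof eventually_elim
    case (elim t)
    have "AE x in lborel. (t, x) \<notin> N" using assms(2)[of t] by (simp add: AE_completion_iff)
    with elim show ?case by eventually_elim auto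
  qed
  then have "AE z in lborel \<Otimes>\<^sub>M lborel. g z = 0"
    by (rule lborel_pair.AE_pair_measure[rotated]) (unfold lborel_prod, simp)
  then have "AE z in lborel. g z = 0" unfolding lborel_prod .
  with eq have "AE z in lborel. z \<notin> N" by eventually_elim (auto simp: indicator_def split: if_splits)
  then show ?thesis by (rule AE_completion)
qed

lemma nn_integral_slices:
  fixes f :: "'a::euclidean_space \<times> 'b::euclidean_space \<Rightarrow> ennreal"
  assumes "f \<in> borel_measurable lebesgue"
  shows "(\<integral>\<^sup>+z. f z \<partial>lebesgue) = (\<integral>\<^sup>+t. (\<integral>\<^sup>+x. f (t, x) \<partial>lebesgue) \<partial>lebesgue)"
proof -
  obtain g where g [measurable]: "g \<in> borel_measurable lborel" and eq: "AE z in lborel. f z = g z"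
    using completion_ex_borel_measurable[OF assms] by blast
  have *: "AE t in lborel. AE x in lborel. f (t, x) = g (t, x)"
    by (rule lborel_pair.AE_pair) (use eq in \<open>unfold lborel_prod\<close>)
  have "(\<integral>\<^sup>+z. f z \<partial>lebesgue) = (\<integral>\<^sup>+z. f z \<partial>lborel)" by (rule nn_integral_completion)
  also have "\<dots> = (\<integral>\<^sup>+z. g z \<partial>(lborel \<Otimes>\<^sub>M lborel))"
    using nn_integral_cong_AE[OF eq] by (simp add: lborel_prod)
  also have "\<dots> = (\<integral>\<^sup>+t. (\<integral>\<^sup>+x. g (t, x) \<partial>lborel) \<partial>lborel)"
    by (rule lborel.nn_integral_fst[symmetric]) (simp add: lborel_prod)
  also have "\<dots> = (\<integral>\<^sup>+t. (\<integral>\<^sup>+x. f (t, x) \<partial>lborel) \<partial>lborel)"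
    by (rule nn_integral_cong_AE) (use * in eventually_elim, rule nn_integral_cong_AE, auto)
  finally show ?thesis by (simp add: nn_integral_completion)
qed

lemma integral_slices:
  fixes f :: "'a::euclidean_space \<times> 'b::euclidean_space \<Rightarrow> real"
  assumes f: "integrable lebesgue f"
    and F: "F \<in> borel_measurable lebesgue" "AE t in lebesgue. F t = (\<integral>x. f (t, x) \<partial>lebesgue)"
    and meas: "\<And>t. (\<lambda>x. f (t, x)) \<in> borel_measurable lebesgue"
  shows "(\<integral>z. f z \<partial>lebesgue) = (\<integral>t. F t \<partial>lebesgue)"
proof -
  obtain g where g [measurable]: "g \<in> borel_measurable borel" "integrable lborel g"
    and eq: "AE z in lborel. f z = g z"
    using lebesgue_borel_rep_integrable[OF f] by blast
  have *: "AE t in lborel. AE x in lborel. f (t, x) = g (t, x)"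
    by (rule lborel_pair.AE_pair) (use eq in \<open>unfold lborel_prod\<close>)
  have G: "(\<lambda>t. \<integral>x. g (t, x) \<partial>lborel) \<in> borel_measurable borel"
    using lborel.borel_measurable_lebesgue_integral[of "\<lambda>t x. g (t, x)" lborel] by (simp add: lborel_prod)
  have "(\<integral>z. f z \<partial>lebesgue) = (\<integral>z. g z \<partial>lborel)"
    using f g eq by (intro lebesgue_integral_cong_AE_borel) auto
  also have "\<dots> = (\<integral>t. (\<integral>x. g (t, x) \<partial>lborel) \<partial>lborel)"
    using lborel_pair.integral_fst'[of g] g by (simp add: lborel_prod)
  also have "\<dots> = (\<integral>t. F t \<partial>lebesgue)"
  proof (rule lebesgue_integral_cong_AE_borel[symmetric, OF F(1) G])
    have "AE t in lborel. F t = (\<integral>x. f (t, x) \<partial>lebesgue)" using F(2) by (simp add: AE_completion_iff)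
    then show "AE t in lborel. F t = (\<integral>x. g (t, x) \<partial>lborel)"
      using *
    proof eventually_elim
      case (elim t)
      then show ?case using lebesgue_integral_cong_AE_borel[OF meas[of t], of "\<lambda>x. g (t, x)"] by simp
    qed
  qed
  finally show ?thesis .
qed

text \<open>\<open>b\<close> and \<open>a\<close> are only Lebesgue measurable, so the exchange goes through Borel representatives;
  the kernel is bounded, hence the integrand is dominated by a product of integrable functions.\<close>
lemma integral_kernel_commute:
  fixes a :: "'a::euclidean_space \<Rightarrow> real" and b :: "'b::euclidean_space \<Rightarrow> real"
    and k :: "'b \<times> 'a \<Rightarrow> real"
  assumes a: "integrable lebesgue a" and b: "integrable lebesgue b"
    and k [measurable]: "k \<in> borel_measurable borel" and kB: "\<And>z. \<bar>k z\<bar> \<le> B"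
  shows "(\<integral>w. (\<integral>z. b z * k (z, w) \<partial>lebesgue) * a w \<partial>lebesgue)
       = (\<integral>z. b z * (\<integral>w. k (z, w) * a w \<partial>lebesgue) \<partial>lebesgue)"
proof -
  obtain a' where a' [measurable]: "a' \<in> borel_measurable borel" and ia: "integrable lborel a'"
    and ea: "AE x in lborel. a x = a' x" and ea': "AE x in lebesgue. a x = a' x"
    using lebesgue_borel_rep_integrable[OF a] by blast
  obtain b' where b' [measurable]: "b' \<in> borel_measurable borel" and ib: "integrable lborel b'"
    and eb: "AE x in lborel. b x = b' x" and eb': "AE x in lebesgue. b x = b' x"
    using lebesgue_borel_rep_integrable[OF b] by blast
  have am: "a \<in> borel_measurable lebesgue" and bm: "b \<in> borel_measurable lebesgue"
    using a b by auto
  have kz: "(\<lambda>w. k (z, w)) \<in> borel_measurable lebesgue" and kw: "(\<lambda>z. k (z, w)) \<in> borel_measurable lebesgue" for z w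
    by (rule measurable_completion, measurable)+
  have 1: "(\<integral>z. b z * k (z, w) \<partial>lebesgue) = (\<integral>z. b' z * k (z, w) \<partial>lborel)" for w
    by (rule lebesgue_integral_cong_AE_borel) (use eb bm kw in \<open>auto\<close>)
  have 2: "(\<integral>w. k (z, w) * a w \<partial>lebesgue) = (\<integral>w. k (z, w) * a' w \<partial>lborel)" for z
    by (rule lebesgue_integral_cong_AE_borel) (use ea am kz in \<open>auto\<close>)
  have m1: "(\<lambda>w. \<integral>z. b' z * k (z, w) \<partial>lborel) \<in> borel_measurable borel"
  proof -
    have [measurable]: "k \<in> borel_measurable (borel \<Otimes>\<^sub>M borel)" by (simp add: borel_prod)
    have "(\<lambda>(w, z). b' z * k (z, w)) \<in> borel_measurable (borel \<Otimes>\<^sub>M borel)"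
      by measurable
    then show ?thesis
      using lborel.borel_measurable_lebesgue_integral[of "\<lambda>w z. b' z * k (z, w)" borel] by simp
  qed
  have m2: "(\<lambda>z. \<integral>w. k (z, w) * a' w \<partial>lborel) \<in> borel_measurable borel"
  proof -
    have [measurable]: "k \<in> borel_measurable (borel \<Otimes>\<^sub>M borel)" by (simp add: borel_prod)
    have "(\<lambda>(z, w). k (z, w) * a' w) \<in> borel_measurable (borel \<Otimes>\<^sub>M borel)"
      by measurable
    then show ?thesis
      using lborel.borel_measurable_lebesgue_integral[of "\<lambda>z w. k (z, w) * a' w" borel] by simp
  qed
  have m1': "(\<lambda>w. \<integral>z. b' z * k (z, w) \<partial>lborel) \<in> borel_measurable lebesgue"
    and m2': "(\<lambda>z. \<integral>w. k (z, w) * a' w \<partial>lborel) \<in> borel_measurable lebesgue"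
    by (rule measurable_completion, use m1 m2 in simp)+
  have int: "integrable (lborel \<Otimes>\<^sub>M lborel) (\<lambda>(z, w). b' z * (k (z, w) * a' w))"
  proof (rule Bochner_Integration.integrable_bound)
    show "integrable (lborel \<Otimes>\<^sub>M lborel) (\<lambda>(z, w). b' z * (B * a' w))"
    proof (rule lborel_pair.Fubini_integrable)
      show "integrable lborel (\<lambda>x. \<integral>y. norm (case (x, y) of (z, w) \<Rightarrow> b' z * (B * a' w)) \<partial>lborel)"
        using ia ib by (simp add: abs_mult)
      show "(\<lambda>(z, w). b' z * (B * a' w)) \<in> borel_measurable (lborel \<Otimes>\<^sub>M lborel)" by measurable
    qed (use ia ib in auto)
    have [measurable]: "k \<in> borel_measurable (borel \<Otimes>\<^sub>M borel)" by (simp add: borel_prod)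
    show "(\<lambda>(z, w). b' z * (k (z, w) * a' w)) \<in> borel_measurable (lborel \<Otimes>\<^sub>M lborel)"
      by measurable
    have "0 \<le> B" using kB[of undefined] by linarith
    then show "AE x in lborel \<Otimes>\<^sub>M lborel. norm (case x of (z, w) \<Rightarrow> b' z * (k (z, w) * a' w))
           \<le> norm (case x of (z, w) \<Rightarrow> b' z * (B * a' w))"
      using kB by (intro AE_I2) (auto simp: abs_mult intro!: mult_left_mono mult_right_mono)
  qed
  have "(\<integral>w. (\<integral>z. b z * k (z, w) \<partial>lebesgue) * a w \<partial>lebesgue)
      = (\<integral>w. (\<integral>z. b' z * k (z, w) \<partial>lborel) * a' w \<partial>lborel)"
    unfolding 1 by (rule lebesgue_integral_cong_AE_borel) (use ea am m1 m1' in auto)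
  also have "\<dots> = (\<integral>w. (\<integral>z. b' z * (k (z, w) * a' w) \<partial>lborel) \<partial>lborel)"
    by (simp add: mult.assoc[symmetric])
  also have "\<dots> = (\<integral>z. (\<integral>w. b' z * (k (z, w) * a' w) \<partial>lborel) \<partial>lborel)"
    using lborel_pair.Fubini_integral[of "\<lambda>z w. b' z * (k (z, w) * a' w)"] int by simp
  also have "\<dots> = (\<integral>z. b' z * (\<integral>w. k (z, w) * a' w \<partial>lborel) \<partial>lborel)"
    by simp
  also have "\<dots> = (\<integral>z. b z * (\<integral>w. k (z, w) * a w \<partial>lebesgue) \<partial>lebesgue)"
    unfolding 2 by (rule lebesgue_integral_cong_AE_borel[symmetric])
      (use eb bm m2 m2' in auto)
  finally show ?thesis .
qed

section \<open>Approximation in the mean\<close>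

lemma compact_open_sandwich:
  fixes A :: "'a::euclidean_space set"
  assumes A: "A \<in> sets borel" "emeasure lborel A < \<infinity>" and "e > (0::real)"
  obtains K U where "compact K" "open U" "K \<subseteq> A" "A \<subseteq> U" "emeasure lborel (U - K) < e"
proof -
  have [measurable]: "A \<in> sets borel" by fact
  obtain U where U: "open U" "A \<subseteq> U" "emeasure lborel (U - A) < ennreal (e / 4)"
    using outer_regular_lborel[OF A(1), of "e / 4"] \<open>e > 0\<close> by auto
  have "(\<lambda>n. emeasure lborel (A - cball 0 (real n))) \<longlonglongrightarrow> emeasure lborel (\<Inter>n. A - cball 0 (real n))"
  proof (rule Lim_emeasure_decseq)
    show "decseq (\<lambda>n. A - cball 0 (real n))" by (auto simp: decseq_def)
    show "emeasure lborel (A - cball 0 (real n)) \<noteq> \<infinity>" for n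
      using emeasure_mono[of "A - cball 0 (real n)" A lborel] A by (auto simp: top_unique)
  qed auto
  moreover have *: "(\<Inter>n. A - cball 0 (real n)) = {}"
    by (auto simp: not_le) (meson linorder_not_le real_arch_simple)
  ultimately have "(\<lambda>n. emeasure lborel (A - cball 0 (real n))) \<longlonglongrightarrow> 0" unfolding * by simp
  then have "eventually (\<lambda>n. emeasure lborel (A - cball 0 (real n)) < ennreal (e / 4)) sequentially"
    using \<open>e > 0\<close> by (intro order_tendstoD) auto
  then obtain n where n: "emeasure lborel (A - cball 0 (real n)) < ennreal (e / 4)"
    by (auto simp: eventually_sequentially)
  have "A \<inter> cball 0 (real n) \<in> sets lebesgue" "e / 4 > 0" using \<open>e > 0\<close> by simp_all
  then obtain K where K: "closed K" "K \<subseteq> A \<inter> cball 0 (real n)"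
    "A \<inter> cball 0 (real n) - K \<in> lmeasurable"
    "emeasure lebesgue (A \<inter> cball 0 (real n) - K) < ennreal (e / 4)"
    by (rule sets_lebesgue_inner_closed)
  have [measurable]: "K \<in> sets borel" "U \<in> sets borel" by (rule borel_closed[OF K(1)], rule borel_open[OF U(1)])
  have "bounded K" using bounded_subset[OF bounded_cball[of 0 "real n"]] K(2) by blast
  show thesis
  proof
    show "compact K" using K(1) \<open>bounded K\<close> by (simp add: compact_eq_bounded_closed)
    have "U - K \<subseteq> (U - A) \<union> ((A - cball 0 (real n)) \<union> (A \<inter> cball 0 (real n) - K))" by auto
    then have "emeasure lborel (U - K)
        \<le> emeasure lborel ((U - A) \<union> ((A - cball 0 (real n)) \<union> (A \<inter> cball 0 (real n) - K)))"
      by (rule emeasure_mono) simp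
    also have "\<dots> \<le> emeasure lborel (U - A) + emeasure lborel ((A - cball 0 (real n)) \<union> (A \<inter> cball 0 (real n) - K))"
      by (rule emeasure_subadditive) simp_all
    also have "\<dots> \<le> emeasure lborel (U - A) + (emeasure lborel (A - cball 0 (real n)) + emeasure lborel (A \<inter> cball 0 (real n) - K))"
      by (intro add_left_mono emeasure_subadditive) simp_all
    also have "\<dots> \<le> ennreal (e / 4) + (ennreal (e / 4) + ennreal (e / 4))"
      by (intro add_mono less_imp_le U n) (use K(4) in simp)
    also have "\<dots> = ennreal (3 / 4 * e)" using \<open>e > 0\<close> by (simp add: ennreal_plus[symmetric] del: ennreal_plus)
    also have "\<dots> < ennreal e" using \<open>e > 0\<close> by (intro ennreal_lessI) auto
    finally show "emeasure lborel (U - K) < e" .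
  qed (use U K in auto)
qed

text \<open>Translating the indicator function of a set squeezed between a compact and an open set changes it only in
  the gap between the two, as long as the translation is shorter than their distance.  Linear combinations and
  \<open>L\<^sup>1\<close>-limits inherit the property.\<close>
lemma L1_translation_continuous:
  fixes f :: "'a::euclidean_space \<Rightarrow> 'b::{banach, second_countable_topology}"
  assumes "integrable lborel f" "e > (0::real)"
  shows "\<exists>d>0. \<forall>h. norm h < d \<longrightarrow> (\<integral>\<^sup>+x. norm (f (x + h) - f x) \<partial>lborel) \<le> e"
  using assms
proof (induction arbitrary: e rule: integrable_induct)
  case (base A c)
  then have A [measurable]: "A \<in> sets borel" and Af: "emeasure lborel A < \<infinity>" by auto
  define e' where "e' = e / (2 * (norm c + 1))"
  have "e' > 0" using base by (simp add: e'_def add_nonneg_pos)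
  obtain K U where K: "compact K" "open U" "K \<subseteq> A" "A \<subseteq> U" "emeasure lborel (U - K) < e'"
    using compact_open_sandwich[OF A Af \<open>e' > 0\<close>] by auto
  have [measurable]: "K \<in> sets borel" "U \<in> sets borel" using K by (auto simp: borel_compact)
  obtain d where d: "d > 0" "\<And>x y. x \<in> K \<Longrightarrow> y \<notin> U \<Longrightarrow> d \<le> dist x y"
    using separate_compact_closed[of K "- U"] K
    by (auto simp: disjoint_eq_subset_Compl closed_Compl) (meson ComplI order_trans)
  show ?case
  proof (intro exI[of _ d] conjI allI impI)
    fix h :: 'a assume h: "norm h < d"
    have le: "norm (indicator A (x + h) *\<^sub>R c - indicator A x *\<^sub>R c)
        \<le> (indicator (U - K) (x + h) + indicator (U - K) x) * norm c" for x
    proof -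
      have "x + h \<in> U" if "x \<in> K" using d(2)[OF that, of "x + h"] h by (force simp: dist_norm)
      moreover have "x \<in> U" if "x + h \<in> K" using d(2)[OF that, of x] h by (force simp: dist_norm)
      ultimately show ?thesis using K by (auto simp: indicator_def)
    qed
    have "(\<integral>\<^sup>+x. norm (indicator A (x + h) *\<^sub>R c - indicator A x *\<^sub>R c) \<partial>lborel)
        \<le> (\<integral>\<^sup>+x. ennreal (norm c) * indicator (U - K) (x + h) + ennreal (norm c) * indicator (U - K) x \<partial>lborel)"
    proof (rule nn_integral_mono)
      fix x
      have "ennreal (norm (indicator A (x + h) *\<^sub>R c - indicator A x *\<^sub>R c))
         \<le> ennreal ((indicator (U - K) (x + h) + indicator (U - K) x) * norm c)"
        using le by (rule ennreal_leI)
      also have "\<dots> = ennreal (norm c) * indicator (U - K) (x + h) + ennreal (norm c) * indicator (U - K) x"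
        by (simp add: distrib_left ennreal_mult ennreal_indicator mult.commute)
      finally show "ennreal (norm (indicator A (x + h) *\<^sub>R c - indicator A x *\<^sub>R c))
         \<le> ennreal (norm c) * indicator (U - K) (x + h) + ennreal (norm c) * indicator (U - K) x" .
    qed
    also have "\<dots> = ennreal (norm c) * (\<integral>\<^sup>+x. indicator (U - K) (x + h) \<partial>lborel)
       + ennreal (norm c) * emeasure lborel (U - K)"
      by (simp add: nn_integral_add nn_integral_cmult)
    also have "(\<integral>\<^sup>+x. indicator (U - K) (x + h) \<partial>lborel) = emeasure lborel (U - K)"
      by (subst nn_integral_translate_lborel) auto
    also have "ennreal (norm c) * emeasure lborel (U - K) + ennreal (norm c) * emeasure lborel (U - K)
        \<le> ennreal (norm c) * ennreal e' + ennreal (norm c) * ennreal e'"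
      using K(5) by (intro add_mono mult_left_mono) auto
    also have "\<dots> = ennreal (2 * norm c * e')"
      using \<open>e' > 0\<close> by (simp add: ennreal_mult[symmetric] ennreal_plus[symmetric] del: ennreal_plus)
    also have "\<dots> \<le> ennreal e"
    proof (rule ennreal_leI)
      have "2 * norm c * e' = e * (norm c / (norm c + 1))"
        by (simp add: e'_def field_simps add_nonneg_eq_0_iff)
      also have "\<dots> \<le> e * 1" using base by (intro mult_left_mono) (auto simp: divide_simps add_nonneg_pos)
      finally show "2 * norm c * e' \<le> e" by simp
    qed
    finally show "(\<integral>\<^sup>+x. norm (indicator A (x + h) *\<^sub>R c - indicator A x *\<^sub>R c) \<partial>lborel) \<le> e" .
  qed (use d in auto)
next
  case (add f g)
  have [measurable]: "f \<in> borel_measurable borel" "g \<in> borel_measurable borel" using add by auto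
  obtain d1 where d1: "d1 > 0" "\<And>h. norm h < d1 \<Longrightarrow> (\<integral>\<^sup>+x. norm (f (x + h) - f x) \<partial>lborel) \<le> ennreal (e / 2)"
    using add.IH(1)[of "e / 2"] add.prems by auto
  obtain d2 where d2: "d2 > 0" "\<And>h. norm h < d2 \<Longrightarrow> (\<integral>\<^sup>+x. norm (g (x + h) - g x) \<partial>lborel) \<le> ennreal (e / 2)"
    using add.IH(2)[of "e / 2"] add.prems by auto
  show ?case
  proof (intro exI[of _ "min d1 d2"] conjI allI impI)
    fix h :: 'a assume h: "norm h < min d1 d2"
    have "(\<integral>\<^sup>+x. norm (f (x + h) + g (x + h) - (f x + g x)) \<partial>lborel)
       \<le> (\<integral>\<^sup>+x. ennreal (norm (f (x + h) - f x)) + ennreal (norm (g (x + h) - g x)) \<partial>lborel)"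
      by (intro nn_integral_mono)
         (simp add: ennreal_plus[symmetric] norm_diff_triangle_ineq ennreal_leI del: ennreal_plus)
    also have "\<dots> = (\<integral>\<^sup>+x. norm (f (x + h) - f x) \<partial>lborel) + (\<integral>\<^sup>+x. norm (g (x + h) - g x) \<partial>lborel)"
      by (rule nn_integral_add) auto
    also have "\<dots> \<le> ennreal (e / 2) + ennreal (e / 2)" using d1 d2 h by (intro add_mono) auto
    also have "\<dots> = e" using add.prems by (simp add: ennreal_plus[symmetric] del: ennreal_plus)
    finally show "(\<integral>\<^sup>+x. norm (f (x + h) + g (x + h) - (f x + g x)) \<partial>lborel) \<le> e" .
  qed (use d1 d2 in auto)
next
  case (lim f s)
  have [measurable]: "f \<in> borel_measurable borel" "\<And>i. s i \<in> borel_measurable borel" using lim by auto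
  have "(\<lambda>i. \<integral>\<^sup>+x. norm (f x - s i x) \<partial>lborel) \<longlonglongrightarrow> 0"
  proof (rule nn_integral_dominated_convergence_norm[where w = "\<lambda>x. 2 * norm (f x)"])
    show "(\<integral>\<^sup>+x. ennreal (2 * norm (f x)) \<partial>lborel) < \<infinity>"
      using lim.hyps by (auto simp: integrable_iff_bounded ennreal_mult nn_integral_cmult ennreal_mult_less_top)
  qed (use lim in auto)
  then have "eventually (\<lambda>i. (\<integral>\<^sup>+x. norm (f x - s i x) \<partial>lborel) < ennreal (e / 3)) sequentially"
    using lim.prems by (intro order_tendstoD) auto
  then obtain i where i: "(\<integral>\<^sup>+x. norm (f x - s i x) \<partial>lborel) < ennreal (e / 3)"
    by (auto simp: eventually_sequentially)
  obtain d where d: "d > 0" "\<And>h. norm h < d \<Longrightarrow> (\<integral>\<^sup>+x. norm (s i (x + h) - s i x) \<partial>lborel) \<le> ennreal (e / 3)"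
    using lim.IH[of "e / 3" i] lim.prems by auto
  show ?case
  proof (intro exI[of _ d] conjI allI impI)
    fix h :: 'a assume h: "norm h < d"
    have "(\<integral>\<^sup>+x. norm (f (x + h) - f x) \<partial>lborel)
       \<le> (\<integral>\<^sup>+x. ennreal (norm (f (x + h) - s i (x + h))) + (ennreal (norm (s i (x + h) - s i x)) + ennreal (norm (f x - s i x))) \<partial>lborel)"
    proof (rule nn_integral_mono)
      fix x
      have "norm (f (x + h) - f x) \<le> norm (f (x + h) - s i (x + h)) + (norm (s i (x + h) - s i x) + norm (f x - s i x))"
        using norm_triangle_ineq[of "f (x + h) - s i (x + h)" "(s i (x + h) - s i x) + (s i x - f x)"]
          norm_triangle_ineq[of "s i (x + h) - s i x" "s i x - f x"]
        by (simp add: norm_minus_commute)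
      then show "ennreal (norm (f (x + h) - f x)) \<le> ennreal (norm (f (x + h) - s i (x + h)))
          + (ennreal (norm (s i (x + h) - s i x)) + ennreal (norm (f x - s i x)))"
        by (auto simp: ennreal_plus[symmetric] simp del: ennreal_plus intro: ennreal_leI)
    qed
    also have "\<dots> = (\<integral>\<^sup>+x. norm (f (x + h) - s i (x + h)) \<partial>lborel)
         + ((\<integral>\<^sup>+x. norm (s i (x + h) - s i x) \<partial>lborel) + (\<integral>\<^sup>+x. norm (f x - s i x) \<partial>lborel))"
      by (simp add: nn_integral_add)
    also have "(\<integral>\<^sup>+x. norm (f (x + h) - s i (x + h)) \<partial>lborel) = (\<integral>\<^sup>+x. norm (f x - s i x) \<partial>lborel)"
      by (rule nn_integral_translate_lborel[of "\<lambda>x. ennreal (norm (f x - s i x))"]) auto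
    also have "(\<integral>\<^sup>+x. norm (f x - s i x) \<partial>lborel) + ((\<integral>\<^sup>+x. norm (s i (x + h) - s i x) \<partial>lborel) + (\<integral>\<^sup>+x. norm (f x - s i x) \<partial>lborel))
        \<le> ennreal (e / 3) + (ennreal (e / 3) + ennreal (e / 3))"
      using i d h by (intro add_mono) auto
    also have "\<dots> = e" using lim.prems by (simp add: ennreal_plus[symmetric] del: ennreal_plus)
    finally show "(\<integral>\<^sup>+x. norm (f (x + h) - f x) \<partial>lborel) \<le> e" .
  qed (use d in auto)
qed

text \<open>Convolution with a kernel of integral 1 concentrated near 0 averages translates of \<open>f\<close>,
  so its \<open>L\<^sup>1\<close>-distance to \<open>f\<close> is controlled by the moduli of translation.\<close>
lemma convolution_L1_close:
  fixes f :: "'a::euclidean_space \<Rightarrow> 'b::euclidean_space" and \<kappa> :: "'a \<Rightarrow> real"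
  assumes f: "integrable lborel f" and \<kappa> [measurable]: "\<kappa> \<in> borel_measurable borel"
    and B: "\<And>y. \<bar>\<kappa> y\<bar> \<le> B" and int1: "integrable lborel \<kappa>" "(\<integral>y. \<kappa> y \<partial>lborel) = 1"
    and C: "(\<integral>y. \<bar>\<kappa> y\<bar> \<partial>lborel) \<le> C"
    and e: "0 \<le> e" and T: "\<And>y. \<kappa> y \<noteq> 0 \<Longrightarrow> (\<integral>\<^sup>+x. norm (f (x - y) - f x) \<partial>lborel) \<le> ennreal e"
  shows "(\<integral>\<^sup>+x. norm (f x - (\<integral>y. \<kappa> (x - y) *\<^sub>R f y \<partial>lborel)) \<partial>lborel) \<le> ennreal (C * e)"
proof -
  have [measurable]: "f \<in> borel_measurable borel" using f by simp
  have pw: "ennreal (norm (f x - (\<integral>y. \<kappa> (x - y) *\<^sub>R f y \<partial>lborel)))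
     \<le> (\<integral>\<^sup>+y. ennreal (\<bar>\<kappa> y\<bar> * norm (f (x - y) - f x)) \<partial>lborel)" for x
  proof -
    have "integrable lborel (\<lambda>y. f (x - y))"
      unfolding integrable_iff_bounded using integral_reflect_lborel(2)[of f x] f by (simp add: integrable_iff_bounded)
    then have i1: "integrable lborel (\<lambda>y. \<kappa> y *\<^sub>R f (x - y))"
      by (rule Bochner_Integration.integrable_bound[OF integrable_scaleR_right[of B]])
         (use B in \<open>auto intro!: AE_I2 mult_right_mono order_trans[OF B abs_ge_self]\<close>)
    have i2: "integrable lborel (\<lambda>y. \<kappa> y *\<^sub>R f x)" using int1 by simp
    have "(\<integral>y. \<kappa> (x - y) *\<^sub>R f y \<partial>lborel) = (\<integral>y. \<kappa> y *\<^sub>R f (x - y) \<partial>lborel)"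
      using integral_reflect_lborel(1)[of "\<lambda>y. \<kappa> y *\<^sub>R f (x - y)" x] by simp
    then have "f x - (\<integral>y. \<kappa> (x - y) *\<^sub>R f y \<partial>lborel) = (\<integral>y. \<kappa> y *\<^sub>R f x \<partial>lborel) - (\<integral>y. \<kappa> y *\<^sub>R f (x - y) \<partial>lborel)"
      using int1 by simp
    also have "\<dots> = (\<integral>y. \<kappa> y *\<^sub>R f x - \<kappa> y *\<^sub>R f (x - y) \<partial>lborel)"
      by (rule Bochner_Integration.integral_diff[symmetric, OF i2 i1])
    finally have "norm (f x - (\<integral>y. \<kappa> (x - y) *\<^sub>R f y \<partial>lborel)) = norm (\<integral>y. \<kappa> y *\<^sub>R f x - \<kappa> y *\<^sub>R f (x - y) \<partial>lborel)"
      by simp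
    also have "ennreal \<dots> \<le> (\<integral>\<^sup>+y. norm (\<kappa> y *\<^sub>R f x - \<kappa> y *\<^sub>R f (x - y)) \<partial>lborel)"
      by (rule integral_norm_bound_ennreal) (use i1 i2 in auto)
    also have "\<dots> = (\<integral>\<^sup>+y. ennreal (\<bar>\<kappa> y\<bar> * norm (f (x - y) - f x)) \<partial>lborel)"
      by (simp add: scaleR_diff_right[symmetric] norm_minus_commute)
    finally show ?thesis .
  qed
  have "(\<integral>\<^sup>+x. norm (f x - (\<integral>y. \<kappa> (x - y) *\<^sub>R f y \<partial>lborel)) \<partial>lborel)
     \<le> (\<integral>\<^sup>+x. (\<integral>\<^sup>+y. ennreal (\<bar>\<kappa> y\<bar> * norm (f (x - y) - f x)) \<partial>lborel) \<partial>lborel)"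
    by (rule nn_integral_mono) (rule pw)
  also have "\<dots> = (\<integral>\<^sup>+y. (\<integral>\<^sup>+x. ennreal (\<bar>\<kappa> y\<bar> * norm (f (x - y) - f x)) \<partial>lborel) \<partial>lborel)"
    by (rule lborel_pair.Fubini'[symmetric]) measurable
  also have "\<dots> = (\<integral>\<^sup>+y. ennreal \<bar>\<kappa> y\<bar> * (\<integral>\<^sup>+x. ennreal (norm (f (x - y) - f x)) \<partial>lborel) \<partial>lborel)"
    by (simp add: ennreal_mult nn_integral_cmult)
  also have "\<dots> \<le> (\<integral>\<^sup>+y. ennreal \<bar>\<kappa> y\<bar> * ennreal e \<partial>lborel)"
  proof (rule nn_integral_mono)
    fix y
    show "ennreal \<bar>\<kappa> y\<bar> * (\<integral>\<^sup>+x. ennreal (norm (f (x - y) - f x)) \<partial>lborel) \<le> ennreal \<bar>\<kappa> y\<bar> * ennreal e"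
      using T[of y] by (cases "\<kappa> y = 0") (auto intro: mult_left_mono)
  qed
  also have "\<dots> = ennreal (\<integral>y. \<bar>\<kappa> y\<bar> \<partial>lborel) * ennreal e"
    using int1 by (simp add: nn_integral_multc nn_integral_eq_integral)
  also have "\<dots> = ennreal ((\<integral>y. \<bar>\<kappa> y\<bar> \<partial>lborel) * e)" using e by (simp add: ennreal_mult)
  also have "\<dots> \<le> ennreal (C * e)" using C e by (intro ennreal_leI mult_right_mono)
  finally show ?thesis .
qed

section \<open>A mollifier whose dyadic increments are third derivatives\<close>

text \<open>A function equal to \<open>s\<^sup>2 / 2\<close> up to 1 and to 0 from 2 on.  Its second derivative passes from 1 to 0, so
  the third derivative has compact support and integral \<open>- 1\<close>.\<close>
definition cut_quad :: "real \<Rightarrow> real" where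
  "cut_quad s = s\<^sup>2 / 2 * step (2 - s)"

definition moll :: "real \<Rightarrow> real" where
  "moll s = - deriv (deriv (deriv cut_quad)) s"

text \<open>Both terms equal \<open>s\<^sup>2 / 2\<close> near the origin and to its left, so their difference has compact support although
  neither of them has.  This is why a mollifier made from a quadratic function changes from one dyadic scale to
  the next by the third derivative of a compactly supported function.\<close>
definition incr :: "real \<Rightarrow> real" where
  "incr s = cut_quad (2 * s) / 4 - cut_quad s"

lemma smooth_cut_quad: "smooth cut_quad"
proof -
  have "smooth (\<lambda>s. step (-1 * s + 2))" by (rule smooth_affine[OF smooth_step])
  then have "smooth (\<lambda>s. step (2 - s))" by (simp add: algebra_simps)
  then have "smooth (\<lambda>s. (1 / 2 * s ^ 2) * step (2 - s))"
    by (intro smooth_mult smooth_power smooth_const smooth_id)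
  then show ?thesis by (simp add: cut_quad_def[abs_def])
qed

lemma smooth_moll: "smooth moll"
  unfolding moll_def[abs_def] by (intro smooth_minus smooth_deriv smooth_cut_quad)

lemma smooth_incr: "smooth incr"
proof -
  have "smooth (\<lambda>s. cut_quad (2 * s + 0))" by (rule smooth_affine[OF smooth_cut_quad])
  then have "smooth (\<lambda>s. (1 / 4) * cut_quad (2 * s) - cut_quad s)"
    by (intro smooth_diff smooth_mult smooth_const smooth_cut_quad) simp
  then show ?thesis by (simp add: incr_def[abs_def])
qed

lemma cut_quad_derivs_left:
  assumes "s < 1"
  shows "deriv cut_quad s = s" "deriv (deriv cut_quad) s = 1" "deriv (deriv (deriv cut_quad)) s = 0"
proof -
  have ev: "eventually (\<lambda>y. y \<in> {..<1::real}) (nhds y)" if "y < 1" for y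
    using that by (intro eventually_nhds_in_open) auto
  have 1: "deriv cut_quad y = y" if "y < 1" for y
  proof -
    have "deriv cut_quad y = deriv (\<lambda>s. s\<^sup>2 / 2) y"
      by (rule deriv_cong_ev[OF eventually_mono[OF ev[OF that]]]) (auto simp: cut_quad_def step_eq_1)
    also have "\<dots> = y" by (rule DERIV_imp_deriv) (auto intro!: derivative_eq_intros)
    finally show ?thesis .
  qed
  have 2: "deriv (deriv cut_quad) y = 1" if "y < 1" for y
  proof -
    have "deriv (deriv cut_quad) y = deriv (\<lambda>s. s) y"
      by (rule deriv_cong_ev[OF eventually_mono[OF ev[OF that]]]) (auto simp: 1)
    then show ?thesis by simp
  qed
  show "deriv cut_quad s = s" "deriv (deriv cut_quad) s = 1" using assms 1 2 by auto
  show "deriv (deriv (deriv cut_quad)) s = 0"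
    by (rule deriv_eq_0_open[of "{..<1}" _ _ 1]) (use assms 2 in auto)
qed

lemma cut_quad_derivs_right:
  assumes "2 < s"
  shows "deriv (deriv cut_quad) s = 0" "deriv (deriv (deriv cut_quad)) s = 0"
proof -
  have 1: "deriv cut_quad y = 0" if "2 < y" for y
    by (rule deriv_eq_0_open[of "{2<..}" _ _ 0]) (use that in \<open>auto simp: cut_quad_def step_eq_0\<close>)
  have 2: "deriv (deriv cut_quad) y = 0" if "2 < y" for y
    by (rule deriv_eq_0_open[of "{2<..}" _ _ 0]) (use that 1 in auto)
  show "deriv (deriv cut_quad) s = 0" using 2 assms .
  show "deriv (deriv (deriv cut_quad)) s = 0"
    by (rule deriv_eq_0_open[of "{2<..}" _ _ 0]) (use assms 2 in auto)
qed

lemma moll_eq_0: "s \<notin> {0..2} \<Longrightarrow> moll s = 0"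
  using cut_quad_derivs_left(3)[of s] cut_quad_derivs_right(2)[of s] by (auto simp: moll_def)

lemma incr_eq_0: "s \<notin> {0..2} \<Longrightarrow> incr s = 0"
  by (auto simp: incr_def cut_quad_def step_eq_0 step_eq_1 power2_eq_square)

lemma deriv_incr: "deriv (deriv (deriv incr)) s = moll s - 2 * moll (2 * s)"
proof -
  have D: "((\<lambda>s. f (2 * s)) has_real_derivative 2 * deriv f (2 * s)) (at s)" if "smooth f" for f s
  proof -
    have "((\<lambda>s. 2 * s) has_real_derivative 2) (at s)" by (auto intro!: derivative_eq_intros)
    from smooth_DERIV_chain[OF that this] show ?thesis by (simp only: mult.commute[of "deriv f _" 2])
  qed
  note S = smooth_cut_quad smooth_deriv[OF smooth_cut_quad] smooth_deriv[OF smooth_deriv[OF smooth_cut_quad]]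
  have 1: "deriv incr = (\<lambda>s. deriv cut_quad (2 * s) / 2 - deriv cut_quad s)"
  proof (intro ext DERIV_imp_deriv)
    fix s show "(incr has_real_derivative deriv cut_quad (2 * s) / 2 - deriv cut_quad s) (at s)"
      unfolding incr_def[abs_def]
      using DERIV_diff[OF DERIV_cdivide[OF D[OF S(1)], of 4 s] smooth_has_deriv[OF S(1), of s]] by simp
  qed
  have 2: "deriv (deriv incr) = (\<lambda>s. deriv (deriv cut_quad) (2 * s) - deriv (deriv cut_quad) s)"
  proof (intro ext DERIV_imp_deriv)
    fix s show "(deriv incr has_real_derivative deriv (deriv cut_quad) (2 * s) - deriv (deriv cut_quad) s) (at s)"
      unfolding 1
      using DERIV_diff[OF DERIV_cdivide[OF D[OF S(2)], of 2 s] smooth_has_deriv[OF S(2), of s]] by simp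
  qed
  have "(deriv (deriv incr) has_real_derivative moll s - 2 * moll (2 * s)) (at s)"
    unfolding 2 moll_def
    using DERIV_diff[OF D[OF S(3), of s] smooth_has_deriv[OF S(3), of s]] by simp
  then show ?thesis by (rule DERIV_imp_deriv)
qed

lemma integrable_of_support:
  fixes f :: "real \<Rightarrow> real"
  assumes "smooth f" "\<And>x. x \<notin> {a..b} \<Longrightarrow> f x = 0"
  shows "integrable lborel f"
proof -
  have "integrable lborel (\<lambda>x. indicator {a..b} x *\<^sub>R f x)"
    using borel_integrable_atLeastAtMost'[of a b f] smooth_continuous[OF assms(1)] by (simp add: set_integrable_def)
  also have "(\<lambda>x. indicator {a..b} x *\<^sub>R f x) = f"
    by (rule ext, subst indicator_def) (use assms(2) in auto)
  finally show ?thesis .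
qed

lemma integral_moll: "integrable lborel moll" "(\<integral>s. moll s \<partial>lborel) = 1"
proof -
  show "integrable lborel moll" by (rule integrable_of_support[OF smooth_moll moll_eq_0])
  define f where "f = deriv (deriv cut_quad)"
  have sf: "smooth f" unfolding f_def by (intro smooth_deriv smooth_cut_quad)
  have "(\<integral>s. indicator {0..3} s *\<^sub>R deriv f s \<partial>lborel) = f 3 - f 0"
    by (rule integral_FTC_atLeastAtMost)
       (auto intro!: smooth_continuous smooth_deriv sf simp flip: has_real_derivative_iff_has_vector_derivative
         intro: has_field_derivative_at_within smooth_has_deriv)
  also have "\<dots> = - 1" using cut_quad_derivs_left(2)[of 0] cut_quad_derivs_right(1)[of 3] by (simp add: f_def)
  also have "(\<lambda>s. indicator {0..3} s *\<^sub>R deriv f s) = (\<lambda>s. - moll s)"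
    using moll_eq_0 by (fastforce simp: indicator_def moll_def f_def)
  finally show "(\<integral>s. moll s \<partial>lborel) = 1" by simp
qed

definition mollN :: "nat \<Rightarrow> real \<Rightarrow> real" where
  "mollN n s = 2 ^ n * moll (2 ^ n * s)"

definition incrN :: "nat \<Rightarrow> real \<Rightarrow> real" where
  "incrN n s = incr (2 ^ n * s) / 4 ^ n"

lemma smooth_scale: "smooth f \<Longrightarrow> smooth (\<lambda>s. c * f (a * s))"
  using smooth_mult[OF smooth_const smooth_affine[of f a 0], of c] by simp

lemma smooth_mollN: "smooth (mollN n)"
  unfolding mollN_def[abs_def] by (rule smooth_scale[OF smooth_moll])

lemma smooth_incrN: "smooth (incrN n)"
  using smooth_scale[OF smooth_incr, of "1 / 4 ^ n" "2 ^ n"] by (simp add: incrN_def[abs_def])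

lemma smooth_reflect: "smooth f \<Longrightarrow> smooth (\<lambda>s. f (c - s))"
  using smooth_affine[of f "-1" c] by simp

lemma mollN_eq_0: "s \<notin> {0..2 / 2 ^ n} \<Longrightarrow> mollN n s = 0"
proof -
  assume "s \<notin> {0..2 / 2 ^ n}"
  then have "2 ^ n * s \<notin> {0..2}" by (simp add: pos_le_divide_eq zero_le_mult_iff mult.commute not_le)
  then show ?thesis by (simp add: mollN_def moll_eq_0)
qed

lemma incrN_eq_0: "s \<notin> {0..2 / 2 ^ n} \<Longrightarrow> incrN n s = 0"
proof -
  assume "s \<notin> {0..2 / 2 ^ n}"
  then have "2 ^ n * s \<notin> {0..2}" by (simp add: pos_le_divide_eq zero_le_mult_iff mult.commute not_le)
  then show ?thesis by (simp add: incrN_def incr_eq_0)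
qed

lemma integral_mollN:
  "integrable lborel (mollN n)" "(\<integral>s. mollN n s \<partial>lborel) = 1"
  "(\<integral>s. \<bar>mollN n s\<bar> \<partial>lborel) = (\<integral>s. \<bar>moll s\<bar> \<partial>lborel)"
proof -
  show "integrable lborel (mollN n)" by (rule integrable_of_support[OF smooth_mollN mollN_eq_0])
  show "(\<integral>s. mollN n s \<partial>lborel) = 1"
    using lborel_integral_real_affine[of "2 ^ n" moll 0] integral_moll
    by (simp add: mollN_def[abs_def])
  show "(\<integral>s. \<bar>mollN n s\<bar> \<partial>lborel) = (\<integral>s. \<bar>moll s\<bar> \<partial>lborel)"
    using lborel_integral_real_affine[of "2 ^ n" "\<lambda>s. \<bar>moll s\<bar>" 0]
    by (simp add: mollN_def[abs_def] abs_mult)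
qed

lemma deriv_scale:
  assumes "smooth f"
  shows "deriv (\<lambda>s. c * f (a * s)) = (\<lambda>s. (c * a) * deriv f (a * s))"
proof (intro ext DERIV_imp_deriv)
  fix s show "((\<lambda>s. c * f (a * s)) has_real_derivative c * a * deriv f (a * s)) (at s)"
  proof -
    have "((\<lambda>s. a * s) has_real_derivative a) (at s)" by (auto intro!: derivative_eq_intros)
    from DERIV_cmult[OF smooth_DERIV_chain[OF assms this], of c] show ?thesis by (simp only: mult_ac)
  qed
qed

lemma deriv_reflect:
  assumes "smooth f"
  shows "deriv (\<lambda>s. k * f (c - s)) = (\<lambda>s. (- k) * deriv f (c - s))"
proof (intro ext DERIV_imp_deriv)
  fix s show "((\<lambda>s. k * f (c - s)) has_real_derivative - k * deriv f (c - s)) (at s)"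
  proof -
    have "((\<lambda>s. c - s) has_real_derivative -1) (at s)" by (auto intro!: derivative_eq_intros)
    from DERIV_cmult[OF smooth_DERIV_chain[OF assms this], of k] show ?thesis by simp
  qed
qed

lemma deriv_incrN: "deriv (deriv (deriv (incrN n))) s = mollN n s - mollN (Suc n) s"
proof -
  note S = smooth_incr smooth_deriv[OF smooth_incr] smooth_deriv[OF smooth_deriv[OF smooth_incr]]
  have "incrN n = (\<lambda>s. (1 / 4 ^ n) * incr (2 ^ n * s))" by (simp add: incrN_def[abs_def])
  then have "deriv (deriv (deriv (incrN n))) s = 1 / 4 ^ n * 2 ^ n * 2 ^ n * 2 ^ n * deriv (deriv (deriv incr)) (2 ^ n * s)"
    by (simp only: deriv_scale[OF S(1)] deriv_scale[OF S(2)] deriv_scale[OF S(3)])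
  also have "1 / 4 ^ n * 2 ^ n * 2 ^ n * 2 ^ n = (2 ^ n :: real)"
    by (simp add: power_mult_distrib[symmetric])
  finally show ?thesis by (simp add: deriv_incr mollN_def algebra_simps)
qed

lemma deriv_incrN_reflect:
  "deriv (deriv (deriv (\<lambda>s. incrN n (c - s)))) s = mollN (Suc n) (c - s) - mollN n (c - s)"
proof -
  note S = smooth_incrN smooth_deriv[OF smooth_incrN] smooth_deriv[OF smooth_deriv[OF smooth_incrN]]
  have "(\<lambda>s. incrN n (c - s)) = (\<lambda>s. 1 * incrN n (c - s))" by simp
  then have "deriv (deriv (deriv (\<lambda>s. incrN n (c - s)))) s = - deriv (deriv (deriv (incrN n))) (c - s)"
    by (simp only: deriv_reflect[OF S(1)] deriv_reflect[OF S(2)] deriv_reflect[OF S(3)])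
  then show ?thesis by (simp add: deriv_incrN)
qed

section \<open>Mollification of locally integrable functions\<close>

lemma integral_tens:
  fixes g :: "'a::euclidean_space \<Rightarrow> real \<Rightarrow> real"
  assumes g: "\<And>b. b \<in> Basis \<Longrightarrow> integrable lborel (g b)"
  shows "integrable lborel (tens g)" "(\<integral>x. tens g x \<partial>lborel) = (\<Prod>b\<in>Basis. \<integral>s. g b s \<partial>lborel)"
proof -
  interpret product_sigma_finite "\<lambda>b::'a. lborel :: real measure" ..
  have gm: "g b \<in> borel_measurable borel" if "b \<in> Basis" for b using g[OF that] by simp
  have T [measurable]: "(\<lambda>f. \<Sum>b\<in>Basis. f b *\<^sub>R b) \<in> (\<Pi>\<^sub>M b\<in>Basis. lborel) \<rightarrow>\<^sub>M (borel :: 'a measure)"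
    by measurable
  have tm: "tens g \<in> borel_measurable borel"
    unfolding tens_def[abs_def]
  proof (rule borel_measurable_prod)
    fix b :: 'a assume "b \<in> Basis"
    note [measurable] = gm[OF this]
    show "(\<lambda>x. g b (x \<bullet> b)) \<in> borel_measurable borel" by measurable
  qed
  have eq: "tens g (\<Sum>b\<in>Basis. f b *\<^sub>R b) = (\<Prod>b\<in>Basis. g b (f b))" for f
    unfolding tens_def by (intro prod.cong) (auto simp: inner_sum_left_Basis)
  show "integrable lborel (tens g)"
    by (subst lborel_eq, subst integrable_distr_eq[OF T tm]) (unfold eq, rule product_integrable_prod, auto intro: g)
  show "(\<integral>x. tens g x \<partial>lborel) = (\<Prod>b\<in>Basis. \<integral>s. g b s \<partial>lborel)"
    by (subst lborel_eq, subst integral_distr[OF T tm]) (unfold eq, rule product_integral_prod, auto intro: g)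
qed

text \<open>The mollifier at scale \<open>2 ^ - n\<close>, centred at \<open>x\<close>, as a function of \<open>y\<close>.\<close>
definition K :: "nat \<Rightarrow> 'a::euclidean_space \<Rightarrow> 'a \<Rightarrow> real" where
  "K n x = tens (\<lambda>b s. mollN n (x \<bullet> b - s))"

lemma K_eq: "K n x y = tens (\<lambda>b. mollN n) (x - y)"
  by (simp add: K_def tens_def inner_diff_left)

lemma moll_bound: obtains B where "B \<ge> 0" "\<And>s. \<bar>moll s\<bar> \<le> B"
  using bounded_of_support[OF smooth_moll moll_eq_0] by blast

lemma mollN_bound: obtains B where "B \<ge> 0" "\<And>n s. \<bar>mollN n s\<bar> \<le> 2 ^ n * B"
proof -
  obtain B where "B \<ge> 0" "\<And>s. \<bar>moll s\<bar> \<le> B" using moll_bound by blast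
  then show thesis by (intro that[of B]) (auto simp: mollN_def abs_mult intro!: mult_left_mono)
qed

lemma K_bound: obtains B where "B \<ge> 0" "\<And>x y::'a::euclidean_space. \<bar>K n x y\<bar> \<le> B"
proof -
  obtain B where B: "B \<ge> 0" "\<And>s. \<bar>mollN n s\<bar> \<le> 2 ^ n * B" using mollN_bound by metis
  show thesis
  proof
    show "\<bar>K n x y\<bar> \<le> (\<Prod>b\<in>(Basis::'a set). 2 ^ n * B)" for x y :: 'a
      unfolding K_def by (rule abs_tens_le) (rule B(2))
  qed (use B in simp)
qed

text \<open>The kernel \<open>K n x\<close> lives on the cube with upper corner \<open>x\<close> and lower corner \<open>x - corner n\<close>, because the
  one-dimensional mollifier lives on the positive half-line.\<close>
definition corner :: "nat \<Rightarrow> 'a::euclidean_space" where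
  "corner n = (2 / 2 ^ n) *\<^sub>R One"

lemma corner_inner: "b \<in> Basis \<Longrightarrow> corner n \<bullet> b = 2 / 2 ^ n"
  by (simp add: corner_def)

lemma K_zero_outside:
  assumes "y \<notin> cbox (x - corner n) x"
  shows "K n x y = 0"
  unfolding K_def
  by (rule tens_zero_outside[OF _ assms]) (auto simp: inner_diff_left corner_inner intro!: mollN_eq_0)

lemma K_test_fun:
  assumes "cbox (x - corner n) x \<subseteq> \<Omega>"
  shows "K n x \<in> test_fun \<Omega>"
  unfolding K_def
  by (rule tens_test_fun[OF _ _ assms])
     (auto simp: inner_diff_left corner_inner intro!: mollN_eq_0 smooth_reflect smooth_mollN)

lemma K_measurable [measurable]: "K n x \<in> borel_measurable borel"
  unfolding K_def by (rule tens_measurable) (intro smooth_reflect smooth_mollN)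

lemma K_measurable_pair [measurable]:
  "(\<lambda>z::'a::euclidean_space \<times> 'a. K n (fst z) (snd z)) \<in> borel_measurable borel"
proof -
  have "tens (\<lambda>b. mollN n) \<in> borel_measurable (borel :: 'a measure)"
    by (rule tens_measurable) (rule smooth_mollN)
  moreover have "(\<lambda>z::'a \<times> 'a. fst z - snd z) \<in> borel_measurable borel"
    by (intro borel_measurable_continuous_onI continuous_intros)
  ultimately show ?thesis unfolding K_eq by (rule measurable_compose[rotated])
qed

lemma cbox_corner_subset:
  fixes x :: "'a::euclidean_space"
  assumes "2 * DIM('a) / 2 ^ n \<le> r"
  shows "cbox (x - corner n) x \<subseteq> cball x r"
proof
  fix y assume y: "y \<in> cbox (x - corner n) x"
  have "norm (x - y) \<le> (\<Sum>b\<in>Basis. \<bar>(x - y) \<bullet> b\<bar>)" by (rule norm_le_l1)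
  also have "\<dots> \<le> (\<Sum>b\<in>(Basis::'a set). 2 / 2 ^ n)"
    using y by (intro sum_mono) (auto simp: mem_box inner_diff_left corner_inner algebra_simps)
  also have "\<dots> = 2 * DIM('a) / 2 ^ n" by simp
  finally show "y \<in> cball x r" using assms by (simp add: dist_norm)
qed

lemma eventually_small_corner:
  assumes "r > 0"
  shows "eventually (\<lambda>n. 2 * DIM('a::euclidean_space) / 2 ^ n \<le> r) sequentially"
proof -
  have "(\<lambda>n. 2 * real DIM('a) * (1 / 2) ^ n) \<longlonglongrightarrow> 2 * real DIM('a) * 0"
    by (intro tendsto_intros LIMSEQ_power_zero) auto
  then have "eventually (\<lambda>n. 2 * real DIM('a) * (1 / 2) ^ n < r) sequentially"
    using assms by (intro order_tendstoD) auto
  then show ?thesis by eventually_elim (simp add: power_divide)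
qed

lemma mollify_L1:
  fixes f :: "'a::euclidean_space \<Rightarrow> 'b::euclidean_space"
  assumes "integrable lebesgue f"
  shows "(\<lambda>n. \<integral>\<^sup>+x. norm (f x - (\<integral>y. K n x y *\<^sub>R f y \<partial>lebesgue)) \<partial>lebesgue) \<longlonglongrightarrow> 0"
proof -
  obtain g where g [measurable]: "g \<in> borel_measurable borel" and ig: "integrable lborel g"
    and eq: "AE x in lborel. f x = g x"
    using lebesgue_borel_rep_integrable[OF assms] by metis
  have fm: "f \<in> borel_measurable lebesgue" using assms by simp
  have "(\<integral>y. K n x y *\<^sub>R f y \<partial>lebesgue) = (\<integral>y. tens (\<lambda>b. mollN n) (x - y) *\<^sub>R g y \<partial>lborel)" for n x
    unfolding K_eq[symmetric]
    by (rule lebesgue_integral_cong_AE_borel)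
       (use eq in \<open>auto intro!: borel_measurable_scaleR[OF measurable_completion fm]\<close>)
  then have eq2: "(\<integral>\<^sup>+x. norm (f x - (\<integral>y. K n x y *\<^sub>R f y \<partial>lebesgue)) \<partial>lebesgue)
      = (\<integral>\<^sup>+x. norm (g x - (\<integral>y. tens (\<lambda>b. mollN n) (x - y) *\<^sub>R g y \<partial>lborel)) \<partial>lborel)" for n
    unfolding nn_integral_completion by (intro nn_integral_cong_AE) (use eq in eventually_elim, simp)
  define C where "C = (\<Prod>b\<in>(Basis::'a set). \<integral>s. \<bar>moll s\<bar> \<partial>lborel)"
  have C0: "C \<ge> 0" unfolding C_def by (intro prod_nonneg) simp
  show ?thesis unfolding eq2
  proof (rule order_tendstoI)
    fix a :: ennreal assume "a > 0"
    have "\<exists>e>0. ennreal e < a"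
    proof (cases a)
      case (real r)
      with \<open>a > 0\<close> show ?thesis by (intro exI[of _ "r / 2"]) (auto simp: ennreal_less_iff)
    next
      case top
      then show ?thesis by (intro exI[of _ 1]) auto
    qed
    then obtain e where e: "e > 0" "ennreal e < a" by blast
    define e' where "e' = e / (C + 1)"
    have e': "e' > 0" "C * e' \<le> e" using e C0 by (auto simp: e'_def field_simps)
    obtain d where d: "d > 0" "\<And>h. norm h < d \<Longrightarrow> (\<integral>\<^sup>+x. norm (g (x + h) - g x) \<partial>lborel) \<le> e'"
      using L1_translation_continuous[OF ig e'(1)] by auto
    have "eventually (\<lambda>n. 2 * DIM('a) / 2 ^ n \<le> d / 2) sequentially"
      using d by (intro eventually_small_corner) auto
    then show "eventually (\<lambda>n. (\<integral>\<^sup>+x. norm (g x - (\<integral>y. tens (\<lambda>b. mollN n) (x - y) *\<^sub>R g y \<partial>lborel)) \<partial>lborel) < a) sequentially"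
    proof eventually_elim
      case (elim n)
      obtain B where B: "\<And>x y::'a. \<bar>K n x y\<bar> \<le> B" using K_bound by metis
      have "(\<integral>\<^sup>+x. norm (g x - (\<integral>y. tens (\<lambda>b. mollN n) (x - y) *\<^sub>R g y \<partial>lborel)) \<partial>lborel) \<le> ennreal (C * e')"
      proof (rule convolution_L1_close[OF ig])
        show "tens (\<lambda>b. mollN n) \<in> borel_measurable (borel::'a measure)"
          by (rule tens_measurable) (rule smooth_mollN)
        show "\<bar>tens (\<lambda>b. mollN n) y\<bar> \<le> B" for y :: 'a using B[of y 0] by (simp add: K_eq)
        show "integrable lborel (tens (\<lambda>b. mollN n) :: 'a \<Rightarrow> real)"
          by (rule integral_tens) (rule integral_mollN)
        have "(\<integral>x. tens (\<lambda>b. mollN n) (x::'a) \<partial>lborel) = (\<Prod>b\<in>(Basis::'a set). \<integral>s. mollN n s \<partial>lborel)"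
          by (rule integral_tens) (rule integral_mollN)
        then show "(\<integral>x. tens (\<lambda>b. mollN n) (x::'a) \<partial>lborel) = 1" by (simp add: integral_mollN)
        have "(\<integral>x. \<bar>tens (\<lambda>b. mollN n) (x::'a)\<bar> \<partial>lborel) = (\<integral>x. tens (\<lambda>b s. \<bar>mollN n s\<bar>) (x::'a) \<partial>lborel)"
          by (simp add: tens_def abs_prod)
        also have "\<dots> = (\<Prod>b\<in>(Basis::'a set). \<integral>s. \<bar>mollN n s\<bar> \<partial>lborel)"
          by (rule integral_tens) (intro integrable_abs integral_mollN)
        finally show "(\<integral>x. \<bar>tens (\<lambda>b. mollN n) (x::'a)\<bar> \<partial>lborel) \<le> C"
          by (simp add: integral_mollN C_def)
        fix y :: 'a assume "tens (\<lambda>b. mollN n) y \<noteq> 0"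
        then have "- y \<in> cbox (0 - corner n) 0"
          using K_zero_outside[of "- y" 0 n] by (auto simp: K_eq)
        then have "norm y \<le> d / 2" using cbox_corner_subset[OF elim, of 0] by (auto simp: dist_norm)
        then have "norm (- y) < d" using d by simp
        from d(2)[OF this] show "(\<integral>\<^sup>+x. norm (g (x - y) - g x) \<partial>lborel) \<le> ennreal e'" by simp
      qed (use e' in auto)
      also have "\<dots> \<le> ennreal e" using e' by (intro ennreal_leI)
      finally show ?case using e by simp
    qed
  qed simp
qed

lemma loc_intD: "loc_int \<Omega> f \<Longrightarrow> compact X \<Longrightarrow> X \<subseteq> \<Omega> \<Longrightarrow> integrable lebesgue (\<lambda>x. indicator X x *\<^sub>R f x)"
  by (simp add: loc_int_def set_integrable_def)

lemma loc_int_mult: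
  fixes f :: "'a::euclidean_space \<Rightarrow> 'b::euclidean_space"
  assumes f: "loc_int \<Omega> f" and X: "compact X" "X \<subseteq> \<Omega>" and k: "k \<in> borel_measurable lebesgue"
    and M: "\<And>y. \<bar>k y\<bar> \<le> M" and k0: "\<And>y. y \<notin> X \<Longrightarrow> k y = 0"
  shows "integrable lebesgue (\<lambda>y. k y *\<^sub>R f y)"
    and "ennreal (norm (\<integral>y. k y *\<^sub>R f y \<partial>lebesgue)) \<le> ennreal M * (\<integral>\<^sup>+y. indicator X y * norm (f y) \<partial>lebesgue)"
proof -
  note i = loc_intD[OF f X]
  have eq: "(\<lambda>y. k y *\<^sub>R f y) = (\<lambda>y. k y *\<^sub>R (indicator X y *\<^sub>R f y))"
    by (rule ext, subst indicator_def) (use k0 in auto)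
  have M0: "M \<ge> 0" using M[of undefined] by linarith
  show int: "integrable lebesgue (\<lambda>y. k y *\<^sub>R f y)"
    unfolding eq
  proof (rule Bochner_Integration.integrable_bound[OF integrable_scaleR_right[OF i, of M]])
    show "(\<lambda>y. k y *\<^sub>R (indicat_real X y *\<^sub>R f y)) \<in> borel_measurable lebesgue"
      by (rule borel_measurable_scaleR[OF k borel_measurable_integrable[OF i]])
    show "AE y in lebesgue. norm (k y *\<^sub>R (indicat_real X y *\<^sub>R f y)) \<le> norm (M *\<^sub>R (indicat_real X y *\<^sub>R f y))"
      using M M0 by (intro AE_I2) (simp only: norm_scaleR abs_of_nonneg mult_right_mono mult_nonneg_nonneg abs_ge_zero norm_ge_zero)
  qed
  have "ennreal (norm (\<integral>y. k y *\<^sub>R f y \<partial>lebesgue)) \<le> (\<integral>\<^sup>+y. norm (k y *\<^sub>R f y) \<partial>lebesgue)"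
    by (rule integral_norm_bound_ennreal[OF int])
  also have "\<dots> \<le> (\<integral>\<^sup>+y. ennreal M * (indicator X y * norm (f y)) \<partial>lebesgue)"
  proof (rule nn_integral_mono)
    fix y
    have "norm (k y *\<^sub>R f y) \<le> M * (indicator X y * norm (f y))"
      using M[of y] k0[of y] by (auto simp: indicator_def intro: mult_right_mono)
    then show "ennreal (norm (k y *\<^sub>R f y)) \<le> ennreal M * (indicator X y * norm (f y))"
      using M0 by (auto simp: ennreal_mult[symmetric] indicator_def intro: ennreal_leI)
  qed
  also have "\<dots> = ennreal M * (\<integral>\<^sup>+y. indicator X y * norm (f y) \<partial>lebesgue)"
  proof (rule nn_integral_cmult)
    have "(\<lambda>y. ennreal (norm (indicator X y *\<^sub>R f y))) \<in> borel_measurable lebesgue" using i by measurable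
    also have "(\<lambda>y. ennreal (norm (indicator X y *\<^sub>R f y))) = (\<lambda>y. indicator X y * norm (f y))"
      by (auto simp: indicator_def)
    finally show "(\<lambda>y. ennreal (indicat_real X y * norm (f y))) \<in> borel_measurable lebesgue" .
  qed
  finally show "ennreal (norm (\<integral>y. k y *\<^sub>R f y \<partial>lebesgue)) \<le> ennreal M * (\<integral>\<^sup>+y. indicator X y * norm (f y) \<partial>lebesgue)" .
qed

text \<open>The fixed compact set \<open>Y\<close> contains the supports of all kernels with centre in \<open>X\<close> at small scales; on it a
  locally integrable function is integrable.\<close>
lemma compact_margin:
  fixes X :: "'a::euclidean_space set"
  assumes "compact X" "open \<Omega>" "X \<subseteq> \<Omega>"
  obtains Y where "compact Y" "X \<subseteq> Y" "Y \<subseteq> \<Omega>"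
    "eventually (\<lambda>n. \<forall>x\<in>X. cbox (x - corner n) x \<subseteq> Y) sequentially"
proof -
  obtain e where e: "e > 0" "(\<Union>x\<in>X. cball x e) \<subseteq> \<Omega>"
    using compact_subset_open_imp_cball_epsilon_subset[OF assms] by blast
  show thesis
  proof
    show "compact (\<Union>x\<in>X. cball x e)" by (rule compact_minkowski_sum_cball[OF assms(1)])
    show "X \<subseteq> (\<Union>x\<in>X. cball x e)" using e by force
    show "eventually (\<lambda>n. \<forall>x\<in>X. cbox (x - corner n) x \<subseteq> (\<Union>x\<in>X. cball x e)) sequentially"
      using eventually_small_corner[OF e(1), where 'a='a] by eventually_elim (use cbox_corner_subset in blast)
  qed (rule e)
qed

lemma mollify_local:
  fixes f :: "'a::euclidean_space \<Rightarrow> 'b::euclidean_space"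
  assumes f: "loc_int \<Omega> f" and X: "compact X" "open \<Omega>" "X \<subseteq> \<Omega>"
  shows "(\<lambda>n. \<integral>\<^sup>+x. indicator X x * norm (f x - (\<integral>y. K n x y *\<^sub>R f y \<partial>lebesgue)) \<partial>lebesgue) \<longlonglongrightarrow> 0"
proof -
  obtain Y where Y: "compact Y" "X \<subseteq> Y" "Y \<subseteq> \<Omega>"
    "eventually (\<lambda>n. \<forall>x\<in>X. cbox (x - corner n) x \<subseteq> Y) sequentially"
    by (rule compact_margin[OF X])
  define g where "g = (\<lambda>x. indicator Y x *\<^sub>R f x)"
  have "integrable lebesgue g" unfolding g_def by (rule loc_intD[OF f Y(1,3)])
  from mollify_L1[OF this]
  show ?thesis
  proof (rule tendsto_sandwich[OF _ _ tendsto_const, rotated 2])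
    show "eventually (\<lambda>n. (\<integral>\<^sup>+x. indicator X x * norm (f x - (\<integral>y. K n x y *\<^sub>R f y \<partial>lebesgue)) \<partial>lebesgue)
        \<le> (\<integral>\<^sup>+x. norm (g x - (\<integral>y. K n x y *\<^sub>R g y \<partial>lebesgue)) \<partial>lebesgue)) sequentially"
      using Y(4)
    proof eventually_elim
      case (elim n)
      show ?case
      proof (rule nn_integral_mono)
        fix x
        show "ennreal (indicator X x * norm (f x - (\<integral>y. K n x y *\<^sub>R f y \<partial>lebesgue)))
           \<le> ennreal (norm (g x - (\<integral>y. K n x y *\<^sub>R g y \<partial>lebesgue)))"
        proof (cases "x \<in> X")
          case True
          then have "K n x y *\<^sub>R g y = K n x y *\<^sub>R f y" for y
            using elim K_zero_outside[of y x n] by (auto simp: g_def indicator_def)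
          then have "(\<integral>y. K n x y *\<^sub>R g y \<partial>lebesgue) = (\<integral>y. K n x y *\<^sub>R f y \<partial>lebesgue)" by (simp only:)
          moreover have "g x = f x" using True Y by (auto simp: g_def)
          ultimately show ?thesis using True by simp
        qed simp
      qed
    qed
  qed simp
qed

lemma AE_on_open:
  fixes \<Omega> :: "'a::euclidean_space set"
  assumes \<Omega>: "open \<Omega>" and Y: "\<And>Y. compact Y \<Longrightarrow> Y \<subseteq> \<Omega> \<Longrightarrow> AE x in lebesgue. x \<in> Y \<longrightarrow> P x"
  shows "AE x in lebesgue. x \<in> \<Omega> \<longrightarrow> P x"
proof -
  obtain D where D: "countable D" "D \<subseteq> Pow \<Omega>" "\<And>X. X \<in> D \<Longrightarrow> \<exists>a b. X = cbox a b" "\<Union>D = \<Omega>"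
    using open_countable_Union_open_cbox[OF \<Omega>] by metis
  have "AE x in lebesgue. x \<in> Y \<longrightarrow> P x" if "Y \<in> D" for Y
    by (rule Y) (use D(2) D(3)[OF that] that in auto)
  then have "AE x in lebesgue. \<forall>Y\<in>D. x \<in> Y \<longrightarrow> P x"
    unfolding AE_ball_countable[OF D(1)] by blast
  then show ?thesis by eventually_elim (use D in auto)
qed

text \<open>The mollifications of \<open>f\<close> are its integrals against test functions, so they vanish, and \<open>f\<close> is their limit.\<close>
lemma weak_zero_imp_AE_zero:
  fixes f :: "'a::euclidean_space \<Rightarrow> 'b::euclidean_space"
  assumes f: "loc_int \<Omega> f" and \<Omega>: "open \<Omega>"
    and zero: "\<And>\<phi>. \<phi> \<in> test_fun \<Omega> \<Longrightarrow> (\<integral>x. \<phi> x *\<^sub>R f x \<partial>lebesgue) = 0"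
  shows "AE x in lebesgue. x \<in> \<Omega> \<longrightarrow> f x = 0"
proof (rule AE_on_open[OF \<Omega>])
  fix X assume X: "compact X" "X \<subseteq> \<Omega>"
  obtain Y where Y: "compact Y" "X \<subseteq> Y" "Y \<subseteq> \<Omega>"
    "eventually (\<lambda>n. \<forall>x\<in>X. cbox (x - corner n) x \<subseteq> Y) sequentially"
    by (rule compact_margin[OF X(1) \<Omega> X(2)])
  have "(\<lambda>n. \<integral>\<^sup>+x. indicator X x * norm (f x - (\<integral>y. K n x y *\<^sub>R f y \<partial>lebesgue)) \<partial>lebesgue) \<longlonglongrightarrow> 0"
    by (rule mollify_local[OF f X(1) \<Omega> X(2)])
  moreover have "eventually (\<lambda>n. (\<integral>\<^sup>+x. indicator X x * norm (f x - (\<integral>y. K n x y *\<^sub>R f y \<partial>lebesgue)) \<partial>lebesgue)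
      = (\<integral>\<^sup>+x. indicator X x * norm (f x) \<partial>lebesgue)) sequentially"
    using Y(4)
  proof eventually_elim
    case (elim n)
    show ?case
    proof (rule nn_integral_cong)
      fix x
      have "(\<integral>y. K n x y *\<^sub>R f y \<partial>lebesgue) = 0" if "x \<in> X"
        by (rule zero, rule K_test_fun) (use elim that Y in blast)
      then show "ennreal (indicator X x * norm (f x - (\<integral>y. K n x y *\<^sub>R f y \<partial>lebesgue))) = ennreal (indicator X x * norm (f x))"
        by (auto simp: indicator_def)
    qed
  qed
  ultimately have "(\<lambda>n::nat. \<integral>\<^sup>+x. indicator X x * norm (f x) \<partial>lebesgue) \<longlonglongrightarrow> 0"
    by (rule Lim_transform_eventually)
  then have "(\<integral>\<^sup>+x. indicator X x * norm (f x) \<partial>lebesgue) = 0" by (simp add: LIMSEQ_const_iff)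
  also have "(\<lambda>x. ennreal (indicator X x * norm (f x))) = (\<lambda>x. ennreal (norm (indicator X x *\<^sub>R f x)))"
    by (auto simp: indicator_def)
  finally have z: "(\<integral>\<^sup>+x. ennreal (norm (indicator X x *\<^sub>R f x)) \<partial>lebesgue) = 0" .
  have "(\<lambda>x. ennreal (norm (indicator X x *\<^sub>R f x))) \<in> borel_measurable lebesgue"
    using loc_intD[OF f X] by measurable
  with z have "AE x in lebesgue. ennreal (norm (indicator X x *\<^sub>R f x)) = 0"
    by (simp only: nn_integral_0_iff_AE)
  then show "AE x in lebesgue. x \<in> X \<longrightarrow> f x = 0" by eventually_elim (auto simp: indicator_def split: if_splits)
qed

lemma test_fun_props:
  assumes "\<phi> \<in> test_fun \<Omega>"
  obtains X where "compact X" "X \<subseteq> \<Omega>" "\<forall>x. x \<notin> X \<longrightarrow> \<phi> x = 0" "\<phi> \<in> borel_measurable borel"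
    "\<exists>M. \<forall>x. \<bar>\<phi> x\<bar> \<le> M"
proof -
  obtain X where X: "compact X" "X \<subseteq> \<Omega>" "\<forall>x. x \<notin> X \<longrightarrow> \<phi> x = 0"
    using assms by (auto simp: test_fun_def)
  have "\<phi> differentiable at x" for x
    using assms by (auto simp: test_fun_def dest!: spec[of _ "[]"])
  then have c: "continuous_on A \<phi>" for A
    by (meson continuous_at_imp_continuous_on differentiable_imp_continuous_within)
  have "bounded (\<phi> ` X)" by (rule compact_imp_bounded[OF compact_continuous_image[OF c X(1)]])
  then obtain M where M: "\<forall>x\<in>X. \<bar>\<phi> x\<bar> \<le> M" unfolding bounded_iff real_norm_def by blast
  have "\<bar>\<phi> x\<bar> \<le> \<bar>M\<bar>" for x using M X(3) by (cases "x \<in> X") force+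
  then have bd: "\<exists>M. \<forall>x. \<bar>\<phi> x\<bar> \<le> M" by blast
  have "\<phi> \<in> borel_measurable borel" by (rule borel_measurable_continuous_onI) (rule c)
  from that[OF X this bd] show thesis .
qed

lemma test_fun_integrable:
  fixes f :: "'a::euclidean_space \<Rightarrow> 'b::euclidean_space"
  assumes "\<phi> \<in> test_fun \<Omega>" "loc_int \<Omega> f"
  shows "integrable lebesgue (\<lambda>x. \<phi> x *\<^sub>R f x)"
proof -
  obtain X where X: "compact X" "X \<subseteq> \<Omega>" "\<forall>x. x \<notin> X \<longrightarrow> \<phi> x = 0" "\<phi> \<in> borel_measurable borel"
    "\<exists>M. \<forall>x. \<bar>\<phi> x\<bar> \<le> M" by (rule test_fun_props[OF assms(1)])
  then obtain M where M: "\<And>x. \<bar>\<phi> x\<bar> \<le> M" by blast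
  have "\<phi> \<in> borel_measurable lebesgue" by (rule measurable_completion) (simp add: X(4))
  then show ?thesis
    by (rule loc_int_mult(1)[OF assms(2) X(1,2) _ M]) (use X(3) in auto)
qed

lemma weak_deriv_unique:
  fixes f :: "'a::euclidean_space \<Rightarrow> 'b::euclidean_space"
  assumes "open \<Omega>" "has_weak_deriv \<Omega> vs f g" "has_weak_deriv \<Omega> vs f h"
  shows "AE x in lebesgue. x \<in> \<Omega> \<longrightarrow> g x = h x"
proof -
  have g: "loc_int \<Omega> g" and h: "loc_int \<Omega> h" using assms by (auto simp: has_weak_deriv_def)
  have "AE x in lebesgue. x \<in> \<Omega> \<longrightarrow> g x - h x = 0"
  proof (rule weak_zero_imp_AE_zero[OF _ assms(1)])
    show "loc_int \<Omega> (\<lambda>x. g x - h x)"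
      using g h by (auto simp: loc_int_def set_integral_diff)
    fix \<phi> :: "'a \<Rightarrow> real" assume \<phi>: "\<phi> \<in> test_fun \<Omega>"
    have "(-1) ^ length vs *\<^sub>R (\<integral>x. \<phi> x *\<^sub>R g x \<partial>lebesgue) = (-1) ^ length vs *\<^sub>R (\<integral>x. \<phi> x *\<^sub>R h x \<partial>lebesgue)"
      using assms(2,3) \<phi> unfolding has_weak_deriv_def by metis
    then have "(\<integral>x. \<phi> x *\<^sub>R g x \<partial>lebesgue) = (\<integral>x. \<phi> x *\<^sub>R h x \<partial>lebesgue)" by simp
    then show "(\<integral>x. \<phi> x *\<^sub>R (g x - h x) \<partial>lebesgue) = 0"
      using test_fun_integrable[OF \<phi> g] test_fun_integrable[OF \<phi> h] by (simp add: scaleR_diff_right)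
  qed
  then show ?thesis by eventually_elim auto
qed

section \<open>A Sobolev inequality\<close>

lemma loc_int_measurable:
  fixes f :: "'a::euclidean_space \<Rightarrow> 'b::euclidean_space"
  assumes "loc_int UNIV f"
  shows "f \<in> borel_measurable lebesgue"
proof (rule borel_measurable_LIMSEQ_metric)
  show "(\<lambda>x. indicator (cball 0 (real n)) x *\<^sub>R f x) \<in> borel_measurable lebesgue" for n
    using loc_intD[OF assms, of "cball 0 (real n)"] by simp
  fix x :: 'a
  have "eventually (\<lambda>n. norm x \<le> real n) sequentially"
    by (rule eventually_sequentiallyI[of "nat \<lceil>norm x\<rceil>"]) linarith
  then have "eventually (\<lambda>n. f x = indicator (cball 0 (real n)) x *\<^sub>R f x) sequentially"
    by eventually_elim (auto simp: indicator_def)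
  then show "(\<lambda>n. indicator (cball 0 (real n)) x *\<^sub>R f x) \<longlonglongrightarrow> f x"
    by (rule Lim_transform_eventually[OF tendsto_const])
qed

text \<open>Where \<open>norm (g x)\<close> exceeds \<open>\<epsilon> * L\<close>, it is dominated by a multiple of its power with exponent \<open>p\<close>; the rest
  is paid for by the volume of \<open>X\<close>.  The level \<open>L\<close> is free, to be adapted to that volume.\<close>
lemma nn_integral_le_Lp:
  fixes g :: "'a::euclidean_space \<Rightarrow> 'b::euclidean_space"
  assumes g: "g \<in> borel_measurable lebesgue" and X: "X \<in> sets lebesgue" "emeasure lebesgue X \<le> ennreal V"
    and pos: "V \<ge> 0" "\<epsilon> > 0" "L > 0" "p \<ge> 1"
    and int: "(\<integral>\<^sup>+x. ennreal (norm (g x) powr p) \<partial>lebesgue) \<le> ennreal (\<epsilon> powr p)"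
  shows "(\<integral>\<^sup>+x. ennreal (indicator X x * norm (g x)) \<partial>lebesgue) \<le> ennreal (\<epsilon> * (L * V + L powr (1 - p)))"
proof -
  define \<mu> where "\<mu> = \<epsilon> * L"
  have \<mu>: "\<mu> > 0" using pos by (simp add: \<mu>_def)
  have pw: "t \<le> \<mu> + \<mu> powr (1 - p) * t powr p" if "t \<ge> 0" for t
  proof (cases "t \<le> \<mu>")
    case True
    then show ?thesis by (simp add: add_increasing2)
  next
    case False
    then have t: "t > \<mu>" "t > 0" using \<mu> by auto
    have "t / \<mu> = (t / \<mu>) powr 1" using t \<mu> by simp
    also have "\<dots> \<le> (t / \<mu>) powr p" using t \<mu> pos by (intro powr_mono) auto
    also have "\<dots> = t powr p / \<mu> powr p" using t \<mu> by (simp add: powr_divide)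
    finally have "t \<le> \<mu> * (t powr p / \<mu> powr p)" using \<mu> by (simp add: field_simps)
    also have "\<dots> = \<mu> powr (1 - p) * t powr p" using \<mu> by (simp add: powr_diff)
    finally show ?thesis using \<mu> by simp
  qed
  have [measurable]: "g \<in> borel_measurable lebesgue" "X \<in> sets lebesgue" by fact+
  have "(\<integral>\<^sup>+x. ennreal (indicator X x * norm (g x)) \<partial>lebesgue)
     \<le> (\<integral>\<^sup>+x. ennreal \<mu> * indicator X x + ennreal (\<mu> powr (1 - p)) * ennreal (norm (g x) powr p) \<partial>lebesgue)"
  proof (rule nn_integral_mono)
    fix x
    have "indicator X x * norm (g x) \<le> \<mu> * indicator X x + \<mu> powr (1 - p) * norm (g x) powr p"
      using pw[of "norm (g x)"] \<mu> by (auto simp: indicator_def)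
    then have "ennreal (indicator X x * norm (g x)) \<le> ennreal (\<mu> * indicator X x + \<mu> powr (1 - p) * norm (g x) powr p)"
      by (rule ennreal_leI)
    also have "\<dots> = ennreal \<mu> * indicator X x + ennreal (\<mu> powr (1 - p)) * ennreal (norm (g x) powr p)"
      using \<mu> by (simp add: ennreal_plus ennreal_mult ennreal_indicator)
    finally show "ennreal (indicator X x * norm (g x)) \<le> ennreal \<mu> * indicator X x + ennreal (\<mu> powr (1 - p)) * ennreal (norm (g x) powr p)" .
  qed
  also have "\<dots> = ennreal \<mu> * emeasure lebesgue X + ennreal (\<mu> powr (1 - p)) * (\<integral>\<^sup>+x. ennreal (norm (g x) powr p) \<partial>lebesgue)"
    by (subst nn_integral_add) (auto simp: nn_integral_cmult)
  also have "\<dots> \<le> ennreal \<mu> * ennreal V + ennreal (\<mu> powr (1 - p)) * ennreal (\<epsilon> powr p)"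
    using X int by (intro add_mono mult_left_mono) auto
  also have "\<dots> = ennreal (\<mu> * V + \<mu> powr (1 - p) * \<epsilon> powr p)"
    using \<mu> pos by (simp add: ennreal_plus ennreal_mult)
  also have "\<mu> * V + \<mu> powr (1 - p) * \<epsilon> powr p = \<epsilon> * (L * V + L powr (1 - p))"
  proof -
    have "\<mu> powr (1 - p) * \<epsilon> powr p = L powr (1 - p) * (\<epsilon> powr (1 - p) * \<epsilon> powr p)"
      using pos by (simp add: \<mu>_def powr_mult)
    also have "\<epsilon> powr (1 - p) * \<epsilon> powr p = \<epsilon>" using pos by (simp flip: powr_add)
    finally show ?thesis by (simp add: \<mu>_def algebra_simps)
  qed
  finally show ?thesis .
qed

lemma iter_deriv_tens3:
  assumes "\<And>b. b \<in> Basis \<Longrightarrow> smooth (h b)" "v \<in> Basis"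
  shows "iter_deriv [v, v, v] (tens h) = tens (h(v := deriv (deriv (deriv (h v)))))"
proof -
  have 1: "iter_deriv [v] (tens h) = tens (h(v := deriv (h v)))"
    by (rule iter_deriv_tens) (use assms in auto)
  have 2: "iter_deriv [v, v] (tens h) = tens ((h(v := deriv (h v)))(v := deriv ((h(v := deriv (h v))) v)))"
    by (rule iter_deriv_tens_Cons[OF _ assms(2) 1]) (use assms smooth_deriv in auto)
  then have 2: "iter_deriv [v, v] (tens h) = tens (h(v := deriv (deriv (h v))))" by (simp del: iter_deriv.simps)
  have "iter_deriv [v, v, v] (tens h) = tens ((h(v := deriv (deriv (h v))))(v := deriv ((h(v := deriv (deriv (h v)))) v)))"
    by (rule iter_deriv_tens_Cons[OF _ assms(2) 2]) (use assms smooth_deriv in auto)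
  then show ?thesis by (simp del: iter_deriv.simps)
qed

lemma emeasure_corner_box:
  fixes x :: "real^3"
  shows "emeasure lebesgue (cbox (x - corner n) x) = ennreal (8 / 8 ^ n)"
proof -
  have "emeasure lborel (cbox (x - corner n) x) = ennreal (\<Prod>b\<in>Basis. (x - (x - corner n)) \<bullet> b)"
    by (rule emeasure_lborel_cbox) (simp add: inner_diff_left corner_inner)
  also have "(\<Prod>b\<in>Basis. (x - (x - corner n)) \<bullet> b) = (\<Prod>b\<in>(Basis::(real^3) set). 2 / 2 ^ n)"
    by (intro prod.cong) (auto simp: corner_inner)
  also have "\<dots> = (2 / 2 ^ n) ^ 3" by simp
  also have "(2 / 2 ^ n) ^ 3 = 2 ^ 3 / (2 ^ 3 :: real) ^ n"
    by (simp only: power_divide power_mult[symmetric] mult.commute[of n])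
  also have "\<dots> = 8 / (8::real) ^ n" by simp
  finally show ?thesis by simp
qed

text \<open>Passing from scale \<open>2 ^ - n\<close> to \<open>2 ^ - Suc n\<close> one coordinate at a time, each change is the third
  derivative, in that coordinate, of a test function which is bounded by a constant and lives on a cube of
  volume of order \<open>8 ^ - n\<close>.\<close>
lemma moll_step:
  fixes f :: "real^3 \<Rightarrow> 'b::euclidean_space"
  assumes D: "\<And>b. b \<in> Basis \<Longrightarrow> has_weak_deriv UNIV [b, b, b] f (D b)"
    and int: "\<And>b. b \<in> Basis \<Longrightarrow> (\<integral>\<^sup>+x. ennreal (norm (D b x) powr 2) \<partial>lebesgue) \<le> ennreal (\<epsilon> powr 2)"
    and \<epsilon>: "\<epsilon> > 0" and B: "B \<ge> 0" "\<And>n s. \<bar>mollN n s\<bar> \<le> 2 ^ n * B"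
    and Bi: "Bi \<ge> 0" "\<And>s. \<bar>incr s\<bar> \<le> Bi"
  shows "norm ((\<integral>y. K (Suc n) x y *\<^sub>R f y \<partial>lebesgue) - (\<integral>y. K n x y *\<^sub>R f y \<partial>lebesgue))
           \<le> 3 * (4 * Bi * B\<^sup>2 * (9 * \<epsilon> / 2 ^ n))"
proof -
  define g where "g S b = (\<lambda>s. (if b \<in> S then mollN (Suc n) else mollN n) (x \<bullet> b - s))" for S :: "(real^3) set" and b :: "real^3"
  define X where "X = cbox (x - corner n) x"
  have X: "compact X" by (simp add: X_def)
  have locf: "loc_int UNIV f" using D[of "axis 1 1"] by (auto simp: has_weak_deriv_def axis_in_Basis_iff)
  have sm: "smooth (g S b)" for S b
    unfolding g_def by (cases "b \<in> S") (simp_all add: smooth_reflect smooth_mollN del: mollN_def)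
  have zero: "g S b s = 0" if "b \<in> Basis" "s \<notin> {(x - corner n) \<bullet> b..x \<bullet> b}" for S b s
  proof -
    have "(2::real) / 2 ^ Suc n \<le> 2 / 2 ^ n" by (simp add: field_simps)
    moreover have "x \<bullet> b - s \<notin> {0..2 / 2 ^ n}" using that by (auto simp: inner_diff_left corner_inner)
    ultimately have "x \<bullet> b - s \<notin> {0..2 / 2 ^ Suc n}" by auto
    then show ?thesis using mollN_eq_0 \<open>x \<bullet> b - s \<notin> {0..2 / 2 ^ n}\<close> by (auto simp: g_def)
  qed
  have gB: "\<bar>g S b s\<bar> \<le> 2 ^ Suc n * B" for S b s
  proof -
    have "2 ^ n * B \<le> 2 ^ Suc n * B" using B by simp
    then show ?thesis using B(2)[of n "x \<bullet> b - s"] B(2)[of "Suc n" "x \<bullet> b - s"] unfolding g_def by auto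
  qed
  have tf: "tens (g S) \<in> test_fun UNIV" for S
    by (rule tens_test_fun[of _ "x - corner n" x]) (use sm zero in auto)
  have step: "norm ((\<integral>y. tens (g (insert b S)) y *\<^sub>R f y \<partial>lebesgue) - (\<integral>y. tens (g S) y *\<^sub>R f y \<partial>lebesgue))
        \<le> 4 * Bi * B\<^sup>2 * (9 * \<epsilon> / 2 ^ n)" if b: "b \<in> Basis" "b \<notin> S" for b S
  proof -
    define h where "h = (g S)(b := (\<lambda>s. incrN n (x \<bullet> b - s)))"
    have smh: "smooth (h c)" for c
      unfolding h_def using sm smooth_reflect[OF smooth_incrN] by simp
    have zh: "h c s = 0" if "c \<in> Basis" "s \<notin> {(x - corner n) \<bullet> c..x \<bullet> c}" for c s
      using zero[OF that, of S] incrN_eq_0[of "x \<bullet> c - s" n] that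
      by (auto simp: h_def inner_diff_left corner_inner)
    have tfh: "tens h \<in> test_fun UNIV"
      by (rule tens_test_fun[of _ "x - corner n" x]) (use smh zh in auto)
    \<comment> \<open>The gain \<open>4 ^ - n\<close> in the direction \<open>b\<close> compensates the factors \<open>2 ^ n\<close> of the two other directions.\<close>
    have hB: "\<bar>tens h y\<bar> \<le> 4 * Bi * B\<^sup>2" for y
    proof -
      have "\<bar>tens h y\<bar> \<le> (\<Prod>c\<in>Basis. if c = b then Bi / 4 ^ n else 2 ^ Suc n * B)"
        by (rule abs_tens_le) (use gB Bi in \<open>auto simp: h_def incrN_def abs_mult divide_right_mono\<close>)
      also have "\<dots> = (Bi / 4 ^ n) * (\<Prod>c\<in>Basis - {b}. if c = b then Bi / 4 ^ n else 2 ^ Suc n * B)"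
        using b by (subst prod.remove[of _ b]) auto
      also have "(\<Prod>c\<in>Basis - {b}. if c = b then Bi / 4 ^ n else 2 ^ Suc n * B) = (\<Prod>c\<in>Basis - {b}. 2 ^ Suc n * B)"
        by (intro prod.cong) auto
      also have "\<dots> = (2 ^ Suc n * B) ^ 2" using b by (simp add: card_Diff_singleton)
      also have "(Bi / 4 ^ n) * (2 ^ Suc n * B) ^ 2 = 4 * Bi * B\<^sup>2"
      proof -
        have "(2::real) ^ n * 2 ^ n = 4 ^ n" by (simp flip: power_mult_distrib)
        then have "(2 ^ Suc n * B) ^ 2 = 4 * B\<^sup>2 * 4 ^ n" by (simp add: power2_eq_square mult_ac)
        then show ?thesis by simp
      qed
      finally show ?thesis .
    qed
    have eq: "tens (g (insert b S)) y - tens (g S) y = iter_deriv [b, b, b] (tens h) y" for y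
    proof -
      have "tens (g (insert b S)) y = mollN (Suc n) (x \<bullet> b - y \<bullet> b) * (\<Prod>c\<in>Basis - {b}. g S c (y \<bullet> c))"
        using b(1) by (subst tens_split[of b]) (auto simp: g_def intro!: prod.cong)
      moreover have "tens (g S) y = mollN n (x \<bullet> b - y \<bullet> b) * (\<Prod>c\<in>Basis - {b}. g S c (y \<bullet> c))"
        using b by (subst tens_split[of b]) (auto simp: g_def)
      moreover have "iter_deriv [b, b, b] (tens h) y = deriv (deriv (deriv (h b))) (y \<bullet> b) * (\<Prod>c\<in>Basis - {b}. h c (y \<bullet> c))"
        by (subst iter_deriv_tens3) (use smh b in \<open>auto simp only: tens_upd\<close>)
      moreover have "(\<Prod>c\<in>Basis - {b}. h c (y \<bullet> c)) = (\<Prod>c\<in>Basis - {b}. g S c (y \<bullet> c))"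
        by (intro prod.cong) (auto simp: h_def)
      moreover have "deriv (deriv (deriv (h b))) (y \<bullet> b) = mollN (Suc n) (x \<bullet> b - y \<bullet> b) - mollN n (x \<bullet> b - y \<bullet> b)"
        using deriv_incrN_reflect[of n "x \<bullet> b" "y \<bullet> b"] by (simp add: h_def)
      ultimately show ?thesis by (simp only: left_diff_distrib)
    qed
    have "(\<integral>y. tens (g (insert b S)) y *\<^sub>R f y \<partial>lebesgue) - (\<integral>y. tens (g S) y *\<^sub>R f y \<partial>lebesgue)
        = (\<integral>y. tens (g (insert b S)) y *\<^sub>R f y - tens (g S) y *\<^sub>R f y \<partial>lebesgue)"
      using test_fun_integrable[OF tf locf] by simp
    also have "\<dots> = (\<integral>y. iter_deriv [b, b, b] (tens h) y *\<^sub>R f y \<partial>lebesgue)"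
      by (simp only: eq[symmetric] scaleR_diff_left)
    also have "\<dots> = (-1) ^ length [b, b, b] *\<^sub>R (\<integral>y. tens h y *\<^sub>R D b y \<partial>lebesgue)"
      using D[OF b(1)] tfh unfolding has_weak_deriv_def by blast
    finally have "norm ((\<integral>y. tens (g (insert b S)) y *\<^sub>R f y \<partial>lebesgue) - (\<integral>y. tens (g S) y *\<^sub>R f y \<partial>lebesgue))
        = norm (\<integral>y. tens h y *\<^sub>R D b y \<partial>lebesgue)" by simp
    moreover have "ennreal (norm (\<integral>y. tens h y *\<^sub>R D b y \<partial>lebesgue)) \<le> ennreal (4 * Bi * B\<^sup>2 * (9 * \<epsilon> / 2 ^ n))"
    proof -
      have locD: "loc_int UNIV (D b)" using D[OF b(1)] by (auto simp: has_weak_deriv_def)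
      have tm: "tens h \<in> borel_measurable lebesgue"
        by (rule measurable_completion) (simp, rule tens_measurable, rule smh)
      have "ennreal (norm (\<integral>y. tens h y *\<^sub>R D b y \<partial>lebesgue)) \<le> ennreal (4 * Bi * B\<^sup>2) * (\<integral>\<^sup>+y. indicator X y * norm (D b y) \<partial>lebesgue)"
        by (rule loc_int_mult(2)[OF locD X _ tm hB]) (use tens_zero_outside[of "x - corner n" x h] zh in \<open>auto simp: X_def\<close>)
      \<comment> \<open>The level \<open>2 ^ n\<close> makes the contributions of the volume and of the square integral both at most of order \<open>2 ^ - n\<close>.\<close>
      also have "\<dots> \<le> ennreal (4 * Bi * B\<^sup>2) * ennreal (\<epsilon> * (2 ^ n * (8 / 8 ^ n) + (2 ^ n) powr (1 - 2)))"
        by (intro mult_left_mono nn_integral_le_Lp[OF loc_int_measurable[OF locD]])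
           (use int[OF b(1)] \<epsilon> X in \<open>auto simp: X_def emeasure_corner_box borel_compact\<close>)
      also have "\<dots> \<le> ennreal (4 * Bi * B\<^sup>2) * ennreal (9 * \<epsilon> / 2 ^ n)"
      proof (intro mult_left_mono ennreal_leI)
        have "(2::real) ^ n * (8 / 8 ^ n) = 8 / 4 ^ n"
          by (simp add: power_mult_distrib[symmetric] field_simps)
        also have "\<dots> \<le> 8 / 2 ^ n" by (intro divide_left_mono power_mono) auto
        finally have "2 ^ n * (8 / 8 ^ n) + (2 ^ n) powr (1 - 2) \<le> 9 / (2::real) ^ n"
          by (simp add: powr_minus_divide powr_neg_one)
        from mult_left_mono[OF this, of \<epsilon>] \<epsilon>
        show "\<epsilon> * (2 ^ n * (8 / 8 ^ n) + (2 ^ n) powr (1 - 2)) \<le> 9 * \<epsilon> / 2 ^ n" by (simp add: mult.commute)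
      qed simp
      also have "\<dots> = ennreal (4 * Bi * B\<^sup>2 * (9 * \<epsilon> / 2 ^ n))" using B Bi \<epsilon> by (intro ennreal_mult[symmetric]) auto
      finally show ?thesis .
    qed
    ultimately show ?thesis using B Bi \<epsilon> by (simp add: ennreal_le_iff)
  qed
  have "norm ((\<integral>y. tens (g S) y *\<^sub>R f y \<partial>lebesgue) - (\<integral>y. tens (g {}) y *\<^sub>R f y \<partial>lebesgue))
      \<le> card S * (4 * Bi * B\<^sup>2 * (9 * \<epsilon> / 2 ^ n))" if "finite S" "S \<subseteq> Basis" for S
    using that
  proof (induction S rule: finite_induct)
    case (insert b S)
    then show ?case
      using step[of b S] norm_triangle_ineq[of "(\<integral>y. tens (g (insert b S)) y *\<^sub>R f y \<partial>lebesgue) - (\<integral>y. tens (g S) y *\<^sub>R f y \<partial>lebesgue)"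
          "(\<integral>y. tens (g S) y *\<^sub>R f y \<partial>lebesgue) - (\<integral>y. tens (g {}) y *\<^sub>R f y \<partial>lebesgue)"]
      by (simp add: distrib_right add_divide_distrib)
  qed simp
  from this[of Basis] have "norm ((\<integral>y. tens (g Basis) y *\<^sub>R f y \<partial>lebesgue) - (\<integral>y. tens (g {}) y *\<^sub>R f y \<partial>lebesgue))
      \<le> 3 * (4 * Bi * B\<^sup>2 * (9 * \<epsilon> / 2 ^ n))" by simp
  moreover have "tens (g Basis) = K (Suc n) x" unfolding K_def by (rule tens_cong) (auto simp: g_def)
  moreover have "tens (g {}) = K n x" unfolding K_def by (rule tens_cong) (auto simp: g_def)
  ultimately show ?thesis by simp
qed

lemma AE_le_of_mollified_le:
  fixes f :: "'a::euclidean_space \<Rightarrow> 'b::euclidean_space"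
  assumes f: "loc_int UNIV f" and M: "\<And>n x. norm (\<integral>y. K n x y *\<^sub>R f y \<partial>lebesgue) \<le> M"
  shows "AE x in lebesgue. norm (f x) \<le> M"
proof -
  have fm [measurable]: "f \<in> borel_measurable lebesgue" by (rule loc_int_measurable[OF f])
  have "AE x in lebesgue. x \<in> cball 0 (real r) \<longrightarrow> norm (f x) \<le> M" for r :: nat
  proof -
    define X :: "'a set" where "X = cball 0 (real r)"
    have X: "compact X" by (simp add: X_def)
    have [measurable]: "X \<in> sets lebesgue" by (simp add: X_def)
    let ?e = "\<lambda>x. ennreal (indicator X x * max 0 (norm (f x) - M))"
    have "(\<integral>\<^sup>+x. ?e x \<partial>lebesgue) \<le> 0"
    proof (rule LIMSEQ_le_const[OF mollify_local[OF f X]])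
      show "\<exists>N. \<forall>n\<ge>N. (\<integral>\<^sup>+x. ?e x \<partial>lebesgue)
         \<le> (\<integral>\<^sup>+x. indicator X x * norm (f x - (\<integral>y. K n x y *\<^sub>R f y \<partial>lebesgue)) \<partial>lebesgue)"
      proof (intro exI allI impI nn_integral_mono ennreal_leI mult_left_mono)
        fix n x
        show "max 0 (norm (f x) - M) \<le> norm (f x - (\<integral>y. K n x y *\<^sub>R f y \<partial>lebesgue))"
          using norm_triangle_ineq2[of "f x" "\<integral>y. K n x y *\<^sub>R f y \<partial>lebesgue"] M[where n=n and x=x] by auto
      qed simp
    qed auto
    then have "(\<integral>\<^sup>+x. ?e x \<partial>lebesgue) = 0" by simp
    then have "AE x in lebesgue. ?e x = 0"
      by (subst (asm) nn_integral_0_iff_AE) measurable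
    then show ?thesis
      by eventually_elim (auto simp: X_def indicator_def ennreal_eq_0_iff split: if_splits)
  qed
  then have "AE x in lebesgue. \<forall>r::nat. x \<in> cball 0 (real r) \<longrightarrow> norm (f x) \<le> M"
    by (simp only: AE_all_countable) auto
  then show ?thesis
  proof eventually_elim
    case (elim x)
    obtain r :: nat where "norm x \<le> real r" using real_arch_simple by blast
    then show ?case using elim by auto
  qed
qed

text \<open>The mollification at scale 1 is bounded by the integral of the \<open>p\<close>-th power, the sum of all later changes by
  the third derivatives, and \<open>f\<close> is the limit of its mollifications.  Homogeneity in \<open>\<epsilon>\<close> allows \<open>\<epsilon>\<close> to be any upper
  bound for both norms.\<close>
proposition sobolev_sup:
  assumes p: "p \<ge> (1::real)"
  shows "\<exists>C>0. \<forall>(f :: real^3 \<Rightarrow> 'b::euclidean_space) D \<epsilon>.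
    \<epsilon> > 0 \<longrightarrow> (\<forall>b\<in>Basis. has_weak_deriv UNIV [b, b, b] f (D b)) \<longrightarrow>
    (\<integral>\<^sup>+x. ennreal (norm (f x) powr p) \<partial>lebesgue) \<le> ennreal (\<epsilon> powr p) \<longrightarrow>
    (\<forall>b\<in>Basis. (\<integral>\<^sup>+x. ennreal (norm (D b x) powr 2) \<partial>lebesgue) \<le> ennreal (\<epsilon> powr 2)) \<longrightarrow>
    (AE x in lebesgue. norm (f x) \<le> C * \<epsilon>)"
proof -
  obtain B where B: "B \<ge> 0" "\<And>n s. \<bar>mollN n s\<bar> \<le> 2 ^ n * B" using mollN_bound by metis
  obtain Bi where Bi: "Bi \<ge> 0" "\<And>s. \<bar>incr s\<bar> \<le> Bi"
    using bounded_of_support[OF smooth_incr incr_eq_0] by metis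
  obtain M0 where M0: "M0 \<ge> 0" "\<And>x y::real^3. \<bar>K 0 x y\<bar> \<le> M0" using K_bound[of 0] by metis
  define M1 where "M1 = 3 * (4 * Bi * B\<^sup>2 * 9)"
  have M1: "M1 \<ge> 0" using B Bi by (simp add: M1_def)
  define C where "C = 9 * M0 + 2 * M1 + 1"
  show ?thesis
  proof (intro exI[of _ C] conjI allI impI)
    show "C > 0" using M0 M1 by (simp add: C_def)
    fix f :: "real^3 \<Rightarrow> 'b" and D \<epsilon>
    assume \<epsilon>: "\<epsilon> > 0" and D: "\<forall>b\<in>Basis. has_weak_deriv UNIV [b, b, b] f (D b)"
      and f: "(\<integral>\<^sup>+x. ennreal (norm (f x) powr p) \<partial>lebesgue) \<le> ennreal (\<epsilon> powr p)"
      and Di: "\<forall>b\<in>Basis. (\<integral>\<^sup>+x. ennreal (norm (D b x) powr 2) \<partial>lebesgue) \<le> ennreal (\<epsilon> powr 2)"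
    have locf: "loc_int UNIV f" using D[rule_format, of "axis 1 1"] by (auto simp: has_weak_deriv_def axis_in_Basis_iff)
    have a0: "norm (\<integral>y. K 0 x y *\<^sub>R f y \<partial>lebesgue) \<le> 9 * M0 * \<epsilon>" for x
    proof -
      define X where "X = cbox (x - corner 0) x"
      have X: "compact X" by (simp add: X_def)
      have Km: "K 0 x \<in> borel_measurable lebesgue" by (rule measurable_completion) simp
      have "ennreal (norm (\<integral>y. K 0 x y *\<^sub>R f y \<partial>lebesgue)) \<le> ennreal M0 * (\<integral>\<^sup>+y. indicator X y * norm (f y) \<partial>lebesgue)"
        by (rule loc_int_mult(2)[OF locf X _ Km M0(2)]) (auto simp: X_def K_zero_outside)
      also have "\<dots> \<le> ennreal M0 * ennreal (\<epsilon> * (1 * 8 + 1 powr (1 - p)))"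
        by (intro mult_left_mono nn_integral_le_Lp[OF loc_int_measurable[OF locf]])
           (use f \<epsilon> X p in \<open>auto simp: X_def emeasure_corner_box borel_compact\<close>)
      also have "\<dots> = ennreal (9 * M0 * \<epsilon>)" using M0 \<epsilon> by (simp add: ennreal_mult[symmetric] mult_ac)
      finally show ?thesis using M0 \<epsilon> by (simp add: ennreal_le_iff)
    qed
    \<comment> \<open>The last factor is the partial sum of the geometric series with ratio \<open>1 / 2\<close>.\<close>
    have an: "norm (\<integral>y. K n x y *\<^sub>R f y \<partial>lebesgue) \<le> 9 * M0 * \<epsilon> + M1 * \<epsilon> * (2 - 2 / 2 ^ n)" for n x
    proof (induction n)
      case (Suc n)
      have "norm ((\<integral>y. K (Suc n) x y *\<^sub>R f y \<partial>lebesgue) - (\<integral>y. K n x y *\<^sub>R f y \<partial>lebesgue))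
           \<le> 3 * (4 * Bi * B\<^sup>2 * (9 * \<epsilon> / 2 ^ n))"
        by (rule moll_step[OF _ _ \<epsilon> B Bi]) (use D Di in auto)
      also have "\<dots> = M1 * \<epsilon> * (1 / 2 ^ n)" by (simp add: M1_def)
      finally have "norm (\<integral>y. K (Suc n) x y *\<^sub>R f y \<partial>lebesgue) \<le> M1 * \<epsilon> * (1 / 2 ^ n) + (9 * M0 * \<epsilon> + M1 * \<epsilon> * (2 - 2 / 2 ^ n))"
        using Suc norm_triangle_ineq2[of "\<integral>y. K (Suc n) x y *\<^sub>R f y \<partial>lebesgue" "\<integral>y. K n x y *\<^sub>R f y \<partial>lebesgue"] by linarith
      then show ?case by (simp add: algebra_simps)
    qed (use a0 in simp)
    show "AE x in lebesgue. norm (f x) \<le> C * \<epsilon>"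
    proof (rule AE_le_of_mollified_le[OF locf])
      fix n x
      have "M1 * \<epsilon> * (2 - 2 / 2 ^ n) \<le> M1 * \<epsilon> * 2" using M1 \<epsilon> by (intro mult_left_mono) auto
      then show "norm (\<integral>y. K n x y *\<^sub>R f y \<partial>lebesgue) \<le> C * \<epsilon>"
        using an[of n x] \<epsilon> by (simp add: C_def algebra_simps)
    qed
  qed
qed

section \<open>Continuity in time with values in the essentially bounded functions\<close>

text \<open>Membership in \<open>C([0,T];L\<^sup>\<infinity>)\<close>, with the supremum norms replaced by bounds that hold almost everywhere.\<close>
definition sup_continuous :: "real \<Rightarrow> (real \<Rightarrow> real^3 \<Rightarrow> 'b::euclidean_space) \<Rightarrow> bool" where
  "sup_continuous T u \<longleftrightarrow>
     (\<forall>t\<in>{0..T}. u t \<in> borel_measurable lebesgue \<and> (\<exists>M. AE x in lebesgue. norm (u t x) \<le> M)) \<and>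
     (\<forall>s\<in>{0..T}. \<forall>e>0. \<exists>d>0. \<forall>t\<in>{0..T}. \<bar>t - s\<bar> < d \<longrightarrow> (AE x in lebesgue. norm (u t x - u s x) \<le> e))"

lemma sup_continuousD:
  assumes "sup_continuous T u"
  shows "t \<in> {0..T} \<Longrightarrow> u t \<in> borel_measurable lebesgue"
    and "s \<in> {0..T} \<Longrightarrow> e > 0 \<Longrightarrow> \<exists>d>0. \<forall>t\<in>{0..T}. \<bar>t - s\<bar> < d \<longrightarrow> (AE x in lebesgue. norm (u t x - u s x) \<le> e)"
  using assms unfolding sup_continuous_def by blast+

lemma sup_continuous_bound:
  assumes "sup_continuous T u"
  obtains M where "M > 0" "\<And>t. t \<in> {0..T} \<Longrightarrow> AE x in lebesgue. norm (u t x) \<le> M"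
proof -
  have "\<forall>s\<in>{0..T}. \<exists>d>0. \<forall>t\<in>{0..T}. \<bar>t - s\<bar> < d \<longrightarrow> (AE x in lebesgue. norm (u t x - u s x) \<le> 1)"
    using sup_continuousD(2)[OF assms, of _ 1] by simp
  then obtain d where d: "\<And>s. s \<in> {0..T} \<Longrightarrow> d s > 0"
    "\<And>s t. s \<in> {0..T} \<Longrightarrow> t \<in> {0..T} \<Longrightarrow> \<bar>t - s\<bar> < d s \<Longrightarrow> AE x in lebesgue. norm (u t x - u s x) \<le> 1"
    unfolding bchoice_iff by blast
  have "\<forall>s\<in>{0..T}. \<exists>M. AE x in lebesgue. norm (u s x) \<le> M"
    using assms unfolding sup_continuous_def by blast
  then obtain M where M: "\<And>s. s \<in> {0..T} \<Longrightarrow> AE x in lebesgue. norm (u s x) \<le> M s"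
    unfolding bchoice_iff by blast
  have "{0..T} \<subseteq> (\<Union>s\<in>{0..T}. ball s (d s))" using d(1) by force
  then obtain C where C: "C \<subseteq> {0..T}" "finite C" "{0..T} \<subseteq> (\<Union>s\<in>C. ball s (d s))"
    using compactE_image[of "{0..T}" "{0..T}" "\<lambda>s. ball s (d s)"] by auto
  define M' where "M' = (\<Sum>s\<in>C. \<bar>M s\<bar>) + 1"
  show thesis
  proof (rule that[of M'])
    show "M' > 0" by (auto simp: M'_def intro!: add_nonneg_pos sum_nonneg)
    fix t assume t: "t \<in> {0..T}"
    then obtain s where s: "s \<in> C" "\<bar>t - s\<bar> < d s" using C(3) by (fastforce simp: dist_real_def)
    have le: "\<bar>M s\<bar> \<le> (\<Sum>s\<in>C. \<bar>M s\<bar>)" using s C by (intro member_le_sum) auto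
    have "AE x in lebesgue. norm (u t x - u s x) \<le> 1" using d(2) s t C by blast
    moreover have "AE x in lebesgue. norm (u s x) \<le> M s" using M s C by blast
    ultimately show "AE x in lebesgue. norm (u t x) \<le> M'"
    proof eventually_elim
      case (elim x)
      then show ?case using le norm_triangle_sub[of "u t x" "u s x"] by (simp add: M'_def)
    qed
  qed
qed

text \<open>\<open>F\<close> is uniformly continuous on the bounded interval that contains almost all values of \<open>r\<close>.  This recovers
  the density from its power \<open>\<gamma> - 1\<close>.\<close>
lemma sup_continuous_compose:
  fixes r v :: "real \<Rightarrow> real^3 \<Rightarrow> real"
  assumes r: "sup_continuous T r" and F: "continuous_on UNIV F"
    and v: "\<And>t. t \<in> {0..T} \<Longrightarrow> AE x in lebesgue. v t x = F (r t x)"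
  shows "sup_continuous T v"
proof -
  obtain M where M: "M > 0" "\<And>t. t \<in> {0..T} \<Longrightarrow> AE x in lebesgue. norm (r t x) \<le> M"
    using sup_continuous_bound[OF r] by metis
  have Fm: "F \<in> borel_measurable borel" using F by (rule borel_measurable_continuous_onI)
  have c: "continuous_on {-M..M} F" using F continuous_on_subset by blast
  then have uc: "uniformly_continuous_on {-M..M} F" by (rule compact_uniformly_continuous) simp
  have "compact (F ` {-M..M})" by (rule compact_continuous_image[OF c]) simp
  then have "bounded (F ` {-M..M})" by (rule compact_imp_bounded)
  then obtain B where B: "\<forall>y\<in>{-M..M}. norm (F y) \<le> B" unfolding bounded_iff by blast
  show ?thesis unfolding sup_continuous_def
  proof (intro conjI ballI allI impI)
    fix t assume t: "t \<in> {0..T}"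
    have "(\<lambda>x. F (r t x)) \<in> borel_measurable lebesgue"
      by (rule measurable_compose[OF sup_continuousD(1)[OF r t] Fm])
    then show "v t \<in> borel_measurable lebesgue"
      by (rule borel_measurable_AE) (use v[OF t] in eventually_elim, simp)
    have "AE x in lebesgue. norm (v t x) \<le> B"
      using v[OF t] M(2)[OF t]
    proof eventually_elim
      case (elim x)
      then have "r t x \<in> {-M..M}" by auto
      then show ?case using B elim by auto
    qed
    then show "\<exists>M. AE x in lebesgue. norm (v t x) \<le> M" ..
  next
    fix s e :: real assume s: "s \<in> {0..T}" and e: "e > 0"
    obtain \<eta> where \<eta>: "\<eta> > 0" "\<And>y z. y \<in> {-M..M} \<Longrightarrow> z \<in> {-M..M} \<Longrightarrow> dist z y < \<eta> \<Longrightarrow> dist (F z) (F y) < e"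
      using uc e unfolding uniformly_continuous_on_def by metis
    obtain d where d: "d > 0" "\<And>t. t \<in> {0..T} \<Longrightarrow> \<bar>t - s\<bar> < d \<Longrightarrow> AE x in lebesgue. norm (r t x - r s x) \<le> \<eta> / 2"
      using sup_continuousD(2)[OF r s, of "\<eta> / 2"] \<eta>(1) by auto
    show "\<exists>d>0. \<forall>t\<in>{0..T}. \<bar>t - s\<bar> < d \<longrightarrow> (AE x in lebesgue. norm (v t x - v s x) \<le> e)"
    proof (intro exI[of _ d] conjI ballI impI)
      fix t assume t: "t \<in> {0..T}" "\<bar>t - s\<bar> < d"
      show "AE x in lebesgue. norm (v t x - v s x) \<le> e"
        using v[OF t(1)] v[OF s] M(2)[OF t(1)] M(2)[OF s] d(2)[OF t]
      proof eventually_elim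
        case (elim x)
        have "r s x \<in> {-M..M}" "r t x \<in> {-M..M}" "dist (r t x) (r s x) < \<eta>"
          using elim \<eta>(1) by (auto simp: dist_real_def)
        from \<eta>(2)[OF this] show ?case using elim by (simp add: dist_real_def)
      qed
    qed (rule d)
  qed
qed

lemma sup_continuous_mult:
  fixes a b :: "real \<Rightarrow> real^3 \<Rightarrow> real"
  assumes a: "sup_continuous T a" and b: "sup_continuous T b"
  shows "sup_continuous T (\<lambda>t x. a t x * b t x)"
proof -
  obtain M where M: "M > 0" "\<And>t. t \<in> {0..T} \<Longrightarrow> AE x in lebesgue. norm (a t x) \<le> M"
    using sup_continuous_bound[OF a] by metis
  obtain N where N: "N > 0" "\<And>t. t \<in> {0..T} \<Longrightarrow> AE x in lebesgue. norm (b t x) \<le> N"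
    using sup_continuous_bound[OF b] by metis
  show ?thesis unfolding sup_continuous_def
  proof (intro conjI ballI allI impI)
    fix t assume t: "t \<in> {0..T}"
    show "(\<lambda>x. a t x * b t x) \<in> borel_measurable lebesgue"
      using sup_continuousD(1)[OF a t] sup_continuousD(1)[OF b t] by simp
    have "AE x in lebesgue. norm (a t x * b t x) \<le> M * N"
      using M(2)[OF t] N(2)[OF t] by eventually_elim (auto simp: abs_mult intro: mult_mono')
    then show "\<exists>M. AE x in lebesgue. norm (a t x * b t x) \<le> M" ..
  next
    fix s e :: real assume s: "s \<in> {0..T}" and e: "e > 0"
    obtain d1 where d1: "d1 > 0" "\<And>t. t \<in> {0..T} \<Longrightarrow> \<bar>t - s\<bar> < d1 \<Longrightarrow> AE x in lebesgue. norm (a t x - a s x) \<le> e / 2 / N"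
      using sup_continuousD(2)[OF a s, of "e / 2 / N"] e N(1) by auto
    obtain d2 where d2: "d2 > 0" "\<And>t. t \<in> {0..T} \<Longrightarrow> \<bar>t - s\<bar> < d2 \<Longrightarrow> AE x in lebesgue. norm (b t x - b s x) \<le> e / 2 / M"
      using sup_continuousD(2)[OF b s, of "e / 2 / M"] e M(1) by auto
    show "\<exists>d>0. \<forall>t\<in>{0..T}. \<bar>t - s\<bar> < d \<longrightarrow> (AE x in lebesgue. norm (a t x * b t x - a s x * b s x) \<le> e)"
    proof (intro exI[of _ "min d1 d2"] conjI ballI impI)
      fix t assume t: "t \<in> {0..T}" "\<bar>t - s\<bar> < min d1 d2"
      then have t': "\<bar>t - s\<bar> < d1" "\<bar>t - s\<bar> < d2" by auto
      show "AE x in lebesgue. norm (a t x * b t x - a s x * b s x) \<le> e"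
        using M(2)[OF t(1)] N(2)[OF s] d1(2)[OF t(1) t'(1)] d2(2)[OF t(1) t'(2)]
      proof eventually_elim
        case (elim x)
        have "a t x * b t x - a s x * b s x = a t x * (b t x - b s x) + (a t x - a s x) * b s x"
          by (simp add: algebra_simps)
        then have "norm (a t x * b t x - a s x * b s x) \<le> \<bar>a t x\<bar> * \<bar>b t x - b s x\<bar> + \<bar>a t x - a s x\<bar> * \<bar>b s x\<bar>"
          by (metis abs_mult abs_triangle_ineq real_norm_def)
        also have "\<dots> \<le> M * (e / 2 / M) + (e / 2 / N) * N"
          using elim M(1) N(1) e by (intro add_mono mult_mono) auto
        also have "\<dots> = e" using M(1) N(1) by simp
        finally show ?case .
      qed
    qed (use d1 d2 in auto)
  qed
qed

lemma sup_continuous_component: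
  fixes u :: "real \<Rightarrow> real^3 \<Rightarrow> real^3"
  assumes u: "sup_continuous T u"
  shows "sup_continuous T (\<lambda>t x. u t x $ i)"
  unfolding sup_continuous_def
proof (intro conjI ballI allI impI)
  fix t assume t: "t \<in> {0..T}"
  show "(\<lambda>x. u t x $ i) \<in> borel_measurable lebesgue"
    by (rule measurable_compose[OF sup_continuousD(1)[OF u t]])
       (intro borel_measurable_continuous_onI continuous_intros)
  obtain M where "AE x in lebesgue. norm (u t x) \<le> M" using u t unfolding sup_continuous_def by blast
  then have "AE x in lebesgue. norm (u t x $ i) \<le> M"
    by eventually_elim (metis component_le_norm_cart order_trans real_norm_def)
  then show "\<exists>M. AE x in lebesgue. norm (u t x $ i) \<le> M" ..
next
  fix s e :: real assume s: "s \<in> {0..T}" and e: "e > 0"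
  obtain d where d: "d > 0" "\<And>t. t \<in> {0..T} \<Longrightarrow> \<bar>t - s\<bar> < d \<Longrightarrow> AE x in lebesgue. norm (u t x - u s x) \<le> e"
    using sup_continuousD(2)[OF u s e] by auto
  show "\<exists>d>0. \<forall>t\<in>{0..T}. \<bar>t - s\<bar> < d \<longrightarrow> (AE x in lebesgue. norm (u t x $ i - u s x $ i) \<le> e)"
  proof (intro exI[of _ d] conjI ballI impI)
    fix t assume "t \<in> {0..T}" "\<bar>t - s\<bar> < d"
    from d(2)[OF this] show "AE x in lebesgue. norm (u t x $ i - u s x $ i) \<le> e"
      by eventually_elim (metis component_le_norm_cart order_trans real_norm_def vector_minus_component)
  qed (rule d)
qed

lemma sup_continuous_integral:
  fixes v :: "real \<Rightarrow> real^3 \<Rightarrow> real"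
  assumes v: "sup_continuous T v" and X: "integrable lebesgue X"
  shows "\<And>t. t \<in> {0..T} \<Longrightarrow> integrable lebesgue (\<lambda>x. v t x * X x)"
    and "continuous_on {0..T} (\<lambda>t. \<integral>x. v t x * X x \<partial>lebesgue)"
proof -
  obtain M where M: "M > 0" "\<And>t. t \<in> {0..T} \<Longrightarrow> AE x in lebesgue. norm (v t x) \<le> M"
    using sup_continuous_bound[OF v] by metis
  have [measurable]: "X \<in> borel_measurable lebesgue" using X by simp
  show int: "integrable lebesgue (\<lambda>x. v t x * X x)" if t: "t \<in> {0..T}" for t
  proof (rule Bochner_Integration.integrable_bound[OF integrable_mult_right[OF X, of M]])
    show "(\<lambda>x. v t x * X x) \<in> borel_measurable lebesgue" using sup_continuousD(1)[OF v t] by simp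
    show "AE x in lebesgue. norm (v t x * X x) \<le> norm (M * X x)"
      using M(2)[OF t] by eventually_elim (use M(1) in \<open>auto simp: abs_mult intro: mult_right_mono\<close>)
  qed
  define N where "N = (\<integral>x. \<bar>X x\<bar> \<partial>lebesgue) + 1"
  have N: "N > 0" by (auto simp: N_def intro: add_nonneg_pos)
  show "continuous_on {0..T} (\<lambda>t. \<integral>x. v t x * X x \<partial>lebesgue)"
    unfolding continuous_on_iff
  proof (intro ballI allI impI)
    fix s e :: real assume s: "s \<in> {0..T}" and e: "e > 0"
    obtain d where d: "d > 0" "\<And>t. t \<in> {0..T} \<Longrightarrow> \<bar>t - s\<bar> < d \<Longrightarrow> AE x in lebesgue. norm (v t x - v s x) \<le> e / N"
      using sup_continuousD(2)[OF v s, of "e / N"] e N by auto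
    show "\<exists>d>0. \<forall>t\<in>{0..T}. dist t s < d \<longrightarrow> dist (\<integral>x. v t x * X x \<partial>lebesgue) (\<integral>x. v s x * X x \<partial>lebesgue) < e"
    proof (intro exI[of _ d] conjI ballI impI)
      fix t assume t: "t \<in> {0..T}" "dist t s < d"
      have "dist (\<integral>x. v t x * X x \<partial>lebesgue) (\<integral>x. v s x * X x \<partial>lebesgue) = \<bar>\<integral>x. v t x * X x - v s x * X x \<partial>lebesgue\<bar>"
        using int[OF t(1)] int[OF s] by (simp add: dist_real_def)
      also have "\<dots> \<le> (\<integral>x. \<bar>v t x * X x - v s x * X x\<bar> \<partial>lebesgue)"
        by (rule integral_abs_bound)
      also have "\<dots> \<le> (\<integral>x. e / N * \<bar>X x\<bar> \<partial>lebesgue)"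
      proof (rule integral_mono_AE)
        have "AE x in lebesgue. norm (v t x - v s x) \<le> e / N" using d(2)[OF t(1)] t(2) by (simp add: dist_real_def)
        then show "AE x in lebesgue. \<bar>v t x * X x - v s x * X x\<bar> \<le> e / N * \<bar>X x\<bar>"
        proof eventually_elim
          case (elim x)
          have "\<bar>v t x * X x - v s x * X x\<bar> = \<bar>v t x - v s x\<bar> * \<bar>X x\<bar>"
            by (simp only: left_diff_distrib[symmetric] abs_mult)
          also have "\<dots> \<le> e / N * \<bar>X x\<bar>" using elim by (intro mult_right_mono) auto
          finally show ?case .
        qed
      qed (use int[OF t(1)] int[OF s] X in auto)
      also have "\<dots> = e / N * (N - 1)" by (simp add: N_def)
      also have "\<dots> < e" using e N by (simp add: field_simps)
      finally show "dist (\<integral>x. v t x * X x \<partial>lebesgue) (\<integral>x. v s x * X x \<partial>lebesgue) < e" .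
    qed (rule d)
  qed
qed

lemma Lp_less:
  fixes f :: "real^3 \<Rightarrow> 'b::euclidean_space"
  assumes "Lp r f < ennreal \<epsilon>" "r > 0" "\<epsilon> > 0"
  shows "f \<in> borel_measurable lebesgue" "(\<integral>\<^sup>+x. ennreal (norm (f x) powr r) \<partial>lebesgue) \<le> ennreal (\<epsilon> powr r)"
proof -
  have m: "f \<in> borel_measurable lebesgue" and i: "integrable lebesgue (\<lambda>x. norm (f x) powr r)"
    and l: "ennreal ((\<integral>x. norm (f x) powr r \<partial>lebesgue) powr (1 / r)) < ennreal \<epsilon>"
    using assms(1) unfolding Lp_def by (auto split: if_splits)
  show "f \<in> borel_measurable lebesgue" by (rule m)
  have n: "(\<integral>x. norm (f x) powr r \<partial>lebesgue) \<ge> 0" by simp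
  have "(\<integral>x. norm (f x) powr r \<partial>lebesgue) powr (1 / r) < \<epsilon>" using l by (simp add: ennreal_less_iff)
  then have "((\<integral>x. norm (f x) powr r \<partial>lebesgue) powr (1 / r)) powr r \<le> \<epsilon> powr r"
    using assms by (intro powr_mono2) auto
  then have "(\<integral>x. norm (f x) powr r \<partial>lebesgue) \<le> \<epsilon> powr r"
    using assms n by (simp add: powr_powr)
  then show "(\<integral>\<^sup>+x. ennreal (norm (f x) powr r) \<partial>lebesgue) \<le> ennreal (\<epsilon> powr r)"
    using i by (simp add: nn_integral_eq_integral ennreal_leI)
qed

lemma Dkr_less:
  fixes f :: "real^3 \<Rightarrow> 'b::euclidean_space"
  assumes "Dkr k r f < ennreal \<epsilon>" "r > 0" "\<epsilon> > 0" "set vs \<subseteq> Basis" "length vs = k"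
  shows "has_weak_deriv UNIV vs f (wderiv UNIV vs f)"
    and "(\<integral>\<^sup>+x. ennreal (norm (wderiv UNIV vs f x) powr r) \<partial>lebesgue) \<le> ennreal (\<epsilon> powr r)"
proof -
  let ?V = "{vs :: (real^3) list. set vs \<subseteq> Basis \<and> length vs = k}"
  have w: "weakly_diff UNIV vs f" and L: "Lp r (\<lambda>x. L2_set (\<lambda>vs. norm (wderiv UNIV vs f x)) ?V) < ennreal \<epsilon>"
    using assms unfolding Dkr_def by (auto split: if_splits)
  show "has_weak_deriv UNIV vs f (wderiv UNIV vs f)"
    using w unfolding weakly_diff_def wderiv_def by (rule someI_ex)
  have fin: "finite ?V" by (rule finite_lists_length_eq) simp
  have "(\<integral>\<^sup>+x. ennreal (norm (wderiv UNIV vs f x) powr r) \<partial>lebesgue)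
      \<le> (\<integral>\<^sup>+x. ennreal (norm (L2_set (\<lambda>vs. norm (wderiv UNIV vs f x)) ?V) powr r) \<partial>lebesgue)"
  proof (intro nn_integral_mono ennreal_leI powr_mono2)
    fix x
    show "norm (wderiv UNIV vs f x) \<le> norm (L2_set (\<lambda>vs. norm (wderiv UNIV vs f x)) ?V)"
      using member_le_L2_set[OF fin, of vs "\<lambda>vs. norm (wderiv UNIV vs f x)"] assms(4,5) by simp
  qed (use assms in auto)
  also have "\<dots> \<le> ennreal (\<epsilon> powr r)" by (rule Lp_less(2)[OF L assms(2,3)])
  finally show "(\<integral>\<^sup>+x. ennreal (norm (wderiv UNIV vs f x) powr r) \<partial>lebesgue) \<le> ennreal (\<epsilon> powr r)" .
qed

lemma sobolev_norms:
  assumes "p \<ge> (1::real)"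
  shows "\<exists>C>0. \<forall>(f :: real^3 \<Rightarrow> 'b::euclidean_space) \<epsilon>. \<epsilon> > 0 \<longrightarrow>
    (\<integral>\<^sup>+x. ennreal (norm (f x) powr p) \<partial>lebesgue) \<le> ennreal (\<epsilon> powr p) \<longrightarrow> Dk 3 f < ennreal \<epsilon> \<longrightarrow>
    (AE x in lebesgue. norm (f x) \<le> C * \<epsilon>)"
proof -
  obtain C where C: "C > 0" "\<And>(f :: real^3 \<Rightarrow> 'b) D \<epsilon>.
    \<epsilon> > 0 \<Longrightarrow> (\<forall>b\<in>Basis. has_weak_deriv UNIV [b, b, b] f (D b)) \<Longrightarrow>
    (\<integral>\<^sup>+x. ennreal (norm (f x) powr p) \<partial>lebesgue) \<le> ennreal (\<epsilon> powr p) \<Longrightarrow>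
    (\<forall>b\<in>Basis. (\<integral>\<^sup>+x. ennreal (norm (D b x) powr 2) \<partial>lebesgue) \<le> ennreal (\<epsilon> powr 2)) \<Longrightarrow>
    (AE x in lebesgue. norm (f x) \<le> C * \<epsilon>)"
    using sobolev_sup[OF assms, where 'b='b] by blast
  show ?thesis
  proof (intro exI[of _ C] conjI allI impI)
    fix f :: "real^3 \<Rightarrow> 'b" and \<epsilon> :: real
    assume "\<epsilon> > 0" "(\<integral>\<^sup>+x. ennreal (norm (f x) powr p) \<partial>lebesgue) \<le> ennreal (\<epsilon> powr p)" "Dk 3 f < ennreal \<epsilon>"
    then show "AE x in lebesgue. norm (f x) \<le> C * \<epsilon>"
      using Dkr_less[of 3 2 f \<epsilon>] by (intro C(2)[where D="\<lambda>b. wderiv UNIV [b, b, b] f"]) auto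
  qed (rule C)
qed

text \<open>The property of a norm that makes continuity in time with respect to it imply \<open>sup_continuous\<close>.\<close>
definition controls_sup :: "'b::euclidean_space snorm \<Rightarrow> bool" where
  "controls_sup N \<longleftrightarrow> (\<forall>f. N f < \<infinity> \<longrightarrow> f \<in> borel_measurable lebesgue) \<and>
     (\<exists>C>0. \<forall>f \<epsilon>. \<epsilon> > 0 \<longrightarrow> N f < ennreal \<epsilon> \<longrightarrow> (AE x in lebesgue. norm (f x) \<le> C * \<epsilon>))"

lemma ex_ennreal_greater: "x < \<infinity> \<Longrightarrow> \<exists>\<epsilon>>0. x < ennreal \<epsilon>"
proof (cases x)
  case (real r)
  then show ?thesis by (intro exI[of _ "r + 1"]) (auto simp: ennreal_less_iff)
qed auto

lemma controls_sup_D1s_D3: "controls_sup (D1s_D3 :: 'b::euclidean_space snorm)"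
proof -
  obtain C where C: "C > 0" "\<And>(f :: real^3 \<Rightarrow> 'b) \<epsilon>. \<epsilon> > 0 \<Longrightarrow>
    (\<integral>\<^sup>+x. ennreal (norm (f x) powr 6) \<partial>lebesgue) \<le> ennreal (\<epsilon> powr 6) \<Longrightarrow> Dk 3 f < ennreal \<epsilon> \<Longrightarrow>
    (AE x in lebesgue. norm (f x) \<le> C * \<epsilon>)"
    using sobolev_norms[of 6, where 'b='b] by auto
  have le: "Lp 6 f \<le> D1s_D3 f" "Dk 3 f \<le> D1s_D3 f" for f :: "real^3 \<Rightarrow> 'b"
    by (auto simp: D1s_D3_def D1s_def add.assoc intro: add_increasing add_increasing2)
  show ?thesis unfolding controls_sup_def
  proof (intro conjI allI impI exI[of _ C])
    fix f :: "real^3 \<Rightarrow> 'b" and \<epsilon> :: real assume \<epsilon>: "\<epsilon> > 0" "D1s_D3 f < ennreal \<epsilon>"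
    have "Lp 6 f < ennreal \<epsilon>" "Dk 3 f < ennreal \<epsilon>" using le \<epsilon>(2) by (auto intro: le_less_trans)
    then show "AE x in lebesgue. norm (f x) \<le> C * \<epsilon>" using Lp_less(2)[of 6 f \<epsilon>] \<epsilon> by (intro C(2)) auto
  next
    fix f :: "real^3 \<Rightarrow> 'b" assume "D1s_D3 f < \<infinity>"
    then obtain \<epsilon> where "\<epsilon> > 0" "D1s_D3 f < ennreal \<epsilon>" using ex_ennreal_greater by blast
    then show "f \<in> borel_measurable lebesgue" using le[of f] Lp_less(1)[of 6 f \<epsilon>] by (auto intro: le_less_trans)
  qed (rule C)
qed

lemma controls_sup_Hs3: "controls_sup (Hs 3 :: 'b::euclidean_space snorm)"
proof -
  obtain C where C: "C > 0" "\<And>(f :: real^3 \<Rightarrow> 'b) \<epsilon>. \<epsilon> > 0 \<Longrightarrow>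
    (\<integral>\<^sup>+x. ennreal (norm (f x) powr 2) \<partial>lebesgue) \<le> ennreal (\<epsilon> powr 2) \<Longrightarrow> Dk 3 f < ennreal \<epsilon> \<Longrightarrow>
    (AE x in lebesgue. norm (f x) \<le> C * \<epsilon>)"
    using sobolev_norms[of 2, where 'b='b] by auto
  have le: "Dk k f \<le> Hs 3 f" if "k \<le> 3" for k and f :: "real^3 \<Rightarrow> 'b"
    unfolding Hs_def using that by (intro member_le_sum) auto
  show ?thesis unfolding controls_sup_def
  proof (intro conjI allI impI exI[of _ C])
    fix f :: "real^3 \<Rightarrow> 'b" and \<epsilon> :: real assume \<epsilon>: "\<epsilon> > 0" "Hs 3 f < ennreal \<epsilon>"
    have D: "Dk 0 f < ennreal \<epsilon>" "Dk 3 f < ennreal \<epsilon>" using le[of 0 f] le[of 3 f] \<epsilon>(2) by (auto intro: le_less_trans)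
    note w = Dkr_less[OF D(1) _ \<epsilon>(1), of "[]"]
    have "has_weak_deriv UNIV [] f f" using w(1) by (auto simp: has_weak_deriv_def)
    then have "AE x in lebesgue. x \<in> UNIV \<longrightarrow> f x = wderiv UNIV [] f x"
      using w(1) by (intro weak_deriv_unique) auto
    then have "AE x in lebesgue. ennreal (norm (f x) powr 2) = ennreal (norm (wderiv UNIV [] f x) powr 2)"
      by eventually_elim simp
    then have "(\<integral>\<^sup>+x. ennreal (norm (f x) powr 2) \<partial>lebesgue) = (\<integral>\<^sup>+x. ennreal (norm (wderiv UNIV [] f x) powr 2) \<partial>lebesgue)"
      by (rule nn_integral_cong_AE)
    then show "AE x in lebesgue. norm (f x) \<le> C * \<epsilon>" using w(2) \<epsilon> D by (intro C(2)) auto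
  next
    fix f :: "real^3 \<Rightarrow> 'b" assume "Hs 3 f < \<infinity>"
    then obtain \<epsilon> where \<epsilon>: "\<epsilon> > 0" "Hs 3 f < ennreal \<epsilon>" using ex_ennreal_greater by blast
    then have "Dk 0 f < ennreal \<epsilon>" using le[of 0 f] by (auto intro: le_less_trans)
    from Dkr_less(1)[OF this _ \<epsilon>(1), of "[]"] have "loc_int UNIV f" by (auto simp: has_weak_deriv_def)
    then show "f \<in> borel_measurable lebesgue" by (rule loc_int_measurable)
  qed (rule C)
qed

lemma C_in_imp_sup_continuous:
  assumes N: "controls_sup N" and u: "C_in T N u"
  shows "sup_continuous T u"
proof -
  obtain C where C: "C > 0" "\<And>f \<epsilon>. \<epsilon> > 0 \<Longrightarrow> N f < ennreal \<epsilon> \<Longrightarrow> AE x in lebesgue. norm (f x) \<le> C * \<epsilon>"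
    and m: "\<And>f. N f < \<infinity> \<Longrightarrow> f \<in> borel_measurable lebesgue"
    using N unfolding controls_sup_def by blast
  show ?thesis unfolding sup_continuous_def
  proof (intro conjI ballI allI impI)
    fix t assume "t \<in> {0..T}"
    then have f: "N (u t) < \<infinity>" using u by (auto simp: C_in_def)
    show "u t \<in> borel_measurable lebesgue" by (rule m[OF f])
    show "\<exists>M. AE x in lebesgue. norm (u t x) \<le> M" using ex_ennreal_greater[OF f] C(2) by blast
  next
    fix s e :: real assume s: "s \<in> {0..T}" and e: "e > 0"
    have "((\<lambda>t. N (\<lambda>x. u t x - u s x)) \<longlongrightarrow> 0) (at s within {0..T})" using u s by (auto simp: C_in_def)
    moreover have "ennreal (e / C) > 0" using e C by simp
    ultimately have "eventually (\<lambda>t. N (\<lambda>x. u t x - u s x) < ennreal (e / C)) (at s within {0..T})"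
      by (rule order_tendstoD)
    then obtain d where d: "d > 0" "\<And>t. t \<in> {0..T} \<Longrightarrow> t \<noteq> s \<Longrightarrow> dist t s < d \<Longrightarrow> N (\<lambda>x. u t x - u s x) < ennreal (e / C)"
      unfolding eventually_at by blast
    show "\<exists>d>0. \<forall>t\<in>{0..T}. \<bar>t - s\<bar> < d \<longrightarrow> (AE x in lebesgue. norm (u t x - u s x) \<le> e)"
    proof (intro exI[of _ d] conjI ballI impI)
      fix t assume t: "t \<in> {0..T}" "\<bar>t - s\<bar> < d"
      show "AE x in lebesgue. norm (u t x - u s x) \<le> e"
      proof (cases "t = s")
        case True
        then show ?thesis using e by simp
      next
        case False
        then show ?thesis using C(2)[of "e / C" "\<lambda>x. u t x - u s x"] d(2) t e C(1) by (auto simp: dist_real_def)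
      qed
    qed (rule d)
  qed
qed

section \<open>From a weak bound on the time derivative to a Lipschitz bound\<close>

lemma step_deriv_props:
  "smooth (deriv step)" "s \<notin> {0..1} \<Longrightarrow> deriv step s = 0"
  "integrable lborel (deriv step)" "(\<integral>s. deriv step s \<partial>lborel) = 1"
proof -
  show sm: "smooth (deriv step)" by (rule smooth_deriv[OF smooth_step])
  show z: "s \<notin> {0..1} \<Longrightarrow> deriv step s = 0" for s
  proof -
    assume "s \<notin> {0..1}"
    then consider "s < 0" | "s > 1" by fastforce
    then show "deriv step s = 0"
    proof cases
      case 1
      then show ?thesis by (intro deriv_eq_0_open[of "{..<0}" _ _ 0]) (auto simp: step_eq_0)
    next
      case 2
      then show ?thesis by (intro deriv_eq_0_open[of "{1<..}" _ _ 1]) (auto simp: step_eq_1)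
    qed
  qed
  show "integrable lborel (deriv step)" by (rule integrable_of_support[OF sm z])
  have "(\<integral>s. indicator {0..1} s *\<^sub>R deriv step s \<partial>lborel) = step 1 - step 0"
    by (rule integral_FTC_atLeastAtMost)
       (auto intro!: smooth_continuous sm simp flip: has_real_derivative_iff_has_vector_derivative
         intro: has_field_derivative_at_within smooth_has_deriv smooth_step)
  also have "(\<lambda>s. indicator {0..1} s *\<^sub>R deriv step s) = deriv step"
    by (rule ext, subst indicator_def) (use z in auto)
  finally show "(\<integral>s. deriv step s \<partial>lborel) = 1" by (simp add: step_eq_0 step_eq_1)
qed

text \<open>The weights form an approximate identity at \<open>s\<close> which is supported to the right of \<open>s\<close>.\<close>
lemma step_average_tendsto:
  fixes F :: "real \<Rightarrow> real"
  assumes F: "continuous_on UNIV F"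
  shows "(\<lambda>n. \<integral>\<sigma>. F \<sigma> * (real (Suc n) * deriv step (real (Suc n) * (\<sigma> - s))) \<partial>lborel) \<longlonglongrightarrow> F s"
proof -
  have Fm [measurable]: "F \<in> borel_measurable borel" using F by (rule borel_measurable_continuous_onI)
  have sm [measurable]: "deriv step \<in> borel_measurable borel" by (rule smooth_measurable[OF step_deriv_props(1)])
  have eq: "(\<integral>\<sigma>. F \<sigma> * (real (Suc n) * deriv step (real (Suc n) * (\<sigma> - s))) \<partial>lborel)
      = (\<integral>y. F (s + y / real (Suc n)) * deriv step y \<partial>lborel)" for n
  proof -
    have "(\<integral>y. F (s + y / real (Suc n)) * deriv step y \<partial>lborel)
       = \<bar>real (Suc n)\<bar> *\<^sub>R (\<integral>\<sigma>. F (s + ((- real (Suc n) * s) + real (Suc n) * \<sigma>) / real (Suc n))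
            * deriv step ((- real (Suc n) * s) + real (Suc n) * \<sigma>) \<partial>lborel)"
      by (rule lborel_integral_real_affine) simp
    also have "\<dots> = (\<integral>\<sigma>. real (Suc n) * (F (s + ((- real (Suc n) * s) + real (Suc n) * \<sigma>) / real (Suc n))
            * deriv step ((- real (Suc n) * s) + real (Suc n) * \<sigma>)) \<partial>lborel)"
      by simp
    also have "\<dots> = (\<integral>\<sigma>. F \<sigma> * (real (Suc n) * deriv step (real (Suc n) * (\<sigma> - s))) \<partial>lborel)"
    proof (rule Bochner_Integration.integral_cong[OF refl])
      fix \<sigma>
      have "s + ((- real (Suc n) * s) + real (Suc n) * \<sigma>) / real (Suc n) = \<sigma>"
        by (simp add: diff_divide_distrib add_divide_distrib del: of_nat_Suc)
      moreover have "(- real (Suc n) * s) + real (Suc n) * \<sigma> = real (Suc n) * (\<sigma> - s)" by (simp only: right_diff_distrib)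
      ultimately show "real (Suc n) * (F (s + ((- real (Suc n) * s) + real (Suc n) * \<sigma>) / real (Suc n))
            * deriv step ((- real (Suc n) * s) + real (Suc n) * \<sigma>)) = F \<sigma> * (real (Suc n) * deriv step (real (Suc n) * (\<sigma> - s)))"
        by (simp only: mult_ac)
    qed
    finally show ?thesis by (rule sym)
  qed
  have "compact (F ` {s..s+1})" by (rule compact_continuous_image) (auto intro: continuous_on_subset[OF F])
  then have "bounded (F ` {s..s+1})" by (rule compact_imp_bounded)
  then obtain B where B: "\<forall>y\<in>{s..s+1}. \<bar>F y\<bar> \<le> B" unfolding bounded_iff real_norm_def by blast
  have "(\<lambda>n. \<integral>y. F (s + y / real (Suc n)) * deriv step y \<partial>lborel) \<longlonglongrightarrow> (\<integral>y. F s * deriv step y \<partial>lborel)"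
  proof (rule integral_dominated_convergence[where w="\<lambda>y. B * \<bar>deriv step y\<bar>"])
    show "integrable lborel (\<lambda>y. B * \<bar>deriv step y\<bar>)" using step_deriv_props(3) by simp
    show "AE y in lborel. (\<lambda>n. F (s + y / real (Suc n)) * deriv step y) \<longlonglongrightarrow> F s * deriv step y"
    proof (intro AE_I2 tendsto_mult_right)
      fix y :: real
      have "(\<lambda>n. s + y * (1 / real (Suc n))) \<longlonglongrightarrow> s + y * 0"
        by (intro tendsto_intros LIMSEQ_Suc lim_1_over_n)
      then have "(\<lambda>n. s + y / real (Suc n)) \<longlonglongrightarrow> s" by simp
      moreover have "isCont F s" using F by (simp add: continuous_on_eq_continuous_at)
      ultimately show "(\<lambda>n. F (s + y / real (Suc n))) \<longlonglongrightarrow> F s" by (rule isCont_tendsto_compose[rotated])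
    qed
    show "AE y in lborel. norm (F (s + y / real (Suc n)) * deriv step y) \<le> B * \<bar>deriv step y\<bar>" for n
    proof (intro AE_I2)
      fix y :: real
      show "norm (F (s + y / real (Suc n)) * deriv step y) \<le> B * \<bar>deriv step y\<bar>"
      proof (cases "y \<in> {0..1}")
        case True
        then have "y / real (Suc n) \<le> 1" by (simp add: divide_le_eq)
        then have "s + y / real (Suc n) \<in> {s..s+1}" using True by simp
        then show ?thesis using B by (auto simp: abs_mult intro: mult_right_mono)
      qed (simp add: step_deriv_props(2))
    qed
  qed measurable
  then show ?thesis unfolding eq by (simp add: step_deriv_props)
qed

text \<open>Smooth approximations of the indicator function of the interval between \<open>s\<close> and \<open>t\<close> have integral close to
  \<open>t - s\<close>, and their derivatives approximate the difference of the point masses at \<open>s\<close> and \<open>t\<close>.\<close>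
lemma time_lipschitz:
  fixes F :: "real \<Rightarrow> real"
  assumes F: "continuous_on {0..T} F" and T: "T > 0" and B: "B \<ge> 0"
    and bound: "\<And>\<tau> a b. smooth \<tau> \<Longrightarrow> 0 < a \<Longrightarrow> b < T \<Longrightarrow> (\<And>s. s \<notin> {a..b} \<Longrightarrow> \<tau> s = 0) \<Longrightarrow>
      \<bar>\<integral>s. F s * deriv \<tau> s \<partial>lebesgue\<bar> \<le> B * (\<integral>s. \<bar>\<tau> s\<bar> \<partial>lborel)"
    and st: "s \<in> {0..T}" "t \<in> {0..T}"
  shows "\<bar>F t - F s\<bar> \<le> B * \<bar>t - s\<bar>"
proof -
  \<comment> \<open>Only the values of \<open>F\<close> on \<open>{0..T}\<close> matter; the constant extension is continuous on the whole line.\<close>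
  define G where "G \<sigma> = F (max 0 (min T \<sigma>))" for \<sigma>
  have G: "continuous_on UNIV G" unfolding G_def
    by (rule continuous_on_compose2[OF F]) (use T in \<open>auto intro!: continuous_intros\<close>)
  have GF: "G \<sigma> = F \<sigma>" if "\<sigma> \<in> {0..T}" for \<sigma> using that by (auto simp: G_def)
  have Gm [measurable]: "G \<in> borel_measurable borel" using G by (rule borel_measurable_continuous_onI)
  have main: "\<bar>F t - F s\<bar> \<le> B * (t - s)" if "0 < s" "s < t" "t < T" for s t
  proof -
    define \<tau> where "\<tau> n \<sigma> = step (real (Suc n) * (\<sigma> - s)) - step (real (Suc n) * (\<sigma> - t))" for n \<sigma>
    have sm: "smooth (\<lambda>\<sigma>. step (real (Suc n) * (\<sigma> - s)))" for n s
    proof -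
      have "(\<lambda>\<sigma>. step (real (Suc n) * (\<sigma> - s))) = (\<lambda>\<sigma>. step (real (Suc n) * \<sigma> + - (real (Suc n) * s)))"
        by (simp add: algebra_simps del: of_nat_Suc)
      moreover have "smooth (\<lambda>\<sigma>. step (real (Suc n) * \<sigma> + - (real (Suc n) * s)))"
        by (rule smooth_affine[OF smooth_step])
      ultimately show ?thesis by (simp only:)
    qed
    have D: "((\<lambda>\<sigma>. step (real (Suc n) * (\<sigma> - s))) has_real_derivative
        real (Suc n) * deriv step (real (Suc n) * (\<sigma> - s))) (at \<sigma>)" for n s \<sigma>
    proof -
      have "((\<lambda>\<sigma>. real (Suc n) * (\<sigma> - s)) has_real_derivative real (Suc n)) (at \<sigma>)"
        by (auto intro!: derivative_eq_intros)
      from smooth_DERIV_chain[OF smooth_step this] show ?thesis by (simp only: mult.commute)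
    qed
    have d\<tau>: "deriv (\<tau> n) \<sigma> = real (Suc n) * deriv step (real (Suc n) * (\<sigma> - s))
        - real (Suc n) * deriv step (real (Suc n) * (\<sigma> - t))" for n \<sigma>
      unfolding \<tau>_def by (rule DERIV_imp_deriv[OF DERIV_diff[OF D D]])
    have z: "\<tau> n \<sigma> = 0" if out: "\<sigma> \<notin> {s..t + 1 / real (Suc n)}" for n \<sigma>
    proof -
      consider "\<sigma> < s" | "\<sigma> > t + 1 / real (Suc n)" using out by (auto simp: not_le simp del: of_nat_Suc)
      then show ?thesis
      proof cases
        case 1
        then have "real (Suc n) * (\<sigma> - s) \<le> 0" "real (Suc n) * (\<sigma> - t) \<le> 0"
          using \<open>s < t\<close> by (auto intro: mult_nonneg_nonpos simp del: of_nat_Suc)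
        then show ?thesis by (simp only: \<tau>_def step_eq_0)
      next
        case 2
        then have "1 \<le> real (Suc n) * (\<sigma> - t)" by (simp add: field_simps del: of_nat_Suc)
        moreover have "real (Suc n) * (\<sigma> - t) \<le> real (Suc n) * (\<sigma> - s)" using \<open>s < t\<close> by (intro mult_left_mono) auto
        ultimately show ?thesis by (simp only: \<tau>_def step_eq_1)
      qed
    qed
    have sm\<tau>: "smooth (\<tau> n)" for n unfolding \<tau>_def by (intro smooth_diff sm)
    have ev: "eventually (\<lambda>n. \<bar>(\<integral>\<sigma>. G \<sigma> * (real (Suc n) * deriv step (real (Suc n) * (\<sigma> - s))) \<partial>lborel)
          - (\<integral>\<sigma>. G \<sigma> * (real (Suc n) * deriv step (real (Suc n) * (\<sigma> - t))) \<partial>lborel)\<bar> \<le> B * (t - s + 1 / real (Suc n))) sequentially"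
    proof -
      have "(\<lambda>n. t + 1 / real (Suc n)) \<longlonglongrightarrow> t + 0" by (intro tendsto_intros LIMSEQ_Suc lim_1_over_n)
      then have "eventually (\<lambda>n. t + 1 / real (Suc n) < T) sequentially"
        using \<open>t < T\<close> by (intro order_tendstoD) auto
      then show ?thesis
      proof eventually_elim
        case (elim n)
        have int: "integrable lborel (\<lambda>\<sigma>. G \<sigma> * (real (Suc n) * deriv step (real (Suc n) * (\<sigma> - s))))" for s
        proof -
          have c: "continuous_on {s..s+1} (\<lambda>\<sigma>. G \<sigma> * (real (Suc n) * deriv step (real (Suc n) * (\<sigma> - s))))"
            by (intro continuous_intros continuous_on_subset[OF G] continuous_on_compose2[OF smooth_continuous[OF step_deriv_props(1), of UNIV]]) auto
          have "integrable lborel (\<lambda>\<sigma>. indicator {s..s+1} \<sigma> *\<^sub>R (G \<sigma> * (real (Suc n) * deriv step (real (Suc n) * (\<sigma> - s)))))"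
            using borel_integrable_atLeastAtMost'[OF c] by (simp add: set_integrable_def)
          also have "(\<lambda>\<sigma>. indicator {s..s+1} \<sigma> *\<^sub>R (G \<sigma> * (real (Suc n) * deriv step (real (Suc n) * (\<sigma> - s)))))
              = (\<lambda>\<sigma>. G \<sigma> * (real (Suc n) * deriv step (real (Suc n) * (\<sigma> - s))))"
          proof
            fix \<sigma>
            have "real (Suc n) * (\<sigma> - s) \<notin> {0..1}" if "\<sigma> \<notin> {s..s+1}"
            proof
              assume a: "real (Suc n) * (\<sigma> - s) \<in> {0..1}"
              then have "0 \<le> \<sigma> - s" by (simp add: zero_le_mult_iff del: of_nat_Suc)
              moreover from this have "1 * (\<sigma> - s) \<le> real (Suc n) * (\<sigma> - s)" by (intro mult_right_mono) auto
              ultimately show False using a that by simp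
            qed
            then show "indicator {s..s+1} \<sigma> *\<^sub>R (G \<sigma> * (real (Suc n) * deriv step (real (Suc n) * (\<sigma> - s))))
              = G \<sigma> * (real (Suc n) * deriv step (real (Suc n) * (\<sigma> - s)))"
              by (cases "\<sigma> \<in> {s..s+1}") (auto simp: step_deriv_props(2) simp del: of_nat_Suc)
          qed
          finally show ?thesis .
        qed
        have dz: "deriv (\<tau> n) \<sigma> = 0" if "\<sigma> \<notin> {s..t + 1 / real (Suc n)}" for \<sigma>
          by (rule deriv_zero_outside[OF z that])
        have "(\<integral>\<sigma>. G \<sigma> * (real (Suc n) * deriv step (real (Suc n) * (\<sigma> - s))) \<partial>lborel)
          - (\<integral>\<sigma>. G \<sigma> * (real (Suc n) * deriv step (real (Suc n) * (\<sigma> - t))) \<partial>lborel) = (\<integral>\<sigma>. G \<sigma> * deriv (\<tau> n) \<sigma> \<partial>lborel)"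
          by (subst Bochner_Integration.integral_diff[symmetric, OF int int]) (simp only: d\<tau> right_diff_distrib)
        also have "\<dots> = (\<integral>\<sigma>. G \<sigma> * deriv (\<tau> n) \<sigma> \<partial>lebesgue)"
          using smooth_measurable[OF smooth_deriv[OF sm\<tau>[of n]]] by (intro integral_completion[symmetric]) simp
        also have "\<dots> = (\<integral>\<sigma>. F \<sigma> * deriv (\<tau> n) \<sigma> \<partial>lebesgue)"
        proof (rule Bochner_Integration.integral_cong[OF refl])
          fix \<sigma>
          show "G \<sigma> * deriv (\<tau> n) \<sigma> = F \<sigma> * deriv (\<tau> n) \<sigma>"
            using GF[of \<sigma>] dz[of \<sigma>] elim \<open>0 < s\<close> by (cases "\<sigma> \<in> {s..t + 1 / real (Suc n)}") auto
        qed
        also have "\<bar>\<dots>\<bar> \<le> B * (\<integral>\<sigma>. \<bar>\<tau> n \<sigma>\<bar> \<partial>lborel)"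
          by (rule bound[OF sm\<tau> \<open>0 < s\<close> elim z])
        also have "\<dots> \<le> B * (t - s + 1 / real (Suc n))"
        proof (rule mult_left_mono[OF _ B])
          have "(\<integral>\<sigma>. \<bar>\<tau> n \<sigma>\<bar> \<partial>lborel) \<le> (\<integral>\<sigma>. indicator {s..t + 1 / real (Suc n)} \<sigma> \<partial>lborel)"
          proof (rule integral_mono)
            show "integrable lborel (\<lambda>\<sigma>. \<bar>\<tau> n \<sigma>\<bar>)" by (rule integrable_abs[OF integrable_of_support[OF sm\<tau> z]])
            show "integrable lborel (indicat_real {s..t + 1 / real (Suc n)})" by (rule integrable_real_indicator) (simp_all add: emeasure_lborel_Icc_eq)
            fix \<sigma>
            have "\<bar>\<tau> n \<sigma>\<bar> \<le> 1"
              using step_ge_0[of "real (Suc n) * (\<sigma> - s)"] step_le_1[of "real (Suc n) * (\<sigma> - s)"]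
                step_ge_0[of "real (Suc n) * (\<sigma> - t)"] step_le_1[of "real (Suc n) * (\<sigma> - t)"]
              unfolding \<tau>_def by linarith
            then show "\<bar>\<tau> n \<sigma>\<bar> \<le> indicator {s..t + 1 / real (Suc n)} \<sigma>"
              using z[of \<sigma> n] by (cases "\<sigma> \<in> {s..t + 1 / real (Suc n)}") auto
          qed
          also have "\<dots> = t - s + 1 / real (Suc n)" using \<open>s < t\<close> by (simp add: add_increasing2 less_imp_le)
          finally show "(\<integral>\<sigma>. \<bar>\<tau> n \<sigma>\<bar> \<partial>lborel) \<le> t - s + 1 / real (Suc n)" .
        qed
        finally show ?case .
      qed
    qed
    have l1: "(\<lambda>n. \<bar>(\<integral>\<sigma>. G \<sigma> * (real (Suc n) * deriv step (real (Suc n) * (\<sigma> - s))) \<partial>lborel)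
          - (\<integral>\<sigma>. G \<sigma> * (real (Suc n) * deriv step (real (Suc n) * (\<sigma> - t))) \<partial>lborel)\<bar>) \<longlonglongrightarrow> \<bar>G s - G t\<bar>"
      by (intro tendsto_intros step_average_tendsto G)
    have l2: "(\<lambda>n. B * (t - s + 1 / real (Suc n))) \<longlonglongrightarrow> B * (t - s + 0)"
      by (intro tendsto_intros LIMSEQ_Suc lim_1_over_n)
    have "\<bar>G s - G t\<bar> \<le> B * (t - s + 0)"
      by (rule tendsto_le[OF sequentially_bot l2 l1 ev])
    then show ?thesis using GF that by (simp add: abs_minus_commute)
  qed
  \<comment> \<open>The endpoints of the time interval, which test functions do not reach, follow by continuity.\<close>
  have le: "\<bar>F t - F s\<bar> \<le> B * (t - s)" if "0 \<le> s" "s < t" "t \<le> T" for s t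
  proof -
    define q where "q n = (t - s) / 3 * (1 / real (Suc n))" for n
    define a where "a n = s + q n" for n
    define b where "b n = t - q n" for n
    have q: "0 < q n" "q n \<le> (t - s) / 3" for n
      using that mult_left_mono[of "1 / real (Suc n)" 1 "(t - s) / 3"] by (auto simp: q_def divide_le_eq)
    have "q \<longlonglongrightarrow> (t - s) / 3 * 0"
      unfolding q_def[abs_def] by (intro tendsto_intros LIMSEQ_Suc lim_1_over_n)
    then have a: "a \<longlonglongrightarrow> s + 0" and b: "b \<longlonglongrightarrow> t - 0"
      unfolding a_def[abs_def] b_def[abs_def] by (auto intro!: tendsto_eq_intros)
    have "(\<lambda>n. \<bar>G (b n) - G (a n)\<bar>) \<longlonglongrightarrow> \<bar>G t - G s\<bar>"
      using a b by (intro tendsto_intros continuous_on_tendsto_compose[OF G]) auto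
    moreover have "(\<lambda>n. B * (b n - a n)) \<longlonglongrightarrow> B * (t - s)" using a b by (auto intro!: tendsto_intros)
    moreover have "\<bar>G (b n) - G (a n)\<bar> \<le> B * (b n - a n)" for n
    proof -
      have "3 * q n \<le> t - s" using q(2)[of n] by simp
      then have "0 < a n" "a n < b n" "b n < T"
        using q(1)[of n] that unfolding a_def b_def by simp_all
      then show ?thesis using main[of "a n" "b n"] GF by auto
    qed
    ultimately have "\<bar>G t - G s\<bar> \<le> B * (t - s)" by (intro LIMSEQ_le) auto
    then show ?thesis using GF that by auto
  qed
  show ?thesis using le[of s t] le[of t s] st by (cases s t rule: linorder_cases) (auto simp: abs_minus_commute)
qed

section \<open>Multiplying a divergence-free field by a Sobolev function\<close>

lemma integral_kernel_integrable:
  fixes a :: "'a::euclidean_space \<Rightarrow> real" and b :: "'b::euclidean_space \<Rightarrow> real"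
    and k :: "'b \<times> 'a \<Rightarrow> real"
  assumes a: "integrable lebesgue a" and b: "integrable lebesgue b"
    and k: "k \<in> borel_measurable borel" and kB: "\<And>z. \<bar>k z\<bar> \<le> B"
  shows "integrable lebesgue (\<lambda>z. b z * (\<integral>w. k (z, w) * a w \<partial>lebesgue))"
proof -
  obtain a' where a' [measurable]: "a' \<in> borel_measurable borel" and ia: "integrable lborel a'"
    and ea: "AE x in lborel. a x = a' x" and ea': "AE x in lebesgue. a x = a' x"
    using lebesgue_borel_rep_integrable[OF a] by blast
  have am: "a \<in> borel_measurable lebesgue" using a by auto
  have [measurable]: "k \<in> borel_measurable (borel \<Otimes>\<^sub>M borel)" using k by (simp add: borel_prod)
  have kz: "(\<lambda>w. k (z, w)) \<in> borel_measurable lebesgue" for z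
    by (rule measurable_completion, measurable)
  have 2: "(\<integral>w. k (z, w) * a w \<partial>lebesgue) = (\<integral>w. k (z, w) * a' w \<partial>lborel)" for z
    by (rule lebesgue_integral_cong_AE_borel) (use ea am kz in \<open>auto\<close>)
  have m2: "(\<lambda>z. \<integral>w. k (z, w) * a' w \<partial>lborel) \<in> borel_measurable borel"
  proof -
    have "(\<lambda>(z, w). k (z, w) * a' w) \<in> borel_measurable (borel \<Otimes>\<^sub>M borel)" by measurable
    then show ?thesis
      using lborel.borel_measurable_lebesgue_integral[of "\<lambda>z w. k (z, w) * a' w" borel] by simp
  qed
  have B0: "B \<ge> 0" using kB[of undefined] by linarith
  have le: "\<bar>\<integral>w. k (z, w) * a' w \<partial>lborel\<bar> \<le> B * (\<integral>w. \<bar>a' w\<bar> \<partial>lborel)" for z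
  proof -
    have i: "integrable lborel (\<lambda>w. k (z, w) * a' w)"
      by (rule Bochner_Integration.integrable_bound[OF integrable_mult_right[OF ia, of B]])
         (use kB B0 in \<open>auto simp: abs_mult intro!: AE_I2 mult_right_mono\<close>)
    have "\<bar>\<integral>w. k (z, w) * a' w \<partial>lborel\<bar> \<le> (\<integral>w. \<bar>k (z, w) * a' w\<bar> \<partial>lborel)" by (rule integral_abs_bound)
    also have "\<dots> \<le> (\<integral>w. B * \<bar>a' w\<bar> \<partial>lborel)"
    proof (rule integral_mono)
      show "integrable lborel (\<lambda>w. \<bar>k (z, w) * a' w\<bar>)" by (rule integrable_abs[OF i])
      show "integrable lborel (\<lambda>w. B * \<bar>a' w\<bar>)" by (rule integrable_mult_right[OF integrable_abs[OF ia]])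
      show "\<bar>k (z, w) * a' w\<bar> \<le> B * \<bar>a' w\<bar>" for w unfolding abs_mult by (rule mult_right_mono[OF kB]) simp
    qed
    finally show ?thesis by simp
  qed
  show ?thesis unfolding 2
  proof (rule Bochner_Integration.integrable_bound[OF integrable_mult_left[OF b, of "B * (\<integral>w. \<bar>a' w\<bar> \<partial>lborel)"]])
    have "(\<lambda>z. \<integral>w. k (z, w) * a' w \<partial>lborel) \<in> borel_measurable lebesgue"
      by (rule measurable_completion) (use m2 in simp)
    then show "(\<lambda>z. b z * (\<integral>w. k (z, w) * a' w \<partial>lborel)) \<in> borel_measurable lebesgue" using b by simp
    have "0 \<le> B * (\<integral>w. \<bar>a' w\<bar> \<partial>lborel)" using B0 by simp
    then show "AE z in lebesgue. norm (b z * (\<integral>w. k (z, w) * a' w \<partial>lborel)) \<le> norm (b z * (B * (\<integral>w. \<bar>a' w\<bar> \<partial>lborel)))"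
      by (intro AE_I2) (simp only: real_norm_def abs_mult[of "b _"], rule mult_left_mono[OF order_trans[OF le abs_ge_self]], simp)
  qed
qed

text \<open>The derivative of the mollifier in its first argument, in direction \<open>e\<close>.\<close>
definition K' :: "nat \<Rightarrow> 'a::euclidean_space \<Rightarrow> 'a \<times> 'a \<Rightarrow> real" where
  "K' n e z = tens ((\<lambda>b. mollN n)(e := deriv (mollN n))) (fst z - snd z)"

lemma K'_measurable: "K' n e \<in> borel_measurable borel"
proof -
  have "tens ((\<lambda>b. mollN n)(e := deriv (mollN n))) \<in> borel_measurable (borel :: 'a measure)"
    by (rule tens_measurable) (simp add: smooth_mollN smooth_deriv)
  moreover have "(\<lambda>z::'a \<times> 'a. fst z - snd z) \<in> borel_measurable borel"
    by (intro borel_measurable_continuous_onI continuous_intros)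
  ultimately show ?thesis unfolding K'_def by (rule measurable_compose[rotated])
qed

lemma K'_bound: obtains B where "\<And>z. \<bar>K' n e z\<bar> \<le> B"
proof -
  obtain B1 where B1: "\<And>s. \<bar>mollN n s\<bar> \<le> 2 ^ n * B1" using mollN_bound by metis
  obtain B2 where B2: "\<And>s. \<bar>deriv (mollN n) s\<bar> \<le> B2"
    using bounded_of_support[of "deriv (mollN n)" 0 "2 / 2 ^ n", OF smooth_deriv[OF smooth_mollN]]
      deriv_zero_outside[of 0 "2 / 2 ^ n" "mollN n", OF mollN_eq_0] by metis
  show thesis
  proof
    show "\<bar>K' n e z\<bar> \<le> (\<Prod>b\<in>Basis. if b = e then B2 else 2 ^ n * B1)" for z
      unfolding K'_def by (rule abs_tens_le) (use B1 B2 in auto)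
  qed
qed

lemma K'_zero_outside:
  assumes "y \<notin> cbox (z - corner n) z"
  shows "K' n e (z, y) = 0"
  unfolding K'_def
proof (rule tens_zero_outside[of 0 "corner n"])
  have "y \<in> cbox (z - corner n) z" if "z - y \<in> cbox 0 (corner n)"
    unfolding mem_box
  proof
    fix i :: 'a assume "i \<in> Basis"
    then have "0 \<le> z \<bullet> i - y \<bullet> i \<and> z \<bullet> i - y \<bullet> i \<le> corner n \<bullet> i"
      using that by (simp add: mem_box inner_diff_left)
    then show "(z - corner n) \<bullet> i \<le> y \<bullet> i \<and> y \<bullet> i \<le> z \<bullet> i" by (auto simp: inner_diff_left)
  qed
  then show "fst (z, y) - snd (z, y) \<notin> cbox 0 (corner n)" using assms by auto
  fix b :: 'a and s assume b: "b \<in> Basis" "s \<notin> {0 \<bullet> b..corner n \<bullet> b}"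
  then have "s \<notin> {0..2 / 2 ^ n}" by (simp add: corner_inner)
  then show "((\<lambda>b. mollN n)(e := deriv (mollN n))) b s = 0"
    using mollN_eq_0[of s n] deriv_zero_outside[of 0 "2 / 2 ^ n" "mollN n" s, OF mollN_eq_0] by auto
qed

lemma iter_deriv_K:
  assumes "e \<in> Basis"
  shows "iter_deriv [e] (K n z) y = - K' n e (z, y)"
proof -
  have d: "deriv (\<lambda>s. mollN n (z \<bullet> e - s)) = (\<lambda>s. - deriv (mollN n) (z \<bullet> e - s))"
    using deriv_reflect[OF smooth_mollN, of 1 n "z \<bullet> e"] by simp
  have "iter_deriv [e] (K n z) = tens ((\<lambda>b s. mollN n (z \<bullet> b - s))(e := deriv (\<lambda>s. mollN n (z \<bullet> e - s))))"
    unfolding K_def by (rule iter_deriv_tens[OF _ assms]) (intro smooth_reflect smooth_mollN)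
  then show ?thesis
    by (simp only: K'_def tens_upd[OF assms] d) (simp add: inner_diff_left)
qed

lemma integrable_bounded_mult:
  fixes f :: "'a::euclidean_space \<Rightarrow> real"
  assumes f: "loc_int \<Omega> f" and X: "compact X" "X \<subseteq> \<Omega>"
    and b: "b \<in> borel_measurable lebesgue" "AE z in lebesgue. \<bar>b z\<bar> \<le> M" "\<And>z. z \<notin> X \<Longrightarrow> b z = 0"
  shows "integrable lebesgue (\<lambda>z. b z * f z)"
proof -
  have iX: "integrable lebesgue (\<lambda>y. indicator X y * f y)" using loc_intD[OF f X] by simp
  show ?thesis
  proof (rule Bochner_Integration.integrable_bound[OF integrable_mult_right[OF iX, of M]])
    have "(\<lambda>z. b z * (indicator X z * f z)) \<in> borel_measurable lebesgue" using b(1) iX by simp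
    also have "(\<lambda>z. b z * (indicator X z * f z)) = (\<lambda>z. b z * f z)"
      by (rule ext) (use b(3) in \<open>auto simp: indicator_def\<close>)
    finally show "(\<lambda>z. b z * f z) \<in> borel_measurable lebesgue" .
    show "AE z in lebesgue. norm (b z * f z) \<le> norm (M * (indicator X z * f z))"
      using b(2)
    proof eventually_elim
      case (elim z)
      then show ?case using b(3)[of z] by (cases "z \<in> X") (auto simp: abs_mult intro: mult_right_mono)
    qed
  qed
qed

lemma mollify_weighted_limit:
  fixes f :: "'a::euclidean_space \<Rightarrow> real"
  assumes f: "loc_int \<Omega> f" and X: "compact X" "open \<Omega>" "X \<subseteq> \<Omega>"
    and b: "b \<in> borel_measurable lebesgue" "AE z in lebesgue. \<bar>b z\<bar> \<le> M" "\<And>z. z \<notin> X \<Longrightarrow> b z = 0"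
  shows "(\<lambda>n. \<integral>z. b z * (\<integral>y. K n z y * f y \<partial>lebesgue) \<partial>lebesgue) \<longlonglongrightarrow> (\<integral>z. b z * f z \<partial>lebesgue)"
proof -
  obtain Y where Y: "compact Y" "X \<subseteq> Y" "Y \<subseteq> \<Omega>"
    "eventually (\<lambda>n. \<forall>x\<in>X. cbox (x - corner n) x \<subseteq> Y) sequentially"
    by (rule compact_margin[OF X])
  have [measurable]: "X \<in> sets lebesgue" using X(1) by (simp add: borel_compact)
  have iY: "integrable lebesgue (\<lambda>y. indicator Y y * f y)" using loc_intD[OF f Y(1,3)] by simp
  have iX: "integrable lebesgue (\<lambda>y. indicator X y * f y)" using loc_intD[OF f X(1,3)] by simp
  have bX: "b = (\<lambda>z. b z * indicator X z)" by (rule ext) (use b(3) in \<open>auto simp: indicator_def\<close>)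
  have ib: "integrable lebesgue b"
  proof (rule Bochner_Integration.integrable_bound[where f="\<lambda>z. M * indicat_real X z"])
    have "emeasure lebesgue X < \<infinity>" using emeasure_compact_finite[OF X(1)] X(1) by (simp add: borel_compact)
    then show "integrable lebesgue (\<lambda>z. M * indicat_real X z)"
      by (intro integrable_mult_right integrable_real_indicator) auto
    show "AE z in lebesgue. norm (b z) \<le> norm (M * indicator X z)"
      using b(2) by eventually_elim (use b(3) in \<open>auto simp: indicator_def\<close>)
  qed (rule b)
  have ibf: "integrable lebesgue (\<lambda>z. b z * f z)"
    by (rule integrable_bounded_mult[OF f X(1,3) b])
  have ev: "eventually (\<lambda>n. ennreal \<bar>(\<integral>z. b z * (\<integral>y. K n z y * f y \<partial>lebesgue) \<partial>lebesgue) - (\<integral>z. b z * f z \<partial>lebesgue)\<bar>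
     \<le> ennreal M * (\<integral>\<^sup>+x. indicator X x * norm (f x - (\<integral>y. K n x y *\<^sub>R f y \<partial>lebesgue)) \<partial>lebesgue)) sequentially"
    using Y(4)
  proof eventually_elim
    case (elim n)
    obtain B where B: "\<And>x y::'a. \<bar>K n x y\<bar> \<le> B" using K_bound by metis
    have i: "integrable lebesgue (\<lambda>z. b z * (\<integral>y. K n (fst (z, y)) (snd (z, y)) * (indicator Y y * f y) \<partial>lebesgue))"
      by (rule integral_kernel_integrable[OF iY ib K_measurable_pair]) (rule B)
    have eq: "b z * (\<integral>y. K n (fst (z, y)) (snd (z, y)) * (indicator Y y * f y) \<partial>lebesgue)
        = b z * (\<integral>y. K n z y * f y \<partial>lebesgue)" for z
    proof (cases "z \<in> X")
      case True
      then have "K n z y * (indicator Y y * f y) = K n z y * f y" for y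
        using elim K_zero_outside[of y z n] by (auto simp: indicator_def)
      then show ?thesis by (simp only: fst_conv snd_conv)
    qed (simp add: b(3))
    have i': "integrable lebesgue (\<lambda>z. b z * (\<integral>y. K n z y * f y \<partial>lebesgue))" using i unfolding eq .
    have ii: "integrable lebesgue (\<lambda>z. b z * (\<integral>y. K n z y * f y \<partial>lebesgue) - b z * f z)"
      using i' ibf by (rule Bochner_Integration.integrable_diff)
    have "ennreal \<bar>(\<integral>z. b z * (\<integral>y. K n z y * f y \<partial>lebesgue) \<partial>lebesgue) - (\<integral>z. b z * f z \<partial>lebesgue)\<bar>
        = ennreal (norm (\<integral>z. b z * (\<integral>y. K n z y * f y \<partial>lebesgue) - b z * f z \<partial>lebesgue))"
      by (subst Bochner_Integration.integral_diff[OF i' ibf]) simp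
    also have "\<dots> \<le> (\<integral>\<^sup>+z. norm (b z * (\<integral>y. K n z y * f y \<partial>lebesgue) - b z * f z) \<partial>lebesgue)"
      by (rule integral_norm_bound_ennreal[OF ii])
    also have "\<dots> \<le> (\<integral>\<^sup>+z. ennreal M * (indicator X z * norm (f z - (\<integral>y. K n z y *\<^sub>R f y \<partial>lebesgue))) \<partial>lebesgue)"
    proof (rule nn_integral_mono_AE)
      show "AE z in lebesgue. ennreal (norm (b z * (\<integral>y. K n z y * f y \<partial>lebesgue) - b z * f z))
        \<le> ennreal M * ennreal (indicator X z * norm (f z - (\<integral>y. K n z y *\<^sub>R f y \<partial>lebesgue)))"
        using b(2)
      proof eventually_elim
        case (elim z)
        have M0: "M \<ge> 0" using elim by linarith
        have "norm (b z * (\<integral>y. K n z y * f y \<partial>lebesgue) - b z * f z)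
            = \<bar>b z\<bar> * \<bar>f z - (\<integral>y. K n z y * f y \<partial>lebesgue)\<bar>"
          by (simp add: right_diff_distrib[symmetric] abs_mult abs_minus_commute)
        also have "\<dots> \<le> M * (indicator X z * \<bar>f z - (\<integral>y. K n z y * f y \<partial>lebesgue)\<bar>)"
          using elim b(3)[of z] by (cases "z \<in> X") (auto intro: mult_right_mono)
        finally have "norm (b z * (\<integral>y. K n z y * f y \<partial>lebesgue) - b z * f z)
           \<le> M * (indicator X z * \<bar>f z - (\<integral>y. K n z y * f y \<partial>lebesgue)\<bar>)" .
        from ennreal_leI[OF this] show ?case using M0 by (simp add: ennreal_mult)
      qed
    qed
    also have "\<dots> = ennreal M * (\<integral>\<^sup>+z. indicator X z * norm (f z - (\<integral>y. K n z y *\<^sub>R f y \<partial>lebesgue)) \<partial>lebesgue)"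
    proof (rule nn_integral_cmult)
      have "integrable lebesgue (\<lambda>z. indicator X z * (\<integral>y. K n (fst (z, y)) (snd (z, y)) * (indicator Y y * f y) \<partial>lebesgue))"
        using emeasure_compact_finite[OF X(1)] X(1)
        by (intro integral_kernel_integrable[OF iY _ K_measurable_pair B] integrable_real_indicator) (auto simp: borel_compact)
      then have "(\<lambda>z. ennreal \<bar>indicator X z * f z - indicator X z * (\<integral>y. K n (fst (z, y)) (snd (z, y)) * (indicator Y y * f y) \<partial>lebesgue)\<bar>) \<in> borel_measurable lebesgue"
        using iX by measurable
      also have "(\<lambda>z. ennreal \<bar>indicator X z * f z - indicator X z * (\<integral>y. K n (fst (z, y)) (snd (z, y)) * (indicator Y y * f y) \<partial>lebesgue)\<bar>)
        = (\<lambda>z. ennreal (indicator X z * norm (f z - (\<integral>y. K n z y *\<^sub>R f y \<partial>lebesgue))))"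
      proof
        fix z
        have "K n z y * (indicator Y y * f y) = K n z y * f y" if "z \<in> X" for y
          using elim K_zero_outside[of y z n] that by (auto simp: indicator_def)
        then show "ennreal \<bar>indicator X z * f z - indicator X z * (\<integral>y. K n (fst (z, y)) (snd (z, y)) * (indicator Y y * f y) \<partial>lebesgue)\<bar>
          = ennreal (indicator X z * norm (f z - (\<integral>y. K n z y *\<^sub>R f y \<partial>lebesgue)))"
          by (cases "z \<in> X") (simp_all only: fst_conv snd_conv, simp_all)
      qed
      finally show "(\<lambda>z. ennreal (indicat_real X z * norm (f z - (\<integral>y. K n z y *\<^sub>R f y \<partial>lebesgue)))) \<in> borel_measurable lebesgue" .
    qed
    finally show ?case .
  qed
  have "(\<lambda>n. ennreal M * (\<integral>\<^sup>+x. indicator X x * norm (f x - (\<integral>y. K n x y *\<^sub>R f y \<partial>lebesgue)) \<partial>lebesgue)) \<longlonglongrightarrow> ennreal M * 0"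
    by (intro ennreal_tendsto_cmult mollify_local[OF f X]) simp
  then have "(\<lambda>n. ennreal \<bar>(\<integral>z. b z * (\<integral>y. K n z y * f y \<partial>lebesgue) \<partial>lebesgue) - (\<integral>z. b z * f z \<partial>lebesgue)\<bar>) \<longlonglongrightarrow> ennreal 0"
    by (intro tendsto_sandwich[OF _ ev tendsto_const]) auto
  then have "(\<lambda>n. \<bar>(\<integral>z. b z * (\<integral>y. K n z y * f y \<partial>lebesgue) \<partial>lebesgue) - (\<integral>z. b z * f z \<partial>lebesgue)\<bar>) \<longlonglongrightarrow> 0"
    by (rule tendsto_ennrealD) auto
  then show ?thesis by (simp add: LIM_zero_iff tendsto_rabs_zero_iff)
qed

text \<open>Testing the divergence equation with \<open>K n z y * \<phi> z\<close> and integrating against \<open>w y\<close> amounts to using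
  the mollification of \<open>w\<close> times \<open>\<phi>\<close> as a test function.\<close>
proposition divergence_free_product:
  fixes V :: "'a::euclidean_space \<Rightarrow> 'a \<Rightarrow> real" and w :: "'a \<Rightarrow> real"
  assumes \<Omega>: "open \<Omega>"
    and V: "\<And>e. e \<in> Basis \<Longrightarrow> loc_int \<Omega> (V e)" "\<And>e. e \<in> Basis \<Longrightarrow> AE z in lebesgue. z \<in> \<Omega> \<longrightarrow> \<bar>V e z\<bar> \<le> M"
    and div: "\<And>\<phi>. \<phi> \<in> test_fun \<Omega> \<Longrightarrow> (\<Sum>e\<in>Basis. \<integral>z. V e z * iter_deriv [e] \<phi> z \<partial>lebesgue) = 0"
    and w: "\<And>e. e \<in> Basis \<Longrightarrow> has_weak_deriv \<Omega> [e] w (D e)" "loc_int \<Omega> w"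
    and g: "\<And>b. b \<in> Basis \<Longrightarrow> smooth (g b)" "\<And>b s. b \<in> Basis \<Longrightarrow> s \<notin> {a \<bullet> b..c \<bullet> b} \<Longrightarrow> g b s = 0" "cbox a c \<subseteq> \<Omega>"
  shows "(\<Sum>e\<in>Basis. \<integral>z. (V e z * tens g z) * D e z \<partial>lebesgue)
       = - (\<Sum>e\<in>Basis. \<integral>z. (V e z * iter_deriv [e] (tens g) z) * w z \<partial>lebesgue)"
proof -
  define X where "X = cbox a c"
  have X: "compact X" "X \<subseteq> \<Omega>" using g(3) by (auto simp: X_def)
  obtain Y where Y: "compact Y" "X \<subseteq> Y" "Y \<subseteq> \<Omega>"
    "eventually (\<lambda>n. \<forall>x\<in>X. cbox (x - corner n) x \<subseteq> Y) sequentially"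
    by (rule compact_margin[OF X(1) \<Omega> X(2)])
  define wY where "wY y = indicator Y y * w y" for y
  have iw: "integrable lebesgue wY" using loc_intD[OF w(2) Y(1,3)] unfolding wY_def[abs_def] by simp
  define dg where "dg e = tens (g(e := deriv (g e)))" for e
  have dg: "iter_deriv [e] (tens g) = dg e" if "e \<in> Basis" for e
    unfolding dg_def by (rule iter_deriv_tens) (use g that in auto)
  have gX: "tens g z = 0" if "z \<notin> X" for z
    by (rule tens_zero_outside[of a c]) (use g that X_def in auto)
  have dgX: "dg e z = 0" if "z \<notin> X" for e z
    unfolding dg_def
  proof (rule tens_zero_outside[of a c])
    show "z \<notin> cbox a c" using that by (simp add: X_def)
    show "(g(e := deriv (g e))) b s = 0" if "b \<in> Basis" "s \<notin> {a \<bullet> b..c \<bullet> b}" for b s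
      using g(2)[OF that] deriv_zero_outside[OF g(2)[OF that(1)] that(2)] by auto
  qed
  have bdg: "\<exists>C. \<forall>z. \<bar>h z\<bar> \<le> C" if "h \<in> insert (tens g) (dg ` Basis)" for h
  proof -
    have "h \<in> test_fun \<Omega>"
      using that
    proof
      assume "h = tens g"
      then show ?thesis using tens_test_fun[OF g(1,2,3)] by simp
    next
      assume "h \<in> dg ` Basis"
      then obtain e where e: "h = dg e" "e \<in> Basis" by auto
      show ?thesis unfolding e dg_def
      proof (rule tens_test_fun[OF _ _ g(3)])
        show "smooth ((g(e := deriv (g e))) b)" if "b \<in> Basis" for b using g(1) that smooth_deriv by auto
        show "(g(e := deriv (g e))) b s = 0" if "b \<in> Basis" "s \<notin> {a \<bullet> b..c \<bullet> b}" for b s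
          using g(2)[OF that] deriv_zero_outside[OF g(2)[OF that(1)] that(2)] by auto
      qed
    qed
    then show ?thesis by (rule test_fun_props)
  qed
  have dgm: "h \<in> borel_measurable lebesgue" if "h \<in> insert (tens g) (dg ` Basis)" for h
  proof (rule measurable_completion)
    have "tens g \<in> borel_measurable borel" by (rule tens_measurable) (rule g(1))
    moreover have "dg e \<in> borel_measurable borel" if "e \<in> Basis" for e
      unfolding dg_def by (rule tens_measurable) (use g(1) that smooth_deriv in auto)
    ultimately show "h \<in> borel_measurable lborel" using that by auto
  qed
  have bV: "(\<lambda>z. V e z * h z) \<in> borel_measurable lebesgue" "\<exists>C. AE z in lebesgue. \<bar>V e z * h z\<bar> \<le> C"
    "integrable lebesgue (\<lambda>z. V e z * h z)"
    if e: "e \<in> Basis" and h: "h \<in> insert (tens g) (dg ` Basis)" for e h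
  proof -
    obtain C where C: "\<And>z. \<bar>h z\<bar> \<le> C" using bdg[OF h] by blast
    have hX: "h z = 0" if "z \<notin> X" for z using h gX[OF that] dgX[OF that] by auto
    have "integrable lebesgue (\<lambda>z. h z *\<^sub>R V e z)"
      by (rule loc_int_mult(1)[OF V(1)[OF e] X dgm[OF h] C hX])
    then show i: "integrable lebesgue (\<lambda>z. V e z * h z)" by (simp add: mult.commute)
    then show "(\<lambda>z. V e z * h z) \<in> borel_measurable lebesgue" by simp
    have "AE z in lebesgue. \<bar>V e z * h z\<bar> \<le> \<bar>M\<bar> * \<bar>C\<bar>"
      using V(2)[OF e]
    proof eventually_elim
      case (elim z)
      show ?case
      proof (cases "z \<in> X")
        case True
        then have "\<bar>V e z\<bar> \<le> \<bar>M\<bar>" using elim X by auto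
        moreover have "\<bar>h z\<bar> \<le> \<bar>C\<bar>" using C[of z] by linarith
        ultimately show ?thesis by (auto simp: abs_mult intro: mult_mono)
      qed (simp add: hX)
    qed
    then show "\<exists>C. AE z in lebesgue. \<bar>V e z * h z\<bar> \<le> C" ..
  qed
  have iVg: "integrable lebesgue (\<lambda>z. V e z * tens g z)" if "e \<in> Basis" for e
    by (rule bV(3)[OF that]) simp
  have iVd: "integrable lebesgue (\<lambda>z. V e z * dg e z)" if "e \<in> Basis" for e
    by (rule bV(3)[OF that]) (use that in simp)
  have step: "(\<Sum>e\<in>Basis. (\<integral>z. (V e z * tens g z) * (\<integral>y. K n z y * D e y \<partial>lebesgue) \<partial>lebesgue)
        + (\<integral>z. (V e z * dg e z) * (\<integral>y. K n z y * w y \<partial>lebesgue) \<partial>lebesgue)) = 0"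
    if n: "\<forall>x\<in>X. cbox (x - corner n) x \<subseteq> Y" for n
  proof -
    obtain B where B: "\<And>x y::'a. \<bar>K n x y\<bar> \<le> B" using K_bound by metis
    have "\<exists>B. \<forall>z. \<bar>K' n e z\<bar> \<le> B" for e :: 'a using K'_bound[of n e] by metis
    then have "\<exists>B'. \<forall>e z. \<bar>K' n (e::'a) z\<bar> \<le> B' e" by (intro choice allI)
    then obtain B' where B': "\<And>(e::'a) z. \<bar>K' n e z\<bar> \<le> B' e" by blast
    \<comment> \<open>For fixed \<open>y\<close> the product \<open>K n z y * tens g z\<close> is itself a tensor product in \<open>z\<close>, hence an admissible test function.\<close>
    have ptw: "(\<Sum>e\<in>Basis. (\<integral>z. (V e z * tens g z) * K' n e (z, y) \<partial>lebesgue)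
         + (\<integral>z. (V e z * dg e z) * K n z y \<partial>lebesgue)) = 0" for y
    proof -
      define h where "h b = (\<lambda>s. mollN n (s - y \<bullet> b) * g b s)" for b
      have smm: "smooth (\<lambda>s. mollN n (s - c))" for c using smooth_affine[OF smooth_mollN[of n], of 1 "- c"] by simp
      have smh: "smooth (h b)" if "b \<in> Basis" for b
        unfolding h_def by (rule smooth_mult[OF smm g(1)[OF that]])
      have tf: "tens h \<in> test_fun \<Omega>"
        by (rule tens_test_fun[OF _ _ g(3)]) (use smh g(2) in \<open>auto simp: h_def\<close>)
      have dh: "iter_deriv [e] (tens h) z = K' n e (z, y) * tens g z + K n z y * dg e z" if e: "e \<in> Basis" for e z
      proof -
        have "deriv (h e) s = deriv (mollN n) (s - y \<bullet> e) * g e s + mollN n (s - y \<bullet> e) * deriv (g e) s" for s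
        proof (rule DERIV_imp_deriv)
          have "((\<lambda>s. s - y \<bullet> e) has_real_derivative 1) (at s)" by (auto intro!: derivative_eq_intros)
          from DERIV_mult[OF smooth_DERIV_chain[OF smooth_mollN this] smooth_has_deriv[OF g(1)[OF e]], of n]
          show "(h e has_real_derivative deriv (mollN n) (s - y \<bullet> e) * g e s + mollN n (s - y \<bullet> e) * deriv (g e) s) (at s)"
            unfolding h_def by (simp add: algebra_simps)
        qed
        then have "iter_deriv [e] (tens h) z = (deriv (mollN n) (z \<bullet> e - y \<bullet> e) * g e (z \<bullet> e) + mollN n (z \<bullet> e - y \<bullet> e) * deriv (g e) (z \<bullet> e))
            * (\<Prod>b\<in>Basis - {e}. h b (z \<bullet> b))"
          by (subst iter_deriv_tens) (use smh e in \<open>auto simp only: tens_upd\<close>)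
        moreover have "(\<Prod>b\<in>Basis - {e}. h b (z \<bullet> b)) = (\<Prod>b\<in>Basis - {e}. mollN n ((z - y) \<bullet> b)) * (\<Prod>b\<in>Basis - {e}. g b (z \<bullet> b))"
          by (simp add: h_def prod.distrib inner_diff_left)
        moreover have "K' n e (z, y) = deriv (mollN n) (z \<bullet> e - y \<bullet> e) * (\<Prod>b\<in>Basis - {e}. mollN n ((z - y) \<bullet> b))"
          unfolding K'_def using e by (simp only: tens_upd) (simp add: inner_diff_left)
        moreover have "K n z y = mollN n (z \<bullet> e - y \<bullet> e) * (\<Prod>b\<in>Basis - {e}. mollN n ((z - y) \<bullet> b))"
          unfolding K_eq using tens_split[OF e, of "\<lambda>b. mollN n" "z - y"] by (simp add: inner_diff_left)
        moreover have "tens g z = g e (z \<bullet> e) * (\<Prod>b\<in>Basis - {e}. g b (z \<bullet> b))" by (rule tens_split[OF e])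
        moreover have "dg e z = deriv (g e) (z \<bullet> e) * (\<Prod>b\<in>Basis - {e}. g b (z \<bullet> b))"
          unfolding dg_def by (rule tens_upd[OF e])
        ultimately show ?thesis by (simp only:) (simp only: distrib_left distrib_right mult_ac)
      qed
      have i1: "integrable lebesgue (\<lambda>z. (V e z * tens g z) * K' n e (z, y))" if e: "e \<in> Basis" for e
      proof (rule Bochner_Integration.integrable_bound[OF integrable_mult_left[OF iVg[OF e], of "B' e"]])
        have "(\<lambda>z. K' n e (z, y)) \<in> borel_measurable lebesgue"
          by (rule measurable_completion) (simp, rule measurable_compose[OF _ K'_measurable], measurable)
        then show "(\<lambda>z. (V e z * tens g z) * K' n e (z, y)) \<in> borel_measurable lebesgue" using iVg[OF e] by simp
        show "AE z in lebesgue. norm (V e z * tens g z * K' n e (z, y)) \<le> norm (V e z * tens g z * B' e)"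
          using B' order_trans[OF B' abs_ge_self] by (intro AE_I2) (auto simp: abs_mult intro!: mult_left_mono)
      qed
      have i2: "integrable lebesgue (\<lambda>z. (V e z * dg e z) * K n z y)" if e: "e \<in> Basis" for e
      proof (rule Bochner_Integration.integrable_bound[OF integrable_mult_left[OF iVd[OF e], of B]])
        have "(\<lambda>z. K n z y) \<in> borel_measurable lebesgue"
          by (rule measurable_completion)
             (use measurable_compose[OF _ K_measurable_pair[of n], of "\<lambda>z. (z, y)" borel] in simp)
        then show "(\<lambda>z. (V e z * dg e z) * K n z y) \<in> borel_measurable lebesgue" using iVd[OF e] by simp
        show "AE z in lebesgue. norm (V e z * dg e z * K n z y) \<le> norm (V e z * dg e z * B)"
          using B order_trans[OF B abs_ge_self] by (intro AE_I2) (auto simp: abs_mult intro!: mult_left_mono)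
      qed
      have "(\<Sum>e\<in>Basis. (\<integral>z. (V e z * tens g z) * K' n e (z, y) \<partial>lebesgue) + (\<integral>z. (V e z * dg e z) * K n z y \<partial>lebesgue))
          = (\<Sum>e\<in>Basis. \<integral>z. V e z * iter_deriv [e] (tens h) z \<partial>lebesgue)"
      proof (rule sum.cong[OF refl])
        fix e :: 'a assume e: "e \<in> Basis"
        have "(\<integral>z. (V e z * tens g z) * K' n e (z, y) \<partial>lebesgue) + (\<integral>z. (V e z * dg e z) * K n z y \<partial>lebesgue)
           = (\<integral>z. (V e z * tens g z) * K' n e (z, y) + (V e z * dg e z) * K n z y \<partial>lebesgue)"
          by (rule Bochner_Integration.integral_add[symmetric, OF i1[OF e] i2[OF e]])
        also have "(\<lambda>z. (V e z * tens g z) * K' n e (z, y) + (V e z * dg e z) * K n z y) = (\<lambda>z. V e z * iter_deriv [e] (tens h) z)"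
          by (rule ext) (simp only: dh[OF e] distrib_left mult_ac)
        finally show "(\<integral>z. (V e z * tens g z) * K' n e (z, y) \<partial>lebesgue) + (\<integral>z. (V e z * dg e z) * K n z y \<partial>lebesgue)
           = (\<integral>z. V e z * iter_deriv [e] (tens h) z \<partial>lebesgue)" .
      qed
      also have "\<dots> = 0" by (rule div[OF tf])
      finally show ?thesis .
    qed
    \<comment> \<open>Exchanging the integrals moves the derivative of the kernel onto \<open>w\<close>.\<close>
    have c1: "(\<integral>y. (\<integral>z. (V e z * tens g z) * K' n e (z, y) \<partial>lebesgue) * wY y \<partial>lebesgue)
        = (\<integral>z. (V e z * tens g z) * (\<integral>y. K n z y * D e y \<partial>lebesgue) \<partial>lebesgue)" if e: "e \<in> Basis" for e
    proof -
      have "(\<integral>y. (\<integral>z. (V e z * tens g z) * K' n e (z, y) \<partial>lebesgue) * wY y \<partial>lebesgue)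
        = (\<integral>z. (V e z * tens g z) * (\<integral>y. K' n e (z, y) * wY y \<partial>lebesgue) \<partial>lebesgue)"
        by (rule integral_kernel_commute[OF iw iVg[OF e] K'_measurable B'])
      also have "\<dots> = (\<integral>z. (V e z * tens g z) * (\<integral>y. K n z y * D e y \<partial>lebesgue) \<partial>lebesgue)"
      proof (rule Bochner_Integration.integral_cong[OF refl])
        fix z
        show "(V e z * tens g z) * (\<integral>y. K' n e (z, y) * wY y \<partial>lebesgue) = (V e z * tens g z) * (\<integral>y. K n z y * D e y \<partial>lebesgue)"
        proof (cases "z \<in> X")
          case True
          have "K' n e (z, y) * wY y = - (iter_deriv [e] (K n z) y *\<^sub>R w y)" for y
            using True n K'_zero_outside[of y z n e] by (auto simp: wY_def indicator_def iter_deriv_K[OF e] simp del: iter_deriv.simps)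
          then have "(\<integral>y. K' n e (z, y) * wY y \<partial>lebesgue) = - (\<integral>y. iter_deriv [e] (K n z) y *\<^sub>R w y \<partial>lebesgue)"
            by (simp only: integral_minus)
          also have "\<dots> = (\<integral>y. K n z y *\<^sub>R D e y \<partial>lebesgue)"
          proof -
            have "K n z \<in> test_fun \<Omega>" by (rule K_test_fun) (use True n Y in blast)
            then have "(\<integral>y. iter_deriv [e] (K n z) y *\<^sub>R w y \<partial>lebesgue) = (-1) ^ length [e] *\<^sub>R (\<integral>y. K n z y *\<^sub>R D e y \<partial>lebesgue)"
              using w(1)[OF e] unfolding has_weak_deriv_def by blast
            then show ?thesis by simp
          qed
          finally show ?thesis by simp
        qed (simp add: gX)
      qed
      finally show ?thesis .
    qed
    have c2: "(\<integral>y. (\<integral>z. (V e z * dg e z) * K n z y \<partial>lebesgue) * wY y \<partial>lebesgue)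
        = (\<integral>z. (V e z * dg e z) * (\<integral>y. K n z y * w y \<partial>lebesgue) \<partial>lebesgue)" if e: "e \<in> Basis" for e
    proof -
      have "(\<integral>y. (\<integral>z. (V e z * dg e z) * K n z y \<partial>lebesgue) * wY y \<partial>lebesgue)
        = (\<integral>z. (V e z * dg e z) * (\<integral>y. K n z y * wY y \<partial>lebesgue) \<partial>lebesgue)"
        using integral_kernel_commute[OF iw iVd[OF e] K_measurable_pair[of n], of B] B by simp
      also have "\<dots> = (\<integral>z. (V e z * dg e z) * (\<integral>y. K n z y * w y \<partial>lebesgue) \<partial>lebesgue)"
      proof (rule Bochner_Integration.integral_cong[OF refl])
        fix z
        have "K n z y * wY y = K n z y * w y" if "z \<in> X" for y
          using n K_zero_outside[of y z n] that by (auto simp: wY_def indicator_def)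
        then show "(V e z * dg e z) * (\<integral>y. K n z y * wY y \<partial>lebesgue) = (V e z * dg e z) * (\<integral>y. K n z y * w y \<partial>lebesgue)"
          using dgX[of z e] by (cases "z \<in> X") (simp_all only: not_False_eq_True mult_zero_right mult_zero_left)
      qed
      finally show ?thesis .
    qed
    have j1: "integrable lebesgue (\<lambda>y. (\<integral>z. (V e z * tens g z) * K' n e (z, y) \<partial>lebesgue) * wY y)" if e: "e \<in> Basis" for e
    proof -
      have m: "(\<lambda>p::'a \<times> 'a. K' n e (snd p, fst p)) \<in> borel_measurable borel"
      proof -
        have "(\<lambda>p::'a \<times> 'a. (snd p, fst p)) \<in> borel_measurable borel"
          by (intro borel_measurable_continuous_onI continuous_intros)
        from measurable_compose[OF this K'_measurable] show ?thesis .
      qed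
      have "integrable lebesgue (\<lambda>y. wY y * (\<integral>z. K' n e (snd (y, z), fst (y, z)) * (V e z * tens g z) \<partial>lebesgue))"
        by (rule integral_kernel_integrable[OF iVg[OF e] iw m, of "B' e"]) (rule B')
      then show ?thesis by (simp add: mult.commute)
    qed
    have j2: "integrable lebesgue (\<lambda>y. (\<integral>z. (V e z * dg e z) * K n z y \<partial>lebesgue) * wY y)" if e: "e \<in> Basis" for e
    proof -
      have m: "(\<lambda>p::'a \<times> 'a. K n (snd p) (fst p)) \<in> borel_measurable borel"
      proof -
        have "(\<lambda>p::'a \<times> 'a. (snd p, fst p)) \<in> borel_measurable borel"
          by (intro borel_measurable_continuous_onI continuous_intros)
        from measurable_compose[OF this K_measurable_pair[of n]] show ?thesis by simp
      qed
      have "integrable lebesgue (\<lambda>y. wY y * (\<integral>z. K n (snd (y, z)) (fst (y, z)) * (V e z * dg e z) \<partial>lebesgue))"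
        by (rule integral_kernel_integrable[OF iVd[OF e] iw m, of B]) (rule B)
      then show ?thesis by (simp add: mult.commute)
    qed
    have "0 = (\<integral>y. (\<Sum>e\<in>Basis. (\<integral>z. (V e z * tens g z) * K' n e (z, y) \<partial>lebesgue) + (\<integral>z. (V e z * dg e z) * K n z y \<partial>lebesgue)) * wY y \<partial>lebesgue)"
      unfolding ptw by simp
    also have "\<dots> = (\<integral>y. (\<Sum>e\<in>Basis. (\<integral>z. (V e z * tens g z) * K' n e (z, y) \<partial>lebesgue) * wY y
         + (\<integral>z. (V e z * dg e z) * K n z y \<partial>lebesgue) * wY y) \<partial>lebesgue)"
      by (simp only: sum_distrib_right distrib_right)
    also have "\<dots> = (\<Sum>e\<in>Basis. \<integral>y. (\<integral>z. (V e z * tens g z) * K' n e (z, y) \<partial>lebesgue) * wY y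
         + (\<integral>z. (V e z * dg e z) * K n z y \<partial>lebesgue) * wY y \<partial>lebesgue)"
      by (rule Bochner_Integration.integral_sum) (intro Bochner_Integration.integrable_add j1 j2)
    also have "\<dots> = (\<Sum>e\<in>Basis. (\<integral>z. (V e z * tens g z) * (\<integral>y. K n z y * D e y \<partial>lebesgue) \<partial>lebesgue)
        + (\<integral>z. (V e z * dg e z) * (\<integral>y. K n z y * w y \<partial>lebesgue) \<partial>lebesgue))"
    proof (rule sum.cong[OF refl])
      fix e :: 'a assume e: "e \<in> Basis"
      show "(\<integral>y. (\<integral>z. (V e z * tens g z) * K' n e (z, y) \<partial>lebesgue) * wY y + (\<integral>z. (V e z * dg e z) * K n z y \<partial>lebesgue) * wY y \<partial>lebesgue)
         = (\<integral>z. (V e z * tens g z) * (\<integral>y. K n z y * D e y \<partial>lebesgue) \<partial>lebesgue)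
        + (\<integral>z. (V e z * dg e z) * (\<integral>y. K n z y * w y \<partial>lebesgue) \<partial>lebesgue)"
        by (subst Bochner_Integration.integral_add[OF j1[OF e] j2[OF e]]) (simp only: c1[OF e] c2[OF e])
    qed
    finally show ?thesis by (rule sym)
  qed
  have "(\<lambda>n. \<Sum>e\<in>Basis. (\<integral>z. (V e z * tens g z) * (\<integral>y. K n z y * D e y \<partial>lebesgue) \<partial>lebesgue)
        + (\<integral>z. (V e z * dg e z) * (\<integral>y. K n z y * w y \<partial>lebesgue) \<partial>lebesgue))
     \<longlonglongrightarrow> (\<Sum>e\<in>Basis. (\<integral>z. (V e z * tens g z) * D e z \<partial>lebesgue) + (\<integral>z. (V e z * dg e z) * w z \<partial>lebesgue))"
  proof (intro tendsto_sum tendsto_add)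
    fix e :: 'a assume e: "e \<in> Basis"
    have locD: "loc_int \<Omega> (D e)" using w(1)[OF e] by (simp add: has_weak_deriv_def)
    obtain C where C: "AE z in lebesgue. \<bar>V e z * tens g z\<bar> \<le> C" using bV(2)[OF e, of "tens g"] by auto
    show "(\<lambda>n. \<integral>z. (V e z * tens g z) * (\<integral>y. K n z y * D e y \<partial>lebesgue) \<partial>lebesgue) \<longlonglongrightarrow> (\<integral>z. (V e z * tens g z) * D e z \<partial>lebesgue)"
      by (rule mollify_weighted_limit[OF locD X(1) \<Omega> X(2) _ C]) (use bV(1)[OF e, of "tens g"] gX in auto)
    obtain C' where C': "AE z in lebesgue. \<bar>V e z * dg e z\<bar> \<le> C'" using bV(2)[OF e, of "dg e"] e by auto
    show "(\<lambda>n. \<integral>z. (V e z * dg e z) * (\<integral>y. K n z y * w y \<partial>lebesgue) \<partial>lebesgue) \<longlonglongrightarrow> (\<integral>z. (V e z * dg e z) * w z \<partial>lebesgue)"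
      by (rule mollify_weighted_limit[OF w(2) X(1) \<Omega> X(2) _ C']) (use bV(1)[OF e, of "dg e"] e dgX in auto)
  qed
  moreover have "eventually (\<lambda>n. (\<Sum>e\<in>Basis. (\<integral>z. (V e z * tens g z) * (\<integral>y. K n z y * D e y \<partial>lebesgue) \<partial>lebesgue)
        + (\<integral>z. (V e z * dg e z) * (\<integral>y. K n z y * w y \<partial>lebesgue) \<partial>lebesgue)) = 0) sequentially"
    using Y(4) by eventually_elim (rule step)
  ultimately have "(\<lambda>n. 0::real) \<longlonglongrightarrow> (\<Sum>e\<in>Basis. (\<integral>z. (V e z * tens g z) * D e z \<partial>lebesgue) + (\<integral>z. (V e z * dg e z) * w z \<partial>lebesgue))"
    by (rule Lim_transform_eventually)
  then have "(\<Sum>e\<in>Basis. (\<integral>z. (V e z * tens g z) * D e z \<partial>lebesgue) + (\<integral>z. (V e z * dg e z) * w z \<partial>lebesgue)) = 0"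
    by (simp add: LIMSEQ_const_iff)
  then have "(\<Sum>e\<in>Basis. \<integral>z. (V e z * tens g z) * D e z \<partial>lebesgue) = - (\<Sum>e\<in>Basis. \<integral>z. (V e z * dg e z) * w z \<partial>lebesgue)"
    by (simp add: sum.distrib)
  also have "(\<Sum>e\<in>Basis. \<integral>z. (V e z * dg e z) * w z \<partial>lebesgue) = (\<Sum>e\<in>Basis. \<integral>z. (V e z * iter_deriv [e] (tens g) z) * w z \<partial>lebesgue)"
    by (intro sum.cong refl) (simp only: dg)
  finally show ?thesis .
qed

section \<open>Test functions on a slab\<close>

lemma Basis_real3: "(Basis :: (real^3) set) = range (\<lambda>j. axis j 1)"
  by (auto simp: Basis_vec_def)

lemma sum_Basis_slab:
  fixes f :: "real \<times> (real^3) \<Rightarrow> real"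
  shows "(\<Sum>e\<in>Basis. f e) = f (1, 0) + (\<Sum>j\<in>UNIV. f (0, axis j 1))"
proof -
  have "(\<Sum>e\<in>Basis. f e) = (\<Sum>e\<in>(\<lambda>u. (u, 0)) ` (Basis :: real set). f e) + (\<Sum>e\<in>(\<lambda>v. (0, v)) ` (Basis :: (real^3) set). f e)"
    unfolding Basis_prod_def by (rule sum.union_disjoint) auto
  also have "(\<Sum>e\<in>(\<lambda>v. (0, v)) ` (Basis :: (real^3) set). f e) = (\<Sum>j\<in>UNIV. f (0, axis j 1))"
    unfolding Basis_real3 image_image by (subst sum.reindex) (auto simp: inj_on_def axis_eq_axis)
  finally show ?thesis by simp
qed

text \<open>\<open>st \<tau> G\<close> collects the factors of the tensor product of \<open>\<tau>\<close> in time and of \<open>G\<close> in space.\<close>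
definition st :: "(real \<Rightarrow> real) \<Rightarrow> (real^3 \<Rightarrow> real \<Rightarrow> real) \<Rightarrow> real \<times> (real^3) \<Rightarrow> real \<Rightarrow> real" where
  "st \<tau> G b = (if snd b = 0 then \<tau> else G (snd b))"

lemma tens_st: "tens (st \<tau> G) (t, x) = \<tau> t * tens G x"
proof -
  have "tens (st \<tau> G) (t, x) = (\<Prod>b\<in>(\<lambda>u. (u, 0)) ` (Basis :: real set). st \<tau> G b ((t, x) \<bullet> b))
      * (\<Prod>b\<in>(\<lambda>v. (0, v)) ` (Basis :: (real^3) set). st \<tau> G b ((t, x) \<bullet> b))"
    unfolding tens_def Basis_prod_def by (rule prod.union_disjoint) auto
  also have "(\<Prod>b\<in>(\<lambda>v. (0, v)) ` (Basis :: (real^3) set). st \<tau> G b ((t, x) \<bullet> b)) = tens G x"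
    unfolding tens_def by (subst prod.reindex) (auto simp: inj_on_def st_def nonzero_Basis intro!: prod.cong)
  also have "(\<Prod>b\<in>(\<lambda>u. (u, 0)) ` (Basis :: real set). st \<tau> G b ((t, x) \<bullet> b)) = \<tau> t"
    by (simp add: st_def)
  finally show ?thesis .
qed

lemma smooth_st: "smooth \<tau> \<Longrightarrow> (\<And>v. v \<in> Basis \<Longrightarrow> smooth (G v)) \<Longrightarrow> b \<in> Basis \<Longrightarrow> smooth (st \<tau> G b)"
  by (auto simp: st_def Basis_prod_def)

lemma iter_deriv_st_time:
  assumes "smooth \<tau>" "\<And>v. v \<in> Basis \<Longrightarrow> smooth (G v)"
  shows "iter_deriv [(1, 0)] (tens (st \<tau> G)) = tens (st (deriv \<tau>) G)"
proof -
  have "iter_deriv [(1, 0)] (tens (st \<tau> G)) = tens ((st \<tau> G)((1, 0) := deriv (st \<tau> G (1, 0))))"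
    by (rule iter_deriv_tens) (use smooth_st[OF assms] in \<open>auto simp: Basis_prod_def\<close>)
  also have "\<dots> = tens (st (deriv \<tau>) G)"
    by (rule tens_cong) (auto simp: st_def Basis_prod_def)
  finally show ?thesis .
qed

lemma iter_deriv_st_space:
  assumes "smooth \<tau>" "\<And>v. v \<in> Basis \<Longrightarrow> smooth (G v)" "v \<in> Basis"
  shows "iter_deriv [(0, v)] (tens (st \<tau> G)) = tens (st \<tau> (G(v := deriv (G v))))"
proof -
  have "iter_deriv [(0, v)] (tens (st \<tau> G)) = tens ((st \<tau> G)((0, v) := deriv (st \<tau> G (0, v))))"
    by (rule iter_deriv_tens) (use smooth_st[OF assms(1,2)] assms(3) in \<open>auto simp: Basis_prod_def\<close>)
  also have "\<dots> = tens (st \<tau> (G(v := deriv (G v))))"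
    using assms(3) by (intro tens_cong) (auto simp: st_def Basis_prod_def nonzero_Basis)
  finally show ?thesis .
qed

definition cube :: "real \<Rightarrow> (real^3) set" where
  "cube r = cbox (- (r *\<^sub>R One)) (r *\<^sub>R One)"

lemma cube_iff: "x \<in> cube r \<longleftrightarrow> (\<forall>b\<in>Basis. \<bar>x \<bullet> b\<bar> \<le> r)"
  by (auto simp: cube_def mem_box abs_le_iff)

lemma cube_measurable [measurable]: "cube r \<in> sets lebesgue"
  by (simp add: cube_def)

lemma st_support:
  assumes "\<And>s. s \<notin> {a..b} \<Longrightarrow> \<tau> s = 0" "\<And>v s. v \<in> Basis \<Longrightarrow> s \<notin> {-L..L} \<Longrightarrow> G v s = 0"
    and "c \<in> Basis" "s \<notin> {(a, - (L *\<^sub>R One)) \<bullet> c..(b, L *\<^sub>R (One :: real^3)) \<bullet> c}"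
  shows "st \<tau> G c s = 0"
  using assms by (auto simp: st_def Basis_prod_def nonzero_Basis)

lemma slab_cbox_subset:
  "0 < a \<Longrightarrow> b < T \<Longrightarrow> cbox (a, - (L *\<^sub>R One)) (b, L *\<^sub>R (One :: real^3)) \<subseteq> slab T"
  by (auto simp: slab_def cbox_Pair_eq)

lemma st_test_fun:
  assumes "smooth \<tau>" "0 < a" "b < T" "\<And>s. s \<notin> {a..b} \<Longrightarrow> \<tau> s = 0"
    and "\<And>v. v \<in> Basis \<Longrightarrow> smooth (G v)" "\<And>v s. v \<in> Basis \<Longrightarrow> s \<notin> {-L..L} \<Longrightarrow> G v s = 0"
  shows "tens (st \<tau> G) \<in> test_fun (slab T)"
proof (rule tens_test_fun[OF _ _ slab_cbox_subset[OF assms(2,3)]])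
  show "smooth (st \<tau> G c)" if "c \<in> Basis" for c
    by (rule smooth_st[OF assms(1) _ that]) (rule assms(5))
  show "st \<tau> G c s = 0" if "c \<in> Basis" "s \<notin> {(a, - (L *\<^sub>R One)) \<bullet> c..(b, L *\<^sub>R (One :: real^3)) \<bullet> c}" for c s
    by (rule st_support[of a b \<tau> L G, OF _ _ that]) (use assms(4,6) in auto)
qed

lemma open_slab: "open (slab T)"
  unfolding slab_def by (intro open_Times) auto

definition cut :: "real \<Rightarrow> real \<Rightarrow> real" where
  "cut r s = step (2 + s / r) * step (2 - s / r)"

lemma smooth_cut: "smooth (cut r)"
proof -
  have "smooth (\<lambda>s. step ((1 / r) * s + 2) * step ((- (1 / r)) * s + 2))"
    by (intro smooth_mult smooth_affine smooth_step)
  then show ?thesis by (simp add: cut_def[abs_def] add.commute)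
qed

lemma cut_bounds: "0 \<le> cut r s" "cut r s \<le> 1"
  using step_ge_0 step_le_1 by (auto simp: cut_def intro: mult_le_one)

lemma cut_eq_1: "r > 0 \<Longrightarrow> \<bar>s\<bar> \<le> r \<Longrightarrow> cut r s = 1"
  unfolding cut_def by (simp add: step_eq_1 field_simps abs_le_iff)

lemma cut_eq_0: "r > 0 \<Longrightarrow> s \<notin> {- (2 * r)..2 * r} \<Longrightarrow> cut r s = 0"
proof -
  assume r: "r > 0" and "s \<notin> {- (2 * r)..2 * r}"
  then have "2 + s / r \<le> 0 \<or> 2 - s / r \<le> 0" by (auto simp: field_simps)
  then show ?thesis by (auto simp: cut_def step_eq_0)
qed

lemma deriv_cut_bound: obtains C where "C > 0" "\<And>r s. r > 0 \<Longrightarrow> \<bar>deriv (cut r) s\<bar> \<le> C / r"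
proof -
  have z: "cut 1 s = 0" if "s \<notin> {-2..2}" for s using cut_eq_0[of 1 s] that by simp
  obtain C where C: "C \<ge> 0" "\<And>s. \<bar>deriv (cut 1) s\<bar> \<le> C"
    using bounded_of_support[of "deriv (cut 1)" "-2" 2, OF smooth_deriv[OF smooth_cut]]
      deriv_zero_outside[of "-2" 2 "cut 1", OF z] by metis
  show thesis
  proof (rule that[of "C + 1"])
    fix r s :: real assume r: "r > 0"
    have "cut r = (\<lambda>s. 1 * cut 1 ((1 / r) * s))" by (simp add: cut_def[abs_def])
    then have "deriv (cut r) s = deriv (\<lambda>s. 1 * cut 1 ((1 / r) * s)) s" by (rule arg_cong)
    also have "\<dots> = (1 * (1 / r)) * deriv (cut 1) ((1 / r) * s)" by (simp only: deriv_scale[OF smooth_cut])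
    finally have "deriv (cut r) s = (1 / r) * deriv (cut 1) ((1 / r) * s)" by (simp only: mult_1)
    then have "\<bar>deriv (cut r) s\<bar> = \<bar>deriv (cut 1) ((1 / r) * s)\<bar> / r" using r by (simp add: abs_mult)
    also have "\<dots> \<le> (C + 1) / r" using C(2)[of "(1 / r) * s"] r by (intro divide_right_mono) auto
    finally show "\<bar>deriv (cut r) s\<bar> \<le> (C + 1) / r" .
  qed (use C in simp)
qed

definition cutoff :: "real \<Rightarrow> real^3 \<Rightarrow> real" where
  "cutoff r = tens (\<lambda>_. cut r)"

definition cutoff_deriv :: "real \<Rightarrow> real^3 \<Rightarrow> real^3 \<Rightarrow> real" where
  "cutoff_deriv r v = tens ((\<lambda>_. cut r)(v := deriv (cut r)))"

lemma cutoff_bounds: "0 \<le> cutoff r x" "cutoff r x \<le> 1"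
  unfolding cutoff_def tens_def using cut_bounds by (auto intro!: prod_nonneg prod_le_1)

lemma cutoff_eq_1: "r > 0 \<Longrightarrow> x \<in> cube r \<Longrightarrow> cutoff r x = 1"
  unfolding cutoff_def tens_def by (rule prod.neutral) (auto simp: cut_eq_1 cube_iff)

lemma cutoff_integrable: "r > 0 \<Longrightarrow> integrable lebesgue (cutoff r)"
proof -
  assume r: "r > 0"
  have "integrable lborel (cutoff r)"
    unfolding cutoff_def by (rule integral_tens) (rule integrable_of_support[OF smooth_cut cut_eq_0[OF r]])
  then show ?thesis by (subst integrable_completion) auto
qed

lemma cutoff_deriv_bound:
  assumes C: "\<And>r s. r > 0 \<Longrightarrow> \<bar>deriv (cut r) s\<bar> \<le> C / r" and r: "r > 0" and v: "v \<in> Basis"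
  shows "\<bar>cutoff_deriv r v x\<bar> \<le> C / r * indicator (cube (2 * r)) x"
proof (cases "x \<in> cube (2 * r)")
  case True
  have "\<bar>cutoff_deriv r v x\<bar> \<le> (\<Prod>b\<in>(Basis :: (real^3) set). if b = v then C / r else 1)"
    unfolding cutoff_deriv_def by (rule abs_tens_le) (use C[OF r] cut_bounds in auto)
  also have "\<dots> = C / r" using v by (simp add: prod.If_cases)
  finally show ?thesis using True by simp
next
  case False
  have "cutoff_deriv r v x = 0"
    unfolding cutoff_deriv_def
  proof (rule tens_zero_outside[of "- ((2 * r) *\<^sub>R One)" "(2 * r) *\<^sub>R One"])
    show "x \<notin> cbox (- ((2 * r) *\<^sub>R One)) ((2 * r) *\<^sub>R One)" using False by (simp add: cube_def)
    fix b :: "real^3" and s assume "b \<in> Basis" "s \<notin> {- ((2 * r) *\<^sub>R One) \<bullet> b..(2 * r) *\<^sub>R One \<bullet> b}"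
    then have "s \<notin> {- (2 * r)..2 * r}" by simp
    then show "((\<lambda>_. cut r)(v := deriv (cut r))) b s = 0"
      using cut_eq_0[OF r] deriv_zero_outside[of "- (2 * r)" "2 * r" "cut r" s, OF cut_eq_0[OF r]] by auto
  qed
  then show ?thesis using False by simp
qed

text \<open>The bounds on the time slices hold off null sets that depend on the time.  By Fubini they combine to a bound
  almost everywhere in space-time, because the set where it fails is measurable.\<close>
lemma AE_slab_bound:
  fixes f :: "real \<Rightarrow> real^3 \<Rightarrow> real"
  assumes f: "loc_int (slab T) (case_prod f)" and M: "M \<ge> 0"
    and le: "\<And>t. t \<in> {0..T} \<Longrightarrow> AE x in lebesgue. \<bar>f t x\<bar> \<le> M"
  shows "AE z in lebesgue. z \<in> slab T \<longrightarrow> \<bar>case_prod f z\<bar> \<le> M"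
proof (rule AE_on_open[OF open_slab])
  fix Y assume Y: "compact Y" "Y \<subseteq> slab T"
  define g where "g z = indicator Y z * case_prod f z" for z
  have "integrable lebesgue g" using loc_intD[OF f Y] unfolding g_def[abs_def] by simp
  then have [measurable]: "g \<in> borel_measurable lebesgue" by simp
  have "{z \<in> space lebesgue. M < \<bar>g z\<bar>} \<in> sets lebesgue" by measurable
  then have N: "{z. M < \<bar>g z\<bar>} \<in> sets lebesgue" by simp
  have "AE z in lebesgue. z \<notin> {z. M < \<bar>g z\<bar>}"
  proof (rule AE_of_slices[OF N])
    fix t
    show "AE x in lebesgue. (t, x) \<notin> {z. M < \<bar>g z\<bar>}"
    proof (cases "t \<in> {0..T}")
      case True
      show ?thesis using le[OF True] by eventually_elim (use M in \<open>auto simp: g_def indicator_def\<close>)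
    next
      case False
      then have "(t, x) \<notin> Y" for x using Y(2) by (auto simp: slab_def)
      then show ?thesis using M by (simp add: g_def)
    qed
  qed
  then show "AE z in lebesgue. z \<in> Y \<longrightarrow> \<bar>case_prod f z\<bar> \<le> M"
    by eventually_elim (auto simp: g_def indicator_def split: if_splits)
qed

section \<open>Balance laws on a slab\<close>

text \<open>The majorant \<open>H\<close> is required to be measurable in place of \<open>h t\<close>, since Lebesgue measurability of \<open>f\<close> in space-time says
  nothing about a given slice.\<close>
lemma slab_integral_bound:
  fixes f :: "real \<times> (real^3) \<Rightarrow> real"
  assumes f: "f \<in> borel_measurable lebesgue" and \<tau>: "smooth \<tau>" "0 < a" "b < T" "\<And>s. s \<notin> {a..b} \<Longrightarrow> \<tau> s = 0"
    and B: "B \<ge> 0"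
    and f_eq: "\<And>t x. f (t, x) = \<tau> t * h t x"
    and h: "AE t in lebesgue. t \<in> {0<..<T} \<longrightarrow>
      (\<exists>H\<in>borel_measurable lebesgue. (AE x in lebesgue. ennreal \<bar>h t x\<bar> \<le> H x) \<and> (\<integral>\<^sup>+x. H x \<partial>lebesgue) \<le> ennreal B)"
  shows "\<bar>\<integral>z. f z \<partial>lebesgue\<bar> \<le> B * (\<integral>s. \<bar>\<tau> s\<bar> \<partial>lborel)"
proof -
  have i\<tau>: "integrable lborel \<tau>" by (rule integrable_of_support[OF \<tau>(1,4)])
  have B0: "0 \<le> B * (\<integral>s. \<bar>\<tau> s\<bar> \<partial>lborel)" using B by simp
  show ?thesis
  proof (cases "integrable lebesgue f")
    case False
    \<comment> \<open>The integral of a function that is not integrable is 0 by definition.\<close>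
    then show ?thesis using B0 by (simp add: not_integrable_integral_eq)
  next
    case True
    have "ennreal \<bar>\<integral>z. f z \<partial>lebesgue\<bar> \<le> (\<integral>\<^sup>+z. ennreal \<bar>f z\<bar> \<partial>lebesgue)"
      using integral_norm_bound_ennreal[OF True] by simp
    also have "\<dots> = (\<integral>\<^sup>+t. (\<integral>\<^sup>+x. ennreal \<bar>f (t, x)\<bar> \<partial>lebesgue) \<partial>lebesgue)"
      by (rule nn_integral_slices) (use f in measurable)
    also have "\<dots> \<le> (\<integral>\<^sup>+t. ennreal B * ennreal \<bar>\<tau> t\<bar> \<partial>lebesgue)"
    proof (rule nn_integral_mono_AE)
      show "AE t in lebesgue. (\<integral>\<^sup>+x. ennreal \<bar>f (t, x)\<bar> \<partial>lebesgue) \<le> ennreal B * ennreal \<bar>\<tau> t\<bar>"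
        using h
      proof eventually_elim
        case (elim t)
        show ?case
        proof (cases "\<tau> t = 0")
          case True
          then show ?thesis by (simp add: f_eq)
        next
          case False
          then have "t \<in> {a..b}" using \<tau>(4) by blast
          then have "t \<in> {0<..<T}" using \<tau>(2,3) by auto
          then obtain H where H: "H \<in> borel_measurable lebesgue" "AE x in lebesgue. ennreal \<bar>h t x\<bar> \<le> H x"
            "(\<integral>\<^sup>+x. H x \<partial>lebesgue) \<le> ennreal B" using elim by blast
          have "(\<integral>\<^sup>+x. ennreal \<bar>f (t, x)\<bar> \<partial>lebesgue) \<le> (\<integral>\<^sup>+x. ennreal \<bar>\<tau> t\<bar> * H x \<partial>lebesgue)"
          proof (rule nn_integral_mono_AE)
            show "AE x in lebesgue. ennreal \<bar>f (t, x)\<bar> \<le> ennreal \<bar>\<tau> t\<bar> * H x"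
              using H(2) by eventually_elim (auto simp: f_eq abs_mult ennreal_mult intro: mult_left_mono)
          qed
          also have "\<dots> = ennreal \<bar>\<tau> t\<bar> * (\<integral>\<^sup>+x. H x \<partial>lebesgue)" by (rule nn_integral_cmult[OF H(1)])
          also have "\<dots> \<le> ennreal \<bar>\<tau> t\<bar> * ennreal B" by (rule mult_left_mono[OF H(3)]) simp
          finally show ?thesis by (simp add: mult.commute)
        qed
      qed
    qed
    also have "\<dots> = (\<integral>\<^sup>+t. ennreal B * ennreal \<bar>\<tau> t\<bar> \<partial>lborel)" by (rule nn_integral_completion)
    also have "\<dots> = ennreal B * (\<integral>\<^sup>+t. ennreal \<bar>\<tau> t\<bar> \<partial>lborel)"
      by (rule nn_integral_cmult) (use smooth_measurable[OF \<tau>(1)] in measurable)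
    also have "(\<integral>\<^sup>+t. ennreal \<bar>\<tau> t\<bar> \<partial>lborel) = ennreal (\<integral>s. \<bar>\<tau> s\<bar> \<partial>lborel)"
      by (rule nn_integral_eq_integral) (use i\<tau> in auto)
    also have "ennreal B * ennreal (\<integral>s. \<bar>\<tau> s\<bar> \<partial>lborel) = ennreal (B * (\<integral>s. \<bar>\<tau> s\<bar> \<partial>lborel))"
      using B by (simp add: ennreal_mult)
    finally show ?thesis using B0 by (simp add: ennreal_le_iff)
  qed
qed

text \<open>By Fubini, testing \<open>v\<close> with the time derivative of a product \<open>\<tau> t * cutoff r x\<close> is testing the continuous
  function \<open>t \<mapsto> \<integral> v t x * cutoff r x\<close> with \<open>deriv \<tau>\<close>.\<close>
lemma balance_lipschitz:
  fixes v :: "real \<Rightarrow> real^3 \<Rightarrow> real"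
  assumes v: "sup_continuous T v" "loc_int (slab T) (case_prod v)" and T: "T > 0" and B: "B \<ge> 0" and r: "r > 0"
    and bound: "\<And>\<tau> a b. smooth \<tau> \<Longrightarrow> 0 < a \<Longrightarrow> b < T \<Longrightarrow> (\<And>s. s \<notin> {a..b} \<Longrightarrow> \<tau> s = 0) \<Longrightarrow>
      \<bar>\<integral>z. case_prod v z * iter_deriv [(1, 0)] (tens (st \<tau> (\<lambda>_. cut r))) z \<partial>lebesgue\<bar> \<le> B * (\<integral>s. \<bar>\<tau> s\<bar> \<partial>lborel)"
    and st: "s \<in> {0..T}" "t \<in> {0..T}"
  shows "\<bar>(\<integral>x. v t x * cutoff r x \<partial>lebesgue) - (\<integral>x. v s x * cutoff r x \<partial>lebesgue)\<bar> \<le> B * \<bar>t - s\<bar>"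
proof -
  define F where "F t = (\<integral>x. v t x * cutoff r x \<partial>lebesgue)" for t
  have Fc: "continuous_on {0..T} F"
    unfolding F_def by (rule sup_continuous_integral(2)[OF v(1) cutoff_integrable[OF r]])
  have "\<bar>F t - F s\<bar> \<le> B * \<bar>t - s\<bar>"
  proof (rule time_lipschitz[OF Fc T B _ st])
    fix \<tau> a b assume \<tau>: "smooth \<tau>" "0 < a" "b < T" "\<And>s. s \<notin> {a..b} \<Longrightarrow> \<tau> s = (0::real)"
    have dz: "deriv \<tau> s = 0" if "s \<notin> {0..T}" for s
      by (rule deriv_zero_outside[OF \<tau>(4)]) (use that \<tau>(2,3) in auto)
    have eq: "iter_deriv [(1, 0)] (tens (st \<tau> (\<lambda>_. cut r))) = tens (st (deriv \<tau>) (\<lambda>_. cut r))"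
      by (rule iter_deriv_st_time[OF \<tau>(1) smooth_cut])
    have "(\<integral>z. case_prod v z * iter_deriv [(1, 0)] (tens (st \<tau> (\<lambda>_. cut r))) z \<partial>lebesgue) = (\<integral>s. F s * deriv \<tau> s \<partial>lebesgue)"
    proof (rule integral_slices)
      have "tens (st (deriv \<tau>) (\<lambda>_. cut r)) \<in> test_fun (slab T)"
        by (rule st_test_fun[OF smooth_deriv[OF \<tau>(1)] \<tau>(2,3) deriv_zero_outside[OF \<tau>(4)] smooth_cut cut_eq_0[OF r]])
      from test_fun_integrable[OF this v(2)]
      show "integrable lebesgue (\<lambda>z. case_prod v z * iter_deriv [(1, 0)] (tens (st \<tau> (\<lambda>_. cut r))) z)"
        unfolding eq by (simp add: mult.commute)
      have "(\<lambda>s. indicator {0..T} s *\<^sub>R F s) \<in> borel_measurable borel"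
        by (rule borel_measurable_continuous_on_indicator[OF _ Fc]) simp
      then have "(\<lambda>s. (indicator {0..T} s *\<^sub>R F s) * deriv \<tau> s) \<in> borel_measurable borel"
        using smooth_measurable[OF smooth_deriv[OF \<tau>(1)]] by (rule borel_measurable_times)
      also have "(\<lambda>s. (indicator {0..T} s *\<^sub>R F s) * deriv \<tau> s) = (\<lambda>s. F s * deriv \<tau> s)"
        by (rule ext, subst indicator_def) (use dz in auto)
      finally show "(\<lambda>s. F s * deriv \<tau> s) \<in> borel_measurable lebesgue" by (intro measurable_completion) simp
      show "AE t in lebesgue. F t * deriv \<tau> t = (\<integral>x. case_prod v (t, x) * iter_deriv [(1, 0)] (tens (st \<tau> (\<lambda>_. cut r))) (t, x) \<partial>lebesgue)"
      proof (rule AE_I2)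
        fix t
        have "(\<lambda>x. case_prod v (t, x) * iter_deriv [(1, 0)] (tens (st \<tau> (\<lambda>_. cut r))) (t, x)) = (\<lambda>x. (v t x * cutoff r x) * deriv \<tau> t)"
          unfolding eq tens_st by (simp add: cutoff_def mult_ac)
        then show "F t * deriv \<tau> t = (\<integral>x. case_prod v (t, x) * iter_deriv [(1, 0)] (tens (st \<tau> (\<lambda>_. cut r))) (t, x) \<partial>lebesgue)"
          by (simp only: F_def integral_mult_left_zero)
      qed
      fix t
      have eq2: "(\<lambda>x. case_prod v (t, x) * iter_deriv [(1, 0)] (tens (st \<tau> (\<lambda>_. cut r))) (t, x)) = (\<lambda>x. (v t x * cutoff r x) * deriv \<tau> t)"
        unfolding eq tens_st by (simp add: cutoff_def mult_ac)
      show "(\<lambda>x. case_prod v (t, x) * iter_deriv [(1, 0)] (tens (st \<tau> (\<lambda>_. cut r))) (t, x)) \<in> borel_measurable lebesgue"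
        unfolding eq2
      proof (cases "t \<in> {0..T}")
        case True
        then show "(\<lambda>x. (v t x * cutoff r x) * deriv \<tau> t) \<in> borel_measurable lebesgue"
          using sup_continuous_integral(1)[OF v(1) cutoff_integrable[OF r]] by auto
      next
        case False
        then show "(\<lambda>x. (v t x * cutoff r x) * deriv \<tau> t) \<in> borel_measurable lebesgue" using dz by simp
      qed
    qed
    with bound[OF \<tau>] show "\<bar>\<integral>s. F s * deriv \<tau> s \<partial>lebesgue\<bar> \<le> B * (\<integral>s. \<bar>\<tau> s\<bar> \<partial>lborel)" by simp
  qed
  then show ?thesis by (simp add: F_def)
qed

section \<open>The mass does not grow\<close>

text \<open>What the laws for mass and momentum need of the density and the velocity of a regular solution.\<close>
locale bounded_flow =
  fixes T :: real and \<rho> :: "real \<Rightarrow> real^3 \<Rightarrow> real" and u :: "real \<Rightarrow> real^3 \<Rightarrow> real^3"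
  assumes T: "T > 0"
    and mass_eq: "cns.mass_eq T (case_prod \<rho>) (case_prod u)"
    and rho: "sup_continuous T \<rho>" and u: "sup_continuous T u"
    and pos: "\<And>t. t \<in> {0..T} \<Longrightarrow> AE x in lebesgue. 0 \<le> \<rho> t x"
begin

lemma rho_measurable: "t \<in> {0..T} \<Longrightarrow> \<rho> t \<in> borel_measurable lebesgue"
  and u_measurable: "t \<in> {0..T} \<Longrightarrow> u t \<in> borel_measurable lebesgue"
  using sup_continuousD(1) rho u by blast+

lemma loc_int_rho: "loc_int (slab T) (case_prod \<rho>)"
  using mass_eq by (simp add: cns.mass_eq_def)

lemma loc_int_rho_u: "loc_int (slab T) (\<lambda>z. case_prod \<rho> z * case_prod u z $ j)"
proof -
  have "loc_int (slab T) (\<lambda>z. case_prod \<rho> z *\<^sub>R case_prod u z)" using mass_eq by (simp add: cns.mass_eq_def)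
  then show ?thesis unfolding loc_int_def
  proof (intro allI impI)
    fix Y assume *: "\<forall>K. compact K \<and> K \<subseteq> slab T \<longrightarrow> (\<lambda>z. case_prod \<rho> z *\<^sub>R case_prod u z) absolutely_integrable_on K"
      and Y: "compact Y \<and> Y \<subseteq> slab T"
    then have "integrable lebesgue (\<lambda>x. indicator Y x *\<^sub>R (case_prod \<rho> x *\<^sub>R case_prod u x))"
      by (simp add: set_integrable_def)
    from integrable_bounded_linear[OF bounded_linear_vec_nth[of j] this]
    show "(\<lambda>z. case_prod \<rho> z * case_prod u z $ j) absolutely_integrable_on Y"
      by (simp add: set_integrable_def mult.assoc)
  qed
qed

lemma mass_test:
  assumes "\<phi> \<in> test_fun (slab T)"
  shows "(\<integral>z. case_prod \<rho> z * iter_deriv [(1, 0)] \<phi> z \<partial>lebesgue)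
     + (\<Sum>j\<in>UNIV. \<integral>z. (case_prod \<rho> z * case_prod u z $ j) * iter_deriv [(0, axis j 1)] \<phi> z \<partial>lebesgue) = 0"
proof -
  have "dist_deriv (1, 0) (dist_of (case_prod \<rho>)) \<phi>
        + (\<Sum>j\<in>UNIV. dist_deriv (0, axis j 1) (dist_of (\<lambda>z. case_prod \<rho> z * case_prod u z $ j)) \<phi>) = 0"
    using mass_eq assms unfolding cns.mass_eq_def by blast
  then show ?thesis
    by (simp add: dist_deriv_def dist_of_def sum_negf del: iter_deriv.simps)
qed

text \<open>The mass equation is tested with a cut-off whose gradient is at most \<open>C / r\<close>, on the cube of size \<open>2 * r\<close>
  and zero elsewhere; hence only the mass \<open>q\<close> in that cube enters.\<close>
lemma mass_lipschitz:
  assumes U: "U \<ge> 0" "\<And>t. t \<in> {0..T} \<Longrightarrow> AE x in lebesgue. norm (u t x) \<le> U"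
    and C: "C > 0" "\<And>r s. r > 0 \<Longrightarrow> \<bar>deriv (cut r) s\<bar> \<le> C / r" and r: "r > 0"
    and q: "q \<ge> 0" "\<And>t. t \<in> {0..T} \<Longrightarrow> (\<integral>\<^sup>+x. ennreal (indicator (cube (2 * r)) x * \<rho> t x) \<partial>lebesgue) \<le> ennreal q"
    and st: "s \<in> {0..T}" "t \<in> {0..T}"
  shows "\<bar>(\<integral>x. \<rho> t x * cutoff r x \<partial>lebesgue) - (\<integral>x. \<rho> s x * cutoff r x \<partial>lebesgue)\<bar> \<le> 3 * (U * (C / r) * q) * \<bar>t - s\<bar>"
proof (rule balance_lipschitz[OF rho loc_int_rho T _ r _ st])
  show "0 \<le> 3 * (U * (C / r) * q)" using U C r q by simp
  fix \<tau> a b assume \<tau>: "smooth \<tau>" "0 < a" "b < T" "\<And>s. s \<notin> {a..b} \<Longrightarrow> \<tau> s = (0::real)"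
  have tf: "tens (st \<tau> (\<lambda>_. cut r)) \<in> test_fun (slab T)"
    by (rule st_test_fun[OF \<tau> smooth_cut cut_eq_0[OF r]])
  have d: "iter_deriv [(0, axis j 1)] (tens (st \<tau> (\<lambda>_. cut r))) = tens (st \<tau> ((\<lambda>_. cut r)(axis j 1 := deriv (cut r))))" for j
    by (rule iter_deriv_st_space[OF \<tau>(1) smooth_cut]) (simp add: axis_in_Basis_iff)
  have j: "\<bar>\<integral>z. (case_prod \<rho> z * case_prod u z $ j) * iter_deriv [(0, axis j 1)] (tens (st \<tau> (\<lambda>_. cut r))) z \<partial>lebesgue\<bar>
      \<le> (U * (C / r) * q) * (\<integral>s. \<bar>\<tau> s\<bar> \<partial>lborel)" for j
  proof (rule slab_integral_bound[OF _ \<tau>, where h="\<lambda>t x. (\<rho> t x * u t x $ j) * cutoff_deriv r (axis j 1) x"])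
    have "iter_deriv [(0, axis j 1)] (tens (st \<tau> (\<lambda>_. cut r))) \<in> test_fun (slab T)"
      unfolding d
    proof (rule st_test_fun[OF \<tau>])
      show "smooth (((\<lambda>_. cut r)(axis j 1 := deriv (cut r))) v)" for v by (simp add: smooth_cut smooth_deriv)
      show "((\<lambda>_. cut r)(axis j 1 := deriv (cut r))) v s = 0" if "s \<notin> {- (2 * r)..2 * r}" for v s
        using cut_eq_0[OF r that] deriv_zero_outside[of "- (2 * r)" "2 * r" "cut r" s, OF cut_eq_0[OF r] that] by auto
    qed
    from test_fun_integrable[OF this loc_int_rho_u[of j]]
    show "(\<lambda>z. (case_prod \<rho> z * case_prod u z $ j) * iter_deriv [(0, axis j 1)] (tens (st \<tau> (\<lambda>_. cut r))) z) \<in> borel_measurable lebesgue"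
      by (simp add: mult.commute del: iter_deriv.simps)
    show "0 \<le> U * (C / r) * q" using U C r q by simp
    show "(case_prod \<rho> (t, x) * case_prod u (t, x) $ j) * iter_deriv [(0, axis j 1)] (tens (st \<tau> (\<lambda>_. cut r))) (t, x)
        = \<tau> t * ((\<rho> t x * u t x $ j) * cutoff_deriv r (axis j 1) x)" for t x
      unfolding d tens_st cutoff_deriv_def by (simp add: mult_ac)
    show "AE t in lebesgue. t \<in> {0<..<T} \<longrightarrow> (\<exists>H\<in>borel_measurable lebesgue.
       (AE x in lebesgue. ennreal \<bar>\<rho> t x * u t x $ j * cutoff_deriv r (axis j 1) x\<bar> \<le> H x) \<and> (\<integral>\<^sup>+x. H x \<partial>lebesgue) \<le> ennreal (U * (C / r) * q))"
    proof (intro AE_I2 impI)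
      fix t assume "t \<in> {0<..<T}"
      then have t: "t \<in> {0..T}" by auto
      let ?H = "\<lambda>x. ennreal (U * (C / r)) * ennreal (indicator (cube (2 * r)) x * \<rho> t x)"
      have [measurable]: "\<rho> t \<in> borel_measurable lebesgue" by (rule rho_measurable[OF t])
      have b1: "AE x in lebesgue. ennreal \<bar>\<rho> t x * u t x $ j * cutoff_deriv r (axis j 1) x\<bar> \<le> ?H x"
        using U(2)[OF t] pos[OF t]
      proof eventually_elim
        case (elim x)
        have "\<bar>u t x $ j\<bar> \<le> U" using elim component_le_norm_cart[of "u t x" j] by linarith
        moreover have "\<bar>cutoff_deriv r (axis j 1) x\<bar> \<le> C / r * indicator (cube (2 * r)) x"
          by (rule cutoff_deriv_bound[OF C(2) r]) (simp_all add: axis_in_Basis_iff)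
        ultimately have "\<bar>u t x $ j\<bar> * \<bar>cutoff_deriv r (axis j 1) x\<bar> \<le> U * (C / r * indicator (cube (2 * r)) x)"
          using U(1) by (intro mult_mono) auto
        then have "\<rho> t x * (\<bar>u t x $ j\<bar> * \<bar>cutoff_deriv r (axis j 1) x\<bar>) \<le> \<rho> t x * (U * (C / r * indicator (cube (2 * r)) x))"
          using elim by (intro mult_left_mono) auto
        then have "\<bar>\<rho> t x * u t x $ j * cutoff_deriv r (axis j 1) x\<bar> \<le> (U * (C / r)) * (indicator (cube (2 * r)) x * \<rho> t x)"
          using elim by (simp add: abs_mult mult_ac)
        from ennreal_leI[OF this] show ?case
          using U C r elim by (subst ennreal_mult[symmetric]) auto
      qed
      have "(\<integral>\<^sup>+x. ?H x \<partial>lebesgue) = ennreal (U * (C / r)) * (\<integral>\<^sup>+x. ennreal (indicator (cube (2 * r)) x * \<rho> t x) \<partial>lebesgue)"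
        by (rule nn_integral_cmult) measurable
      also have "\<dots> \<le> ennreal (U * (C / r)) * ennreal q" by (rule mult_left_mono[OF q(2)[OF t]]) simp
      also have "\<dots> = ennreal (U * (C / r) * q)" using U C r q by (intro ennreal_mult[symmetric]) auto
      finally have b2: "(\<integral>\<^sup>+x. ?H x \<partial>lebesgue) \<le> ennreal (U * (C / r) * q)" .
      have b3: "?H \<in> borel_measurable lebesgue" by measurable
      show "\<exists>H\<in>borel_measurable lebesgue. (AE x in lebesgue. ennreal \<bar>\<rho> t x * u t x $ j * cutoff_deriv r (axis j 1) x\<bar> \<le> H x)
          \<and> (\<integral>\<^sup>+x. H x \<partial>lebesgue) \<le> ennreal (U * (C / r) * q)"
        using b1 b2 b3 by (intro bexI[of _ ?H] conjI)
    qed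
  qed
  have "\<bar>\<integral>z. case_prod \<rho> z * iter_deriv [(1, 0)] (tens (st \<tau> (\<lambda>_. cut r))) z \<partial>lebesgue\<bar>
      = \<bar>\<Sum>j\<in>UNIV. \<integral>z. (case_prod \<rho> z * case_prod u z $ j) * iter_deriv [(0, axis j 1)] (tens (st \<tau> (\<lambda>_. cut r))) z \<partial>lebesgue\<bar>"
    using mass_test[OF tf] by linarith
  also have "\<dots> \<le> (\<Sum>j\<in>UNIV. \<bar>\<integral>z. (case_prod \<rho> z * case_prod u z $ j) * iter_deriv [(0, axis j 1)] (tens (st \<tau> (\<lambda>_. cut r))) z \<partial>lebesgue\<bar>)"
    by (rule sum_abs)
  also have "\<dots> \<le> (\<Sum>j\<in>(UNIV :: 3 set). (U * (C / r) * q) * (\<integral>s. \<bar>\<tau> s\<bar> \<partial>lborel))" by (rule sum_mono) (rule j)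
  also have "\<dots> = 3 * (U * (C / r) * q) * (\<integral>s. \<bar>\<tau> s\<bar> \<partial>lborel)" by simp
  finally show "\<bar>\<integral>z. case_prod \<rho> z * iter_deriv [(1, 0)] (tens (st \<tau> (\<lambda>_. cut r))) z \<partial>lebesgue\<bar>
      \<le> 3 * (U * (C / r) * q) * (\<integral>s. \<bar>\<tau> s\<bar> \<partial>lborel)" .
qed

end

lemma emeasure_cube: "r \<ge> 0 \<Longrightarrow> emeasure lebesgue (cube r) = ennreal (8 * r ^ 3)"
proof -
  assume r: "r \<ge> 0"
  have "emeasure lborel (cube r) = ennreal (\<Prod>b\<in>Basis. ((r *\<^sub>R One) - (- (r *\<^sub>R (One :: real^3)))) \<bullet> b)"
    unfolding cube_def by (rule emeasure_lborel_cbox) (use r in simp)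
  also have "(\<Prod>b\<in>Basis. ((r *\<^sub>R One) - (- (r *\<^sub>R (One :: real^3)))) \<bullet> b) = (\<Prod>b\<in>(Basis::(real^3) set). 2 * r)"
    by (intro prod.cong refl) (simp only: inner_diff_left inner_minus_left inner_scaleR_left, simp)
  also have "\<dots> = 8 * r ^ 3" by (simp add: power_mult_distrib)
  finally show ?thesis by (simp add: cube_def)
qed

context bounded_flow
begin

text \<open>A bound of order \<open>r ^ Suc k\<close> for the mass in cubes of size \<open>r\<close> limits the flux through the cut-off
  region to order \<open>r ^ k\<close>, and with it the mass itself.  Starting from the exponent 3, which comes from the
  boundedness of the density, three such steps bound the mass; a fourth one shows that the flux through the
  cut-off region tends to 0 as \<open>r\<close> grows.\<close>
proposition mass_le:
  assumes m0: "m0 \<ge> 0" "(\<integral>\<^sup>+x. ennreal (\<rho> 0 x) \<partial>lebesgue) \<le> ennreal m0" and t: "t \<in> {0..T}"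
  shows "(\<integral>\<^sup>+x. ennreal (\<rho> t x) \<partial>lebesgue) \<le> ennreal m0"
proof -
  obtain U where U: "U > 0" "\<And>t. t \<in> {0..T} \<Longrightarrow> AE x in lebesgue. norm (u t x) \<le> U"
    using sup_continuous_bound[OF u] by metis
  obtain M where M: "M > 0" "\<And>t. t \<in> {0..T} \<Longrightarrow> AE x in lebesgue. norm (\<rho> t x) \<le> M"
    using sup_continuous_bound[OF rho] by metis
  obtain C where C: "C > 0" "\<And>r s. r > 0 \<Longrightarrow> \<bar>deriv (cut r) s\<bar> \<le> C / r" using deriv_cut_bound by metis
  define F where "F r t = (\<integral>x. \<rho> t x * cutoff r x \<partial>lebesgue)" for r t
  define N where "N r t = (\<integral>\<^sup>+x. ennreal (indicator (cube r) x * \<rho> t x) \<partial>lebesgue)" for r t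
  have T0: "0 \<in> {0..T}" using T by simp
  have F_eq: "ennreal (F r t) = (\<integral>\<^sup>+x. ennreal (\<rho> t x * cutoff r x) \<partial>lebesgue)" if "r > 0" "t \<in> {0..T}" for r t
    unfolding F_def
    by (rule nn_integral_eq_integral[symmetric, OF sup_continuous_integral(1)[OF rho cutoff_integrable[OF that(1)] that(2)]])
       (use pos[OF that(2)] cutoff_bounds in \<open>auto elim!: eventually_mono\<close>)
  have F_nonneg: "F r t \<ge> 0" if "r > 0" "t \<in> {0..T}" for r t
    unfolding F_def by (rule integral_nonneg_AE) (use pos[OF that(2)] cutoff_bounds in \<open>auto elim!: eventually_mono\<close>)
  have N_le: "N r t \<le> ennreal (F r t)" if "r > 0" "t \<in> {0..T}" for r t
    unfolding F_eq[OF that] N_def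
  proof (rule nn_integral_mono_AE)
    show "AE x in lebesgue. ennreal (indicator (cube r) x * \<rho> t x) \<le> ennreal (\<rho> t x * cutoff r x)"
      using pos[OF that(2)]
    proof eventually_elim
      case (elim x)
      then show ?case using cutoff_eq_1[OF that(1), of x] cutoff_bounds[of r x]
        by (cases "x \<in> cube r") (auto intro!: ennreal_leI)
    qed
  qed
  have F0: "F r 0 \<le> m0" if "r > 0" for r
  proof -
    have "ennreal (F r 0) \<le> (\<integral>\<^sup>+x. ennreal (\<rho> 0 x) \<partial>lebesgue)"
      unfolding F_eq[OF that T0]
    proof (rule nn_integral_mono_AE)
      show "AE x in lebesgue. ennreal (\<rho> 0 x * cutoff r x) \<le> ennreal (\<rho> 0 x)"
        using pos[OF T0]
      proof eventually_elim
        case (elim x)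
        then show ?case using mult_left_mono[OF cutoff_bounds(2)[of r x], of "\<rho> 0 x"] by (auto intro!: ennreal_leI)
      qed
    qed
    also have "\<dots> \<le> ennreal m0" by (rule m0)
    finally show ?thesis using m0(1) by (simp add: ennreal_le_iff)
  qed
  have step: "N r t \<le> ennreal (m0 + 3 * (U * (C / r) * q) * T)"
    if r: "r > 0" and q: "q \<ge> 0" "\<And>t. t \<in> {0..T} \<Longrightarrow> N (2 * r) t \<le> ennreal q" and t: "t \<in> {0..T}" for r q t
  proof -
    have "\<bar>F r t - F r 0\<bar> \<le> 3 * (U * (C / r) * q) * \<bar>t - 0\<bar>"
      unfolding F_def
      by (rule mass_lipschitz[OF _ U(2) C r q(1) _ T0 t]) (use U(1) q(2) in \<open>auto simp: N_def\<close>)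
    also have "\<dots> \<le> 3 * (U * (C / r) * q) * T"
      using U C r q t by (intro mult_left_mono) auto
    finally have "F r t \<le> m0 + 3 * (U * (C / r) * q) * T" using F0[OF r] by linarith
    then show ?thesis using N_le[OF r t] by (meson ennreal_leI order_trans)
  qed
  \<comment> \<open>The mass in cubes of size \<open>r\<close> grows at most like \<open>r ^ k\<close>, uniformly in time.\<close>
  define P where "P k \<longleftrightarrow> (\<exists>A\<ge>0. \<forall>r\<ge>1. \<forall>t\<in>{0..T}. N r t \<le> ennreal (A * r ^ k))" for k :: nat
  have P3: "P 3"
    unfolding P_def
  proof (intro exI[of _ "8 * M"] conjI allI impI ballI)
    fix r t assume r: "1 \<le> (r::real)" and t: "t \<in> {0..T}"
    have "N r t \<le> (\<integral>\<^sup>+x. ennreal M * indicator (cube r) x \<partial>lebesgue)"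
      unfolding N_def
    proof (rule nn_integral_mono_AE)
      show "AE x in lebesgue. ennreal (indicator (cube r) x * \<rho> t x) \<le> ennreal M * indicator (cube r) x"
        using M(2)[OF t] by eventually_elim (auto simp: indicator_def intro!: ennreal_leI)
    qed
    also have "\<dots> = ennreal M * ennreal (8 * r ^ 3)"
      using r by (simp only: nn_integral_cmult_indicator[OF cube_measurable] emeasure_cube)
    also have "\<dots> = ennreal (8 * M * r ^ 3)" using M r by (simp add: ennreal_mult[symmetric] mult_ac)
    finally show "N r t \<le> ennreal (8 * M * r ^ 3)" .
  qed (use M(1) in simp)
  have PS: "P k" if "P (Suc k)" for k
  proof -
    from that obtain A where A': "A \<ge> 0 \<and> (\<forall>r\<ge>1. \<forall>t\<in>{0..T}. N r t \<le> ennreal (A * r ^ Suc k))"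
      unfolding P_def by (elim exE)
    have A: "A \<ge> 0" "\<And>r t. r \<ge> 1 \<Longrightarrow> t \<in> {0..T} \<Longrightarrow> N r t \<le> ennreal (A * r ^ Suc k)"
      using A' by simp_all
    show ?thesis unfolding P_def
    proof (intro exI[of _ "m0 + 3 * U * C * A * 2 ^ Suc k * T"] conjI allI impI ballI)
      show "0 \<le> m0 + 3 * U * C * A * 2 ^ Suc k * T" using m0(1) U(1) C(1) A(1) T by simp
      fix r t assume r: "1 \<le> (r::real)" and t: "t \<in> {0..T}"
      have "N r t \<le> ennreal (m0 + 3 * (U * (C / r) * (A * (2 * r) ^ Suc k)) * T)"
      proof (rule step[OF _ _ _ t])
        show "0 < r" using r by simp
        show "0 \<le> A * (2 * r) ^ Suc k" using r A(1) by simp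
        show "N (2 * r) t \<le> ennreal (A * (2 * r) ^ Suc k)" if "t \<in> {0..T}" for t
          by (rule A(2)[OF _ that]) (use r in simp)
      qed
      also have "\<dots> \<le> ennreal ((m0 + 3 * U * C * A * 2 ^ Suc k * T) * r ^ k)"
      proof (rule ennreal_leI)
        have "3 * (U * (C / r) * (A * (2 * r) ^ Suc k)) * T = (3 * U * C * A * 2 ^ Suc k * T) * r ^ k"
          using r by (simp add: power_mult_distrib)
        moreover have "m0 * 1 \<le> m0 * r ^ k" using m0(1) r by (intro mult_left_mono) auto
        ultimately show "m0 + 3 * (U * (C / r) * (A * (2 * r) ^ Suc k)) * T \<le> (m0 + 3 * U * C * A * 2 ^ Suc k * T) * r ^ k"
          unfolding distrib_right by linarith
      qed
      finally show "N r t \<le> ennreal ((m0 + 3 * U * C * A * 2 ^ Suc k * T) * r ^ k)" .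
    qed
  qed
  have "P (Suc (Suc (Suc 0)))" using P3 by (simp only: numeral_3_eq_3)
  then have "P 0" by (rule PS[OF PS[OF PS]])
  then obtain A where A': "A \<ge> 0 \<and> (\<forall>r\<ge>1. \<forall>t\<in>{0..T}. N r t \<le> ennreal (A * r ^ 0))"
    unfolding P_def by (elim exE)
  have A: "A \<ge> 0" "\<And>r t. r \<ge> 1 \<Longrightarrow> t \<in> {0..T} \<Longrightarrow> N r t \<le> ennreal A"
    using A' by simp_all
  have bound: "N (real (Suc n)) t \<le> ennreal (m0 + 3 * U * C * A * T * (1 / real (Suc n)))" for n
  proof -
    have "N (real (Suc n)) t \<le> ennreal (m0 + 3 * (U * (C / real (Suc n)) * A) * T)"
    proof (rule step[OF _ A(1) _ t])
      show "N (2 * real (Suc n)) t \<le> ennreal A" if "t \<in> {0..T}" for t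
        by (rule A(2)[OF _ that]) simp
    qed simp
    then show ?thesis by (simp add: mult_ac)
  qed
  have "(\<lambda>n. N (real (Suc n)) t) \<longlonglongrightarrow> (\<integral>\<^sup>+x. ennreal (\<rho> t x) \<partial>lebesgue)"
    unfolding N_def
  proof (rule nn_integral_LIMSEQ)
    have [measurable]: "\<rho> t \<in> borel_measurable lebesgue" by (rule rho_measurable[OF t])
    show "(\<lambda>x. ennreal (indicator (cube (real (Suc n))) x * \<rho> t x)) \<in> borel_measurable lebesgue" for n
      by measurable
    show "incseq (\<lambda>n x. ennreal (indicator (cube (real (Suc n))) x * \<rho> t x))"
    proof (intro incseq_SucI le_funI)
      fix n and x :: "real^3"
      have "x \<in> cube (real (Suc (Suc n)))" if "x \<in> cube (real (Suc n))"
        using that unfolding cube_iff by fastforce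
      then show "ennreal (indicator (cube (real (Suc n))) x * \<rho> t x) \<le> ennreal (indicator (cube (real (Suc (Suc n)))) x * \<rho> t x)"
        by (cases "x \<in> cube (real (Suc n))") auto
    qed
    fix x :: "real^3"
    obtain k :: nat where k: "norm x \<le> real k" using real_arch_simple by blast
    have "eventually (\<lambda>n. ennreal (\<rho> t x) = ennreal (indicator (cube (real (Suc n))) x * \<rho> t x)) sequentially"
    proof (rule eventually_sequentiallyI[of k])
      fix n assume "k \<le> n"
      have "x \<in> cube (real (Suc n))"
        unfolding cube_iff
      proof
        fix b :: "real^3" assume "b \<in> Basis"
        then have "\<bar>x \<bullet> b\<bar> \<le> norm x" by (rule Basis_le_norm)
        also have "\<dots> \<le> real (Suc n)" using k \<open>k \<le> n\<close> by linarith
        finally show "\<bar>x \<bullet> b\<bar> \<le> real (Suc n)" .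
      qed
      then show "ennreal (\<rho> t x) = ennreal (indicator (cube (real (Suc n))) x * \<rho> t x)" by simp
    qed
    then show "(\<lambda>n. ennreal (indicator (cube (real (Suc n))) x * \<rho> t x)) \<longlonglongrightarrow> ennreal (\<rho> t x)"
      by (rule Lim_transform_eventually[OF tendsto_const])
  qed
  moreover have "(\<lambda>n. ennreal (m0 + 3 * U * C * A * T * (1 / real (Suc n)))) \<longlonglongrightarrow> ennreal (m0 + 3 * U * C * A * T * 0)"
    by (intro tendsto_ennrealI tendsto_intros LIMSEQ_Suc lim_1_over_n)
  ultimately have "(\<integral>\<^sup>+x. ennreal (\<rho> t x) \<partial>lebesgue) \<le> ennreal (m0 + 3 * U * C * A * T * 0)"
    using bound by (intro LIMSEQ_le) auto
  then show ?thesis by simp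
qed

end

section \<open>Conservation of momentum\<close>

lemma loc_int_component:
  fixes v :: "'a::euclidean_space \<Rightarrow> real^3"
  assumes "loc_int \<Omega> v"
  shows "loc_int \<Omega> (\<lambda>z. v z $ i)"
  unfolding loc_int_def
proof (intro allI impI)
  fix Y assume "compact Y \<and> Y \<subseteq> \<Omega>"
  then have "integrable lebesgue (\<lambda>x. indicator Y x *\<^sub>R v x)" using loc_intD[OF assms] by blast
  from integrable_bounded_linear[OF bounded_linear_vec_nth[of i] this]
  show "(\<lambda>z. v z $ i) absolutely_integrable_on Y" by (simp add: set_integrable_def)
qed

lemma iter_deriv_append: "iter_deriv (ws @ vs) \<phi> = iter_deriv ws (iter_deriv vs \<phi>)"
  by (induction ws) auto

lemma iter_deriv_zero_outside:
  assumes "closed W" "\<And>x. x \<notin> W \<Longrightarrow> \<phi> x = 0" "x \<notin> W"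
  shows "iter_deriv vs \<phi> x = 0"
  using assms(3)
proof (induction vs arbitrary: x)
  case Nil
  then show ?case using assms(2) by simp
next
  case (Cons v vs)
  have "((\<lambda>_. 0) has_derivative (\<lambda>_. 0)) (at x)" by simp
  then have "(iter_deriv vs \<phi> has_derivative (\<lambda>_. 0)) (at x)"
    by (rule has_derivative_transform_within_open[of _ _ _ _ "- W"]) (use assms(1) Cons in auto)
  from frechet_derivative_at[OF this] show ?case by (metis iter_deriv.simps(2))
qed

lemma iter_deriv_test_fun:
  assumes "\<phi> \<in> test_fun \<Omega>" "set vs \<subseteq> Basis"
  shows "iter_deriv vs \<phi> \<in> test_fun \<Omega>"
proof -
  obtain W where W: "compact W" "W \<subseteq> \<Omega>" "\<And>x. x \<notin> W \<Longrightarrow> \<phi> x = 0"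
    using assms(1) by (auto simp: test_fun_def)
  show ?thesis unfolding test_fun_def
  proof (intro CollectI conjI allI impI exI[of _ W])
    fix ws :: "'a list" and x assume "set ws \<subseteq> Basis"
    then have "set (ws @ vs) \<subseteq> Basis" using assms(2) by simp
    then have "iter_deriv (ws @ vs) \<phi> differentiable at x" using assms(1) unfolding test_fun_def by blast
    then show "iter_deriv ws (iter_deriv vs \<phi>) differentiable at x" by (simp only: iter_deriv_append)
  qed (use W iter_deriv_zero_outside[OF compact_imp_closed[OF W(1)] W(3)] in auto)
qed

lemma has_weak_deriv_component:
  fixes u :: "'a::euclidean_space \<Rightarrow> real^3"
  assumes "has_weak_deriv \<Omega> vs u g" "set vs \<subseteq> Basis"
  shows "has_weak_deriv \<Omega> vs (\<lambda>z. u z $ i) (\<lambda>z. g z $ i)"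
proof -
  have u: "loc_int \<Omega> u" and g: "loc_int \<Omega> g" using assms by (auto simp: has_weak_deriv_def)
  show ?thesis unfolding has_weak_deriv_def
  proof (intro conjI ballI)
    show "loc_int \<Omega> (\<lambda>z. u z $ i)" "loc_int \<Omega> (\<lambda>z. g z $ i)"
      by (rule loc_int_component[OF u], rule loc_int_component[OF g])
    fix \<phi> :: "'a \<Rightarrow> real" assume \<phi>: "\<phi> \<in> test_fun \<Omega>"
    have c: "(\<integral>x. \<psi> x *\<^sub>R v x \<partial>lebesgue) $ i = (\<integral>x. \<psi> x *\<^sub>R v x $ i \<partial>lebesgue)"
      if "\<psi> \<in> test_fun \<Omega>" "loc_int \<Omega> v" for \<psi> :: "'a \<Rightarrow> real" and v :: "'a \<Rightarrow> real^3"
      using integral_bounded_linear[OF bounded_linear_vec_nth[of i] test_fun_integrable[OF that]] by simp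
    have "(\<integral>x. iter_deriv vs \<phi> x *\<^sub>R u x \<partial>lebesgue) = (-1) ^ length vs *\<^sub>R (\<integral>x. \<phi> x *\<^sub>R g x \<partial>lebesgue)"
      using assms \<phi> unfolding has_weak_deriv_def by blast
    from arg_cong[OF this, of "\<lambda>y. y $ i"]
    show "(\<integral>x. iter_deriv vs \<phi> x *\<^sub>R u x $ i \<partial>lebesgue) = (-1) ^ length vs *\<^sub>R (\<integral>x. \<phi> x *\<^sub>R g x $ i \<partial>lebesgue)"
      by (simp add: c[OF iter_deriv_test_fun[OF \<phi> assms(2)] u] c[OF \<phi> g])
  qed
qed

lemma weakly_diff_wderiv:
  assumes "weakly_diff \<Omega> vs f"
  shows "has_weak_deriv \<Omega> vs f (wderiv \<Omega> vs f)"
  using assms unfolding weakly_diff_def wderiv_def by (rule someI_ex)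

lemma et_Basis: "(1, 0) \<in> (Basis :: (real \<times> (real^3)) set)"
  and ex_Basis: "(0, axis j 1) \<in> (Basis :: (real \<times> (real^3)) set)"
  by (auto simp: Basis_prod_def axis_in_Basis_iff)

text \<open>Near each time the norm stays within 1 of its value there; finitely many such neighbourhoods cover the
  compact time interval.\<close>
lemma C_in_L2_bound:
  fixes f :: "real \<Rightarrow> real^3 \<Rightarrow> 'b::euclidean_space"
  assumes "C_in T (Lp 2) f"
  obtains W where "W \<ge> 0" "\<And>t. t \<in> {0..T} \<Longrightarrow> f t \<in> borel_measurable lebesgue"
    "\<And>t. t \<in> {0..T} \<Longrightarrow> (\<integral>\<^sup>+x. ennreal ((norm (f t x))\<^sup>2) \<partial>lebesgue) \<le> ennreal W"
proof -
  have fin: "Lp 2 (f t) < \<infinity>" if "t \<in> {0..T}" for t using assms that by (auto simp: C_in_def)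
  have sq: "g \<in> borel_measurable lebesgue" "(\<integral>\<^sup>+x. ennreal ((norm (g x))\<^sup>2) \<partial>lebesgue) \<le> ennreal (\<epsilon>\<^sup>2)"
    if "Lp 2 g < ennreal \<epsilon>" "\<epsilon> > 0" for g :: "real^3 \<Rightarrow> 'b" and \<epsilon>
    using Lp_less[OF that(1) _ that(2)] that(2) by (auto simp: powr_numeral)
  have meas: "f t \<in> borel_measurable lebesgue" if "t \<in> {0..T}" for t
    using ex_ennreal_greater[OF fin[OF that]] sq(1) by blast
  have "\<exists>d B. d > 0 \<and> B \<ge> 0 \<and> (\<forall>t\<in>{0..T}. \<bar>t - s\<bar> < d \<longrightarrow> (\<integral>\<^sup>+x. ennreal ((norm (f t x))\<^sup>2) \<partial>lebesgue) \<le> ennreal B)"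
    if s: "s \<in> {0..T}" for s
  proof -
    obtain \<epsilon> where \<epsilon>: "\<epsilon> > 0" "Lp 2 (f s) < ennreal \<epsilon>" using ex_ennreal_greater[OF fin[OF s]] by blast
    have "((\<lambda>t. Lp 2 (\<lambda>x. f t x - f s x)) \<longlongrightarrow> 0) (at s within {0..T})" using assms s by (auto simp: C_in_def)
    then have "eventually (\<lambda>t. Lp 2 (\<lambda>x. f t x - f s x) < ennreal 1) (at s within {0..T})"
      by (rule order_tendstoD) simp
    then obtain d where d: "d > 0" "\<And>t. t \<in> {0..T} \<Longrightarrow> t \<noteq> s \<Longrightarrow> dist t s < d \<Longrightarrow> Lp 2 (\<lambda>x. f t x - f s x) < ennreal 1"
      unfolding eventually_at by blast
    show ?thesis
    proof (rule exI[of _ d], rule exI[of _ "2 * 1\<^sup>2 + 2 * \<epsilon>\<^sup>2"], intro conjI ballI impI)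
      fix t assume t: "t \<in> {0..T}" "\<bar>t - s\<bar> < d"
      have D: "(\<integral>\<^sup>+x. ennreal ((norm (f t x - f s x))\<^sup>2) \<partial>lebesgue) \<le> ennreal (1\<^sup>2)"
      proof (cases "t = s")
        case False
        then show ?thesis using sq(2)[OF d(2)] t by (simp add: dist_real_def)
      qed simp
      have m1: "(\<lambda>x. ennreal ((norm (f t x - f s x))\<^sup>2)) \<in> borel_measurable lebesgue"
        and m2: "(\<lambda>x. ennreal ((norm (f s x))\<^sup>2)) \<in> borel_measurable lebesgue"
        using meas[OF t(1)] meas[OF s] by measurable
      have "(\<integral>\<^sup>+x. ennreal ((norm (f t x))\<^sup>2) \<partial>lebesgue)
          \<le> (\<integral>\<^sup>+x. 2 * ennreal ((norm (f t x - f s x))\<^sup>2) + 2 * ennreal ((norm (f s x))\<^sup>2) \<partial>lebesgue)"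
      proof (rule nn_integral_mono)
        fix x
        have "norm (f t x) \<le> norm (f t x - f s x) + norm (f s x)" using norm_triangle_sub[of "f t x" "f s x"] by simp
        then have "(norm (f t x))\<^sup>2 \<le> (norm (f t x - f s x) + norm (f s x))\<^sup>2" by (intro power_mono) auto
        also have "\<dots> \<le> 2 * (norm (f t x - f s x))\<^sup>2 + 2 * (norm (f s x))\<^sup>2"
          using sum_squares_bound[of "norm (f t x - f s x)" "norm (f s x)"] by (simp add: power2_sum)
        finally have "ennreal ((norm (f t x))\<^sup>2) \<le> ennreal (2 * (norm (f t x - f s x))\<^sup>2 + 2 * (norm (f s x))\<^sup>2)"
          by (rule ennreal_leI)
        then show "ennreal ((norm (f t x))\<^sup>2) \<le> 2 * ennreal ((norm (f t x - f s x))\<^sup>2) + 2 * ennreal ((norm (f s x))\<^sup>2)"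
          by (simp add: ennreal_plus ennreal_mult)
      qed
      also have "\<dots> = 2 * (\<integral>\<^sup>+x. ennreal ((norm (f t x - f s x))\<^sup>2) \<partial>lebesgue) + 2 * (\<integral>\<^sup>+x. ennreal ((norm (f s x))\<^sup>2) \<partial>lebesgue)"
        using m1 m2 by (simp add: nn_integral_add nn_integral_cmult)
      also have "\<dots> \<le> 2 * ennreal (1\<^sup>2) + 2 * ennreal (\<epsilon>\<^sup>2)"
        by (intro add_mono mult_left_mono D sq(2)[OF \<epsilon>(2,1)]) auto
      also have "\<dots> = ennreal (2 * 1\<^sup>2 + 2 * \<epsilon>\<^sup>2)" by (simp add: ennreal_plus ennreal_mult)
      finally show "(\<integral>\<^sup>+x. ennreal ((norm (f t x))\<^sup>2) \<partial>lebesgue) \<le> ennreal (2 * 1\<^sup>2 + 2 * \<epsilon>\<^sup>2)" .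
    qed (use d in auto)
  qed
  then have "\<forall>s\<in>{0..T}. \<exists>d B. d > 0 \<and> B \<ge> 0 \<and> (\<forall>t\<in>{0..T}. \<bar>t - s\<bar> < d \<longrightarrow>
      (\<integral>\<^sup>+x. ennreal ((norm (f t x))\<^sup>2) \<partial>lebesgue) \<le> ennreal B)" by blast
  then obtain d B where dB': "\<forall>s\<in>{0..T}. d s > 0 \<and> B s \<ge> 0 \<and> (\<forall>t\<in>{0..T}. \<bar>t - s\<bar> < d s \<longrightarrow>
      (\<integral>\<^sup>+x. ennreal ((norm (f t x))\<^sup>2) \<partial>lebesgue) \<le> ennreal (B s))"
    unfolding bchoice_iff by blast
  have dB: "\<And>s. s \<in> {0..T} \<Longrightarrow> d s > 0" "\<And>s. s \<in> {0..T} \<Longrightarrow> B s \<ge> 0"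
    "\<And>s t. s \<in> {0..T} \<Longrightarrow> t \<in> {0..T} \<Longrightarrow> \<bar>t - s\<bar> < d s \<Longrightarrow> (\<integral>\<^sup>+x. ennreal ((norm (f t x))\<^sup>2) \<partial>lebesgue) \<le> ennreal (B s)"
    using dB' by blast+
  have "{0..T} \<subseteq> (\<Union>s\<in>{0..T}. ball s (d s))" using dB(1) by force
  then obtain C where C: "C \<subseteq> {0..T}" "finite C" "{0..T} \<subseteq> (\<Union>s\<in>C. ball s (d s))"
    using compactE_image[of "{0..T}" "{0..T}" "\<lambda>s. ball s (d s)"] by auto
  show thesis
  proof (rule that[of "\<Sum>s\<in>C. B s"])
    show "(\<Sum>s\<in>C. B s) \<ge> 0" using C dB(2) by (intro sum_nonneg) auto
    fix t assume t: "t \<in> {0..T}"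
    then obtain s where s: "s \<in> C" "\<bar>t - s\<bar> < d s" using C(3) by (fastforce simp: dist_real_def)
    have "(\<integral>\<^sup>+x. ennreal ((norm (f t x))\<^sup>2) \<partial>lebesgue) \<le> ennreal (B s)" using dB(3) s t C(1) by blast
    also have "\<dots> \<le> ennreal (\<Sum>s\<in>C. B s)" using s C dB(2) by (intro ennreal_leI member_le_sum) auto
    finally show "(\<integral>\<^sup>+x. ennreal ((norm (f t x))\<^sup>2) \<partial>lebesgue) \<le> ennreal (\<Sum>s\<in>C. B s)" .
  qed (rule meas)
qed

context bounded_flow
begin

text \<open>Testing the mass equation with \<open>u\<^sub>i \<phi>\<close> turns the transport form of the acceleration into divergence form.\<close>
lemma acceleration_divergence_form:
  assumes r: "r > 0" and \<tau>: "smooth \<tau>" "0 < a" "b < T" "\<And>s. s \<notin> {a..b} \<Longrightarrow> \<tau> s = 0"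
    and wd: "weakly_diff (slab T) [(1, 0)] (case_prod u)" "\<And>j. weakly_diff (slab T) [(0, axis j 1)] (case_prod u)"
  defines "\<phi> \<equiv> tens (st \<tau> (\<lambda>_. cut r))"
  shows "(\<integral>z. case_prod \<rho> z * (wderiv (slab T) [(1, 0)] (case_prod u) z $ i
            + (\<Sum>j\<in>UNIV. case_prod u z $ j * wderiv (slab T) [(0, axis j 1)] (case_prod u) z $ i)) * \<phi> z \<partial>lebesgue)
       = - (\<integral>z. (case_prod \<rho> z * iter_deriv [(1, 0)] \<phi> z) * case_prod u z $ i \<partial>lebesgue)
         - (\<Sum>j\<in>UNIV. \<integral>z. (case_prod \<rho> z * case_prod u z $ j * iter_deriv [(0, axis j 1)] \<phi> z) * case_prod u z $ i \<partial>lebesgue)"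
    and "\<And>j. integrable lebesgue (\<lambda>z. (case_prod \<rho> z * case_prod u z $ j * iter_deriv [(0, axis j 1)] \<phi> z) * case_prod u z $ i)"
proof -
  let ?\<rho> = "case_prod \<rho>" and ?u = "case_prod u"
  obtain U where U: "U > 0" "\<And>t. t \<in> {0..T} \<Longrightarrow> AE x in lebesgue. norm (u t x) \<le> U"
    using sup_continuous_bound[OF u] by metis
  obtain M where M: "M > 0" "\<And>t. t \<in> {0..T} \<Longrightarrow> AE x in lebesgue. norm (\<rho> t x) \<le> M"
    using sup_continuous_bound[OF rho] by metis
  \<comment> \<open>The space-time field \<open>(\<rho>, \<rho> u)\<close>, indexed by the basis vectors.\<close>
  define V where "V e z = ?\<rho> z * (if fst e = 1 then 1 else ?u z \<bullet> snd e)" for e :: "real \<times> (real^3)" and z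
  define D where "D e z = wderiv (slab T) [e] ?u z $ i" for e z
  have Vt: "V (1, 0) z = ?\<rho> z" and Vx: "V (0, axis j 1) z = ?\<rho> z * ?u z $ j" for z j
    by (auto simp: V_def inner_axis)
  have Basis_cases: "e = (1, 0) \<or> (\<exists>j. e = (0, axis j 1))" if "e \<in> Basis" for e :: "real \<times> (real^3)"
    using that by (auto simp: Basis_prod_def Basis_real3)
  have locV: "loc_int (slab T) (V e)" if "e \<in> Basis" for e
    using Basis_cases[OF that]
  proof (elim disjE exE)
    assume "e = (1, 0)" then show ?thesis using loc_int_rho by (simp add: Vt[abs_def])
  next
    fix j assume "e = (0, axis j 1)" then show ?thesis using loc_int_rho_u[of j] by (simp add: Vx[abs_def])
  qed
  have AEV: "AE z in lebesgue. z \<in> slab T \<longrightarrow> \<bar>V e z\<bar> \<le> M + M * U" if "e \<in> Basis" for e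
    using Basis_cases[OF that]
  proof (elim disjE exE)
    assume e: "e = (1, 0)"
    have "AE z in lebesgue. z \<in> slab T \<longrightarrow> \<bar>?\<rho> z\<bar> \<le> M"
      by (rule AE_slab_bound[OF loc_int_rho]) (use M in auto)
    then show ?thesis using M(1) U(1) unfolding e Vt by (auto elim!: eventually_mono intro: order_trans)
  next
    fix j assume e: "e = (0, axis j 1)"
    have "AE z in lebesgue. z \<in> slab T \<longrightarrow> \<bar>case_prod (\<lambda>t x. \<rho> t x * u t x $ j) z\<bar> \<le> M * U"
    proof (rule AE_slab_bound)
      show "loc_int (slab T) (\<lambda>(t, x). \<rho> t x * u t x $ j)" using loc_int_rho_u[of j] by (simp add: case_prod_unfold)
      show "0 \<le> M * U" using M U by simp
      fix t assume t: "t \<in> {0..T}"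
      show "AE x in lebesgue. \<bar>\<rho> t x * u t x $ j\<bar> \<le> M * U"
        using M(2)[OF t] U(2)[OF t]
      proof eventually_elim
        case (elim x)
        have "\<bar>u t x $ j\<bar> \<le> U" using elim component_le_norm_cart[of "u t x" j] by linarith
        then show ?case using elim M(1) by (auto simp: abs_mult intro: mult_mono)
      qed
    qed
    then show ?thesis using M(1) unfolding e Vx
      by (auto elim!: eventually_mono simp: case_prod_unfold intro: add_increasing)
  qed
  have wD: "has_weak_deriv (slab T) [e] (\<lambda>z. ?u z $ i) (D e)" if "e \<in> Basis" for e
    unfolding D_def
    by (rule has_weak_deriv_component[OF weakly_diff_wderiv])
       (use Basis_cases[OF that] wd that in auto)
  have locu: "loc_int (slab T) (\<lambda>z. ?u z $ i)" using wD[OF et_Basis] by (simp add: has_weak_deriv_def)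
  have div: "(\<Sum>e\<in>Basis. \<integral>z. V e z * iter_deriv [e] \<psi> z \<partial>lebesgue) = 0" if "\<psi> \<in> test_fun (slab T)" for \<psi>
    unfolding sum_Basis_slab Vt Vx by (rule mass_test[OF that])
  define p q where "p = (a, - ((2 * r) *\<^sub>R (One :: real^3)))" and "q = (b, (2 * r) *\<^sub>R (One :: real^3))"
  have sub: "cbox p q \<subseteq> slab T" unfolding p_def q_def by (rule slab_cbox_subset[OF \<tau>(2,3)])
  have sm: "smooth (st \<tau> (\<lambda>_. cut r) c)" if "c \<in> Basis" for c
    by (rule smooth_st[OF \<tau>(1) smooth_cut that])
  have supp: "st \<tau> (\<lambda>_. cut r) c s = 0" if "c \<in> Basis" "s \<notin> {p \<bullet> c..q \<bullet> c}" for c s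
    by (rule st_support[OF \<tau>(4) cut_eq_0[OF r] that[unfolded p_def q_def]])
  have tf: "\<phi> \<in> test_fun (slab T)" unfolding \<phi>_def by (rule st_test_fun[OF \<tau> smooth_cut cut_eq_0[OF r]])
  have main: "(\<Sum>e\<in>Basis. \<integral>z. (V e z * \<phi> z) * D e z \<partial>lebesgue)
       = - (\<Sum>e\<in>Basis. \<integral>z. (V e z * iter_deriv [e] \<phi> z) * ?u z $ i \<partial>lebesgue)"
    unfolding \<phi>_def by (rule divergence_free_product[OF open_slab locV AEV div wD locu sm supp sub])
  have int: "integrable lebesgue (\<lambda>z. (V e z * \<psi> z) * f z)"
    if e: "e \<in> Basis" and \<psi>: "\<psi> \<in> test_fun (slab T)" and f: "loc_int (slab T) f" for e \<psi> f
  proof -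
    obtain W where W: "compact W" "W \<subseteq> slab T" "\<forall>x. x \<notin> W \<longrightarrow> \<psi> x = 0" "\<exists>B. \<forall>x. \<bar>\<psi> x\<bar> \<le> B"
      using test_fun_props[OF \<psi>] by metis
    obtain B where B: "\<And>x. \<bar>\<psi> x\<bar> \<le> B" using W(4) by blast
    show ?thesis
    proof (rule integrable_bounded_mult[OF f W(1,2)])
      show "(\<lambda>z. V e z * \<psi> z) \<in> borel_measurable lebesgue"
        using test_fun_integrable[OF \<psi> locV[OF e]] by (simp add: mult.commute)
      show "AE z in lebesgue. \<bar>V e z * \<psi> z\<bar> \<le> (M + M * U) * B"
        using AEV[OF e]
      proof eventually_elim
        case (elim z)
        have "0 \<le> B" using B[of z] by linarith
        then have pos: "0 \<le> (M + M * U) * B" using M U by simp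
        show ?case
        proof (cases "z \<in> W")
          case True
          then have "\<bar>V e z\<bar> \<le> M + M * U" using elim W(2) by blast
          then show ?thesis using B[of z] M U unfolding abs_mult by (intro mult_mono) auto
        next
          case False
          then have "\<psi> z = 0" using W(3) by blast
          then show ?thesis using pos by simp
        qed
      qed
      fix z assume "z \<notin> W"
      then have "\<psi> z = 0" using W(3) by blast
      then show "V e z * \<psi> z = 0" by simp
    qed
  qed
  have locD: "loc_int (slab T) (D e)" if "e \<in> Basis" for e using wD[OF that] by (simp add: has_weak_deriv_def)
  have "(\<Sum>e\<in>Basis. \<integral>z. (V e z * \<phi> z) * D e z \<partial>lebesgue) = (\<integral>z. (\<Sum>e\<in>Basis. (V e z * \<phi> z) * D e z) \<partial>lebesgue)"
    by (rule Bochner_Integration.integral_sum[symmetric]) (rule int[OF _ tf locD])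
  also have "\<dots> = (\<integral>z. ?\<rho> z * (wderiv (slab T) [(1, 0)] ?u z $ i
            + (\<Sum>j\<in>UNIV. ?u z $ j * wderiv (slab T) [(0, axis j 1)] ?u z $ i)) * \<phi> z \<partial>lebesgue)"
    unfolding sum_Basis_slab Vt Vx D_def
    by (simp add: distrib_left distrib_right sum_distrib_left sum_distrib_right mult_ac)
  finally show "(\<integral>z. ?\<rho> z * (wderiv (slab T) [(1, 0)] ?u z $ i
            + (\<Sum>j\<in>UNIV. ?u z $ j * wderiv (slab T) [(0, axis j 1)] ?u z $ i)) * \<phi> z \<partial>lebesgue)
       = - (\<integral>z. (?\<rho> z * iter_deriv [(1, 0)] \<phi> z) * ?u z $ i \<partial>lebesgue)
         - (\<Sum>j\<in>UNIV. \<integral>z. (?\<rho> z * ?u z $ j * iter_deriv [(0, axis j 1)] \<phi> z) * ?u z $ i \<partial>lebesgue)"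
    using main unfolding sum_Basis_slab Vt Vx by (simp del: iter_deriv.simps)
  show "integrable lebesgue (\<lambda>z. (?\<rho> z * ?u z $ j * iter_deriv [(0, axis j 1)] \<phi> z) * ?u z $ i)" for j
  proof -
    have "iter_deriv [(0, axis j 1)] \<phi> \<in> test_fun (slab T)"
      by (rule iter_deriv_test_fun[OF tf]) (use ex_Basis in auto)
    from int[OF ex_Basis this locu] show ?thesis unfolding Vx .
  qed
qed

end

text \<open>A flux \<open>k\<close> with a spatial integral bounded by \<open>B\<close> at almost all times contributes at most \<open>C * B / r\<close>, because
  the cut-off has a gradient of size \<open>C / r\<close>.\<close>
lemma flux_bound:
  fixes k :: "real \<times> (real^3) \<Rightarrow> real"
  assumes \<tau>: "smooth \<tau>" "0 < a" "b < T" "\<And>s. s \<notin> {a..b} \<Longrightarrow> \<tau> s = 0" and r: "r > 0"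
    and C: "C > 0" "\<And>r s. r > 0 \<Longrightarrow> \<bar>deriv (cut r) s\<bar> \<le> C / r" and B: "B \<ge> 0"
    and meas: "(\<lambda>z. k z * iter_deriv [(0, axis j 1)] (tens (st \<tau> (\<lambda>_. cut r))) z) \<in> borel_measurable lebesgue"
    and H: "AE t in lebesgue. t \<in> {0<..<T} \<longrightarrow>
      (\<exists>H\<in>borel_measurable lebesgue. (AE x in lebesgue. ennreal \<bar>k (t, x)\<bar> \<le> H x) \<and> (\<integral>\<^sup>+x. H x \<partial>lebesgue) \<le> ennreal B)"
  shows "\<bar>\<integral>z. k z * iter_deriv [(0, axis j 1)] (tens (st \<tau> (\<lambda>_. cut r))) z \<partial>lebesgue\<bar> \<le> (C * B / r) * (\<integral>s. \<bar>\<tau> s\<bar> \<partial>lborel)"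
proof (rule slab_integral_bound[OF meas \<tau>, where h="\<lambda>t x. k (t, x) * cutoff_deriv r (axis j 1) x"])
  have d: "iter_deriv [(0, axis j 1)] (tens (st \<tau> (\<lambda>_. cut r))) = tens (st \<tau> ((\<lambda>_. cut r)(axis j 1 := deriv (cut r))))"
    by (rule iter_deriv_st_space[OF \<tau>(1) smooth_cut]) (simp add: axis_in_Basis_iff)
  show "0 \<le> C * B / r" using C(1) B r by simp
  show "k (t, x) * iter_deriv [(0, axis j 1)] (tens (st \<tau> (\<lambda>_. cut r))) (t, x) = \<tau> t * (k (t, x) * cutoff_deriv r (axis j 1) x)" for t x
    unfolding d tens_st cutoff_deriv_def by (simp add: mult_ac)
  show "AE t in lebesgue. t \<in> {0<..<T} \<longrightarrow> (\<exists>H\<in>borel_measurable lebesgue.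
      (AE x in lebesgue. ennreal \<bar>k (t, x) * cutoff_deriv r (axis j 1) x\<bar> \<le> H x) \<and> (\<integral>\<^sup>+x. H x \<partial>lebesgue) \<le> ennreal (C * B / r))"
    using H
  proof eventually_elim
    case (elim t)
    show ?case
    proof
      assume "t \<in> {0<..<T}"
      then obtain H where H: "H \<in> borel_measurable lebesgue" "AE x in lebesgue. ennreal \<bar>k (t, x)\<bar> \<le> H x"
        "(\<integral>\<^sup>+x. H x \<partial>lebesgue) \<le> ennreal B" using elim by blast
      have Cr: "0 \<le> C / r" using C(1) r by simp
      let ?H = "\<lambda>x. ennreal (C / r) * H x"
      have b3: "?H \<in> borel_measurable lebesgue" using H(1) by measurable
      have b1: "AE x in lebesgue. ennreal \<bar>k (t, x) * cutoff_deriv r (axis j 1) x\<bar> \<le> ?H x"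
        using H(2)
      proof eventually_elim
        case (elim x)
        have "\<bar>cutoff_deriv r (axis j 1) x\<bar> \<le> C / r * indicator (cube (2 * r)) x"
          by (rule cutoff_deriv_bound[OF C(2) r]) (simp_all add: axis_in_Basis_iff)
        also have "\<dots> \<le> C / r * 1" using Cr by (intro mult_left_mono) (auto simp: indicator_def)
        finally have "\<bar>k (t, x) * cutoff_deriv r (axis j 1) x\<bar> \<le> C / r * \<bar>k (t, x)\<bar>"
          unfolding abs_mult by (metis abs_ge_zero mult.commute mult.right_neutral mult_right_mono)
        then have "ennreal \<bar>k (t, x) * cutoff_deriv r (axis j 1) x\<bar> \<le> ennreal (C / r * \<bar>k (t, x)\<bar>)" by (rule ennreal_leI)
        also have "\<dots> = ennreal (C / r) * ennreal \<bar>k (t, x)\<bar>" using Cr by (intro ennreal_mult) auto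
        also have "\<dots> \<le> ?H x" by (rule mult_left_mono[OF elim]) simp
        finally show ?case .
      qed
      have "(\<integral>\<^sup>+x. ?H x \<partial>lebesgue) = ennreal (C / r) * (\<integral>\<^sup>+x. H x \<partial>lebesgue)" by (rule nn_integral_cmult[OF H(1)])
      also have "\<dots> \<le> ennreal (C / r) * ennreal B" by (rule mult_left_mono[OF H(3)]) simp
      also have "\<dots> = ennreal (C * B / r)" using Cr B by (subst ennreal_mult[symmetric]) auto
      finally have b2: "(\<integral>\<^sup>+x. ?H x \<partial>lebesgue) \<le> ennreal (C * B / r)" .
      show "\<exists>H\<in>borel_measurable lebesgue. (AE x in lebesgue. ennreal \<bar>k (t, x) * cutoff_deriv r (axis j 1) x\<bar> \<le> H x)
          \<and> (\<integral>\<^sup>+x. H x \<partial>lebesgue) \<le> ennreal (C * B / r)"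
        using b1 b2 b3 by (intro bexI[of _ ?H] conjI)
    qed
  qed
qed

text \<open>By the arithmetic-geometric mean inequality, the weight \<open>\<rho> powr d\<close> in front of the viscous stress is
  shared between the mass density and the weighted gradient.\<close>
lemma viscous_weight_bound:
  fixes p n M d :: real
  assumes "0 < p" "p \<le> M" "0 \<le> n" "0 < d"
  shows "p powr d * n \<le> M powr d * p + (p powr ((d - 1) / 2) * n)\<^sup>2"
proof -
  define x where "x = p powr ((d + 1) / 2)"
  define y where "y = p powr ((d - 1) / 2) * n"
  have "p powr d = p powr ((d + 1) / 2) * p powr ((d - 1) / 2)" by (simp flip: powr_add add: add_divide_distrib diff_divide_distrib)
  then have eq: "p powr d * n = x * y" by (simp add: x_def y_def)
  have xy: "0 \<le> x * y" using assms by (simp add: x_def y_def)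
  note eq
  also have "\<dots> \<le> x\<^sup>2 + y\<^sup>2" using xy sum_squares_bound[of x y] by linarith
  also have "x\<^sup>2 = p powr (d + 1)"
    unfolding x_def power2_eq_square by (simp flip: powr_add add: add_divide_distrib)
  also have "p powr (d + 1) = p powr d * p" using assms by (simp add: powr_add)
  also have "\<dots> \<le> M powr d * p" using assms by (intro mult_right_mono powr_mono2) auto
  finally show ?thesis by (simp add: y_def)
qed

context bounded_flow
begin

text \<open>The convective, the pressure and the viscous flux are bounded in the mean by \<open>BC\<close>, \<open>BP\<close> and \<open>BK\<close> at every time.
  A cut-off at distance \<open>r\<close> therefore changes the momentum balance by \<open>Bt / r\<close> per unit of time, and \<open>r\<close> is
  arbitrary.\<close>
proposition momentum_conserved:
  fixes A R \<gamma> \<nu> \<alpha> \<beta> Sm W m0 :: real and S :: "real \<Rightarrow> real^3 \<Rightarrow> real" and g :: "3 \<Rightarrow> real \<Rightarrow> real^3 \<Rightarrow> real^3"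
  assumes mom: "cns.momentum_eq A R \<gamma> \<nu> \<alpha> \<beta> T (case_prod \<rho>) (case_prod u) (case_prod S)"
    and pos': "\<And>t. t \<in> {0..T} \<Longrightarrow> AE x in lebesgue. 0 < \<rho> t x"
    and A: "A > 0" and \<gamma>: "\<gamma> > 1" and \<delta>: "0 < cns.\<delta> \<gamma> \<nu>"
    and S: "\<And>t. t \<in> {0..T} \<Longrightarrow> AE x in lebesgue. \<bar>S t x\<bar> \<le> Sm"
    and g: "\<And>j. has_weak_deriv (slab T) [(0, axis j 1)] (case_prod u) (case_prod (g j))"
    and W: "W \<ge> 0" "\<And>j t. t \<in> {0..T} \<Longrightarrow> wt \<rho> ((cns.\<delta> \<gamma> \<nu> - 1) / 2) (g j) t \<in> borel_measurable lebesgue"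
      "\<And>j t. t \<in> {0..T} \<Longrightarrow> (\<integral>\<^sup>+x. ennreal ((norm (wt \<rho> ((cns.\<delta> \<gamma> \<nu> - 1) / 2) (g j) t x))\<^sup>2) \<partial>lebesgue) \<le> ennreal W"
    and m0: "m0 \<ge> 0" "\<And>t. t \<in> {0..T} \<Longrightarrow> (\<integral>\<^sup>+x. ennreal (\<rho> t x) \<partial>lebesgue) \<le> ennreal m0"
    and t: "t \<in> {0..T}"
  shows "(\<integral>x. \<rho> t x * u t x $ i \<partial>lebesgue) = (\<integral>x. \<rho> 0 x * u 0 x $ i \<partial>lebesgue)"
proof -
  let ?\<rho> = "case_prod \<rho>" and ?u = "case_prod u" and ?S = "case_prod S"
  obtain U where U: "U > 0" "\<And>t. t \<in> {0..T} \<Longrightarrow> AE x in lebesgue. norm (u t x) \<le> U"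
    using sup_continuous_bound[OF u] by metis
  obtain M where M: "M > 0" "\<And>t. t \<in> {0..T} \<Longrightarrow> AE x in lebesgue. norm (\<rho> t x) \<le> M"
    using sup_continuous_bound[OF rho] by metis
  obtain C where C: "C > 0" "\<And>r s. r > 0 \<Longrightarrow> \<bar>deriv (cut r) s\<bar> \<le> C / r" using deriv_cut_bound by metis
  define d where "d = cns.\<delta> \<gamma> \<nu>"
  define cv where "cv = cns.cv R \<gamma>"
  define P where "P = cns.pressure A R \<gamma> ?\<rho> ?S"
  define Q where "Q j z = cns.Q \<alpha> \<beta> (slab T) (\<lambda>j. (0, axis j 1)) ?u i j z" for j z
  define Kf where "Kf j z = ?\<rho> z powr d * exp (?S z / cv * \<nu>) * Q j z" for j z
  define c where "c = A powr \<nu> * R powr (- \<nu>)"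
  note mom' = mom[unfolded cns.momentum_eq_def Let_def]
  have wd: "weakly_diff (slab T) [(1, 0)] ?u" "\<And>j. weakly_diff (slab T) [(0, axis j 1)] ?u"
    and locP: "loc_int (slab T) P" and locK: "\<And>j. loc_int (slab T) (Kf j)"
    using mom' unfolding P_def Kf_def[abs_def] Q_def d_def cv_def by blast+
  have eq: "(\<integral>z. ?\<rho> z * (wderiv (slab T) [(1, 0)] ?u z $ i
            + (\<Sum>j\<in>UNIV. ?u z $ j * wderiv (slab T) [(0, axis j 1)] ?u z $ i)) * \<phi> z \<partial>lebesgue)
       - (\<integral>z. P z * iter_deriv [(0, axis i 1)] \<phi> z \<partial>lebesgue)
      = c * (\<Sum>j\<in>UNIV. - (\<integral>z. Kf j z * iter_deriv [(0, axis j 1)] \<phi> z \<partial>lebesgue))"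
    if "\<phi> \<in> test_fun (slab T)" for \<phi>
  proof -
    have "dist_of (\<lambda>z. ?\<rho> z * (wderiv (slab T) [(1, 0)] ?u z $ i
            + (\<Sum>j\<in>UNIV. ?u z $ j * wderiv (slab T) [(0, axis j 1)] ?u z $ i))) \<phi>
        + dist_deriv (0, axis i 1) (dist_of P) \<phi> = c * (\<Sum>j\<in>UNIV. dist_deriv (0, axis j 1) (dist_of (Kf j)) \<phi>)"
      using mom' that unfolding P_def Kf_def[abs_def] Q_def d_def cv_def c_def by blast
    then show ?thesis unfolding dist_deriv_def dist_of_def by (simp only: diff_conv_add_uminus)
  qed
  define E where "E = exp (\<bar>Sm\<bar> / \<bar>cv\<bar>)"
  define E' where "E' = exp (\<bar>Sm\<bar> / \<bar>cv\<bar> * \<bar>\<nu>\<bar>)"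
  have Sle: "exp (s / cv) \<le> E" "exp (s / cv * \<nu>) \<le> E'" if "\<bar>s\<bar> \<le> Sm" for s
  proof -
    have 1: "\<bar>s / cv\<bar> \<le> \<bar>Sm\<bar> / \<bar>cv\<bar>" using that by (auto simp: abs_divide intro!: divide_right_mono)
    then show "exp (s / cv) \<le> E" unfolding E_def by (subst exp_le_cancel_iff) linarith
    have "\<bar>s / cv * \<nu>\<bar> \<le> \<bar>Sm\<bar> / \<bar>cv\<bar> * \<bar>\<nu>\<bar>" using 1 unfolding abs_mult by (rule mult_right_mono) simp
    then show "exp (s / cv * \<nu>) \<le> E'" unfolding E'_def by (subst exp_le_cancel_iff) linarith
  qed
  have E0: "E > 0" "E' > 0" by (auto simp: E_def E'_def)
  define BC where "BC = U * U * m0"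
  define BP where "BP = A * E * M powr (\<gamma> - 1) * m0"
  define q where "q = E' * (2 * \<bar>\<alpha>\<bar> + \<bar>\<beta>\<bar>)"
  define BK where "BK = q * (3 * (M powr d * m0 + W))"
  have B0: "BC \<ge> 0" "BP \<ge> 0" "BK \<ge> 0" "q \<ge> 0"
    using U(1) m0(1) A E0 W(1) by (auto simp: BC_def BP_def BK_def q_def)
  define Bt where "Bt = 3 * (C * BC) + C * BP + \<bar>c\<bar> * (3 * (C * BK))"
  have Bt0: "Bt \<ge> 0" using B0 C(1) by (simp add: Bt_def)
  have const_H: "\<exists>H\<in>borel_measurable lebesgue. (AE x in lebesgue. ennreal (h x) \<le> H x) \<and> (\<integral>\<^sup>+x. H x \<partial>lebesgue) \<le> ennreal (k * m0)"
    if t: "t \<in> {0..T}" and k: "k \<ge> 0" and h: "AE x in lebesgue. h x \<le> k * \<rho> t x" for h k t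
  proof (intro bexI[of _ "\<lambda>x. ennreal k * ennreal (\<rho> t x)"] conjI)
    have [measurable]: "\<rho> t \<in> borel_measurable lebesgue" by (rule rho_measurable[OF t])
    show "(\<lambda>x. ennreal k * ennreal (\<rho> t x)) \<in> borel_measurable lebesgue" by measurable
    show "AE x in lebesgue. ennreal (h x) \<le> ennreal k * ennreal (\<rho> t x)"
      using h pos[OF t] by eventually_elim (use k in \<open>auto simp flip: ennreal_mult intro: ennreal_leI\<close>)
    have "(\<integral>\<^sup>+x. ennreal k * ennreal (\<rho> t x) \<partial>lebesgue) = ennreal k * (\<integral>\<^sup>+x. ennreal (\<rho> t x) \<partial>lebesgue)"
      by (rule nn_integral_cmult) measurable
    also have "\<dots> \<le> ennreal k * ennreal m0" by (rule mult_left_mono[OF m0(2)[OF t]]) simp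
    also have "\<dots> = ennreal (k * m0)" using k m0(1) by (intro ennreal_mult[symmetric])
    finally show "(\<integral>\<^sup>+x. ennreal k * ennreal (\<rho> t x) \<partial>lebesgue) \<le> ennreal (k * m0)" .
  qed
  have vs: "sup_continuous T (\<lambda>t x. \<rho> t x * u t x $ i)"
    by (rule sup_continuous_mult[OF rho sup_continuous_component[OF u]])
  have vl: "loc_int (slab T) (\<lambda>(t, x). \<rho> t x * u t x $ i)"
    using loc_int_rho_u[of i] by (simp add: case_prod_unfold)
  have lip: "\<bar>(\<integral>x. (\<rho> t x * u t x $ i) * cutoff r x \<partial>lebesgue) - (\<integral>x. (\<rho> 0 x * u 0 x $ i) * cutoff r x \<partial>lebesgue)\<bar> \<le> Bt / r * \<bar>t - 0\<bar>"
    if r: "r > 0" for r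
  proof (rule balance_lipschitz[OF vs vl T _ r])
    show "0 \<le> Bt / r" using Bt0 r by simp
    show "0 \<in> {0..T}" "t \<in> {0..T}" using T t by auto
    fix \<tau> a b assume \<tau>: "smooth \<tau>" "0 < a" "b < T" "\<And>s. s \<notin> {a..b} \<Longrightarrow> \<tau> s = (0::real)"
    define \<phi> where "\<phi> = tens (st \<tau> (\<lambda>_. cut r))"
    define I where "I = (\<integral>s. \<bar>\<tau> s\<bar> \<partial>lborel)"
    have tf: "\<phi> \<in> test_fun (slab T)" unfolding \<phi>_def by (rule st_test_fun[OF \<tau> smooth_cut cut_eq_0[OF r]])
    have tfd: "iter_deriv [(0, axis j 1)] \<phi> \<in> test_fun (slab T)" for j
      by (rule iter_deriv_test_fun[OF tf]) (use ex_Basis in auto)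
    note acc = acceleration_divergence_form[OF r \<tau> wd, folded \<phi>_def]
    have bC: "\<bar>\<integral>z. (?\<rho> z * ?u z $ j * iter_deriv [(0, axis j 1)] \<phi> z) * ?u z $ i \<partial>lebesgue\<bar> \<le> (C * BC / r) * I" for j
    proof -
      have e: "(\<lambda>z. (?\<rho> z * ?u z $ j * iter_deriv [(0, axis j 1)] \<phi> z) * ?u z $ i)
          = (\<lambda>z. (?\<rho> z * ?u z $ j * ?u z $ i) * iter_deriv [(0, axis j 1)] \<phi> z)" by (rule ext) (simp only: mult_ac)
      have m: "(\<lambda>z. (?\<rho> z * ?u z $ j * ?u z $ i) * iter_deriv [(0, axis j 1)] \<phi> z) \<in> borel_measurable lebesgue"
        using acc(2)[where i=i and j=j] unfolding e by (rule borel_measurable_integrable)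
      show ?thesis unfolding e unfolding I_def \<phi>_def
      proof (rule flux_bound[OF \<tau> r C B0(1) m[unfolded \<phi>_def]], assumption, assumption, intro AE_I2 impI)
        fix t assume "t \<in> {0<..<T}"
        then have t: "t \<in> {0..T}" by auto
        show "\<exists>H\<in>borel_measurable lebesgue. (AE x in lebesgue. ennreal \<bar>?\<rho> (t, x) * ?u (t, x) $ j * ?u (t, x) $ i\<bar> \<le> H x)
            \<and> (\<integral>\<^sup>+x. H x \<partial>lebesgue) \<le> ennreal BC"
          unfolding BC_def
        proof (rule const_H[OF t])
          show "0 \<le> U * U" using U(1) by simp
          show "AE x in lebesgue. \<bar>?\<rho> (t, x) * ?u (t, x) $ j * ?u (t, x) $ i\<bar> \<le> U * U * \<rho> t x"
            using U(2)[OF t] pos[OF t]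
          proof eventually_elim
            case (elim x)
            have "\<bar>u t x $ j\<bar> \<le> U" "\<bar>u t x $ i\<bar> \<le> U"
              using elim component_le_norm_cart[of "u t x" j] component_le_norm_cart[of "u t x" i] by linarith+
            then have "\<bar>u t x $ j\<bar> * \<bar>u t x $ i\<bar> \<le> U * U" by (intro mult_mono) auto
            from mult_right_mono[OF this elim(2)] show ?case using elim(2) by (simp add: abs_mult mult_ac)
          qed
        qed
      qed
    qed
    have bP: "\<bar>\<integral>z. P z * iter_deriv [(0, axis i 1)] \<phi> z \<partial>lebesgue\<bar> \<le> (C * BP / r) * I"
    proof -
      have m: "(\<lambda>z. P z * iter_deriv [(0, axis i 1)] \<phi> z) \<in> borel_measurable lebesgue"
        using borel_measurable_integrable[OF test_fun_integrable[OF tfd locP]] by (simp add: mult.commute del: iter_deriv.simps)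
      show ?thesis unfolding I_def \<phi>_def
      proof (rule flux_bound[OF \<tau> r C B0(2) m[unfolded \<phi>_def]], assumption, assumption, intro AE_I2 impI)
        fix t assume "t \<in> {0<..<T}"
        then have t: "t \<in> {0..T}" by auto
        show "\<exists>H\<in>borel_measurable lebesgue. (AE x in lebesgue. ennreal \<bar>P (t, x)\<bar> \<le> H x) \<and> (\<integral>\<^sup>+x. H x \<partial>lebesgue) \<le> ennreal BP"
          unfolding BP_def
        proof (rule const_H[OF t])
          show "0 \<le> A * E * M powr (\<gamma> - 1)" using A E0 by simp
          show "AE x in lebesgue. \<bar>P (t, x)\<bar> \<le> A * E * M powr (\<gamma> - 1) * \<rho> t x"
            using S[OF t] pos'[OF t] M(2)[OF t]
          proof eventually_elim
            case (elim x)
            have "\<rho> t x powr \<gamma> = \<rho> t x powr (\<gamma> - 1) * \<rho> t x" using elim by (simp add: powr_diff)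
            also have "\<dots> \<le> M powr (\<gamma> - 1) * \<rho> t x" using elim \<gamma> by (intro mult_right_mono powr_mono2) auto
            finally have "A * exp (S t x / cv) * \<rho> t x powr \<gamma> \<le> A * E * (M powr (\<gamma> - 1) * \<rho> t x)"
              using Sle(1)[OF elim(1)] A E0(1) by (intro mult_mono) auto
            then show ?case using A by (simp add: P_def cns.pressure_def cv_def abs_mult mult_ac)
          qed
        qed
      qed
    qed
    \<comment> \<open>The momentum equation speaks of some weak gradient on the slab, the integral bound \<open>W\<close> of the gradients \<open>g j\<close> on
      time slices; both gradients agree on almost all slices.\<close>
    have gAE: "AE t in lebesgue. AE x in lebesgue. \<forall>j. (t, x) \<in> slab T \<longrightarrow> wderiv (slab T) [(0, axis j 1)] ?u (t, x) = g j t x"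
    proof -
      have "AE z in lebesgue. z \<in> slab T \<longrightarrow> wderiv (slab T) [(0, axis j 1)] ?u z = case_prod (g j) z" for j
        by (rule weak_deriv_unique[OF open_slab weakly_diff_wderiv[OF wd(2)] g])
      then have "AE z in lebesgue. \<forall>j\<in>UNIV. z \<in> slab T \<longrightarrow> wderiv (slab T) [(0, axis j 1)] ?u z = case_prod (g j) z"
        by (intro AE_finite_allI finite_class.finite_UNIV)
      from AE_slices[OF this] show ?thesis by (simp only: prod.case ball_UNIV)
    qed
    have bK: "\<bar>\<integral>z. Kf j z * iter_deriv [(0, axis j 1)] \<phi> z \<partial>lebesgue\<bar> \<le> (C * BK / r) * I" for j
    proof -
      have m: "(\<lambda>z. Kf j z * iter_deriv [(0, axis j 1)] \<phi> z) \<in> borel_measurable lebesgue"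
        using borel_measurable_integrable[OF test_fun_integrable[OF tfd locK]] by (simp add: mult.commute del: iter_deriv.simps)
      show ?thesis unfolding I_def \<phi>_def
      proof (rule flux_bound[OF \<tau> r C B0(3) m[unfolded \<phi>_def]])
        show "AE t in lebesgue. t \<in> {0<..<T} \<longrightarrow> (\<exists>H\<in>borel_measurable lebesgue.
            (AE x in lebesgue. ennreal \<bar>Kf j (t, x)\<bar> \<le> H x) \<and> (\<integral>\<^sup>+x. H x \<partial>lebesgue) \<le> ennreal BK)"
          using gAE
        proof eventually_elim
          case (elim t)
          show ?case
          proof
            assume tT: "t \<in> {0<..<T}"
            then have t: "t \<in> {0..T}" by auto
            have sl: "(t, x) \<in> slab T" for x using tT by (auto simp: slab_def)
            let ?w = "\<lambda>k x. (norm (wt \<rho> ((d - 1) / 2) (g k) t x))\<^sup>2"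
            let ?H = "\<lambda>x. ennreal q * (\<Sum>k\<in>(UNIV :: 3 set). ennreal (M powr d) * ennreal (\<rho> t x) + ennreal (?w k x))"
            have [measurable]: "\<rho> t \<in> borel_measurable lebesgue" by (rule rho_measurable[OF t])
            have wm [measurable]: "(\<lambda>x. wt \<rho> ((d - 1) / 2) (g k) t x) \<in> borel_measurable lebesgue" for k
              using W(2)[OF t, of k] by (simp add: d_def)
            have b3: "?H \<in> borel_measurable lebesgue" by measurable
            have b1: "AE x in lebesgue. ennreal \<bar>Kf j (t, x)\<bar> \<le> ?H x"
              using elim S[OF t] pos'[OF t] M(2)[OF t]
            proof eventually_elim
              case (elim x)
              define G where "G = (\<Sum>k\<in>UNIV. norm (g k t x))"
              have wg: "wderiv (slab T) [(0, axis k 1)] ?u (t, x) = g k t x" for k using elim(1) sl by blast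
              have gG: "\<bar>g k t x $ l\<bar> \<le> norm (g k t x)" "norm (g k t x) \<le> G" for k l
                unfolding G_def by (rule component_le_norm_cart) (rule member_le_sum, auto)
              have gG': "\<bar>g k t x $ l\<bar> \<le> G" for k l using gG(1)[of k l] gG(2)[of k] by linarith
              have "\<bar>\<Sum>k\<in>UNIV. g k t x $ k\<bar> \<le> (\<Sum>k\<in>UNIV. \<bar>g k t x $ k\<bar>)" by (rule sum_abs)
              also have "\<dots> \<le> G" unfolding G_def by (rule sum_mono) (rule gG(1))
              finally have div: "\<bar>\<Sum>k\<in>UNIV. g k t x $ k\<bar> \<le> G" .
              have G0: "G \<ge> 0" by (simp add: G_def sum_nonneg)
              have "\<bar>Q j (t, x)\<bar> \<le> \<bar>\<alpha> * (g j t x $ i + g i t x $ j)\<bar> + \<bar>\<beta> * (\<Sum>k\<in>UNIV. g k t x $ k)\<bar>"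
                unfolding Q_def cns.Q_def wg by (auto intro: abs_triangle_ineq)
              also have "\<dots> \<le> \<bar>\<alpha>\<bar> * (2 * G) + \<bar>\<beta>\<bar> * G"
                unfolding abs_mult
              proof (intro add_mono mult_left_mono)
                show "\<bar>g j t x $ i + g i t x $ j\<bar> \<le> 2 * G" using gG'[of j i] gG'[of i j] by linarith
              qed (use div in auto)
              also have "\<dots> = (2 * \<bar>\<alpha>\<bar> + \<bar>\<beta>\<bar>) * G" by (simp add: algebra_simps)
              finally have Qle: "\<bar>Q j (t, x)\<bar> \<le> (2 * \<bar>\<alpha>\<bar> + \<bar>\<beta>\<bar>) * G" .
              have "\<bar>Kf j (t, x)\<bar> = \<rho> t x powr d * (exp (S t x / cv * \<nu>) * \<bar>Q j (t, x)\<bar>)"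
                by (simp add: Kf_def abs_mult)
              also have "\<dots> \<le> \<rho> t x powr d * (E' * ((2 * \<bar>\<alpha>\<bar> + \<bar>\<beta>\<bar>) * G))"
                using Sle(2)[OF elim(2)] Qle E0 by (intro mult_left_mono mult_mono) auto
              also have "\<dots> = q * (\<Sum>k\<in>UNIV. \<rho> t x powr d * norm (g k t x))"
                unfolding q_def G_def sum_distrib_left[symmetric] by (simp only: mult_ac)
              also have "\<dots> \<le> q * (\<Sum>k\<in>(UNIV :: 3 set). M powr d * \<rho> t x + ?w k x)"
              proof (intro mult_left_mono sum_mono B0)
                fix k :: 3
                have "\<rho> t x powr d * norm (g k t x) \<le> M powr d * \<rho> t x + (\<rho> t x powr ((d - 1) / 2) * norm (g k t x))\<^sup>2"
                  by (rule viscous_weight_bound) (use elim \<delta> in \<open>auto simp: d_def\<close>)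
                then show "\<rho> t x powr d * norm (g k t x) \<le> M powr d * \<rho> t x + ?w k x" by (simp add: wt_def)
              qed
              finally have "ennreal \<bar>Kf j (t, x)\<bar> \<le> ennreal (q * (\<Sum>k\<in>(UNIV :: 3 set). M powr d * \<rho> t x + ?w k x))"
                by (rule ennreal_leI)
              also have "\<dots> = ennreal q * ennreal (\<Sum>k\<in>(UNIV :: 3 set). M powr d * \<rho> t x + ?w k x)"
                using B0(4) elim(3) by (intro ennreal_mult sum_nonneg add_nonneg_nonneg mult_nonneg_nonneg) auto
              also have "ennreal (\<Sum>k\<in>(UNIV :: 3 set). M powr d * \<rho> t x + ?w k x)
                = (\<Sum>k\<in>(UNIV :: 3 set). ennreal (M powr d * \<rho> t x + ?w k x))"
                by (rule sum_ennreal[symmetric]) (use elim(3) in auto)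
              also have "\<dots> = (\<Sum>k\<in>(UNIV :: 3 set). ennreal (M powr d) * ennreal (\<rho> t x) + ennreal (?w k x))"
                by (rule sum.cong[OF refl]) (use elim(3) in \<open>simp add: ennreal_plus ennreal_mult\<close>)
              finally show ?case .
            qed
            have "(\<integral>\<^sup>+x. ?H x \<partial>lebesgue) = ennreal q * (\<Sum>k\<in>(UNIV :: 3 set). ennreal (M powr d) * (\<integral>\<^sup>+x. ennreal (\<rho> t x) \<partial>lebesgue) + (\<integral>\<^sup>+x. ennreal (?w k x) \<partial>lebesgue))"
              by (simp add: nn_integral_cmult nn_integral_sum nn_integral_add)
            also have "\<dots> \<le> ennreal q * (\<Sum>k\<in>(UNIV :: 3 set). ennreal (M powr d) * ennreal m0 + ennreal W)"
              using W(3)[OF t] by (intro mult_left_mono sum_mono add_mono m0(2)[OF t]) (auto simp: d_def)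
            also have "\<dots> = ennreal q * (\<Sum>k\<in>(UNIV :: 3 set). ennreal (M powr d * m0 + W))"
              using m0(1) W(1) by (simp add: ennreal_plus ennreal_mult)
            also have "(\<Sum>k\<in>(UNIV :: 3 set). ennreal (M powr d * m0 + W)) = ennreal (\<Sum>k\<in>(UNIV :: 3 set). M powr d * m0 + W)"
              by (rule sum_ennreal) (use m0(1) W(1) in auto)
            also have "ennreal q * ennreal (\<Sum>k\<in>(UNIV :: 3 set). M powr d * m0 + W) = ennreal (q * (\<Sum>k\<in>(UNIV :: 3 set). M powr d * m0 + W))"
              using B0(4) m0(1) W(1) by (intro ennreal_mult[symmetric] sum_nonneg) auto
            also have "q * (\<Sum>k\<in>(UNIV :: 3 set). M powr d * m0 + W) = BK" by (simp add: BK_def)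
            finally have b2: "(\<integral>\<^sup>+x. ?H x \<partial>lebesgue) \<le> ennreal BK" .
            show "\<exists>H\<in>borel_measurable lebesgue. (AE x in lebesgue. ennreal \<bar>Kf j (t, x)\<bar> \<le> H x) \<and> (\<integral>\<^sup>+x. H x \<partial>lebesgue) \<le> ennreal BK"
              using b1 b2 b3 by (intro bexI[of _ ?H] conjI)
          qed
        qed
      qed
    qed
    define IC where "IC j = (\<integral>z. (?\<rho> z * ?u z $ j * iter_deriv [(0, axis j 1)] \<phi> z) * ?u z $ i \<partial>lebesgue)" for j
    define IK where "IK j = (\<integral>z. Kf j z * iter_deriv [(0, axis j 1)] \<phi> z \<partial>lebesgue)" for j
    define IP where "IP = (\<integral>z. P z * iter_deriv [(0, axis i 1)] \<phi> z \<partial>lebesgue)"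
    have "(\<integral>z. (?\<rho> z * iter_deriv [(1, 0)] \<phi> z) * ?u z $ i \<partial>lebesgue)
        = - (\<Sum>j\<in>UNIV. IC j) - IP + c * (\<Sum>j\<in>UNIV. IK j)"
      using eq[OF tf] acc(1)[of i] unfolding IC_def IK_def IP_def sum_negf by linarith
    also have "\<bar>\<dots>\<bar> \<le> \<bar>\<Sum>j\<in>UNIV. IC j\<bar> + \<bar>IP\<bar> + \<bar>c\<bar> * \<bar>\<Sum>j\<in>UNIV. IK j\<bar>"
      by (simp add: abs_mult[symmetric])
    also have "\<dots> \<le> 3 * ((C * BC / r) * I) + (C * BP / r) * I + \<bar>c\<bar> * (3 * ((C * BK / r) * I))"
    proof (intro add_mono mult_left_mono)
      have "\<bar>\<Sum>j\<in>UNIV. IC j\<bar> \<le> (\<Sum>j\<in>UNIV. \<bar>IC j\<bar>)" by (rule sum_abs)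
      also have "\<dots> \<le> (\<Sum>j\<in>(UNIV :: 3 set). (C * BC / r) * I)" unfolding IC_def by (rule sum_mono) (rule bC)
      finally show "\<bar>\<Sum>j\<in>UNIV. IC j\<bar> \<le> 3 * ((C * BC / r) * I)" by simp
      have "\<bar>\<Sum>j\<in>UNIV. IK j\<bar> \<le> (\<Sum>j\<in>UNIV. \<bar>IK j\<bar>)" by (rule sum_abs)
      also have "\<dots> \<le> (\<Sum>j\<in>(UNIV :: 3 set). (C * BK / r) * I)" unfolding IK_def by (rule sum_mono) (rule bK)
      finally show "\<bar>\<Sum>j\<in>UNIV. IK j\<bar> \<le> 3 * ((C * BK / r) * I)" by simp
      show "\<bar>IP\<bar> \<le> (C * BP / r) * I" unfolding IP_def by (rule bP)
    qed simp
    also have "\<dots> = Bt / r * I" using r by (simp add: Bt_def add_divide_distrib algebra_simps)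
    finally have "\<bar>\<integral>z. (?\<rho> z * iter_deriv [(1, 0)] \<phi> z) * ?u z $ i \<partial>lebesgue\<bar> \<le> Bt / r * I" .
    moreover have "(\<lambda>z. (?\<rho> z * iter_deriv [(1, 0)] \<phi> z) * ?u z $ i) = (\<lambda>z. (case z of (t, x) \<Rightarrow> \<rho> t x * u t x $ i) * iter_deriv [(1, 0)] \<phi> z)"
      by (rule ext) (simp add: case_prod_unfold mult_ac del: iter_deriv.simps)
    ultimately show "\<bar>\<integral>z. (case z of (t, x) \<Rightarrow> \<rho> t x * u t x $ i) * iter_deriv [(1, 0)] (tens (st \<tau> (\<lambda>_. cut r))) z \<partial>lebesgue\<bar>
        \<le> Bt / r * (\<integral>s. \<bar>\<tau> s\<bar> \<partial>lborel)"
      by (simp only: \<phi>_def I_def)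
  qed
  have lim: "(\<lambda>n. \<integral>x. (\<rho> t x * u t x $ i) * cutoff (real (Suc n)) x \<partial>lebesgue) \<longlonglongrightarrow> (\<integral>x. \<rho> t x * u t x $ i \<partial>lebesgue)"
    if t: "t \<in> {0..T}" for t
  proof (rule integral_dominated_convergence[where w="\<lambda>x. U * \<rho> t x"])
    have rm: "\<rho> t \<in> borel_measurable lebesgue" by (rule rho_measurable[OF t])
    have "(\<integral>\<^sup>+x. ennreal (\<rho> t x) \<partial>lebesgue) < \<infinity>" using m0(2)[OF t] by (rule le_less_trans) simp
    then have "integrable lebesgue (\<rho> t)" by (rule integrableI_nonneg[OF rm pos[OF t]])
    then show "integrable lebesgue (\<lambda>x. U * \<rho> t x)" by simp
    show vm: "(\<lambda>x. \<rho> t x * u t x $ i) \<in> borel_measurable lebesgue" by (rule sup_continuousD(1)[OF vs t])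
    show "(\<lambda>x. \<rho> t x * u t x $ i * cutoff (real (Suc n)) x) \<in> borel_measurable lebesgue" for n
      by (rule borel_measurable_times[OF vm borel_measurable_integrable[OF cutoff_integrable]]) simp
    show "AE x in lebesgue. (\<lambda>n. \<rho> t x * u t x $ i * cutoff (real (Suc n)) x) \<longlonglongrightarrow> \<rho> t x * u t x $ i"
    proof (rule AE_I2)
      fix x :: "real^3"
      obtain k :: nat where k: "norm x \<le> real k" using real_arch_simple by blast
      have "eventually (\<lambda>n. \<rho> t x * u t x $ i = \<rho> t x * u t x $ i * cutoff (real (Suc n)) x) sequentially"
      proof (rule eventually_sequentiallyI[of k])
        fix n assume n: "k \<le> n"
        have "x \<in> cube (real (Suc n))"
          unfolding cube_iff
        proof
          fix b :: "real^3" assume "b \<in> Basis"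
          then have "\<bar>x \<bullet> b\<bar> \<le> norm x" by (rule Basis_le_norm)
          also have "\<dots> \<le> real (Suc n)" using k n by linarith
          finally show "\<bar>x \<bullet> b\<bar> \<le> real (Suc n)" .
        qed
        then show "\<rho> t x * u t x $ i = \<rho> t x * u t x $ i * cutoff (real (Suc n)) x" by (simp add: cutoff_eq_1)
      qed
      then show "(\<lambda>n. \<rho> t x * u t x $ i * cutoff (real (Suc n)) x) \<longlonglongrightarrow> \<rho> t x * u t x $ i"
        by (rule Lim_transform_eventually[OF tendsto_const])
    qed
    show "AE x in lebesgue. norm (\<rho> t x * u t x $ i * cutoff (real (Suc n)) x) \<le> U * \<rho> t x" for n
      using U(2)[OF t] pos[OF t]
    proof eventually_elim
      case (elim x)
      have "\<bar>u t x $ i\<bar> \<le> U" using elim component_le_norm_cart[of "u t x" i] by linarith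
      then have "\<bar>u t x $ i\<bar> * \<bar>cutoff (real (Suc n)) x\<bar> \<le> U * 1" using cutoff_bounds[of "real (Suc n)" x] by (intro mult_mono) auto
      from mult_left_mono[OF this elim(2)] show ?case using elim(2) by (simp add: abs_mult mult_ac)
    qed
  qed
  have T0: "0 \<in> {0..T}" using T by simp
  have "(\<lambda>n. \<bar>(\<integral>x. (\<rho> t x * u t x $ i) * cutoff (real (Suc n)) x \<partial>lebesgue) - (\<integral>x. (\<rho> 0 x * u 0 x $ i) * cutoff (real (Suc n)) x \<partial>lebesgue)\<bar>)
      \<longlonglongrightarrow> \<bar>(\<integral>x. \<rho> t x * u t x $ i \<partial>lebesgue) - (\<integral>x. \<rho> 0 x * u 0 x $ i \<partial>lebesgue)\<bar>"
    by (intro tendsto_intros lim t T0)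
  moreover have "(\<lambda>n. Bt * \<bar>t - 0\<bar> * (1 / real (Suc n))) \<longlonglongrightarrow> Bt * \<bar>t - 0\<bar> * 0"
    by (intro tendsto_intros LIMSEQ_Suc lim_1_over_n)
  ultimately have "\<bar>(\<integral>x. \<rho> t x * u t x $ i \<partial>lebesgue) - (\<integral>x. \<rho> 0 x * u 0 x $ i \<partial>lebesgue)\<bar> \<le> Bt * \<bar>t - 0\<bar> * 0"
  proof (rule LIMSEQ_le)
    show "\<exists>N. \<forall>n\<ge>N. \<bar>(\<integral>x. (\<rho> t x * u t x $ i) * cutoff (real (Suc n)) x \<partial>lebesgue) - (\<integral>x. (\<rho> 0 x * u 0 x $ i) * cutoff (real (Suc n)) x \<partial>lebesgue)\<bar>
        \<le> Bt * \<bar>t - 0\<bar> * (1 / real (Suc n))"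
      using lip[of "real (Suc n)" for n] by (intro exI[of _ 0] allI impI) (simp add: mult_ac)
  qed
  then show ?thesis by simp
qed

end

section \<open>Decay of the velocity\<close>

text \<open>Integrability of the vector field is what allows components to be taken under the integral.\<close>
lemma momentum_component:
  assumes \<rho>: "\<rho>\<^sub>0 \<in> borel_measurable lebesgue" "mass \<rho>\<^sub>0 < \<infinity>" "AE x in lebesgue. 0 \<le> \<rho>\<^sub>0 x"
    and u: "u\<^sub>0 \<in> borel_measurable lebesgue" "AE x in lebesgue. norm (u\<^sub>0 x) \<le> U"
  shows "momentum \<rho>\<^sub>0 u\<^sub>0 $ i = (\<integral>x. \<rho>\<^sub>0 x * u\<^sub>0 x $ i \<partial>lebesgue)"
proof -
  have "integrable lebesgue \<rho>\<^sub>0" by (rule integrableI_nonneg) (use \<rho> in \<open>auto simp: mass_def\<close>)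
  then have "integrable lebesgue (\<lambda>x. U *\<^sub>R \<rho>\<^sub>0 x)" by (rule integrable_scaleR_right)
  then have "integrable lebesgue (\<lambda>x. \<rho>\<^sub>0 x *\<^sub>R u\<^sub>0 x)"
  proof (rule Bochner_Integration.integrable_bound)
    show "(\<lambda>x. \<rho>\<^sub>0 x *\<^sub>R u\<^sub>0 x) \<in> borel_measurable lebesgue" using \<rho>(1) u(1) by measurable
    show "AE x in lebesgue. norm (\<rho>\<^sub>0 x *\<^sub>R u\<^sub>0 x) \<le> norm (U *\<^sub>R \<rho>\<^sub>0 x)"
      using \<rho>(3) u(2)
    proof eventually_elim
      case (elim x)
      then have "norm (u\<^sub>0 x) * \<rho>\<^sub>0 x \<le> \<bar>U\<bar> * \<rho>\<^sub>0 x" by (intro mult_right_mono) auto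
      then show ?case using elim by (simp add: mult.commute)
    qed
  qed
  from integral_inner_left[OF this, of "axis i 1"] show ?thesis
    by (simp add: momentum_def inner_axis)
qed

lemma momentum_le_sup_mass:
  assumes \<rho>m: "\<rho> \<in> borel_measurable lebesgue"
    and \<rho>: "AE x in lebesgue. 0 \<le> \<rho> x" "(\<integral>\<^sup>+x. ennreal (\<rho> x) \<partial>lebesgue) \<le> ennreal m0" "m0 \<ge> 0"
    and u: "Linf u < ennreal \<epsilon>" and \<epsilon>: "\<epsilon> > 0"
  shows "\<bar>\<integral>x. \<rho> x * u x $ i \<partial>lebesgue\<bar> \<le> \<epsilon> * m0"
proof -
  have "Linf u = esssup lebesgue (\<lambda>x. ennreal (norm (u x)))" using u by (auto simp: Linf_def split: if_splits)
  then have e: "AE x in lebesgue. ennreal (norm (u x)) \<le> Linf u" using esssup_AE[where M=lebesgue and f="\<lambda>x. ennreal (norm (u x))"] by simp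
  have "(\<integral>\<^sup>+x. ennreal \<bar>\<rho> x * u x $ i\<bar> \<partial>lebesgue) \<le> (\<integral>\<^sup>+x. ennreal \<epsilon> * ennreal (\<rho> x) \<partial>lebesgue)"
  proof (rule nn_integral_mono_AE)
    show "AE x in lebesgue. ennreal \<bar>\<rho> x * u x $ i\<bar> \<le> ennreal \<epsilon> * ennreal (\<rho> x)"
      using e \<rho>(1)
    proof eventually_elim
      case (elim x)
      have "ennreal (norm (u x)) \<le> ennreal \<epsilon>" using elim(1) u by (meson less_imp_le order.trans)
      then have "norm (u x) \<le> \<epsilon>" using \<epsilon> by (simp add: ennreal_le_iff)
      then have "\<bar>u x $ i\<bar> \<le> \<epsilon>" using component_le_norm_cart[of "u x" i] by linarith
      then have "\<rho> x * \<bar>u x $ i\<bar> \<le> \<rho> x * \<epsilon>" using elim(2) by (rule mult_left_mono)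
      then have "ennreal \<bar>\<rho> x * u x $ i\<bar> \<le> ennreal (\<epsilon> * \<rho> x)" using elim(2) by (intro ennreal_leI) (simp add: abs_mult mult.commute)
      then show ?case using \<epsilon> elim(2) by (simp add: ennreal_mult)
    qed
  qed
  also have "\<dots> = ennreal \<epsilon> * (\<integral>\<^sup>+x. ennreal (\<rho> x) \<partial>lebesgue)" using \<rho>m by (intro nn_integral_cmult) measurable
  also have "\<dots> \<le> ennreal \<epsilon> * ennreal m0" by (rule mult_left_mono[OF \<rho>(2)]) simp
  also have "\<dots> = ennreal (\<epsilon> * m0)" using \<epsilon> \<rho>(3) by (intro ennreal_mult[symmetric]) auto
  finally have b: "(\<integral>\<^sup>+x. ennreal \<bar>\<rho> x * u x $ i\<bar> \<partial>lebesgue) \<le> ennreal (\<epsilon> * m0)" .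
  show ?thesis
  proof (cases "integrable lebesgue (\<lambda>x. \<rho> x * u x $ i)")
    case True
    from integral_norm_bound_ennreal[OF this] b
    have "ennreal \<bar>\<integral>x. \<rho> x * u x $ i \<partial>lebesgue\<bar> \<le> ennreal (\<epsilon> * m0)" unfolding real_norm_def by (rule order.trans)
    then show ?thesis using \<epsilon> \<rho>(3) by (simp add: ennreal_le_iff)
  next
    case False
    \<comment> \<open>In this case the integral is 0 by definition.\<close>
    then show ?thesis using \<epsilon> \<rho>(3) by (simp add: not_integrable_integral_eq)
  qed
qed

lemma directional_L2_bounds:
  fixes f :: "'i::finite \<Rightarrow> real \<Rightarrow> real^3 \<Rightarrow> 'b::euclidean_space"
  assumes "\<And>j. C_in T (Lp 2) (f j)"
  shows "\<exists>W\<ge>0. \<forall>j. \<forall>t\<in>{0..T}. f j t \<in> borel_measurable lebesgue \<and>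
    (\<integral>\<^sup>+x. ennreal ((norm (f j t x))\<^sup>2) \<partial>lebesgue) \<le> ennreal W"
proof -
  have "\<exists>W\<ge>0. \<forall>t\<in>{0..T}. f j t \<in> borel_measurable lebesgue \<and>
    (\<integral>\<^sup>+x. ennreal ((norm (f j t x))\<^sup>2) \<partial>lebesgue) \<le> ennreal W" for j
    using C_in_L2_bound[OF assms[of j]] by metis
  then obtain W where W: "\<forall>j. W j \<ge> 0 \<and> (\<forall>t\<in>{0..T}. f j t \<in> borel_measurable lebesgue \<and>
    (\<integral>\<^sup>+x. ennreal ((norm (f j t x))\<^sup>2) \<partial>lebesgue) \<le> ennreal (W j))" by metis
  have le: "W j \<le> sum W UNIV" for j by (rule member_le_sum) (use W in auto)
  show ?thesis
  proof (intro exI[of _ "sum W UNIV"] conjI allI ballI)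
    show "0 \<le> sum W UNIV" using W by (simp add: sum_nonneg)
    fix j t assume t: "t \<in> {0..T}"
    show "f j t \<in> borel_measurable lebesgue" using W t by blast
    have "(\<integral>\<^sup>+x. ennreal ((norm (f j t x))\<^sup>2) \<partial>lebesgue) \<le> ennreal (W j)" using W t by blast
    also have "\<dots> \<le> ennreal (sum W UNIV)" by (rule ennreal_leI[OF le])
    finally show "(\<integral>\<^sup>+x. ennreal ((norm (f j t x))\<^sup>2) \<partial>lebesgue) \<le> ennreal (sum W UNIV)" .
  qed
qed

lemma regular_solution_bounded_flow:
  assumes sol: "cns.regular_solution A R \<gamma> \<nu> \<alpha> \<beta> dal Sb T \<rho>\<^sub>0 u\<^sub>0 S\<^sub>0 \<rho> u S" and T: "T > 0" and \<gamma>: "\<gamma> > 1"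
  shows "bounded_flow T \<rho> u"
proof
  note r = sol[unfolded cns.regular_solution_def cns.solves_E_def Let_def]
  show "T > 0" by (rule T)
  show "cns.mass_eq T (case_prod \<rho>) (case_prod u)" using r by (elim conjE)
  have pos: "AE x in lebesgue. 0 < \<rho> t x" if "t \<in> {0..T}" for t using r that by (elim conjE) (erule bspec)
  show "AE x in lebesgue. 0 \<le> \<rho> t x" if "t \<in> {0..T}" for t
    using pos[OF that] by eventually_elim simp
  have "C_in T (Hs 3) u" using r by (elim conjE)
  then show "sup_continuous T u" by (rule C_in_imp_sup_continuous[OF controls_sup_Hs3])
  have "C_in T D1s_D3 (\<lambda>t x. \<rho> t x powr (\<gamma> - 1))" using r by (elim conjE)
  then have "sup_continuous T (\<lambda>t x. \<rho> t x powr (\<gamma> - 1))" by (rule C_in_imp_sup_continuous[OF controls_sup_D1s_D3])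
  then show "sup_continuous T \<rho>"
  \<comment> \<open>The absolute value extends the inverse of \<open>y \<mapsto> y powr (\<gamma> - 1)\<close> continuously to the whole line.\<close>
  proof (rule sup_continuous_compose[where F="\<lambda>y. \<bar>y\<bar> powr (1 / (\<gamma> - 1))"])
    show "continuous_on UNIV (\<lambda>y. \<bar>y\<bar> powr (1 / (\<gamma> - 1)))"
      using \<gamma> by (intro continuous_on_powr' continuous_intros) auto
    show "AE x in lebesgue. \<rho> t x = \<bar>\<rho> t x powr (\<gamma> - 1)\<bar> powr (1 / (\<gamma> - 1))" if "t \<in> {0..T}" for t
      using pos[OF that] by eventually_elim (use \<gamma> in \<open>simp add: powr_powr\<close>)
  qed
qed

text \<open>Conservation moves the momentum to a time \<open>t\<close> at which the velocity is below \<open>\<epsilon>\<close>.\<close>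
lemma regular_solution_momentum_bound:
  assumes sol: "cns.regular_solution A R \<gamma> \<nu> \<alpha> \<beta> dal Sb T \<rho>\<^sub>0 u\<^sub>0 S\<^sub>0 \<rho> u S"
    and A: "A > 0" and \<gamma>: "\<gamma> > 1" and \<nu>: "\<nu> > 0"
    and m: "mass \<rho>\<^sub>0 \<le> ennreal m0" "m0 \<ge> 0"
    and t: "t \<in> {0..T}" and T: "T > 0" and \<epsilon>: "Linf (u t) < ennreal \<epsilon>" "\<epsilon> > 0"
  shows "\<bar>momentum \<rho>\<^sub>0 u\<^sub>0 $ i\<bar> \<le> \<epsilon> * m0"
proof -
  interpret bounded_flow T \<rho> u by (rule regular_solution_bounded_flow[OF sol T \<gamma>])
  note r = sol[unfolded cns.regular_solution_def cns.solves_E_def Let_def]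
  have T0: "0 \<in> {0..T}" using T by simp
  have init: "AE x in lebesgue. \<rho> 0 x = \<rho>\<^sub>0 x \<and> u 0 x = u\<^sub>0 x \<and> S 0 x = S\<^sub>0 x" using r by (elim conjE)
  have \<rho>0: "AE x in lebesgue. \<rho> 0 x = \<rho>\<^sub>0 x" and u0: "AE x in lebesgue. u 0 x = u\<^sub>0 x"
    using init by (auto elim: eventually_mono)
  have "(\<integral>\<^sup>+x. ennreal (\<rho> 0 x) \<partial>lebesgue) = mass \<rho>\<^sub>0"
    unfolding mass_def by (rule nn_integral_cong_AE) (use \<rho>0 in \<open>auto elim: eventually_mono\<close>)
  then have m0: "(\<integral>\<^sup>+x. ennreal (\<rho> 0 x) \<partial>lebesgue) \<le> ennreal m0" using m(1) by simp
  note mt = mass_le[OF m(2) m0]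
  have mom: "cns.momentum_eq A R \<gamma> \<nu> \<alpha> \<beta> T (case_prod \<rho>) (case_prod u) (case_prod S)" using r by (elim conjE)
  have pos': "AE x in lebesgue. 0 < \<rho> t x" if "t \<in> {0..T}" for t using r that by (elim conjE) (erule bspec)
  have "C_in T D1s_D3 (\<lambda>t x. S t x - Sb)" using r by (elim conjE)
  from sup_continuous_bound[OF C_in_imp_sup_continuous[OF controls_sup_D1s_D3 this]]
  obtain M where M: "\<forall>t\<in>{0..T}. AE x in lebesgue. norm (S t x - Sb) \<le> M" by metis
  have S: "AE x in lebesgue. \<bar>S t x\<bar> \<le> M + \<bar>Sb\<bar>" if "t \<in> {0..T}" for t
    using bspec[OF M that] by eventually_elim (unfold real_norm_def, linarith)
  have "grad_in T u (\<lambda>g. C_in T (Lp 2) (wt \<rho> ((cns.\<delta> \<gamma> \<nu> - 1) / 2) g))" using r by (elim conjE)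
  then have "\<exists>g. has_weak_deriv (slab T) [(0, axis j 1)] (case_prod u) (case_prod g) \<and>
      C_in T (Lp 2) (wt \<rho> ((cns.\<delta> \<gamma> \<nu> - 1) / 2) g)" for j :: 3
    unfolding grad_in_def using axis_in_Basis_iff[of j "1::real"] by (metis (no_types, lifting) Basis_real_def insertI1)
  then obtain g :: "3 \<Rightarrow> real \<Rightarrow> real^3 \<Rightarrow> real^3" where
    g: "\<forall>j. has_weak_deriv (slab T) [(0, axis j 1)] (case_prod u) (case_prod (g j)) \<and>
      C_in T (Lp 2) (wt \<rho> ((cns.\<delta> \<gamma> \<nu> - 1) / 2) (g j))" by metis
  obtain W where W: "W \<ge> 0" "\<forall>j. \<forall>t\<in>{0..T}. wt \<rho> ((cns.\<delta> \<gamma> \<nu> - 1) / 2) (g j) t \<in> borel_measurable lebesgue \<and>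
    (\<integral>\<^sup>+x. ennreal ((norm (wt \<rho> ((cns.\<delta> \<gamma> \<nu> - 1) / 2) (g j) t x))\<^sup>2) \<partial>lebesgue) \<le> ennreal W"
    using directional_L2_bounds[of T "\<lambda>j. wt \<rho> ((cns.\<delta> \<gamma> \<nu> - 1) / 2) (g j)"] g by blast
  have cons: "(\<integral>x. \<rho> t x * u t x $ i \<partial>lebesgue) = (\<integral>x. \<rho> 0 x * u 0 x $ i \<partial>lebesgue)"
  proof (rule momentum_conserved[OF mom pos' A \<gamma> _ S _ W(1) _ _ m(2) mt t])
    show "0 < cns.\<delta> \<gamma> \<nu>" using \<gamma> \<nu> by (simp add: cns.\<delta>_def)
    show "has_weak_deriv (slab T) [(0, axis j 1)] (case_prod u) (case_prod (g j))" for j using g by blast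
    show "wt \<rho> ((cns.\<delta> \<gamma> \<nu> - 1) / 2) (g j) t \<in> borel_measurable lebesgue" if "t \<in> {0..T}" for j t using W(2) that by blast
    show "(\<integral>\<^sup>+x. ennreal ((norm (wt \<rho> ((cns.\<delta> \<gamma> \<nu> - 1) / 2) (g j) t x))\<^sup>2) \<partial>lebesgue) \<le> ennreal W" if "t \<in> {0..T}" for j t
      using W(2) that by blast
  qed
  obtain U where U: "\<forall>t\<in>{0..T}. AE x in lebesgue. norm (u t x) \<le> U" using sup_continuous_bound[OF u] by metis
  have "momentum \<rho>\<^sub>0 u\<^sub>0 = momentum (\<rho> 0) (u 0)"
    unfolding momentum_def
  proof (rule integral_cong_AE)
    have "(\<lambda>x. \<rho> 0 x *\<^sub>R u 0 x) \<in> borel_measurable lebesgue"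
      using rho_measurable[OF T0] u_measurable[OF T0] by measurable
    moreover have eq: "AE x in lebesgue. \<rho> 0 x *\<^sub>R u 0 x = \<rho>\<^sub>0 x *\<^sub>R u\<^sub>0 x" using init by eventually_elim simp
    ultimately show "(\<lambda>x. \<rho>\<^sub>0 x *\<^sub>R u\<^sub>0 x) \<in> borel_measurable lebesgue" by (rule borel_measurable_AE)
    show "(\<lambda>x. \<rho> 0 x *\<^sub>R u 0 x) \<in> borel_measurable lebesgue" by fact
    show "AE x in lebesgue. \<rho>\<^sub>0 x *\<^sub>R u\<^sub>0 x = \<rho> 0 x *\<^sub>R u 0 x" using eq by eventually_elim simp
  qed
  also have "\<dots> $ i = (\<integral>x. \<rho> 0 x * u 0 x $ i \<partial>lebesgue)"
  proof (rule momentum_component[OF rho_measurable[OF T0] _ pos[OF T0] u_measurable[OF T0] bspec[OF U T0]])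
    show "mass (\<rho> 0) < \<infinity>" unfolding mass_def using m0 by (rule le_less_trans) simp
  qed
  finally have "\<bar>momentum \<rho>\<^sub>0 u\<^sub>0 $ i\<bar> = \<bar>\<integral>x. \<rho> t x * u t x $ i \<partial>lebesgue\<bar>" using cons by simp
  also have "\<dots> \<le> \<epsilon> * m0" by (rule momentum_le_sup_mass[OF rho_measurable[OF t] pos[OF t] mt[OF t] m(2) \<epsilon>])
  finally show ?thesis .
qed

theorem corollary1p1:
  fixes A R \<gamma> \<delta> \<nu> \<alpha> \<beta> dal Sb q :: real
    and \<rho>\<^sub>0 S\<^sub>0 g\<^sub>5 :: "real^3 \<Rightarrow> real"
    and u\<^sub>0 g\<^sub>2 :: "real^3 \<Rightarrow> real^3"
    and g\<^sub>1 g\<^sub>3 :: "3 \<Rightarrow> real^3 \<Rightarrow> real^3"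
    and g\<^sub>4 g\<^sub>6 :: "3 \<Rightarrow> real^3 \<Rightarrow> real"
  assumes "A > 0" "R > 0" "\<nu> > 0" "\<delta> = \<nu> * (\<gamma> - 1)"
    and "\<gamma> > 1" "0 < \<delta>" "\<delta> < 1" "\<gamma> + \<delta> \<le> 2" "\<alpha> > 0" "2 * \<alpha> + 3 * \<beta> \<ge> 0" "dal > 0"
    and "q > 3"
    and "cns.initial_regularity \<gamma> \<nu> Sb q \<rho>\<^sub>0 u\<^sub>0 S\<^sub>0"
    and "cns.initial_compatibility R \<gamma> \<nu> \<alpha> \<beta> \<rho>\<^sub>0 u\<^sub>0 S\<^sub>0 g\<^sub>1 g\<^sub>2 g\<^sub>3 g\<^sub>4 g\<^sub>5 g\<^sub>6"
    and "0 < mass \<rho>\<^sub>0" "mass \<rho>\<^sub>0 < \<infinity>"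
    and "norm (momentum \<rho>\<^sub>0 u\<^sub>0) > 0"
  shows "\<not> (\<exists>\<rho> u S. cns.global_regular_solution A R \<gamma> \<nu> \<alpha> \<beta> dal Sb q \<rho>\<^sub>0 u\<^sub>0 S\<^sub>0 \<rho> u S \<and>
                    Limsup at_top (\<lambda>t. Linf (u t)) = 0)"
proof
  assume "\<exists>\<rho> u S. cns.global_regular_solution A R \<gamma> \<nu> \<alpha> \<beta> dal Sb q \<rho>\<^sub>0 u\<^sub>0 S\<^sub>0 \<rho> u S \<and>
                    Limsup at_top (\<lambda>t. Linf (u t)) = 0"
  then obtain \<rho> u S where glob: "cns.global_regular_solution A R \<gamma> \<nu> \<alpha> \<beta> dal Sb q \<rho>\<^sub>0 u\<^sub>0 S\<^sub>0 \<rho> u S"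
    and lim: "Limsup at_top (\<lambda>t. Linf (u t)) = 0" by blast
  define m0 where "m0 = enn2real (mass \<rho>\<^sub>0)"
  have m0: "mass \<rho>\<^sub>0 \<le> ennreal m0" "m0 \<ge> 0" using \<open>mass \<rho>\<^sub>0 < \<infinity>\<close> by (auto simp: m0_def)
  obtain i where "momentum \<rho>\<^sub>0 u\<^sub>0 $ i \<noteq> 0"
    using \<open>norm (momentum \<rho>\<^sub>0 u\<^sub>0) > 0\<close> by (auto simp: vec_eq_iff)
  then have p: "\<bar>momentum \<rho>\<^sub>0 u\<^sub>0 $ i\<bar> > 0" by simp
  \<comment> \<open>The summand 1 makes the final inequality strict.\<close>
  define \<epsilon> where "\<epsilon> = \<bar>momentum \<rho>\<^sub>0 u\<^sub>0 $ i\<bar> / (m0 + 1)"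
  have \<epsilon>: "\<epsilon> > 0" using p m0 by (simp add: \<epsilon>_def)
  have "\<forall>\<^sub>F t in at_top. Linf (u t) < ennreal \<epsilon>" by (rule Limsup_lessD) (use lim \<epsilon> in simp)
  then obtain t where t: "t \<ge> 0" "Linf (u t) < ennreal \<epsilon>"
    using eventually_conj[OF eventually_ge_at_top[of 0]] eventually_happens' trivial_limit_at_top_linorder by (metis (mono_tags, lifting))
  have "cns.regular_solution A R \<gamma> \<nu> \<alpha> \<beta> dal Sb (t + 1) \<rho>\<^sub>0 u\<^sub>0 S\<^sub>0 \<rho> u S"
    using glob t(1) unfolding cns.global_regular_solution_def by (auto intro: add_nonneg_pos)
  from regular_solution_momentum_bound[OF this \<open>A > 0\<close> \<open>\<gamma> > 1\<close> \<open>\<nu> > 0\<close> m0 _ _ t(2) \<epsilon>] t(1)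
  have "\<bar>momentum \<rho>\<^sub>0 u\<^sub>0 $ i\<bar> \<le> \<epsilon> * m0" by auto
  also have "\<dots> < \<epsilon> * (m0 + 1)" using \<epsilon> by simp
  also have "\<dots> = \<bar>momentum \<rho>\<^sub>0 u\<^sub>0 $ i\<bar>" using m0 by (simp add: \<epsilon>_def)
  finally show False by simp
qed

end
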